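(* Let $1<p\le q<\infty$, $\alpha>-1$, $\beta>-1$, $f\in L^q_{\beta}$, and $$\gamma=\frac{n+1+\beta}{q}-\frac{n+1+\alpha}{p}.$$ Then $H_{f}^{\beta}$ and $H_{\bar{f}}^{\beta}$ are both bounded from $A^p_{\alpha}$ to $L^q_{\beta}$ if and only if $f\in BMO^q_{\gamma}$.
   Context: $\mathbb{B}_n$ is the open unit ball of $\mathbb{C}^n$ ($n\ge 1$), $\langle z,w\rangle=\sum_k z_k\overline{w_k}$, and $dv$ is Lebesgue volume measure on $\mathbb{B}_n$ normalized so that $v(\mathbb{B}_n)=1$. For $\alpha>-1$, $dv_\alpha(z)=c_\alpha(1-|z|^2)^\alpha dv(z)$ with $c_\alpha>0$ such that $v_\alpha(\mathbb{B}_n)=1$; $L^p_\alpha=L^p(\mathbb{B}_n,dv_\alpha)$ with norm $\|\cdot\|_{p,\alpha}$, and $A^p_\alpha$ is the subspace of holomorphic functions in $L^p_\alpha$ (weighted Bergman space). Projection and Hankel operators: $P_{\beta} g(z)=\int_{\mathbb{B}_n} \frac{g(w)\,dv_{\beta}(w)}{(1-\langle z,w\rangle )^{n+1+\beta}}$, and $H^\beta_f g=(I-P_\beta)(fg)$, defined for $g$ in the space $H^\infty$ of bounded holomorphic functions, which is dense in $A^p_\alpha$. Boundedness from $A^p_\alpha$ to $L^q_\beta$ means there is $C>0$ with $\|H^\beta_f g\|_{q,\beta}\le C\|g\|_{p,\alpha}$ for all $g\in H^\infty$ (so that the operator extends boundedly to $A^p_\alpha$). Bergman metric: for $z,w\in\mathbb{B}_n$,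 let $\rho(z,w)\in[0,1)$ be given by $1-\rho(z,w)^2=\frac{(1-|z|^2)(1-|w|^2)}{|1-\langle z,w\rangle|^2}$; the Bergman distance is $\beta(z,w)=\frac12\log\frac{1+\rho(z,w)}{1-\rho(z,w)}$ (not to be confused with the number $\beta$), and $D(z,r)=\{w\in\mathbb{B}_n:\beta(z,w)<r\}$. Weighted BMO: for $\gamma\in\mathbb{R}$, $r>0$, $1\le q<\infty$ and $\sigma\in\mathbb{R}$, put $dv_\sigma(z)=(1-|z|^2)^\sigma dv(z)$ (normalization is irrelevant here), $\widehat{f_r}(z)=\frac{1}{v_\sigma(D(z,r))}\int_{D(z,r)}f\,dv_\sigma$, and $MO_{q,r}(f)(z)=\left[\frac{1}{v_\sigma(D(z,r))}\int_{D(z,r)}|f(w)-\widehat{f_r}(z)|^q dv_\sigma(w)\right]^{1/q}$. The space $BMO^q_{r,\gamma}$ consists of all $f\in L^q_{loc}(\mathbb{B}_n)$ with $\sup_{z\in\mathbb{B}_n}(1-|z|^2)^\gamma MO_{q,r}(f)(z)<\infty$. This space does not depend on $\sigma\in\mathbb{R}$ or $r>0$, and is denoted $BMO^q_\gamma$. *)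

theory Defs
  imports "HOL-Analysis.Analysis"
begin

text \<open>
  Complex n-space is \<^typ>\<open>complex ^ 'n\<close> with n the cardinality of \<^typ>\<open>'n\<close>; its
  \<^const>\<open>norm\<close> is the Hermitian norm. Functions on the unit ball are represented by functions on
  the whole space, but every notion below depends only on their values in the ball: the measures
  have the ball itself as their underlying space.
\<close>

abbreviation unit_ball :: "(complex ^ 'n) set" where
  "unit_ball \<equiv> ball 0 1"

definition herm :: "complex ^ 'n \<Rightarrow> complex ^ 'n \<Rightarrow> complex" where
  "herm z w = (\<Sum>k\<in>UNIV. z $ k * cnj (w $ k))"

subsection \<open>Measures and Lebesgue spaces\<close>

definition ball_vol :: "(complex ^ 'n) measure" where
  "ball_vol = uniform_measure (lebesgue_on unit_ball) unit_ball"

text \<open>The weighted measure without normalizing constant, for arbitrary real exponent.\<close>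

definition wt_vol :: "real \<Rightarrow> (complex ^ 'n) measure" where
  "wt_vol \<sigma> = density ball_vol (\<lambda>z. ennreal ((1 - (norm z)\<^sup>2) powr \<sigma>))"

text \<open>The probability measure; it is meaningful for \<open>\<alpha> > -1\<close>, when the integral in the
  normalizing constant is finite.\<close>

definition norm_const :: "'n::finite itself \<Rightarrow> real \<Rightarrow> real" where
  "norm_const _ \<alpha> = 1 / (LINT z|(ball_vol :: (complex ^ 'n) measure). (1 - (norm z)\<^sup>2) powr \<alpha>)"

definition prob_vol :: "real \<Rightarrow> (complex ^ 'n) measure" where
  "prob_vol \<alpha> =
     density ball_vol (\<lambda>z. ennreal (norm_const TYPE('n) \<alpha> * (1 - (norm z)\<^sup>2) powr \<alpha>))"

definition Lp_space :: "real \<Rightarrow> real \<Rightarrow> (complex ^ 'n \<Rightarrow> complex) set" where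
  "Lp_space p \<alpha> =
     {f \<in> borel_measurable (prob_vol \<alpha>). integrable (prob_vol \<alpha>) (\<lambda>z. norm (f z) powr p)}"

definition Lp_norm :: "real \<Rightarrow> real \<Rightarrow> (complex ^ 'n \<Rightarrow> complex) \<Rightarrow> real" where
  "Lp_norm p \<alpha> f = (LINT z|prob_vol \<alpha>. norm (f z) powr p) powr (1 / p)"

subsection \<open>Holomorphic functions, Bergman projection and Hankel operators\<close>

text \<open>Holomorphy of several variables: Frechet differentiability with complex-linear derivative.\<close>

definition cn_holomorphic_on :: "(complex ^ 'n \<Rightarrow> complex) \<Rightarrow> (complex ^ 'n) set \<Rightarrow> bool" where
  "cn_holomorphic_on f S \<longleftrightarrow>
     (\<forall>z\<in>S. \<exists>f'. (f has_derivative f') (at z) \<and> (\<forall>c v. f' (c *s v) = c * f' v))"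

definition H_infinity :: "(complex ^ 'n \<Rightarrow> complex) set" where
  "H_infinity = {g. cn_holomorphic_on g unit_ball \<and> bounded (g ` unit_ball)}"

text \<open>The complex power is the principal one; \<open>1 - herm z w\<close> has positive real part for z, w in the
  ball.\<close>

definition bergman_proj ::
  "real \<Rightarrow> (complex ^ 'n \<Rightarrow> complex) \<Rightarrow> complex ^ 'n \<Rightarrow> complex" where
  "bergman_proj \<beta> g z =
     (LINT w|prob_vol \<beta>. g w / (1 - herm z w) powr complex_of_real (real CARD('n) + 1 + \<beta>))"

definition hankel ::
  "real \<Rightarrow> (complex ^ 'n \<Rightarrow> complex) \<Rightarrow> (complex ^ 'n \<Rightarrow> complex) \<Rightarrow> complex ^ 'n \<Rightarrow> complex" where
  "hankel \<beta> f g = (\<lambda>z. f z * g z - bergman_proj \<beta> (\<lambda>w. f w * g w) z)"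

text \<open>Boundedness of the Hankel operator from the weighted Bergman space (exponent p, weight
  \<open>\<alpha>\<close>) into the weighted Lebesgue space (exponent q, weight \<open>\<beta>\<close>), tested on the
  dense subspace of bounded holomorphic functions. Membership in the target space is stated
  explicitly because \<^const>\<open>Lp_norm\<close> takes the value 0 where the integral diverges.\<close>

definition hankel_bounded ::
  "real \<Rightarrow> real \<Rightarrow> real \<Rightarrow> real \<Rightarrow> (complex ^ 'n \<Rightarrow> complex) \<Rightarrow> bool" where
  "hankel_bounded p \<alpha> q \<beta> f \<longleftrightarrow>
     (\<exists>C>0. \<forall>g\<in>H_infinity.
        hankel \<beta> f g \<in> Lp_space q \<beta> \<and> Lp_norm q \<beta> (hankel \<beta> f g) \<le> C * Lp_norm p \<alpha> g)"

subsection \<open>Bergman metric and weighted BMO\<close>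

definition bergman_rho :: "complex ^ 'n \<Rightarrow> complex ^ 'n \<Rightarrow> real" where
  "bergman_rho z w =
     sqrt (1 - (1 - (norm z)\<^sup>2) * (1 - (norm w)\<^sup>2) / (norm (1 - herm z w))\<^sup>2)"

definition bergman_dist :: "complex ^ 'n \<Rightarrow> complex ^ 'n \<Rightarrow> real" where
  "bergman_dist z w = 1 / 2 * ln ((1 + bergman_rho z w) / (1 - bergman_rho z w))"

definition bergman_ball :: "complex ^ 'n \<Rightarrow> real \<Rightarrow> (complex ^ 'n) set" where
  "bergman_ball z r = {w \<in> unit_ball. bergman_dist z w < r}"

definition bergman_avg ::
  "real \<Rightarrow> real \<Rightarrow> (complex ^ 'n \<Rightarrow> complex) \<Rightarrow> complex ^ 'n \<Rightarrow> complex" where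
  "bergman_avg \<sigma> r f z =
     (LINT w:bergman_ball z r|wt_vol \<sigma>. f w) / of_real (measure (wt_vol \<sigma>) (bergman_ball z r))"

definition mean_osc ::
  "real \<Rightarrow> real \<Rightarrow> real \<Rightarrow> (complex ^ 'n \<Rightarrow> complex) \<Rightarrow> complex ^ 'n \<Rightarrow> real" where
  "mean_osc \<sigma> q r f z =
     ((LINT w:bergman_ball z r|wt_vol \<sigma>. norm (f w - bergman_avg \<sigma> r f z) powr q)
        / measure (wt_vol \<sigma>) (bergman_ball z r)) powr (1 / q)"

definition Lq_loc :: "real \<Rightarrow> (complex ^ 'n \<Rightarrow> complex) set" where
  "Lq_loc q = {f \<in> borel_measurable ball_vol.
     \<forall>K. compact K \<and> K \<subseteq> unit_ball \<longrightarrow> set_integrable ball_vol K (\<lambda>z. norm (f z) powr q)}"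

text \<open>Since f is locally q-integrable and Bergman balls are relatively compact in the unit ball, all
  the integrals in \<^const>\<open>mean_osc\<close> converge, so \<^const>\<open>bdd_above\<close> expresses that the supremum
  is finite.\<close>

definition BMO :: "real \<Rightarrow> real \<Rightarrow> real \<Rightarrow> real \<Rightarrow> (complex ^ 'n \<Rightarrow> complex) set" where
  "BMO \<sigma> q r \<gamma> =
     {f \<in> Lq_loc q. bdd_above ((\<lambda>z. (1 - (norm z)\<^sup>2) powr \<gamma> * mean_osc \<sigma> q r f z) ` unit_ball)}"

end

theory Submission
  imports Defs "HOL-Complex_Analysis.Complex_Analysis"
begin

text \<open>
  Write \<open>P\<^sub>b\<close> for the Bergman projection with weight exponent \<open>b\<close>. The projection
  \<open>P\<^sub>\<beta>\<close> reproduces \<open>H\<^sup>\<infinity>\<close>, and \<open>P\<^sub>b\<close> is bounded on \<open>L\<^sup>q\<^sub>\<beta>\<close> for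
  \<open>b \<ge> \<beta>\<close> by Schur's test and the Forelli--Rudin estimates.

  Necessity: apply both Hankel operators to a kernel function \<open>k\<close> at \<open>a\<close> with a large exponent.
  Together they show that \<open>f k\<close> is, up to a small error in \<open>L\<^sup>q\<^sub>\<beta>\<close>, a constant multiple
  \<open>c k\<close>, and \<open>\<bar>k\<bar>\<close> is comparable to a constant on the Bergman ball around \<open>a\<close>; this bounds the
  mean oscillation there.

  Sufficiency: let \<open>F\<close> be the average of \<open>f\<close> over Bergman balls. Summing the local oscillation along
  radii gives \<open>\<bar>F z - F w\<bar> \<le> C \<bar>1 - \<langle>z,w\<rangle>\<bar>\<^sup>x ((1 - \<bar>z\<bar>\<^sup>2) (1 - \<bar>w\<bar>\<^sup>2))\<^sup>-\<^sup>y\<close>, where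
  \<open>y\<close> is small and \<open>x = 2 y - \<gamma>\<close>, so that
  \<open>g \<mapsto> \<integral> (F z - F w) g(w) K\<^sub>b(z,w)\<close> is bounded by Schur's test, while \<open>(f - F) g\<close> is controlled by
  a Carleson embedding. Since \<open>P\<^sub>\<beta> P\<^sub>b = P\<^sub>b\<close> for large \<open>b\<close>, the operator \<open>I - P\<^sub>\<beta>\<close>
  maps \<open>f g\<close> and \<open>f g - P\<^sub>b (f g)\<close> to the same function, which reduces the claim to these two bounds.
\<close>

section \<open>Hermitian geometry of the ball\<close>

text \<open>All geometry is carried by two scalars, \<open>hgt z\<close> and
  \<open>kdis z w\<close>. The quotient of \<open>(kdis z w)\<^sup>2\<close> by
  \<open>hgt z * hgt w\<close> is the squared cosh of the Bergman distance, so Bergman balls, their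
  composition and the kernel size are treated by algebra, with no change of variables by
  automorphisms. Nor are there integrals over spheres: moments come from circular symmetry, from
  differentiating a translated weight and from dilations. The one modulus integral evaluated exactly
  is \<open>kernel_L2_norm\<close>; volumes of tents and Bergman balls and the Forelli--Rudin bounds
  are derived from it.

  The projection exponent is raised for two different reasons. In the necessity part it keeps the
  inner kernel integrals uniformly bounded, so that Fubini asks only for integrability. In the
  sufficiency part Schur's test has to absorb the weight \<alpha>, which may far exceed \<beta>. The
  hypothesis p \<le> q acts twice: the surplus power of |g| is traded for the norm of g through
  pointwise growth, and \<gamma> < (1 + \<beta>) / q leaves room for the exponent \<open>e\<close>
  of the oscillation bound.\<close>

definition hgt :: "complex ^ 'n \<Rightarrow> real" where
  "hgt z = 1 - (norm z)\<^sup>2"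

definition kdis :: "complex ^ 'n \<Rightarrow> complex ^ 'n \<Rightarrow> real" where
  "kdis z w = norm (1 - herm z w)"

lemma herm_add_left: "herm (z + z') w = herm z w + herm z' w"
  by (simp add: herm_def sum.distrib algebra_simps)

lemma herm_diff_left: "herm (z - z') w = herm z w - herm z' w"
  by (simp add: herm_def sum_subtractf algebra_simps)

lemma herm_smult_left: "herm (c *s z) w = c * herm z w"
  by (simp add: herm_def sum_distrib_left algebra_simps)

lemma scaleR_eq_smult: "c *\<^sub>R (z :: complex ^ 'n) = complex_of_real c *s z"
  unfolding vec_eq_iff vector_scaleR_component vector_smult_component by (simp only: scaleR_conv_of_real) simp

lemma herm_scaleR_left: "herm (c *\<^sub>R z) w = of_real c * herm z w"
  by (simp add: scaleR_eq_smult herm_smult_left)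

lemma cnj_herm: "cnj (herm z w) = herm w z"
  by (simp add: herm_def mult.commute)

lemma herm_add_right: "herm w (z + z') = herm w z + herm w z'"
  by (simp add: herm_def sum.distrib algebra_simps)

lemma herm_diff_right: "herm w (z - z') = herm w z - herm w z'"
  by (simp add: herm_def sum_subtractf algebra_simps)

lemma herm_smult_right: "herm w (c *s z) = cnj c * herm w z"
  by (simp add: herm_def sum_distrib_left algebra_simps)

lemma herm_scaleR_right: "herm w (c *\<^sub>R z) = of_real c * herm w z"
  by (simp add: scaleR_eq_smult herm_smult_right)

lemmas herm_simps = herm_add_left herm_diff_left herm_smult_left herm_scaleR_left
  herm_add_right herm_diff_right herm_smult_right herm_scaleR_right

lemma norm_cvec_sq: "(norm (z :: complex ^ 'n))\<^sup>2 = (\<Sum>i\<in>UNIV. (norm (z $ i))\<^sup>2)"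
  by (simp add: norm_vec_def L2_set_def sum_nonneg)

lemma herm_self: "herm z z = of_real ((norm z)\<^sup>2)"
  unfolding norm_cvec_sq herm_def of_real_sum complex_norm_square ..

lemma norm_herm_le: "norm (herm z w) \<le> norm z * norm w"
proof -
  have "norm (herm z w) \<le> (\<Sum>k\<in>UNIV. \<bar>norm (z $ k)\<bar> * \<bar>norm (w $ k)\<bar>)"
    unfolding herm_def by (rule order_trans[OF norm_sum]) (simp add: norm_mult)
  also have "\<dots> \<le> norm z * norm w"
    unfolding norm_vec_def by (rule L2_set_mult_ineq)
  finally show ?thesis .
qed

lemma norm_smult_cvec: "norm (c *s (z :: complex ^ 'n)) = norm c * norm z"
proof -
  have "(norm (c *s z))\<^sup>2 = (norm c * norm z)\<^sup>2"
    unfolding power_mult_distrib norm_cvec_sq by (simp add: norm_mult power_mult_distrib sum_distrib_left)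
  then show ?thesis by (simp add: power2_eq_iff_nonneg)
qed

lemma norm_diff_cvec_sq: "(norm (u - v :: complex ^ 'n))\<^sup>2 = (norm u)\<^sup>2 - 2 * Re (herm u v) + (norm v)\<^sup>2"
proof -
  have "of_real ((norm (u - v))\<^sup>2) = herm u u - herm u v - cnj (herm u v) + herm v v"
    unfolding herm_self[symmetric] cnj_herm by (simp add: herm_simps)
  also have "\<dots> = of_real ((norm u)\<^sup>2 - 2 * Re (herm u v) + (norm v)\<^sup>2)"
    by (simp add: herm_self complex_eq_iff)
  finally show ?thesis by (simp only: of_real_eq_iff)
qed

section \<open>Comparison of heights and kernel modulus in the ball\<close>

lemma hgt_pos: "z \<in> ball 0 1 \<Longrightarrow> hgt z > 0"
  by (simp add: hgt_def power_less_one_iff)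

lemma hgt_le_1: "hgt z \<le> 1"
  by (simp add: hgt_def)

lemma kdis_sym: "kdis z w = kdis w z"
proof -
  have "1 - herm z w = cnj (1 - herm w z)" by (simp add: cnj_herm)
  then show ?thesis unfolding kdis_def by (metis complex_mod_cnj)
qed

lemma kdis_ge_sub: "kdis z w \<ge> 1 - norm z * norm w"
proof -
  have "1 - norm (herm z w) \<le> kdis z w"
    unfolding kdis_def by (metis norm_one norm_triangle_ineq2)
  with norm_herm_le[of z w] show ?thesis by linarith
qed

lemma hgt_le_kdis: assumes "z \<in> ball 0 1" "w \<in> ball 0 1" shows "hgt z \<le> 2 * kdis z w"
proof -
  have z: "norm z < 1" "norm w < 1" using assms by auto
  have "norm z * norm w \<le> norm z * 1" using z by (intro mult_left_mono) auto
  then have "1 - norm z \<le> kdis z w" using kdis_ge_sub[of z w] by simp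
  \<comment> \<open>The difference of the two sides is the square of 1 - |z|.\<close>
  moreover have "hgt z \<le> 2 * (1 - norm z)"
    using sum_squares_ge_zero[of "1 - norm z" 0] by (simp add: hgt_def power2_eq_square algebra_simps)
  ultimately show ?thesis by simp
qed

lemma hgt_le_kdis': "z \<in> ball 0 1 \<Longrightarrow> w \<in> ball 0 1 \<Longrightarrow> hgt w \<le> 2 * kdis z w"
  using hgt_le_kdis[of w z] by (simp add: kdis_sym)

lemma kdis_pos: "z \<in> ball 0 1 \<Longrightarrow> w \<in> ball 0 1 \<Longrightarrow> kdis z w > 0"
  using hgt_le_kdis[of z w] hgt_pos[of z] by linarith

lemma kdis_le_2: assumes "z \<in> ball 0 1" "w \<in> ball 0 1" shows "kdis z w \<le> 2"
proof -
  have "norm (herm z w) \<le> 1 * 1"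
    by (rule order_trans[OF norm_herm_le mult_mono]) (use assms in auto)
  then show ?thesis unfolding kdis_def using norm_triangle_ineq4[of 1 "herm z w"] by simp
qed

lemma norm_herm_less_1: assumes "z \<in> ball 0 1" "w \<in> ball 0 1" shows "norm (herm z w) < 1"
proof -
  have "norm (herm z w) \<le> norm z * norm w" by (rule norm_herm_le)
  also have "\<dots> \<le> norm z * 1" by (rule mult_left_mono) (use assms in auto)
  also have "\<dots> < 1" using assms by simp
  finally show ?thesis .
qed

lemma Re_one_minus_herm_pos: assumes "z \<in> ball 0 1" "w \<in> ball 0 1" shows "Re (1 - herm z w) > 0"
  using norm_herm_less_1[OF assms] abs_Re_le_cmod[of "herm z w"] by simp

text \<open>The vector \<open>a z\<close> in the proof is the numerator of the ball automorphism exchanging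
  \<open>0\<close> and \<open>u\<close>, and the displayed identity is the polarized form of
  \<open>1 - \<bar>\<phi> z\<bar>\<^sup>2 = (1 - \<bar>z\<bar>\<^sup>2) (1 - \<bar>u\<bar>\<^sup>2) / \<bar>1 - \<langle>z,u\<rangle>\<bar>\<^sup>2\<close>.\<close>

lemma kdis_triangle_aux:
  fixes u :: "complex ^ 'n"
  assumes u: "u \<in> ball 0 1"
  shows "\<exists>a :: complex ^ 'n \<Rightarrow> complex ^ 'n.
    (\<forall>z w. herm (a z) (a w) = (1 - herm z u) * (1 - herm u w) - (1 - herm z w) * of_real (hgt u)) \<and>
    (\<forall>z. (norm (a z))\<^sup>2 = (kdis z u)\<^sup>2 - hgt z * hgt u)"
proof -
  define s where "s = sqrt (hgt u)"
  have s: "s > 0" "s\<^sup>2 = hgt u" using hgt_pos[OF u] by (auto simp: s_def)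
  define S where "S = complex_of_real s"
  have S: "1 + S \<noteq> 0" "cnj S = S" "S * S = of_real (hgt u)"
    using s by (auto simp: S_def complex_eq_iff power2_eq_square simp flip: of_real_mult)
  have uu: "herm u u = 1 - S * S"
    unfolding herm_self S(3) by (simp add: hgt_def)
  define a where "a z = S *s z + (herm z u / (1 + S) - 1) *s u" for z
  have 1: "herm (a z) (a w) = (1 - herm z u) * (1 - herm u w) - (1 - herm z w) * of_real (hgt u)" for z w
  proof -
    \<comment> \<open>Writing both inner products as multiples of 1 + S clears the denominators, and
      \<open>uu\<close> gives |u|^2 as 1 - S^2; what remains is a polynomial identity.\<close>
    define A where "A = herm z u / (1 + S)"
    define B where "B = herm u w / (1 + S)"
    have A: "herm z u = A * (1 + S)" and B: "herm u w = B * (1 + S)"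
      using S by (auto simp: A_def B_def)
    have cB: "cnj (herm w u / (1 + S) - 1) = B - 1"
      by (simp add: B_def S cnj_herm)
    have "herm (a z) (a w) = S * (S * herm z w) + (A - 1) * (S * herm u w)
       + ((B - 1) * (S * herm z u) + (B - 1) * ((A - 1) * herm u u))"
      unfolding a_def herm_simps cB A_def[symmetric] S(2) by (simp add: algebra_simps)
    also have "\<dots> = (1 - herm z u) * (1 - herm u w) - (1 - herm z w) * (S * S)"
      unfolding A B uu by (simp add: algebra_simps)
    finally show ?thesis by (simp add: S)
  qed
  have 2: "(norm (a z))\<^sup>2 = (kdis z u)\<^sup>2 - hgt z * hgt u" for z
  proof -
    have "of_real ((norm (a z))\<^sup>2) = (1 - herm z u) * cnj (1 - herm z u) - (1 - herm z z) * of_real (hgt u)"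
      unfolding herm_self[symmetric] 1 by (simp add: cnj_herm)
    also have "\<dots> = of_real ((kdis z u)\<^sup>2 - hgt z * hgt u)"
      unfolding kdis_def complex_norm_square[symmetric] herm_self hgt_def by simp
    finally show ?thesis by (simp only: of_real_eq_iff)
  qed
  show ?thesis using 1 2 by (intro exI[of _ a]) blast
qed

text \<open>This is 1 - \<rho>^2 \<le> 1 for the pseudo-hyperbolic distance \<rho>; it keeps the
  radicands in \<open>kdis_triangle\<close> nonnegative.\<close>

lemma hgt_mult_le: fixes u z :: "complex ^ 'n" assumes "u \<in> ball 0 1" shows "hgt z * hgt u \<le> (kdis z u)\<^sup>2"
proof -
  obtain a :: "complex ^ 'n \<Rightarrow> complex ^ 'n" where a: "\<And>z. (norm (a z))\<^sup>2 = (kdis z u)\<^sup>2 - hgt z * hgt u"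
    using kdis_triangle_aux[OF assms] by blast
  show ?thesis using zero_le_power2[of "norm (a z)"] unfolding a by linarith
qed

text \<open>Cauchy--Schwarz for the vectors \<open>a z\<close> and \<open>a w\<close>. Divided by
  hgt u times the square root of hgt z hgt w it reads cosh d(z,w) \<le> cosh d(z,u) cosh d(u,w) +
  sinh d(z,u) sinh d(u,w), the triangle inequality of the Bergman distance d. Bounding each root by
  the distance next to it leaves a quasi-triangle inequality with factor 2.\<close>

lemma kdis_triangle:
  fixes u z w :: "complex ^ 'n"
  assumes u: "u \<in> ball 0 1"
  shows "kdis z w * hgt u \<le> kdis z u * kdis u w
    + sqrt ((kdis z u)\<^sup>2 - hgt z * hgt u) * sqrt ((kdis u w)\<^sup>2 - hgt u * hgt w)"
proof -
  obtain a :: "complex ^ 'n \<Rightarrow> complex ^ 'n" where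
    a1: "\<And>z w. herm (a z) (a w) = (1 - herm z u) * (1 - herm u w) - (1 - herm z w) * of_real (hgt u)"
    and a2: "\<And>z. (norm (a z))\<^sup>2 = (kdis z u)\<^sup>2 - hgt z * hgt u"
    using kdis_triangle_aux[OF u] by blast
  have "kdis z w * hgt u = norm ((1 - herm z w) * of_real (hgt u))"
    using hgt_pos[OF u] by (simp add: kdis_def norm_mult)
  also have "(1 - herm z w) * of_real (hgt u) = (1 - herm z u) * (1 - herm u w) - herm (a z) (a w)"
    unfolding a1 by simp
  also have "norm \<dots> \<le> kdis z u * kdis u w + norm (a z) * norm (a w)"
    unfolding kdis_def norm_mult[symmetric]
    by (rule order_trans[OF norm_triangle_ineq4]) (simp add: norm_herm_le)
  also have "norm (a z) = sqrt ((kdis z u)\<^sup>2 - hgt z * hgt u)"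
    unfolding a2[symmetric] by simp
  also have "norm (a w) = sqrt ((kdis u w)\<^sup>2 - hgt u * hgt w)"
    using a2[of w] by (metis kdis_sym mult.commute norm_ge_zero real_sqrt_unique)
  finally show ?thesis .
qed

text \<open>Determinants are avoided by testing against the unit ball B. The measure of the preimage
  of A times that of B is a double integral of the indicators of A at f x + y and of B at y. After a
  shift and Fubini the inner integral counts the x with y - f x in B; as f preserves norms, this
  says that b y - x lies in B, which is a ball of the same volume. Cancelling the positive finite
  volume of B finishes.\<close>

lemma lborel_distr_isometry:
  fixes f :: "'a::euclidean_space \<Rightarrow> 'a"
  assumes lin: "linear f" and iso: "\<And>x. norm (f x) = norm x"
  shows "distr lborel borel f = lborel"
proof -
  have inj: "inj f"
  proof (rule linear_injective_0[THEN iffD2, OF lin, rule_format])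
    fix x assume "f x = 0" then show "x = 0" using iso[of x] by simp
  qed
  have surj: "surj f" using linear_injective_imp_surjective[OF lin inj] by simp
  define b where "b = inv f"
  have fb: "f (b y) = y" for y unfolding b_def by (rule surj_f_inv_f[OF surj])
  have [measurable]: "f \<in> borel_measurable borel"
    by (intro borel_measurable_continuous_onI linear_continuous_on linear_conv_bounded_linear[THEN iffD1] lin)
  have tr: "(\<integral>\<^sup>+x. F (x + c) \<partial>lborel) = (\<integral>\<^sup>+x. F x \<partial>lborel)" if [measurable]: "F \<in> borel_measurable borel"
    for F :: "'a \<Rightarrow> ennreal" and c
    by (subst (2) lborel_distr_plus[of c, symmetric]) (simp add: nn_integral_distr add.commute)
  have refl: "(\<integral>\<^sup>+x. F (- x) \<partial>lborel) = (\<integral>\<^sup>+x. F x \<partial>lborel)" if [measurable]: "F \<in> borel_measurable borel"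
    for F :: "'a \<Rightarrow> ennreal"
    by (subst (2) lborel_affine[of "-1" 0]) (simp_all add: nn_integral_density nn_integral_distr)
  define B :: "'a set" where "B = ball 0 1"
  have [measurable]: "B \<in> sets borel" by (simp add: B_def)
  have B0: "emeasure lborel B \<noteq> 0" 
    using content_ball_pos[of 1 "0::'a"] by (auto simp: B_def measure_def)
  have Bf: "emeasure lborel B \<noteq> top"
    unfolding B_def using emeasure_lborel_ball_finite[of "0::'a" 1] by (simp add: less_top)
  show ?thesis
  proof (rule measure_eqI)
    fix A assume "A \<in> sets (distr lborel borel f)"
    then have [measurable]: "A \<in> sets borel" by simp
    have "emeasure (distr lborel borel f) A * emeasure lborel B
        = (\<integral>\<^sup>+x. indicator A (f x) \<partial>lborel) * emeasure lborel B"
      by (simp add: nn_integral_distr flip: nn_integral_indicator)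
    also have "\<dots> = (\<integral>\<^sup>+y. (\<integral>\<^sup>+x. indicator A (f x) \<partial>lborel) * indicator B y \<partial>lborel)"
      by (simp add: nn_integral_cmult)
    also have "\<dots> = (\<integral>\<^sup>+y. (\<integral>\<^sup>+x. indicator A (f (x + b y)) \<partial>lborel) * indicator B y \<partial>lborel)"
      by (subst tr[of "\<lambda>x. indicator A (f x)"]) auto
    also have "\<dots> = (\<integral>\<^sup>+y. (\<integral>\<^sup>+x. indicator A (f x + y) * indicator B y \<partial>lborel) \<partial>lborel)"
      by (simp add: linear_add[OF lin] fb nn_integral_multc)
    also have "\<dots> = (\<integral>\<^sup>+x. (\<integral>\<^sup>+y. indicator A (f x + y) * indicator B y \<partial>lborel) \<partial>lborel)"
      by (rule lborel_pair.Fubini') simp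
    also have "\<dots> = (\<integral>\<^sup>+x. (\<integral>\<^sup>+y. indicator A y * indicator B (y - f x) \<partial>lborel) \<partial>lborel)"
    proof (rule nn_integral_cong)
      fix x
      show "(\<integral>\<^sup>+y. indicator A (f x + y) * indicator B y \<partial>lborel)
          = (\<integral>\<^sup>+y. indicator A y * indicator B (y - f x) \<partial>lborel)"
        using tr[of "\<lambda>y. indicator A y * indicator B (y - f x)" "f x"] by (simp add: add.commute)
    qed
    also have "\<dots> = (\<integral>\<^sup>+y. (\<integral>\<^sup>+x. indicator A y * indicator B (y - f x) \<partial>lborel) \<partial>lborel)"
      by (rule lborel_pair.Fubini') simp
    also have "\<dots> = (\<integral>\<^sup>+y. indicator A y * (\<integral>\<^sup>+x. indicator B (y - f x) \<partial>lborel) \<partial>lborel)"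
      by (simp add: nn_integral_cmult)
    also have "\<dots> = (\<integral>\<^sup>+y. indicator A y * emeasure lborel B \<partial>lborel)"
    proof (rule nn_integral_cong, rule arg_cong[where f="(*) _"])
      fix y
      have "y - f x \<in> B \<longleftrightarrow> - x + b y \<in> B" for x
      proof -
        have "y - f x = f (- x + b y)" by (simp add: linear_diff[OF lin] fb)
        then show ?thesis unfolding B_def by (simp only: mem_ball_0 iso)
      qed
      then have "(\<integral>\<^sup>+x. indicator B (y - f x) \<partial>lborel) = (\<integral>\<^sup>+x. indicator B (- x + b y) \<partial>lborel)"
        by (intro nn_integral_cong) (auto split: split_indicator)
      also have "\<dots> = emeasure lborel B"
        by (subst refl[of "\<lambda>x. indicator B (x + b y)"], simp, subst tr) auto
      finally show "(\<integral>\<^sup>+x. indicator B (y - f x) \<partial>lborel) = emeasure lborel B" .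
    qed
    also have "\<dots> = emeasure lborel A * emeasure lborel B"
      by (simp add: nn_integral_multc)
    finally show "emeasure (distr lborel borel f) A = emeasure lborel A"
      using B0 Bf by (simp add: mult.commute[of _ "emeasure lborel B"] ennreal_mult_cancel_left)
  qed simp
qed

lemma linear_smult_cvec: "linear (\<lambda>w :: complex ^ 'n. c *s w)"
  by (rule linearI) (simp_all add: vec_eq_iff algebra_simps)

lemma lborel_distr_smult:
  assumes "norm c = 1"
  shows "distr lborel borel (\<lambda>w :: complex ^ 'n. c *s w) = lborel"
  by (rule lborel_distr_isometry[OF linear_smult_cvec]) (simp add: norm_smult_cvec assms)

lemma integral_lborel_scaleR:
  fixes F :: "'a::euclidean_space \<Rightarrow> 'b::{banach, second_countable_topology}"
  assumes [measurable]: "F \<in> borel_measurable borel" and "c \<noteq> 0"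
  shows "(LINT x|lborel. F x) = \<bar>c\<bar> ^ DIM('a) *\<^sub>R (LINT x|lborel. F (c *\<^sub>R x))"
  by (subst lborel_affine[of c 0]) (simp_all add: assms integral_density integral_distr)

section \<open>The mean value property\<close>

lemma has_vector_derivative_iff_tendsto:
  "(f has_vector_derivative D) (at x) \<longleftrightarrow> ((\<lambda>h. inverse h *\<^sub>R (f (x + h) - f x)) \<longlongrightarrow> D) (at 0)"
proof -
  have "(f has_vector_derivative D) (at x) \<longleftrightarrow> ((\<lambda>h. norm (f (x + h) - f x - h *\<^sub>R D) / norm h) \<longlongrightarrow> 0) (at 0)"
    unfolding has_vector_derivative_def has_derivative_at by (simp add: bounded_linear_scaleR_left)
  also have "\<dots> \<longleftrightarrow> ((\<lambda>h. norm (inverse h *\<^sub>R (f (x + h) - f x) - D)) \<longlongrightarrow> 0) (at 0)"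
  proof (rule tendsto_cong, rule eventually_at[THEN iffD2], intro exI[of _ 1] conjI ballI impI)
    fix h :: real assume "h \<noteq> 0 \<and> dist h 0 < 1"
    then have "f (x + h) - f x - h *\<^sub>R D = h *\<^sub>R (inverse h *\<^sub>R (f (x + h) - f x) - D)" "h \<noteq> 0"
      by (auto simp: scaleR_diff_right)
    then show "norm (f (x + h) - f x - h *\<^sub>R D) / norm h = norm (inverse h *\<^sub>R (f (x + h) - f x) - D)"
      by (simp del: scaleR_diff_right)
  qed auto
  also have "\<dots> \<longleftrightarrow> ((\<lambda>h. inverse h *\<^sub>R (f (x + h) - f x)) \<longlongrightarrow> D) (at 0)"
    by (simp add: tendsto_norm_zero_iff LIM_zero_iff)
  finally show ?thesis .
qed

text \<open>The mean value inequality bounds every difference quotient by B, so dominated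
  convergence applies along each sequence tending to 0.\<close>

lemma integral_has_vector_derivative_dominated:
  fixes f :: "real \<Rightarrow> 'a \<Rightarrow> 'b::{banach, second_countable_topology}"
  assumes int: "\<And>t. integrable M (f t)"
    and der: "\<And>t w. ((\<lambda>t. f t w) has_vector_derivative f' t w) (at t)"
    and bd: "\<And>t w. norm (f' t w) \<le> B w" and B: "integrable M B"
    and meas: "f' 0 \<in> borel_measurable M"
  shows "((\<lambda>t. LINT w|M. f t w) has_vector_derivative (LINT w|M. f' 0 w)) (at 0)"
proof -
  have lip: "norm (f h w - f 0 w) \<le> B w * \<bar>h\<bar>" for h w
  proof -
    have "norm (f h w - f 0 w) \<le> B w * norm (h - 0)"
      by (rule differentiable_bound[OF convex_UNIV, where f'="\<lambda>t h. h *\<^sub>R f' t w"])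
         (use der bd in \<open>auto simp: has_vector_derivative_def mult.commute[of "\<bar>_\<bar>"] intro!: onorm_le mult_right_mono\<close>)
    then show ?thesis by simp
  qed
  have "((\<lambda>h. inverse h *\<^sub>R ((LINT w|M. f h w) - (LINT w|M. f 0 w))) \<longlongrightarrow> (LINT w|M. f' 0 w)) (at 0)"
    unfolding tendsto_at_iff_sequentially comp_def
  proof (intro allI impI)
    fix X :: "nat \<Rightarrow> real"
    assume X: "\<forall>i. X i \<in> UNIV - {0}" "X \<longlonglongrightarrow> 0"
    have "(\<lambda>i. LINT w|M. inverse (X i) *\<^sub>R (f (X i) w - f 0 w)) \<longlonglongrightarrow> (LINT w|M. f' 0 w)"
    proof (rule integral_dominated_convergence[where w=B])
      show "AE w in M. (\<lambda>i. inverse (X i) *\<^sub>R (f (X i) w - f 0 w)) \<longlonglongrightarrow> f' 0 w"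
      proof (rule AE_I2)
        fix w
        have "((\<lambda>h. inverse h *\<^sub>R (f h w - f 0 w)) \<longlongrightarrow> f' 0 w) (at 0)"
          using der[of w 0] unfolding has_vector_derivative_iff_tendsto by simp
        then show "(\<lambda>i. inverse (X i) *\<^sub>R (f (X i) w - f 0 w)) \<longlonglongrightarrow> f' 0 w"
          using X unfolding tendsto_at_iff_sequentially comp_def by blast
      qed
      show "AE w in M. norm (inverse (X i) *\<^sub>R (f (X i) w - f 0 w)) \<le> B w" for i
      proof (rule AE_I2)
        fix w
        show "norm (inverse (X i) *\<^sub>R (f (X i) w - f 0 w)) \<le> B w"
          using lip[of "X i" w] X(1) by (simp add: divide_simps mult.commute)
      qed
    qed (use B int meas in auto)
    then show "(\<lambda>i. inverse (X i) *\<^sub>R ((LINT w|M. f (X i) w) - (LINT w|M. f 0 w))) \<longlonglongrightarrow> (LINT w|M. f' 0 w)"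
      by (simp add: int)
  qed
  then show ?thesis
    unfolding has_vector_derivative_iff_tendsto by simp
qed

lemma circle_mean_value:
  assumes "continuous_on (cball 0 1) h" "h holomorphic_on ball 0 1"
  shows "(LINT t|restrict_space lborel {0..1}. h (exp (2 * of_real pi * \<i> * of_real t))) = h 0"
proof -
  have "((\<lambda>u. h u / (u - 0)) has_contour_integral (2 * of_real pi * \<i> * h 0)) (circlepath 0 1)"
    by (rule Cauchy_integral_circlepath) (use assms in auto)
  then have "((\<lambda>t. (2 * of_real pi * \<i>) * h (exp (2 * of_real pi * \<i> * of_real t))) has_integral (2 * of_real pi * \<i> * h 0)) {0..1}"
    unfolding has_contour_integral_def
    by (rule has_integral_eq[rotated]) (simp add: vector_derivative_circlepath01, simp add: circlepath)
  then have "((\<lambda>t. (1 / (2 * of_real pi * \<i>)) * ((2 * of_real pi * \<i>) * h (exp (2 * of_real pi * \<i> * of_real t)))) has_integral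
      (1 / (2 * of_real pi * \<i>)) * (2 * of_real pi * \<i> * h 0)) {0..1}"
    by (rule has_integral_mult_right)
  then have hi: "((\<lambda>t. h (exp (2 * of_real pi * \<i> * of_real t))) has_integral h 0) {0..1}"
    by simp
  have "continuous_on {0..1} (\<lambda>t::real. h (exp (2 * of_real pi * \<i> * of_real t)))"
    by (intro continuous_on_compose2[OF assms(1)] continuous_intros) auto
  then have "set_integrable lborel {0..1} (\<lambda>t::real. h (exp (2 * of_real pi * \<i> * of_real t)))"
    by (rule borel_integrable_atLeastAtMost')
  from set_borel_integral_eq_integral(2)[OF this] hi
  show ?thesis
    by (simp add: set_lebesgue_integral_def integral_restrict_space integral_unique)
qed

lemma cn_holomorphic_line:
  assumes "cn_holomorphic_on g S" "x + s *s v \<in> S"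
  shows "\<exists>D. ((\<lambda>s. g (x + s *s v)) has_field_derivative D) (at s)"
proof -
  obtain f' where f': "(g has_derivative f') (at (x + s *s v))" "\<And>c v. f' (c *s v) = c * f' v"
    using assms unfolding cn_holomorphic_on_def by blast
  have lin: "bounded_linear (\<lambda>h. h *s v)"
    by (intro linear_conv_bounded_linear[THEN iffD1] linearI) (simp_all add: vec_eq_iff algebra_simps)
  have "((\<lambda>s. x + s *s v) has_derivative (\<lambda>h. h *s v)) (at s)"
    using has_derivative_add[OF has_derivative_const bounded_linear.has_derivative[OF lin has_derivative_ident]]
    by simp
  from has_derivative_compose[OF this f'(1)]
  have "((\<lambda>s. g (x + s *s v)) has_derivative (\<lambda>h. f' v * h)) (at s)"
    by (simp add: f'(2) mult.commute)
  then show ?thesis unfolding has_field_derivative_def by blast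
qed

lemma cn_holomorphic_line_on:
  assumes "cn_holomorphic_on g S" "\<And>s. s \<in> U \<Longrightarrow> x + s *s v \<in> S"
  shows "(\<lambda>s. g (x + s *s v)) holomorphic_on U"
  unfolding holomorphic_on_def field_differentiable_def
  using cn_holomorphic_line[OF assms(1)] assms(2) has_field_derivative_at_within by blast

lemma cn_holomorphic_continuous_on: "cn_holomorphic_on g S \<Longrightarrow> continuous_on S g"
  unfolding cn_holomorphic_on_def continuous_on_eq_continuous_within
  using has_derivative_continuous continuous_at_imp_continuous_at_within by blast

text \<open>Multiplication of w by a unimodular scalar preserves \<phi> and Lebesgue measure, so the
  integral equals its own average over the circle. By Fubini this average can be taken inside, where
  the one-variable mean value property on the complex line through x and x + w yields g x. Only
  invariance under the circle is used, not under all unitary maps.\<close>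

lemma cn_mean_value:
  fixes g :: "complex ^ 'n \<Rightarrow> complex" and \<phi> :: "complex ^ 'n \<Rightarrow> real"
  assumes hol: "cn_holomorphic_on g (ball x s)" and bd: "\<And>y. y \<in> ball x s \<Longrightarrow> norm (g y) \<le> M"
    and \<phi>: "integrable lborel \<phi>" and circ: "\<And>(c::complex) w. norm c = 1 \<Longrightarrow> \<phi> (c *s w) = \<phi> w"
    and supp: "\<And>w. \<phi> w \<noteq> 0 \<Longrightarrow> norm w < s"
  shows "integrable lborel (\<lambda>w. \<phi> w *\<^sub>R g (x + w))"
    and "(LINT w|lborel. \<phi> w *\<^sub>R g (x + w)) = (LINT w|lborel. \<phi> w) *\<^sub>R g x"
proof -
  \<comment> \<open>Outside the ball nothing is known about g, not even measurability; the cut-off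
    is invisible because \<phi> vanishes there.\<close>
  define g0 where "g0 w = indicator (ball 0 s) w *\<^sub>R g (x + w)" for w
  have [measurable]: "g0 \<in> borel_measurable borel"
    unfolding g0_def
    by (intro borel_measurable_continuous_on_indicator continuous_on_compose2[OF cn_holomorphic_continuous_on[OF hol]] continuous_intros)
       (auto simp: dist_norm)
  have [measurable]: "\<phi> \<in> borel_measurable borel" using \<phi> by auto
  have M0: "norm (g0 w) \<le> \<bar>M\<bar>" for w
    using bd[of "x + w"] by (auto simp: g0_def dist_norm split: split_indicator)
  define G where "G w = \<phi> w *\<^sub>R g0 w" for w
  have G: "G = (\<lambda>w. \<phi> w *\<^sub>R g (x + w))"
    using supp by (auto simp: G_def g0_def fun_eq_iff split: split_indicator)
  have Gb: "norm (G w) \<le> \<bar>\<phi> w\<bar> * \<bar>M\<bar>" for w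
    using M0[of w] by (simp add: G_def mult_left_mono)
  have [measurable]: "G \<in> borel_measurable borel" unfolding G_def by measurable
  have intG: "integrable lborel G"
    by (rule Bochner_Integration.integrable_bound[where f="\<lambda>w. \<bar>\<phi> w\<bar> * \<bar>M\<bar>"]) (use \<phi> Gb in auto)
  then show "integrable lborel (\<lambda>w. \<phi> w *\<^sub>R g (x + w))" unfolding G .
  define e where "e t = exp (2 * of_real pi * \<i> * of_real t :: complex)" for t :: real
  have e1: "norm (e t) = 1" for t by (simp add: e_def)
  have [measurable]: "e \<in> borel_measurable borel"
    unfolding e_def by (intro borel_measurable_continuous_onI continuous_intros)
  define I where "I = restrict_space lborel {0..1::real}"
  have eI [measurable]: "e \<in> borel_measurable I"
    unfolding I_def by (intro measurable_restrict_space1) simp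
  have emI: "emeasure I (space I) = 1"
    by (simp add: I_def emeasure_restrict_space space_restrict_space)
  interpret I: finite_measure I
    by (rule finite_measureI) (simp add: emI)
  interpret P: pair_sigma_finite I "lborel :: (complex ^ 'n) measure" ..
  have m2 [measurable]: "(\<lambda>(t, w). e t *s w) \<in> borel_measurable (I \<Otimes>\<^sub>M (lborel :: (complex ^ 'n) measure))"
  proof -
    have "continuous_on UNIV (\<lambda>p. fst p *s (snd p :: complex ^ 'n))"
      unfolding vector_scalar_mult_def by (intro continuous_intros)
    then have "(\<lambda>p. fst p *s (snd p :: complex ^ 'n)) \<in> borel_measurable (borel \<Otimes>\<^sub>M borel)"
      by (simp add: borel_prod borel_measurable_continuous_onI)
    then have "(\<lambda>p. fst p *s (snd p :: complex ^ 'n)) \<circ> (\<lambda>(t, w). (e t, w)) \<in> borel_measurable (I \<Otimes>\<^sub>M (lborel :: (complex ^ 'n) measure))"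
      by (rule measurable_comp[rotated]) measurable
    then show ?thesis by (simp add: comp_def case_prod_unfold)
  qed
  have rot: "(LINT w|lborel. G (e t *s w)) = (LINT w|lborel. G w)" for t
    by (subst (2) lborel_distr_smult[OF e1, of t, symmetric], subst integral_distr) 
       (auto intro!: borel_measurable_continuous_onI linear_continuous_on simp: linear_smult_cvec linear_conv_bounded_linear[symmetric])
  have "integrable (I \<Otimes>\<^sub>M lborel) (\<lambda>(t, w). \<bar>\<phi> w\<bar> * \<bar>M\<bar>)"
    by (rule P.Fubini_integrable) (use \<phi> in auto)
  then have int2: "integrable (I \<Otimes>\<^sub>M lborel) (\<lambda>(t, w). G (e t *s w))"
    by (rule Bochner_Integration.integrable_bound) (use Gb circ e1 in \<open>auto simp: case_prod_unfold intro!: AE_I2\<close>, metis)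
  have "(LINT w|lborel. G w) = (LINT t|I. LINT w|lborel. G (e t *s w))"
    unfolding rot by (simp add: measure_def emI)
  also have "\<dots> = (LINT w|lborel. LINT t|I. G (e t *s w))"
    by (rule P.Fubini_integral[symmetric]) (rule int2)
  also have "\<dots> = (LINT w|lborel. \<phi> w *\<^sub>R g x)"
  proof (rule Bochner_Integration.integral_cong[OF refl])
    fix w
    show "(LINT t|I. G (e t *s w)) = \<phi> w *\<^sub>R g x"
    proof (cases "norm w < s")
      case True
      define h where "h c = g (x + c *s w)" for c
      \<comment> \<open>The scalars c with x + c w in the ball form a disc of radius s / |w| > 1;
        for w = 0 any radius above 1 serves.\<close>
      define r where "r = (if w = 0 then 2 else s / norm w)"
      have r: "r > 1" using True by (auto simp: r_def)
      have "h holomorphic_on ball 0 r"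
        unfolding h_def
      proof (rule cn_holomorphic_line_on[OF hol])
        fix c :: complex assume "c \<in> ball 0 r"
        then show "x + c *s w \<in> ball x s"
          using True by (auto simp: dist_norm norm_smult_cvec r_def field_simps split: if_splits)
      qed
      then have "h holomorphic_on cball 0 1" by (rule holomorphic_on_subset) (use r in auto)
      then have "(LINT t|I. h (e t)) = h 0"
        unfolding I_def e_def
        by (intro circle_mean_value holomorphic_on_imp_continuous_on) (auto intro: holomorphic_on_subset)
      moreover have "G (e t *s w) = \<phi> w *\<^sub>R h (e t)" for t
        unfolding G h_def by (simp add: circ e1)
      ultimately show ?thesis by (simp add: h_def)
    next
      case False
      then have "\<phi> w = 0" using supp by blast
      then show ?thesis unfolding G by (simp add: circ e1)
    qed
  qed
  also have "\<dots> = (LINT w|lborel. \<phi> w) *\<^sub>R g x" by (rule integral_scaleR_left) (rule \<phi>)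
  finally show "(LINT w|lborel. \<phi> w *\<^sub>R g (x + w)) = (LINT w|lborel. \<phi> w) *\<^sub>R g x" unfolding G .
qed

section \<open>Moments of holomorphic functions against radial weights\<close>

text \<open>Since \<open>0 powr b\<close> is 0 for every b, the truncation extends the weight by
  zero off the ball. Integrals over the ball thereby become integrals over the whole space, where
  translations and dilations act.\<close>

definition wt :: "real \<Rightarrow> complex ^ 'n \<Rightarrow> real" where
  "wt b u = max 0 (hgt u) powr b"

definition wt_mass :: "'n::finite itself \<Rightarrow> real \<Rightarrow> real" where
  "wt_mass _ b = (LINT u|(lborel :: (complex ^ 'n) measure). wt b u)"

lemma hgt_pos_iff: "hgt z > 0 \<longleftrightarrow> z \<in> ball 0 1"
  by (simp add: hgt_def power_less_one_iff abs_square_less_1)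

lemma wt_eq: "wt b u = (if u \<in> ball 0 1 then hgt u powr b else 0)"
  using hgt_pos_iff[of u] by (auto simp: wt_def max_def)

lemma wt_nonneg [simp]: "wt b u \<ge> 0"
  by (simp add: wt_def)

lemma hgt_measurable [measurable]: "hgt \<in> borel_measurable borel"
  unfolding hgt_def by measurable

lemma wt_measurable [measurable]: "wt b \<in> borel_measurable borel"
  unfolding wt_def by measurable

lemma continuous_on_herm [continuous_intros]:
  "continuous_on S f \<Longrightarrow> continuous_on S g \<Longrightarrow> continuous_on S (\<lambda>x. herm (f x) (g x))"
  unfolding herm_def by (intro continuous_intros)

lemma herm_measurable [measurable]:
  "f \<in> borel_measurable M \<Longrightarrow> g \<in> borel_measurable M \<Longrightarrow> (\<lambda>x. herm (f x) (g x)) \<in> borel_measurable M"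
  by (rule borel_measurable_continuous_Pair[where H=herm]) (auto intro!: continuous_intros)

lemma wt_smult: "norm c = 1 \<Longrightarrow> wt b (c *s u) = wt b u"
  by (simp add: wt_def hgt_def norm_smult_cvec)

lemma wt_le: "b \<ge> 0 \<Longrightarrow> wt b u \<le> indicator (ball 0 1) u"
  using hgt_le_1[of u] hgt_pos[of u] by (auto simp: wt_eq powr_le1)

lemma integrable_lborel_ball: "integrable lborel (indicator (ball (x::'a::euclidean_space) r) :: _ \<Rightarrow> real)"
  using emeasure_lborel_ball_finite[of x r] by (intro integrable_real_indicator) simp_all

lemma integrable_wt_nonneg: "b \<ge> 0 \<Longrightarrow> integrable lborel (wt b)"
  by (rule Bochner_Integration.integrable_bound[OF integrable_lborel_ball[of 0 1]])
     (use wt_le in \<open>auto intro!: AE_I2\<close>)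

text \<open>The point is differentiability at 0, where b > 1 is needed. For this reason the moments
  are first computed for weights with positive exponent, whose predecessors \<open>b + 1\<close>
  satisfy this condition, and reach exponents down to -1 by another route.\<close>

lemma has_real_derivative_max_powr:
  assumes b: "b > 1"
  shows "((\<lambda>x. max 0 x powr b) has_real_derivative b * max 0 x powr (b - 1)) (at x)"
proof -
  consider "x > 0" | "x < 0" | "x = 0" by linarith
  then show ?thesis
  proof cases
    case 1
    have "((\<lambda>x. x powr b) has_real_derivative b * x powr (b - 1)) (at x)"
      using 1 by (auto intro!: derivative_eq_intros)
    then have "((\<lambda>x. max 0 x powr b) has_real_derivative b * x powr (b - 1)) (at x)"
      by (rule has_field_derivative_transform_within_open[where S="{0<..}"]) (use 1 in auto)
    then show ?thesis using 1 by simp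
  next
    case 2
    have "((\<lambda>x. 0) has_real_derivative 0) (at x)" by simp
    then have "((\<lambda>x. max 0 x powr b) has_real_derivative 0) (at x)"
      by (rule has_field_derivative_transform_within_open[where S="{..<0}"]) (use 2 in auto)
    then show ?thesis using 2 by simp
  next
    case 3
    have "((\<lambda>h. \<bar>h\<bar> powr (b - 1)) \<longlongrightarrow> 0) (at (0::real))"
    proof (rule tendsto_zero_powrI)
      show "((\<lambda>h::real. \<bar>h\<bar>) \<longlongrightarrow> 0) (at 0)" by (rule tendsto_rabs_zero) (rule tendsto_ident_at)
    qed (use b in auto)
    then have "((\<lambda>h. max 0 h powr b / h) \<longlongrightarrow> 0) (at (0::real))"
    proof (rule Lim_null_comparison[rotated])
      have "norm (max 0 h powr b / h) \<le> \<bar>h\<bar> powr (b - 1)" for h :: real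
      proof (cases "h > 0")
        case True then show ?thesis by (simp add: powr_diff)
      qed (simp add: max_absorb1)
      then show "\<forall>\<^sub>F h in at (0::real). norm (max 0 h powr b / h) \<le> \<bar>h\<bar> powr (b - 1)" by simp
    qed
    then show ?thesis using b by (simp add: DERIV_def 3)
  qed
qed

section \<open>Differentiating a translated weight along a complex line\<close>

definition ker_term :: "complex ^ 'n \<Rightarrow> real \<Rightarrow> nat \<Rightarrow> complex ^ 'n \<Rightarrow> complex" where
  "ker_term z b j u = herm z u ^ j * of_real (wt b u)"

text \<open>The derivative of \<open>ker_term z b j (u - t *\<^sub>R y)\<close> in the real
  parameter t, at t = 0. Truncated subtraction in \<open>j - 1\<close> is harmless because of the
  factor j.\<close>

definition ker_der :: "complex ^ 'n \<Rightarrow> real \<Rightarrow> nat \<Rightarrow> complex ^ 'n \<Rightarrow> complex ^ 'n \<Rightarrow> complex" where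
  "ker_der z b j y u = - of_nat j * herm z u ^ (j - 1) * herm z y * of_real (wt b u)
     + herm z u ^ j * of_real (2 * b * wt (b - 1) u * Re (herm u y))"

lemma ker_term_measurable [measurable]: "ker_term z b j \<in> borel_measurable borel"
  unfolding ker_term_def by measurable

lemma ker_der_measurable [measurable]: "ker_der z b j y \<in> borel_measurable borel"
  unfolding ker_der_def by measurable

lemma ker_term_has_vector_derivative:
  assumes b: "b > 1"
  shows "((\<lambda>t. ker_term z b j (u - t *\<^sub>R y)) has_vector_derivative ker_der z b j y (u - t *\<^sub>R y)) (at t)"
proof -
  have "((\<lambda>s. (herm z u - s * herm z y) ^ j) has_field_derivative
      - of_nat j * (herm z u - of_real t * herm z y) ^ (j - 1) * herm z y) (at (of_real t))"
    by (auto intro!: derivative_eq_intros)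
  from has_vector_derivative_real_field[OF this]
  have 1: "((\<lambda>t. herm z (u - t *\<^sub>R y) ^ j) has_vector_derivative
      - of_nat j * herm z (u - t *\<^sub>R y) ^ (j - 1) * herm z y) (at t)"
    by (simp add: herm_simps)
  have h: "hgt (u - t *\<^sub>R y) = 1 - ((norm u)\<^sup>2 - 2 * t * Re (herm u y) + t\<^sup>2 * (norm y)\<^sup>2)" for t
    unfolding hgt_def norm_diff_cvec_sq by (simp add: herm_simps power_mult_distrib)
  have "((\<lambda>t. hgt (u - t *\<^sub>R y)) has_real_derivative 2 * Re (herm (u - t *\<^sub>R y) y)) (at t)"
    unfolding h by (auto intro!: derivative_eq_intros simp: herm_simps herm_self)
  from DERIV_chain2[OF has_real_derivative_max_powr[OF b] this]
  have "((\<lambda>t. wt b (u - t *\<^sub>R y)) has_real_derivative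
      2 * b * wt (b - 1) (u - t *\<^sub>R y) * Re (herm (u - t *\<^sub>R y) y)) (at t)"
    unfolding wt_def by (simp add: mult_ac)
  then have 2: "((\<lambda>t. complex_of_real (wt b (u - t *\<^sub>R y))) has_vector_derivative
      of_real (2 * b * wt (b - 1) (u - t *\<^sub>R y) * Re (herm (u - t *\<^sub>R y) y))) (at t)"
    by (rule has_vector_derivative_of_real)
  show ?thesis
    using has_vector_derivative_mult[OF 1 2] unfolding ker_term_def ker_der_def by (simp add: add.commute)
qed

lemma ker_der_bound:
  assumes b: "b > 1"
  shows "norm (ker_der z b j y u) \<le> of_nat j * norm z ^ (j - 1) * (norm z * norm y) + norm z ^ j * (2 * b * norm y)"
proof (cases "u \<in> ball 0 1")
  case True
  have hz: "norm (herm z u) \<le> norm z"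
    using order_trans[OF norm_herm_le mult_left_mono[of "norm u" 1 "norm z"]] True by simp
  have hy: "\<bar>Re (herm u y)\<bar> \<le> norm y"
    using order_trans[OF abs_Re_le_cmod order_trans[OF norm_herm_le mult_right_mono[of "norm u" 1 "norm y"]]] True by simp
  have w: "wt b u \<le> 1" "wt (b - 1) u \<le> 1" using wt_le[of b u] wt_le[of "b - 1" u] b True by auto
  have "norm (of_nat j * herm z u ^ (j - 1) * herm z y * of_real (wt b u)) \<le> of_nat j * norm z ^ (j - 1) * (norm z * norm y) * 1"
    unfolding norm_mult norm_power
    by (intro mult_mono power_mono hz norm_herm_le) (use w in auto)
  moreover have "norm (herm z u ^ j * of_real (2 * b * wt (b - 1) u * Re (herm u y))) \<le> norm z ^ j * (2 * b * 1 * norm y)"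
    unfolding norm_mult norm_power norm_of_real abs_mult
    by (intro mult_mono power_mono hz hy) (use w b in auto)
  ultimately show ?thesis
    unfolding ker_der_def by (intro order_trans[OF norm_triangle_ineq]) simp
next
  case False
  then show ?thesis using b by (simp add: ker_der_def wt_eq)
qed

lemma ker_term_bound: "b \<ge> 0 \<Longrightarrow> norm (ker_term z b j u) \<le> norm z ^ j * indicator (ball 0 1) u"
proof -
  assume b: "b \<ge> 0"
  show ?thesis
  proof (cases "u \<in> ball 0 1")
    case True
    have hz: "norm (herm z u) \<le> norm z"
      using order_trans[OF norm_herm_le mult_left_mono[of "norm u" 1 "norm z"]] True by simp
    have "norm (ker_term z b j u) \<le> norm z ^ j * 1"
      unfolding ker_term_def norm_mult norm_power
      by (intro mult_mono power_mono hz) (use wt_le[OF b, of u] True in auto)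
    then show ?thesis using True by simp
  qed (simp add: ker_term_def wt_eq)
qed

text \<open>The combination is a Wirtinger derivative in direction z. The factor
  \<open>herm z u ^ j\<close> is antiholomorphic in u, so its contribution cancels; the derivative
  of the weight contributes the conjugate of \<open>herm u z\<close>, one further factor
  \<open>herm z u\<close>. Hence b drops by one and j rises by one.\<close>

lemma ker_der_wirtinger:
  "ker_der z b j z u - \<i> * ker_der z b j (\<i> *s z) u = 2 * of_real b * ker_term z (b - 1) (Suc j) u"
proof -
  define h where "h = herm u z"
  have hu: "herm z u = cnj h" by (simp add: h_def cnj_herm)
  have "of_real (Re h) - \<i> * of_real (Im h) = cnj h"
    by (simp add: complex_eq_iff)
  then have e: "cnj h = of_real (Re h) - \<i> * of_real (Im h)" by simp
  show ?thesis
    unfolding ker_der_def ker_term_def herm_simps hu h_def[symmetric]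
    by (simp add: algebra_simps) (simp add: e algebra_simps)
qed

text \<open>The margin \<rho> > 1 leaves room to translate the unit ball by small multiples of z.
  Functions on the unit ball alone are reached afterwards through their dilates.\<close>

locale hol_on_larger_ball =
  fixes g :: "complex ^ 'n \<Rightarrow> complex" and \<rho> M :: real
  assumes rho: "\<rho> > 1" and hol: "cn_holomorphic_on g (ball 0 \<rho>)"
    and bd: "\<And>w. w \<in> ball 0 \<rho> \<Longrightarrow> norm (g w) \<le> M"
begin

definition g0 :: "complex ^ 'n \<Rightarrow> complex" where
  "g0 w = indicator (ball 0 \<rho>) w *\<^sub>R g w"

lemma g0_measurable [measurable]: "g0 \<in> borel_measurable borel"
  unfolding g0_def
  by (intro borel_measurable_continuous_on_indicator cn_holomorphic_continuous_on[OF hol]) simp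

lemma g0_bound: "norm (g0 w) \<le> \<bar>M\<bar> * indicator (ball 0 \<rho>) w"
  using bd[of w] by (auto simp: g0_def split: split_indicator)

text \<open>Translating the weight instead of g puts all derivatives in s on explicit functions, and
  g needs only to be bounded and measurable for them.\<close>

definition conv :: "complex ^ 'n \<Rightarrow> real \<Rightarrow> nat \<Rightarrow> complex \<Rightarrow> complex" where
  "conv z b j s = (LINT w|lborel. g0 w * ker_term z b j (w - s *s z))"

lemma integrable_g0_mult:
  assumes [measurable]: "h \<in> borel_measurable borel" and "\<And>w. norm (h w) \<le> K"
  shows "integrable lborel (\<lambda>w. g0 w * h w)"
proof (rule Bochner_Integration.integrable_bound)
  show "integrable lborel (\<lambda>w. \<bar>M\<bar> * \<bar>K\<bar> * indicator (ball 0 \<rho>) w :: real)"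
    by (intro integrable_mult_right integrable_lborel_ball)
  show "AE w in lborel. norm (g0 w * h w) \<le> norm (\<bar>M\<bar> * \<bar>K\<bar> * indicator (ball 0 \<rho>) w :: real)"
  proof (rule AE_I2)
    fix w
    have "norm (g0 w * h w) \<le> (\<bar>M\<bar> * indicator (ball 0 \<rho>) w) * \<bar>K\<bar>"
      unfolding norm_mult by (intro mult_mono g0_bound order_trans[OF assms(2)]) auto
    then show "norm (g0 w * h w) \<le> norm (\<bar>M\<bar> * \<bar>K\<bar> * indicator (ball 0 \<rho>) w :: real)"
      by (simp add: mult_ac abs_mult)
  qed
qed measurable

lemma integrable_conv: "b \<ge> 0 \<Longrightarrow> integrable lborel (\<lambda>w. g0 w * ker_term z b j (w - y))"
proof (rule integrable_g0_mult[where K="norm z ^ j"])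
  fix w assume "b \<ge> 0"
  show "norm (ker_term z b j (w - y)) \<le> norm z ^ j"
    by (rule order_trans[OF ker_term_bound[OF \<open>b \<ge> 0\<close>]]) (simp split: split_indicator)
qed measurable

lemma conv_has_vector_derivative:
  assumes b: "b > 1"
  shows "((\<lambda>t. conv z b j (s + of_real t * v)) has_vector_derivative
    (LINT w|lborel. g0 w * ker_der z b j (v *s z) (w - s *s z))) (at 0)"
proof -
  define K where "K = of_nat j * norm z ^ (j - 1) * (norm z * norm (v *s z)) + norm z ^ j * (2 * b * norm (v *s z))"
  have sh: "w - (s + of_real t * v) *s z = (w - s *s z) - t *\<^sub>R (v *s z)" for w t
    unfolding scaleR_eq_smult by (simp add: vec_eq_iff algebra_simps)
  have "((\<lambda>t. LINT w|lborel. g0 w * ker_term z b j ((w - s *s z) - t *\<^sub>R (v *s z))) has_vector_derivative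
    (LINT w|lborel. g0 w * ker_der z b j (v *s z) ((w - s *s z) - 0 *\<^sub>R (v *s z)))) (at 0)"
  proof (rule integral_has_vector_derivative_dominated[where B="\<lambda>w. \<bar>M\<bar> * K * indicator (ball 0 \<rho>) w"
        and f'="\<lambda>t w. g0 w * ker_der z b j (v *s z) ((w - s *s z) - t *\<^sub>R (v *s z))"])
    show "integrable lborel (\<lambda>w. g0 w * ker_term z b j (w - s *s z - t *\<^sub>R (v *s z)))" for t
      unfolding diff_diff_eq by (rule integrable_conv) (use b in simp)
    show "((\<lambda>t. g0 w * ker_term z b j (w - s *s z - t *\<^sub>R (v *s z))) has_vector_derivative
            g0 w * ker_der z b j (v *s z) (w - s *s z - t *\<^sub>R (v *s z))) (at t)" for t w
      by (rule has_vector_derivative_mult_right[OF ker_term_has_vector_derivative[OF b]])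
    show "norm (g0 w * ker_der z b j (v *s z) (w - s *s z - t *\<^sub>R (v *s z))) \<le> \<bar>M\<bar> * K * indicator (ball 0 \<rho>) w" for t w
    proof -
      have "norm (g0 w * ker_der z b j (v *s z) (w - s *s z - t *\<^sub>R (v *s z))) \<le> (\<bar>M\<bar> * indicator (ball 0 \<rho>) w) * K"
        unfolding norm_mult K_def by (intro mult_mono g0_bound ker_der_bound b) auto
      then show ?thesis by (simp add: mult_ac)
    qed
  qed (auto intro!: integrable_mult_right integrable_lborel_ball)
  then show ?thesis unfolding conv_def sh by simp
qed

text \<open>Differentiability in the complex sense is assumed here, and is supplied by the induction
  in \<open>conv_eq\<close>. It makes the directional derivative complex linear, so D can be read
  off from the directions 1 and \<i>, in exactly the combination in which
  \<open>ker_der_wirtinger\<close> simplifies the integrand.\<close>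

lemma conv_deriv:
  assumes b: "b > 1" and D: "(conv z b j has_field_derivative D) (at s)"
  shows "D = of_real b * conv z (b - 1) (Suc j) s"
proof -
  define I where "I v = (LINT w|lborel. g0 w * ker_der z b j (v *s z) (w - s *s z))" for v
  have Dv: "D * v = I v" for v
  proof -
    have "((\<lambda>t. conv z b j (s + of_real t * v)) has_vector_derivative I v) (at 0)"
      unfolding I_def by (rule conv_has_vector_derivative[OF b])
    moreover have "((\<lambda>t. conv z b j (s + of_real t * v)) has_vector_derivative D * v) (at 0)"
    proof -
      have "((\<lambda>t. s + t * v) has_field_derivative v) (at (of_real 0))"
        by (auto intro!: derivative_eq_intros)
      then have "((\<lambda>t. conv z b j (s + t * v)) has_field_derivative D * v) (at (of_real 0))"
        by (rule DERIV_chain2[rotated]) (use D in simp)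
      from has_vector_derivative_real_field[OF this] show ?thesis by simp
    qed
    ultimately show ?thesis by (rule vector_derivative_unique_at[symmetric])
  qed
  have int: "integrable lborel (\<lambda>w. g0 w * ker_der z b j y (w - s *s z))" for y
    by (rule integrable_g0_mult[OF _ ker_der_bound[OF b]]) measurable
  have "2 * D = I 1 - \<i> * I \<i>"
    using mult.left_commute[of \<i> D \<i>] by (simp add: Dv[symmetric])
  also have "\<dots> = (LINT w|lborel. g0 w * ker_der z b j z (w - s *s z) - \<i> * (g0 w * ker_der z b j (\<i> *s z) (w - s *s z)))"
    unfolding I_def using int[of z] int[of "\<i> *s z"] by simp
  also have "\<dots> = (LINT w|lborel. 2 * of_real b * (g0 w * ker_term z (b - 1) (Suc j) (w - s *s z)))"
  proof (rule Bochner_Integration.integral_cong[OF refl])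
    fix w
    have "g0 w * ker_der z b j z (w - s *s z) - \<i> * (g0 w * ker_der z b j (\<i> *s z) (w - s *s z))
      = g0 w * (ker_der z b j z (w - s *s z) - \<i> * ker_der z b j (\<i> *s z) (w - s *s z))"
      by (simp add: algebra_simps)
    then show "g0 w * ker_der z b j z (w - s *s z) - \<i> * (g0 w * ker_der z b j (\<i> *s z) (w - s *s z))
      = 2 * of_real b * (g0 w * ker_term z (b - 1) (Suc j) (w - s *s z))"
      unfolding ker_der_wirtinger by (simp add: mult_ac)
  qed
  also have "\<dots> = 2 * (of_real b * conv z (b - 1) (Suc j) s)"
    by (simp add: conv_def)
  finally show ?thesis by simp
qed

lemma open_dom: "open {s :: complex. norm s * norm z + 1 < \<rho>}"
  by (intro open_Collect_less continuous_intros)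

lemma slice_holomorphic: "(\<lambda>s. g (s *s z)) holomorphic_on {s. norm s * norm z + 1 < \<rho>}"
  using cn_holomorphic_line_on[OF hol, of "{s. norm s * norm z + 1 < \<rho>}" 0 z] by (auto simp: norm_smult_cvec)

text \<open>Induction on j with b varying. For j = 0 the weight around \<open>s *s z\<close> is
  circular and the mean value property applies. The step differentiates the identity for b + 1 and
  j: the right side gains a derivative, while on the left \<open>conv_deriv\<close> produces
  exponent b and index j + 1 with the factor b + 1. These factors build up the Pochhammer
  symbol.\<close>

lemma conv_eq:
  assumes "b > 0" "norm s * norm z + 1 < \<rho>"
  shows "conv z b j s = of_real (wt_mass TYPE('n) (b + real j) / pochhammer (b + 1) j) * (deriv ^^ j) (\<lambda>s. g (s *s z)) s"
  using assms
proof (induction j arbitrary: b s)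
  case 0
  define x where "x = s *s z"
  have x: "norm x + 1 < \<rho>" using 0 by (simp add: x_def norm_smult_cvec)
  have sub: "ball x 1 \<subseteq> ball 0 \<rho>"
  proof
    fix y assume "y \<in> ball x 1"
    then show "y \<in> ball 0 \<rho>" using x norm_triangle_sub[of y x] by (simp add: dist_norm norm_minus_commute)
  qed
  have "conv z b 0 s = (LINT u|lborel. g0 (x + u) * of_real (wt b u))"
    unfolding conv_def ker_term_def x_def[symmetric]
    by (subst lborel_distr_plus[of x, symmetric]) (simp add: integral_distr)
  also have "\<dots> = (LINT u|lborel. wt b u *\<^sub>R g (x + u))"
  proof (rule Bochner_Integration.integral_cong[OF refl])
    fix u
    show "g0 (x + u) * of_real (wt b u) = wt b u *\<^sub>R g (x + u)"
    proof (cases "u \<in> ball 0 1")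
      case True
      then have "x + u \<in> ball x 1" by (simp add: dist_norm)
      then have "x + u \<in> ball 0 \<rho>" using sub by blast
      then show ?thesis by (simp add: g0_def scaleR_conv_of_real)
    qed (simp add: wt_eq)
  qed
  also have "\<dots> = (LINT (u :: complex ^ 'n)|lborel. wt b u) *\<^sub>R g x"
  proof -
    have h1: "cn_holomorphic_on g (ball x 1)" using hol sub unfolding cn_holomorphic_on_def by blast
    have h2: "integrable lborel (wt b :: complex ^ 'n \<Rightarrow> real)" using 0 by (intro integrable_wt_nonneg) simp
    have h3: "norm (g y) \<le> M" if "y \<in> ball x 1" for y using bd sub that by blast
    have h4: "wt b (c *s w) = wt b w" if "norm c = 1" for c and w :: "complex ^ 'n" by (rule wt_smult[OF that])
    have h5: "norm w < 1" if "wt b w \<noteq> 0" for w :: "complex ^ 'n" using that by (auto simp: wt_eq split: if_splits)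
    show ?thesis by (rule cn_mean_value(2)[of g x 1 M "wt b", OF h1 h3 h2 h4 h5])
  qed
  finally show ?case by (simp add: wt_mass_def x_def scaleR_conv_of_real)
next
  case (Suc j)
  define U where "U = {s :: complex. norm s * norm z + 1 < \<rho>}"
  define c where "c = wt_mass TYPE('n) (b + 1 + real j) / pochhammer (b + 1 + 1) j"
  have "(deriv ^^ j) (\<lambda>s. g (s *s z)) holomorphic_on U"
    by (rule holomorphic_higher_deriv) (auto simp: U_def open_dom slice_holomorphic)
  then have "((deriv ^^ j) (\<lambda>s. g (s *s z)) has_field_derivative (deriv ^^ Suc j) (\<lambda>s. g (s *s z)) s) (at s)"
    using Suc.prems by (simp add: holomorphic_derivI[where S=U] U_def open_dom)
  then have "((\<lambda>s. of_real c * (deriv ^^ j) (\<lambda>s. g (s *s z)) s) has_field_derivative of_real c * (deriv ^^ Suc j) (\<lambda>s. g (s *s z)) s) (at s)"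
    by (rule DERIV_cmult)
  then have "(conv z (b + 1) j has_field_derivative of_real c * (deriv ^^ Suc j) (\<lambda>s. g (s *s z)) s) (at s)"
    by (rule has_field_derivative_transform_within_open[where S=U])
       (use Suc.IH[of "b + 1"] Suc.prems in \<open>auto simp: U_def open_dom c_def\<close>)
  from conv_deriv[OF _ this] Suc.prems
  have "of_real c * (deriv ^^ Suc j) (\<lambda>s. g (s *s z)) s = of_real (b + 1) * conv z b (Suc j) s" by simp
  moreover have "complex_of_real (b + 1) \<noteq> 0" using Suc.prems by (simp only: of_real_eq_0_iff)
  ultimately have "conv z b (Suc j) s = of_real c * (deriv ^^ Suc j) (\<lambda>s. g (s *s z)) s / of_real (b + 1)"
    by (simp add: field_simps)
  also have "\<dots> = of_real (c / (b + 1)) * (deriv ^^ Suc j) (\<lambda>s. g (s *s z)) s" by simp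
  also have "c / (b + 1) = wt_mass TYPE('n) (b + real (Suc j)) / pochhammer (b + 1) (Suc j)"
    by (simp add: c_def pochhammer_rec add_ac)
  finally show ?case .
qed

lemma moment_pos:
  assumes "b > 0"
  shows "(LINT w|lborel. g w * ker_term z b m w)
     = of_real (wt_mass TYPE('n) (b + real m) / pochhammer (b + 1) m) * (deriv ^^ m) (\<lambda>s. g (s *s z)) 0"
proof -
  have "g w * ker_term z b m w = g0 w * ker_term z b m w" for w
    using rho by (auto simp: g0_def ker_term_def wt_eq split: split_indicator)
  then have "(LINT w|lborel. g w * ker_term z b m w) = conv z b m 0"
    unfolding conv_def by (intro Bochner_Integration.integral_cong) simp_all
  then show ?thesis using conv_eq[of b 0 z m] assms rho by simp
qed

end

text \<open>With an integer N \<ge> b, Bernoulli's inequality bounds 1 - (1 - t)^b by N t, uniformly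
  in t. The bound by the power b - 1 is the majorant for the difference quotients below; if \<eta>
  exceeds x, already x^b itself is small enough.\<close>

lemma powr_quotient_bound:
  fixes b :: real
  assumes "b > 0"
  shows "\<exists>K\<ge>0. \<forall>x \<eta>. \<eta> > 0 \<longrightarrow> 0 \<le> max 0 x powr b - max 0 (x - \<eta>) powr b \<and>
    max 0 x powr b - max 0 (x - \<eta>) powr b \<le> K * \<eta> * max 0 x powr (b - 1)"
proof -
  define N where "N = nat \<lceil>b\<rceil>"
  have N: "N \<ge> 1" "b \<le> real N" using assms unfolding N_def by linarith+
  have "0 \<le> max 0 x powr b - max 0 (x - \<eta>) powr b \<and>
    max 0 x powr b - max 0 (x - \<eta>) powr b \<le> real N * \<eta> * max 0 x powr (b - 1)" if \<eta>: "\<eta> > 0" for x \<eta> :: real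
  proof
    have "max 0 (x - \<eta>) powr b \<le> max 0 x powr b" using \<eta> assms by (intro powr_mono2) auto
    then show "0 \<le> max 0 x powr b - max 0 (x - \<eta>) powr b" by simp
    consider "x \<le> 0" | "x > 0" "x < \<eta>" | "x > 0" "x \<ge> \<eta>" by linarith
    then show "max 0 x powr b - max 0 (x - \<eta>) powr b \<le> real N * \<eta> * max 0 x powr (b - 1)"
    proof cases
      case 1
      then show ?thesis using \<eta> by (simp add: max_absorb1)
    next
      case 2
      have "x powr b = x * x powr (b - 1)" using 2 by (simp add: powr_diff)
      also have "\<dots> \<le> (real N * \<eta>) * x powr (b - 1)"
        using 2 N mult_mono[of 1 "real N" x \<eta>] by (intro mult_right_mono) auto
      finally show ?thesis using 2 by (simp add: max_absorb1)
    next
      case 3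
      define t where "t = \<eta> / x"
      have t: "0 < t" "t \<le> 1" "\<eta> = t * x" using 3 \<eta> by (auto simp: t_def)
      have "1 - real N * t \<le> (1 - t) ^ N"
        using Bernoulli_inequality[of "- t" N] t by simp
      also have "\<dots> = (1 - t) powr real N" using t N by (simp add: powr_realpow')
      also have "\<dots> \<le> (1 - t) powr b" using t N by (intro powr_mono') auto
      finally have "x powr b * (1 - real N * t) \<le> x powr b * (1 - t) powr b"
        by (intro mult_left_mono) auto
      also have "\<dots> = (x - \<eta>) powr b"
        using 3 t by (simp add: powr_mult[symmetric] algebra_simps)
      finally have le: "x powr b - (x - \<eta>) powr b \<le> real N * t * x powr b"
        by (simp add: algebra_simps)
      have "x powr b = x * x powr (b - 1)" using 3 by (simp add: powr_diff)
      then have "real N * t * x powr b = real N * \<eta> * x powr (b - 1)" unfolding t(3) by (simp only: mult_ac)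
      then have "x powr b - (x - \<eta>) powr b \<le> real N * \<eta> * x powr (b - 1)" using le by (simp only:)
      then show ?thesis using 3 by simp
    qed
  qed
  then show ?thesis by (intro exI[of _ "real N"]) simp
qed

section \<open>Lowering the weight exponent by one through dilations\<close>

definition eta :: "nat \<Rightarrow> real" where "eta k = 1 / (real k + 2)"

lemma eta_pos: "0 < eta k" "eta k < 1" by (auto simp: eta_def)

lemma eta_tendsto: "eta \<longlonglongrightarrow> 0"
  unfolding eta_def by real_asymp

lemma filterlim_eta: "filterlim (\<lambda>k. - eta k) (at 0) sequentially"
  unfolding filterlim_at using tendsto_minus[OF eta_tendsto] by (auto simp: eta_def[abs_def])

lemma quotient_eta_tendsto:
  fixes f :: "real \<Rightarrow> real"
  assumes "(f has_real_derivative D) (at x)"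
  shows "(\<lambda>k. (f x - f (x - eta k)) / eta k) \<longlonglongrightarrow> D"
proof -
  have "(\<lambda>k. (f (x + - eta k) - f x) / (- eta k)) \<longlonglongrightarrow> D"
    using assms unfolding DERIV_def by (rule filterlim_compose[OF _ filterlim_eta])
  then show ?thesis by (simp add: minus_divide_left[symmetric] minus_divide_right[symmetric] diff_divide_distrib)
qed

text \<open>A backward difference quotient, in the height, of the b-th power divided by b; it tends
  to \<open>wt (b - 1)\<close>. Its integrals are accessible because the height diminished by \<eta>
  is, up to a factor, the height in a smaller concentric ball.\<close>

definition shell :: "real \<Rightarrow> nat \<Rightarrow> complex ^ 'n \<Rightarrow> real" where
  "shell b k w = (wt b w - max 0 (hgt w - eta k) powr b) / (b * eta k)"

lemma shell_measurable [measurable]: "shell b k \<in> borel_measurable borel"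
  unfolding shell_def by measurable

lemma shell_nonneg: "b > 0 \<Longrightarrow> shell b k w \<ge> 0"
  using powr_quotient_bound[of b] eta_pos(1)[of k] unfolding shell_def wt_def
  by (intro divide_nonneg_pos) auto

lemma shell_bound: assumes "b > 0"
  shows "\<exists>K\<ge>0. \<forall>k w. shell b k w \<le> K * wt (b - 1) w"
proof -
  obtain K where K: "K \<ge> 0" "\<And>x \<eta>. \<eta> > 0 \<Longrightarrow> max 0 x powr b - max 0 (x - \<eta>) powr b \<le> K * \<eta> * max 0 x powr (b - 1)"
    using powr_quotient_bound[OF assms] by blast
  have "shell b k w \<le> K / b * wt (b - 1) w" for k w
  proof -
    have "shell b k w \<le> (K * eta k * max 0 (hgt w) powr (b - 1)) / (b * eta k)"
      unfolding shell_def wt_def using eta_pos(1)[of k] assms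
      by (intro divide_right_mono K(2)) auto
    then show ?thesis using eta_pos(1)[of k] assms by (simp add: wt_def)
  qed
  then show ?thesis using K(1) assms by (intro exI[of _ "K / b"]) auto
qed

lemma shell_tendsto: assumes "b > 0"
  shows "(\<lambda>k. shell b k w) \<longlonglongrightarrow> wt (b - 1) w"
proof (cases "hgt w > 0")
  case True
  have "((\<lambda>x. x powr b) has_real_derivative b * hgt w powr (b - 1)) (at (hgt w))"
    using True by (auto intro!: derivative_eq_intros)
  then have "((\<lambda>x. max 0 x powr b) has_real_derivative b * hgt w powr (b - 1)) (at (hgt w))"
    by (rule has_field_derivative_transform_within_open[where S="{0<..}"]) (use True in auto)
  from tendsto_divide[OF quotient_eta_tendsto[OF this] tendsto_const, of b]
  show ?thesis using assms True by (simp add: shell_def wt_def mult.commute)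
next
  case False
  then show ?thesis using eta_pos(1) by (simp add: shell_def wt_def max_absorb1 order_trans[of "hgt w" 0 "eta _"] less_imp_le)
qed

lemma quotient_power_tendsto: "(\<lambda>k. (1 - (1 - eta k) powr e) / eta k) \<longlonglongrightarrow> e"
proof -
  have "((\<lambda>x. x powr e) has_real_derivative e * 1 powr (e - 1)) (at 1)"
    by (auto intro!: derivative_eq_intros)
  from quotient_eta_tendsto[OF this] show ?thesis by simp
qed

text \<open>Substitution of w = sqrt (1 - \<eta>) u: the reduced height becomes (1 - \<eta>) times
  the height of u. The real dimension is 2n, so the Jacobian is (1 - \<eta>)^n.\<close>

lemma integral_shrunk_weight:
  fixes G :: "complex ^ 'n \<Rightarrow> complex"
  assumes [measurable]: "G \<in> borel_measurable borel" and \<eta>: "0 < \<eta>" "\<eta> < 1"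
  shows "(LINT w|lborel. G w * of_real (max 0 (hgt w - \<eta>) powr b))
    = of_real ((1 - \<eta>) powr (real CARD('n) + b)) * (LINT u|lborel. G (sqrt (1 - \<eta>) *\<^sub>R u) * of_real (wt b u))"
proof -
  define l where "l = sqrt (1 - \<eta>)"
  have l: "l > 0" "l\<^sup>2 = 1 - \<eta>" using \<eta> by (auto simp: l_def)
  have h: "max 0 (hgt (l *\<^sub>R u) - \<eta>) powr b = (1 - \<eta>) powr b * wt b u" for u :: "complex ^ 'n"
  proof -
    have "hgt (l *\<^sub>R u) - \<eta> = (1 - \<eta>) * hgt u"
      unfolding hgt_def norm_scaleR power_mult_distrib by (simp add: l algebra_simps)
    moreover have "max 0 ((1 - \<eta>) * hgt u) = (1 - \<eta>) * max 0 (hgt u)"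
      using \<eta> by (auto simp: max_def zero_le_mult_iff)
    ultimately show ?thesis using \<eta> by (simp add: powr_mult wt_def)
  qed
  have pw: "\<bar>l\<bar> ^ DIM(complex ^ 'n) = (1 - \<eta>) powr real CARD('n)"
  proof -
    have "\<bar>l\<bar> ^ DIM(complex ^ 'n) = l ^ (2 * CARD('n))" using l by (simp add: mult.commute)
    also have "\<dots> = (l\<^sup>2) ^ CARD('n)" by (rule power_mult)
    finally have "\<bar>l\<bar> ^ DIM(complex ^ 'n) = (l\<^sup>2) ^ CARD('n)" .
    then show ?thesis using l \<eta> by (simp add: powr_realpow)
  qed
  have "(LINT w|lborel. G w * of_real (max 0 (hgt w - \<eta>) powr b))
    = \<bar>l\<bar> ^ DIM(complex ^ 'n) *\<^sub>R (LINT u|lborel. G (l *\<^sub>R u) * of_real (max 0 (hgt (l *\<^sub>R u) - \<eta>) powr b))"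
    by (rule integral_lborel_scaleR) (use l in auto)
  also have "(LINT u|lborel. G (l *\<^sub>R u) * of_real (max 0 (hgt (l *\<^sub>R u) - \<eta>) powr b))
    = of_real ((1 - \<eta>) powr b) * (LINT u|lborel. G (l *\<^sub>R u) * of_real (wt b u))"
    unfolding h by (simp add: mult_ac flip: integral_mult_right_zero)
  finally show ?thesis unfolding pw by (simp add: powr_add scaleR_conv_of_real l_def)
qed

text \<open>The homogeneity \<open>hom\<close> is demanded of the weighted integral rather than of G
  itself: G will contain an arbitrary holomorphic factor, and only its moment scales by a pure
  power. Both terms of the shell are then multiples of one integral.\<close>

lemma integral_shell:
  fixes G :: "complex ^ 'n \<Rightarrow> complex"
  assumes [measurable]: "G \<in> borel_measurable borel" and G: "\<And>w. w \<in> ball 0 1 \<Longrightarrow> norm (G w) \<le> K" and b: "b > 0"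
    and hom: "\<And>\<eta>. 0 < \<eta> \<Longrightarrow> \<eta> < 1 \<Longrightarrow>
      (LINT u|lborel. G (sqrt (1 - \<eta>) *\<^sub>R u) * of_real (wt b u)) = of_real ((1 - \<eta>) powr e) * (LINT u|lborel. G u * of_real (wt b u))"
  shows "integrable lborel (\<lambda>w. G w * of_real (shell b k w))"
    and "(LINT w|lborel. G w * of_real (shell b k w))
    = of_real ((1 - (1 - eta k) powr (real CARD('n) + b + e)) / eta k / b) * (LINT u|lborel. G u * of_real (wt b u))"
proof -
  have K: "norm (G w * of_real (max 0 (hgt w - \<eta>) powr b)) \<le> \<bar>K\<bar> * indicator (ball 0 1) w" if "\<eta> \<ge> 0" for \<eta> w
  proof (cases "w \<in> ball 0 1")
    case True
    have "norm (G w * of_real (max 0 (hgt w - \<eta>) powr b)) \<le> \<bar>K\<bar> * 1"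
      unfolding norm_mult using G[OF True] that hgt_le_1[of w] b
      by (intro mult_mono) (auto simp: powr_le1)
    then show ?thesis using True by simp
  next
    case False
    then have "max 0 (hgt w - \<eta>) = 0" using that hgt_pos_iff[of w] by (intro max_absorb1) auto
    then show ?thesis by simp
  qed
  have int: "integrable lborel (\<lambda>w. G w * of_real (max 0 (hgt w - \<eta>) powr b))" if "\<eta> \<ge> 0" for \<eta>
    by (rule Bochner_Integration.integrable_bound[where f="\<lambda>w. \<bar>K\<bar> * indicator (ball 0 1) w :: real"])
       (use K[OF that] in \<open>auto intro!: integrable_mult_right integrable_lborel_ball AE_I2\<close>)
  have i0: "integrable lborel (\<lambda>w. G w * of_real (wt b w))"
    using int[of 0] by (simp add: wt_def)
  have alg: "(A - of_real r * A) * of_real (1 / (b * h)) = of_real ((1 - r) / h / b) * A" for A :: complex and r h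
    by (cases "b = 0 \<or> h = 0") (auto simp: field_simps)
  have eq: "G w * of_real (shell b k w) = (G w * of_real (wt b w) - G w * of_real (max 0 (hgt w - eta k) powr b)) * of_real (1 / (b * eta k))" for w
    by (simp add: shell_def field_simps)
  show "integrable lborel (\<lambda>w. G w * of_real (shell b k w))"
    unfolding eq using i0 int[of "eta k"] eta_pos(1)[of k] by (intro integrable_mult_left Bochner_Integration.integrable_diff) auto
  have "(LINT w|lborel. G w * of_real (shell b k w)) = ((LINT w|lborel. G w * of_real (wt b w)) -
     (LINT w|lborel. G w * of_real (max 0 (hgt w - eta k) powr b))) * of_real (1 / (b * eta k))"
    unfolding eq using i0 int[of "eta k"] eta_pos(1)[of k] by simp
  also have "(LINT w|lborel. G w * of_real (max 0 (hgt w - eta k) powr b))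
     = of_real ((1 - eta k) powr (real CARD('n) + b + e)) * (LINT u|lborel. G u * of_real (wt b u))"
    using integral_shrunk_weight[OF assms(1) eta_pos[of k], of b] hom[OF eta_pos[of k]] by (simp add: powr_add)
  finally show "(LINT w|lborel. G w * of_real (shell b k w))
    = of_real ((1 - (1 - eta k) powr (real CARD('n) + b + e)) / eta k / b) * (LINT u|lborel. G u * of_real (wt b u))"
    by (simp only: alg)
qed

text \<open>For b < 1 the weight is unbounded near the sphere. The shells approximating it have
  integrals that are known and converge, so Fatou's lemma gives integrability.\<close>

lemma wt_mass_aux:
  assumes b: "b > 0"
  shows "integrable lborel (wt (b - 1) :: complex ^ 'n \<Rightarrow> real)"
proof -
  let ?c = "\<lambda>k. (1 - (1 - eta k) powr (real CARD('n) + b)) / eta k / b * wt_mass TYPE('n) b"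
  have I: "integrable lborel (\<lambda>w :: complex ^ 'n. 1 * complex_of_real (shell b k w))"
    "(LINT w::complex ^ 'n|lborel. 1 * complex_of_real (shell b k w))
      = of_real ((1 - (1 - eta k) powr (real CARD('n) + b + 0)) / eta k / b) * (LINT u::complex ^ 'n|lborel. 1 * of_real (wt b u))" for k
    by (rule integral_shell(1)[where K=1 and G="\<lambda>_. 1" and e=0]; use b in simp)
       (rule integral_shell(2)[where K=1 and G="\<lambda>_. 1" and e=0]; use b in simp)
  have i: "integrable lborel (shell b k :: complex ^ 'n \<Rightarrow> real)" for k
    using I(1)[of k] by (simp only: mult_1 complex_of_real_integrable_eq)
  have v: "(LINT w::complex ^ 'n|lborel. shell b k w) = ?c k" for k
    using I(2)[of k] unfolding mult_1 integral_complex_of_real add_0_right wt_mass_def of_real_mult[symmetric] of_real_eq_iff .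
  have "(\<lambda>k. ?c k) \<longlonglongrightarrow> (real CARD('n) + b) / b * wt_mass TYPE('n) b"
    by (intro tendsto_intros quotient_power_tendsto) (use b in auto)
  then have lim: "(\<lambda>k. ennreal (?c k)) \<longlonglongrightarrow> ennreal ((real CARD('n) + b) / b * wt_mass TYPE('n) b)"
    by (rule tendsto_ennrealI)
  have "(\<integral>\<^sup>+w. ennreal (wt (b - 1) (w :: complex ^ 'n)) \<partial>lborel) = (\<integral>\<^sup>+w. liminf (\<lambda>k. ennreal (shell b k (w :: complex ^ 'n))) \<partial>lborel)"
    by (intro nn_integral_cong lim_imp_Liminf[symmetric] tendsto_ennrealI shell_tendsto b) simp
  also have "\<dots> \<le> liminf (\<lambda>k. \<integral>\<^sup>+w. ennreal (shell b k (w :: complex ^ 'n)) \<partial>lborel)"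
    by (rule nn_integral_liminf) simp
  also have "\<dots> = liminf (\<lambda>k. ennreal (?c k))"
    by (simp add: nn_integral_eq_integral[OF i] shell_nonneg[OF b] v)
  also have "\<dots> = ennreal ((real CARD('n) + b) / b * wt_mass TYPE('n) b)"
    by (rule lim_imp_Liminf[OF _ lim]) simp
  finally have "(\<integral>\<^sup>+w. ennreal (wt (b - 1) (w :: complex ^ 'n)) \<partial>lborel) < \<infinity>"
    by (rule order_le_less_trans) simp
  then show ?thesis by (intro integrableI_bounded) simp_all
qed

lemma integrable_wt: "b > -1 \<Longrightarrow> integrable lborel (wt b :: complex ^ 'n \<Rightarrow> real)"
  using wt_mass_aux[of "b + 1"] by simp

text \<open>Dominated convergence in the shell identity, with \<open>shell_bound\<close> as
  majorant; the quotient (1 - (1 - \<eta>)^k) / \<eta> tends to its exponent k. This descends from b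
  to b - 1 without differentiating the weight, and so covers all exponents above -1.\<close>

lemma moment_step:
  fixes G :: "complex ^ 'n \<Rightarrow> complex"
  assumes [measurable]: "G \<in> borel_measurable borel" and G: "\<And>w. w \<in> ball 0 1 \<Longrightarrow> norm (G w) \<le> K" and b: "b > 0"
    and hom: "\<And>\<eta>. 0 < \<eta> \<Longrightarrow> \<eta> < 1 \<Longrightarrow>
      (LINT u|lborel. G (sqrt (1 - \<eta>) *\<^sub>R u) * of_real (wt b u)) = of_real ((1 - \<eta>) powr e) * (LINT u|lborel. G u * of_real (wt b u))"
  shows "(LINT w|lborel. G w * of_real (wt (b - 1) w))
    = of_real ((real CARD('n) + b + e) / b) * (LINT u|lborel. G u * of_real (wt b u))"
proof -
  note I = integral_shell[OF assms]
  obtain B where B: "B \<ge> 0" "\<And>k w. shell b k (w :: complex ^ 'n) \<le> B * wt (b - 1) w"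
    using shell_bound[OF b] by blast
  have "(\<lambda>k. LINT w|lborel. G w * of_real (shell b k w)) \<longlonglongrightarrow> (LINT w|lborel. G w * of_real (wt (b - 1) w))"
  proof (rule integral_dominated_convergence[where w="\<lambda>w. \<bar>K\<bar> * B * wt (b - 1) w"])
    show "integrable lborel (\<lambda>w :: complex ^ 'n. \<bar>K\<bar> * B * wt (b - 1) w)"
      by (intro integrable_mult_right wt_mass_aux b)
    show "AE w in lborel. (\<lambda>k. G w * of_real (shell b k w)) \<longlonglongrightarrow> G w * of_real (wt (b - 1) w)"
      by (intro AE_I2 tendsto_intros shell_tendsto b)
    show "AE w in lborel. norm (G w * of_real (shell b k w)) \<le> \<bar>K\<bar> * B * wt (b - 1) w" for k
    proof (rule AE_I2)
      fix w :: "complex ^ 'n"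
      show "norm (G w * of_real (shell b k w)) \<le> \<bar>K\<bar> * B * wt (b - 1) w"
      proof (cases "w \<in> ball 0 1")
        case True
        have "norm (G w * of_real (shell b k w)) \<le> \<bar>K\<bar> * (B * wt (b - 1) w)"
          unfolding norm_mult using G[OF True] B(2)[of k w] shell_nonneg[OF b, of k w]
          by (intro mult_mono) auto
        then show ?thesis by (simp add: mult_ac)
      next
        case False
        then have "shell b k w = 0" using B(2)[of k w] shell_nonneg[OF b, of k w] by (simp add: wt_eq)
        then show ?thesis using B(1) by simp
      qed
    qed
  qed measurable
  moreover have "(\<lambda>k. LINT w|lborel. G w * of_real (shell b k w)) \<longlonglongrightarrow>
     of_real ((real CARD('n) + b + e) / b) * (LINT u|lborel. G u * of_real (wt b u))"
  proof -
    have I2: "(LINT w|lborel. G w * of_real (shell b k w))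
      = of_real ((1 - (1 - eta k) powr (real CARD('n) + b + e)) / eta k / b) * (LINT u|lborel. G u * of_real (wt b u))" for k
      by (rule I(2))
    show ?thesis unfolding I2 by (intro tendsto_intros quotient_power_tendsto) (use b in auto)
  qed
  ultimately show ?thesis by (rule LIMSEQ_unique)
qed

lemma wt_mass_step:
  assumes b: "b > 0"
  shows "wt_mass TYPE('n::finite) (b - 1) = (real CARD('n) + b) / b * wt_mass TYPE('n) b"
proof -
  have "(LINT w::complex ^ 'n|lborel. 1 * complex_of_real (wt (b - 1) w))
    = of_real ((real CARD('n) + b + 0) / b) * (LINT u::complex ^ 'n|lborel. 1 * of_real (wt b u))"
    by (rule moment_step[where K=1 and G="\<lambda>_. 1"]) (use b in auto)
  then show ?thesis
    unfolding mult_1 integral_complex_of_real add_0_right wt_mass_def of_real_mult[symmetric] of_real_eq_iff .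
qed

lemma wt_mass_pos:
  assumes "b > -1" shows "wt_mass TYPE('n::finite) b > 0"
proof -
  have "wt_mass TYPE('n) b \<noteq> 0"
  proof
    assume "wt_mass TYPE('n) b = 0"
    then have "AE w::complex ^ 'n in lborel. wt b w = 0"
      unfolding wt_mass_def using integrable_wt[OF assms] by (subst (asm) integral_nonneg_eq_0_iff_AE) auto
    then have "AE w in lborel. w \<notin> ball (0::complex ^ 'n) 1"
      by eventually_elim (use hgt_pos in \<open>force simp: wt_eq split: if_splits\<close>)
    then have "emeasure lborel (ball (0::complex ^ 'n) 1) = 0"
      by (subst (asm) AE_iff_measurable[OF _ refl]) (auto simp: ball_def)
    then show False using content_ball_pos[of 1 "0::complex ^ 'n"] by (simp add: measure_def)
  qed
  moreover have "wt_mass TYPE('n) b \<ge> 0" unfolding wt_mass_def by simp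
  ultimately show ?thesis by simp
qed

text \<open>The Beta-function ratio obtained by iterating the one-step recursion. The masses
  themselves are never evaluated; only such ratios enter.\<close>

lemma wt_mass_shift:
  assumes "b > -1"
  shows "wt_mass TYPE('n::finite) (b + real m) = wt_mass TYPE('n) b * pochhammer (b + 1) m / pochhammer (real CARD('n) + 1 + b) m"
proof (induction m)
  case (Suc m)
  have p: "pochhammer (real CARD('n) + 1 + b) m > 0" using assms by (intro pochhammer_pos) simp
  have s: "b + real m + 1 > 0" using assms by simp
  have "wt_mass TYPE('n) (b + real m) = (real CARD('n) + (b + real m + 1)) / (b + real m + 1) * wt_mass TYPE('n) (b + real m + 1)"
    using wt_mass_step[OF s, where 'n='n] by simp
  then have "wt_mass TYPE('n) (b + real m + 1) = wt_mass TYPE('n) (b + real m) * (b + 1 + real m) / (real CARD('n) + 1 + b + real m)"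
    using s by (simp add: field_simps)
  then show ?case using p by (simp add: Suc.IH pochhammer_Suc add_ac)
qed simp

lemma cn_holomorphic_on_scaleR:
  assumes hol: "cn_holomorphic_on g T" and sub: "\<And>w. w \<in> S \<Longrightarrow> l *\<^sub>R w \<in> T"
  shows "cn_holomorphic_on (\<lambda>w. g (l *\<^sub>R w)) S"
  unfolding cn_holomorphic_on_def
proof
  fix w assume "w \<in> S"
  then obtain f' where f': "(g has_derivative f') (at (l *\<^sub>R w))" "\<And>c v. f' (c *s v) = c * f' v"
    using hol sub unfolding cn_holomorphic_on_def by blast
  have "((\<lambda>w. g (l *\<^sub>R w)) has_derivative (\<lambda>v. f' (l *\<^sub>R v))) (at w)"
    by (rule has_derivative_compose[of "\<lambda>w. l *\<^sub>R w" "\<lambda>v. l *\<^sub>R v" w UNIV g f']) (auto intro!: derivative_eq_intros f'(1))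
  moreover have "f' (l *\<^sub>R (c *s v)) = c * f' (l *\<^sub>R v)" for c v
    unfolding scaleR_eq_smult f'(2) by simp
  ultimately show "\<exists>f'. ((\<lambda>w. g (l *\<^sub>R w)) has_derivative f') (at w) \<and> (\<forall>c v. f' (c *s v) = c * f' v)" by blast
qed

context hol_on_larger_ball
begin

text \<open>The formula is known at b = \<beta> + 1 > 0 and descends to \<beta> by one
  \<open>moment_step\<close> with e = m. The two recursions for the masses then combine to the
  stated constant.\<close>

lemma moment:
  assumes \<beta>: "\<beta> > -1"
  shows "(LINT w|lborel. g w * ker_term z \<beta> m w)
     = of_real (wt_mass TYPE('n) \<beta> / pochhammer (real CARD('n) + 1 + \<beta>) m) * (deriv ^^ m) (\<lambda>s. g (s *s z)) 0"
proof -
  define b where "b = \<beta> + 1"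
  have b: "b > 0" using \<beta> by (simp add: b_def)
  define c where "c = wt_mass TYPE('n) (b + real m) / pochhammer (b + 1) m"
  define D where "D = (deriv ^^ m) (\<lambda>s. g (s *s z)) 0"
  define G where "G w = g0 w * herm z w ^ m" for w
  have g0: "g0 w = g w" if "w \<in> ball 0 1" for w using that rho by (simp add: g0_def)
  have Gk: "G w * of_real (wt a w) = g w * ker_term z a m w" for a w
    unfolding G_def ker_term_def by (cases "w \<in> ball 0 1") (simp_all add: g0 wt_eq)
  \<comment> \<open>Dilation by l contributes l^m from the factor \<open>herm z w ^ m\<close> and
    another l^m from the m-th derivative at 0; hence the moment is homogeneous of degree m in l^2 =
    1 - \<eta>.\<close>
  have sc: "(LINT u|lborel. G (l *\<^sub>R u) * of_real (wt b u)) = of_real (l ^ (2 * m)) * (of_real c * D)"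
    if l: "0 < l" "l \<le> 1" for l
  proof -
    interpret S: hol_on_larger_ball "\<lambda>w. g (l *\<^sub>R w)" \<rho> M
    proof
      have lb: "l *\<^sub>R w \<in> ball 0 \<rho>" if "w \<in> ball 0 \<rho>" for w :: "complex ^ 'n"
        using that l mult_left_le_one_le[of "norm w" l] by simp
      then show "norm (g (l *\<^sub>R w)) \<le> M" if "w \<in> ball 0 \<rho>" for w using that bd by blast
      show "cn_holomorphic_on (\<lambda>w. g (l *\<^sub>R w)) (ball 0 \<rho>)"
        by (rule cn_holomorphic_on_scaleR[OF hol lb])
    qed (rule rho)
    have "(LINT u|lborel. G (l *\<^sub>R u) * of_real (wt b u)) = (LINT u|lborel. of_real (l ^ m) * (g (l *\<^sub>R u) * ker_term z b m u))"
    proof (rule Bochner_Integration.integral_cong[OF refl])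
      fix u :: "complex ^ 'n"
      show "G (l *\<^sub>R u) * of_real (wt b u) = of_real (l ^ m) * (g (l *\<^sub>R u) * ker_term z b m u)"
      proof (cases "u \<in> ball 0 1")
        case True
        have "l *\<^sub>R u \<in> ball 0 1" using True l mult_left_le_one_le[of "norm u" l] by simp
        from g0[OF this] show ?thesis
          by (simp add: G_def ker_term_def herm_simps power_mult_distrib)
      qed (simp add: wt_eq ker_term_def)
    qed
    also have "\<dots> = of_real (l ^ m) * (of_real c * (deriv ^^ m) (\<lambda>s. g (l *\<^sub>R (s *s z))) 0)"
      unfolding c_def using S.moment_pos[OF b, of z m] by simp
    also have "(\<lambda>s. g (l *\<^sub>R (s *s z))) = (\<lambda>s. g ((of_real l * s) *s z))"
      by (simp add: scaleR_eq_smult fun_eq_iff)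
    also have "(deriv ^^ m) (\<lambda>s. g ((of_real l * s) *s z)) 0 = of_real l ^ m * D"
    proof -
      have "(deriv ^^ m) (\<lambda>s. g ((of_real l * s) *s z)) 0 = of_real l ^ m * (deriv ^^ m) (\<lambda>s. g (s *s z)) (of_real l * 0)"
      proof (rule higher_deriv_compose_linear[OF slice_holomorphic open_dom open_dom])
        fix s :: complex assume "s \<in> {s. norm s * norm z + 1 < \<rho>}"
        moreover have "l * norm s * norm z \<le> norm s * norm z"
          using l by (intro mult_right_mono mult_left_le_one_le) auto
        ultimately show "of_real l * s \<in> {s. norm s * norm z + 1 < \<rho>}" using l by (simp add: norm_mult)
      qed (use rho in simp)
      then show ?thesis by (simp add: D_def)
    qed
    finally show ?thesis by (simp add: power_add mult_2 mult.assoc)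
  qed
  have "(LINT w|lborel. G w * of_real (wt (b - 1) w))
    = of_real ((real CARD('n) + b + real m) / b) * (LINT u|lborel. G u * of_real (wt b u))"
  proof (rule moment_step[where K="M * norm z ^ m", OF _ _ b])
    show "G \<in> borel_measurable borel" unfolding G_def by measurable
    fix w :: "complex ^ 'n" assume w: "w \<in> ball 0 1"
    have "norm (herm z w) \<le> norm z"
      using order_trans[OF norm_herm_le mult_left_mono[of "norm w" 1 "norm z"]] w by simp
    moreover have "norm (g0 w) \<le> M" using bd[of w] w rho by (simp add: g0)
    ultimately show "norm (G w) \<le> M * norm z ^ m"
      unfolding G_def norm_mult norm_power by (intro mult_mono power_mono) (auto intro: order_trans[OF norm_ge_zero])
  next
    fix \<eta> :: real assume \<eta>: "0 < \<eta>" "\<eta> < 1"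
    have "sqrt (1 - \<eta>) ^ (2 * m) = (1 - \<eta>) powr real m"
      using \<eta> by (simp add: power_mult powr_realpow)
    then show "(LINT u|lborel. G (sqrt (1 - \<eta>) *\<^sub>R u) * of_real (wt b u)) = of_real ((1 - \<eta>) powr real m) * (LINT u|lborel. G u * of_real (wt b u))"
      using sc[of "sqrt (1 - \<eta>)"] sc[of 1] \<eta> by simp
  qed
  also have "(LINT u|lborel. G u * of_real (wt b u)) = of_real c * D" using sc[of 1] by simp
  finally have "(LINT w|lborel. g w * ker_term z \<beta> m w) = of_real ((real CARD('n) + b + real m) / b * c) * D"
    unfolding Gk by (simp add: b_def)
  also have "(real CARD('n) + b + real m) / b * c = wt_mass TYPE('n) \<beta> / pochhammer (real CARD('n) + 1 + \<beta>) m"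
  proof -
    have p: "pochhammer (real CARD('n) + 1 + \<beta>) m > 0" "pochhammer b m > 0" "pochhammer (b + 1) m > 0" 
      using b \<beta> by (auto intro!: pochhammer_pos)
    have pb: "b * pochhammer (b + 1) m = pochhammer b m * (b + real m)"
      using pochhammer_rec[of b m] pochhammer_Suc[of b m] by simp
    have bm: "b + real m > 0" using b by simp
    have 1: "wt_mass TYPE('n) (\<beta> + real m) = (real CARD('n) + b + real m) / (b + real m) * wt_mass TYPE('n) (b + real m)"
      using wt_mass_step[OF bm, where 'n='n] by (simp add: b_def add_ac)
    have "(real CARD('n) + b + real m) / b * c = (real CARD('n) + b + real m) * wt_mass TYPE('n) (b + real m) / (b * pochhammer (b + 1) m)"
      by (simp add: c_def)
    also have "\<dots> = wt_mass TYPE('n) (\<beta> + real m) / pochhammer b m"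
      unfolding 1 pb using bm by simp
    also have "\<dots> = wt_mass TYPE('n) \<beta> / pochhammer (real CARD('n) + 1 + \<beta>) m"
      unfolding wt_mass_shift[OF \<beta>, where 'n='n] using p by (simp add: b_def add_ac)
    finally show ?thesis .
  qed
  finally show ?thesis unfolding D_def .
qed

end

section \<open>The reproducing formula\<close>

text \<open>The cut-off keeps the principal power away from its branch cut, which makes the kernel
  jointly Borel measurable; on the ball the real part is always positive.\<close>

definition kern :: "real \<Rightarrow> complex ^ 'n \<Rightarrow> complex ^ 'n \<Rightarrow> complex" where
  "kern b z w = (if Re (1 - herm z w) > 0 then (1 - herm z w) powr (- of_real (real CARD('n) + 1 + b)) else 0)"

lemma kern_eq: "z \<in> ball 0 1 \<Longrightarrow> w \<in> ball 0 1 \<Longrightarrow>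
  kern b z (w :: complex ^ 'n) = (1 - herm z w) powr (- of_real (real CARD('n) + 1 + b))"
  using Re_one_minus_herm_pos[of z w] by (auto simp: kern_def)

lemma kern_measurable [measurable]:
  fixes f g :: "'m \<Rightarrow> complex ^ 'n"
  assumes [measurable]: "f \<in> borel_measurable M" "g \<in> borel_measurable M"
  shows "(\<lambda>x. kern b (f x) (g x)) \<in> borel_measurable M"
proof -
  let ?c = "- of_real (real CARD('n) + 1 + b) :: complex"
  define S where "S = {x :: complex. Re x > 0}"
  have S: "open S" unfolding S_def by (rule open_halfspace_Re_gt)
  have [measurable]: "(\<lambda>x. indicator S x *\<^sub>R x powr ?c) \<in> borel_measurable borel"
    by (intro borel_measurable_continuous_on_indicator) (auto intro!: continuous_intros simp: S S_def complex_nonpos_Reals_iff)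
  have "kern b (f x) (g x) = indicator S (1 - herm (f x) (g x)) *\<^sub>R (1 - herm (f x) (g x)) powr ?c" for x
    by (simp add: kern_def S_def)
  moreover have "(\<lambda>x. (\<lambda>y. indicator S y *\<^sub>R y powr ?c) (1 - herm (f x) (g x))) \<in> borel_measurable M"
    by (rule measurable_compose[of _ _ borel]) measurable
  ultimately show ?thesis by simp
qed

lemma norm_kern: "z \<in> ball 0 1 \<Longrightarrow> w \<in> ball 0 1 \<Longrightarrow>
  norm (kern b z (w :: complex ^ 'n)) = kdis z w powr (- (real CARD('n) + 1 + b))"
  using kdis_pos[of z w] by (simp add: kern_eq powr_def kdis_def Re_Ln)

lemma cnj_kern: assumes "z \<in> ball 0 1" "w \<in> ball 0 1"
  shows "cnj (kern b z w) = kern b w z"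
proof -
  have r: "Re (1 - herm z w) > 0" by (rule Re_one_minus_herm_pos[OF assms])
  have e: "1 - herm w z = cnj (1 - herm z w)" by (simp add: cnj_herm)
  have ln: "Ln (1 - herm w z) = cnj (Ln (1 - herm z w))"
    unfolding e by (rule cnj_Ln[symmetric]) (use r in \<open>simp add: complex_nonpos_Reals_iff\<close>)
  have nz: "1 - herm z w \<noteq> 0" "1 - herm w z \<noteq> 0" using r e by auto
  show ?thesis
    unfolding kern_eq[OF assms] kern_eq[OF assms(2,1)] powr_def ln using nz by (simp add: exp_cnj)
qed

context hol_on_larger_ball
begin

text \<open>The kernel expands in powers of \<open>herm z w\<close> with coefficients
  \<open>pochhammer N k / fact k\<close>. The moments of g carry \<open>pochhammer N k\<close> in
  the denominator, so termwise integration leaves, up to the total mass, the Taylor series of s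
  \<mapsto> g (s z) at the point s = 1.\<close>

lemma reproducing_larger:
  assumes \<beta>: "\<beta> > -1" and z: "z \<in> ball 0 1"
  shows "integrable lborel (\<lambda>w. g w * kern \<beta> z w * of_real (wt \<beta> w))"
    and "(LINT w|lborel. g w * kern \<beta> z w * of_real (wt \<beta> w)) = of_real (wt_mass TYPE('n) \<beta>) * g z"
proof -
  define N where "N = real CARD('n) + 1 + \<beta>"
  have N: "N > 0" using \<beta> by (simp add: N_def)
  define c where "c k = pochhammer N k / fact k" for k
  have c: "c k \<ge> 0" for k using pochhammer_pos[OF N] by (simp add: c_def less_imp_le)
  define f where "f k w = of_real (c k) * (g0 w * ker_term z \<beta> k w)" for k w
  have g0: "g0 w = g w" if "w \<in> ball 0 1" for w using that rho by (simp add: g0_def)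
  have M0: "M \<ge> 0" using order_trans[OF norm_ge_zero bd[of 0]] rho by simp
  have neg1: "(- 1) ^ k * (- 1) ^ k = (1 :: 'a :: comm_ring_1)" for k
    by (simp flip: power_mult_distrib)
  \<comment> \<open>The two signs cancel: binomial coefficients of -x at -h are rising factorials of
    x at h.\<close>
  have gb: "((- x) gchoose k) * (- h) ^ k = pochhammer x k / fact k * h ^ k" for x h :: "'a :: field_char_0" and k
  proof -
    have "((- x) gchoose k) * (- h) ^ k = ((- 1) ^ k * (- 1) ^ k) * (pochhammer x k / fact k * h ^ k)"
      unfolding gbinomial_pochhammer minus_minus power_minus[of h k] by (simp only: mult_ac times_divide_eq_left times_divide_eq_right)
    then show ?thesis unfolding neg1 by simp
  qed
  have cs: "of_real (c k) * h ^ k = ((- of_real N :: complex) gchoose k) * (- h) ^ k" for k h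
    unfolding gb by (simp add: c_def pochhammer_of_real)
  have sm: "(\<lambda>k. f k w) sums (g w * kern \<beta> z w * of_real (wt \<beta> w))" for w
  proof (cases "w \<in> ball 0 1")
    case True
    have "norm (- herm z w) < 1" using norm_herm_less_1[OF z True] by simp
    from gen_binomial_complex[OF this, of "- of_real N"]
    have "(\<lambda>k. of_real (c k) * herm z w ^ k) sums kern \<beta> z w"
      unfolding cs[symmetric] by (simp add: kern_eq[OF z True] N_def)
    then have "(\<lambda>k. g w * of_real (wt \<beta> w) * (of_real (c k) * herm z w ^ k)) sums (g w * of_real (wt \<beta> w) * kern \<beta> z w)"
      by (rule sums_mult)
    then show ?thesis by (simp add: f_def g0[OF True] ker_term_def mult_ac)
  qed (simp add: f_def ker_term_def wt_eq)
  have fb: "norm (f k w) \<le> c k * norm z ^ k * M * wt \<beta> w" for k w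
  proof (cases "w \<in> ball 0 1")
    case True
    have hz: "norm (herm z w) \<le> norm z"
      using order_trans[OF norm_herm_le mult_left_mono[of "norm w" 1 "norm z"]] True by simp
    have "norm (f k w) = c k * (norm (g w) * (norm (herm z w) ^ k * wt \<beta> w))"
      using c[of k] by (simp add: f_def g0[OF True] norm_mult norm_power ker_term_def)
    also have "\<dots> \<le> c k * (M * (norm z ^ k * wt \<beta> w))"
      using True rho bd[of w] hz c[of k] M0 by (intro mult_mono power_mono mult_nonneg_nonneg) auto
    finally show ?thesis by (simp add: mult_ac)
  qed (simp add: f_def ker_term_def wt_eq)
  have cz: "summable (\<lambda>k. c k * norm z ^ k)"
  proof -
    have "\<bar>- norm z\<bar> < 1" using z by simp
    from gen_binomial_real[OF this, of "- N"]
    have "summable (\<lambda>k. ((- N) gchoose k) * (- norm z) ^ k)" by (rule sums_summable)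
    then show ?thesis unfolding gb by (simp add: c_def)
  qed
  have int: "integrable lborel (f k)" for k
    by (rule Bochner_Integration.integrable_bound[where f="\<lambda>w. c k * norm z ^ k * M * wt \<beta> w"])
       (use fb c M0 in \<open>auto intro!: integrable_mult_right integrable_wt \<beta> AE_I2 simp: f_def[abs_def]\<close>)
  have s1: "AE w in lborel. summable (\<lambda>k. norm (f k w))"
  proof (rule AE_I2)
    fix w :: "complex ^ 'n"
    have "summable (\<lambda>k. c k * norm z ^ k * M * wt \<beta> w)" by (intro summable_mult2 cz)
    then show "summable (\<lambda>k. norm (f k w))" by (rule summable_comparison_test'[of _ 0]) (use fb in simp)
  qed
  have s2: "summable (\<lambda>k. LINT w|lborel. norm (f k w))"
  proof (rule summable_comparison_test'[of _ 0])
    show "summable (\<lambda>k. c k * norm z ^ k * M * wt_mass TYPE('n) \<beta>)" by (intro summable_mult2 cz)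
    fix k
    have "(LINT w|lborel. norm (f k w)) \<le> (LINT w::complex ^ 'n|lborel. c k * norm z ^ k * M * wt \<beta> w)"
      by (rule integral_mono) (use int fb in \<open>auto intro!: integrable_mult_right integrable_wt \<beta>\<close>)
    then show "norm (LINT w|lborel. norm (f k w)) \<le> c k * norm z ^ k * M * wt_mass TYPE('n) \<beta>"
      by (simp add: wt_mass_def)
  qed
  have sumeq: "(\<Sum>k. f k w) = g w * kern \<beta> z w * of_real (wt \<beta> w)" for w
    using sm sums_unique by metis
  show "integrable lborel (\<lambda>w. g w * kern \<beta> z w * of_real (wt \<beta> w))"
    using integrable_suminf[OF int s1 s2] unfolding sumeq .
  have "(\<lambda>k. LINT w|lborel. f k w) sums (LINT w|lborel. g w * kern \<beta> z w * of_real (wt \<beta> w))"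
    using sums_integral[OF int s1 s2] unfolding sumeq .
  moreover have "(\<lambda>k. LINT w|lborel. f k w) sums (of_real (wt_mass TYPE('n) \<beta>) * g z)"
  proof -
    have fk: "(LINT w|lborel. f k w) = of_real (wt_mass TYPE('n) \<beta>) * ((deriv ^^ k) (\<lambda>s. g (s *s z)) 0 / fact k * (1 - 0) ^ k)" for k
    proof -
      have fe: "f k w = of_real (c k) * (g w * ker_term z \<beta> k w)" for w
        by (cases "w \<in> ball 0 1") (simp_all add: f_def g0 ker_term_def wt_eq)
      have "(LINT w|lborel. f k w) = of_real (c k) * (LINT w|lborel. g w * ker_term z \<beta> k w)"
        unfolding fe by simp
      also have "\<dots> = of_real (c k * (wt_mass TYPE('n) \<beta> / pochhammer N k)) * (deriv ^^ k) (\<lambda>s. g (s *s z)) 0"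
        unfolding moment[OF \<beta>] by (simp add: N_def)
      also have "c k * (wt_mass TYPE('n) \<beta> / pochhammer N k) = wt_mass TYPE('n) \<beta> / fact k"
        using pochhammer_pos[OF N, of k] by (simp add: c_def)
      finally show ?thesis by simp
    qed
    \<comment> \<open>A radius of convergence beyond 1, so that the Taylor series may be evaluated
      at s = 1.\<close>
    define r where "r = (if z = 0 then 2 else \<rho> / norm z)"
    have r: "r > 1" using z rho by (auto simp: r_def field_simps)
    have "(\<lambda>s. g (s *s z)) holomorphic_on ball 0 r"
    proof -
      have "(\<lambda>s. g (0 + s *s z)) holomorphic_on ball 0 r"
        by (rule cn_holomorphic_line_on[OF hol])
           (use z rho in \<open>auto simp: norm_smult_cvec r_def field_simps split: if_splits\<close>)
      then show ?thesis by simp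
    qed
    from holomorphic_power_series[OF this, of 1] r
    have "(\<lambda>k. (deriv ^^ k) (\<lambda>s. g (s *s z)) 0 / fact k * (1 - 0) ^ k) sums g z" by simp
    then show ?thesis unfolding fk by (rule sums_mult)
  qed
  ultimately show "(LINT w|lborel. g w * kern \<beta> z w * of_real (wt \<beta> w)) = of_real (wt_mass TYPE('n) \<beta>) * g z"
    by (rule sums_unique2)
qed

end

section \<open>Lebesgue measure on the ball and weighted masses\<close>

definition Lb :: "(complex ^ 'n) measure" where
  "Lb = lebesgue_on (ball 0 1)"

lemma space_Lb [simp]: "space Lb = ball 0 1"
  by (simp add: Lb_def)

lemma measurable_Lb_id [measurable]: "(\<lambda>x. x) \<in> borel_measurable Lb"
  unfolding Lb_def by (intro measurable_restrict_space1 measurable_completion) simp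

lemma measurable_snd_Lb [measurable]: "snd \<in> borel_measurable (M \<Otimes>\<^sub>M Lb)"
  using measurable_compose[OF measurable_snd measurable_Lb_id] by auto

lemma hgt_measurable' [measurable]: "f \<in> borel_measurable M \<Longrightarrow> (\<lambda>x. hgt (f x)) \<in> borel_measurable M"
  by (rule measurable_compose[OF _ hgt_measurable])

lemma kdis_measurable [measurable]:
  assumes [measurable]: "f \<in> borel_measurable M" "g \<in> borel_measurable M"
  shows "(\<lambda>x. kdis (f x) (g x)) \<in> borel_measurable M"
  unfolding kdis_def by measurable

lemma nn_integral_Lb: "(\<integral>\<^sup>+w. f w \<partial>Lb) = (\<integral>\<^sup>+w. f w * indicator (ball 0 1) w \<partial>lborel)"
  unfolding Lb_def by (simp add: nn_integral_restrict_space nn_integral_completion)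

lemma integral_Lb:
  fixes f :: "complex ^ 'n \<Rightarrow> 'b::{banach, second_countable_topology}"
  assumes "(\<lambda>w. indicator (ball 0 1) w *\<^sub>R f w) \<in> borel_measurable borel"
  shows "(LINT w|Lb. f w) = (LINT w|lborel. indicator (ball 0 1) w *\<^sub>R f w)"
    and "integrable Lb f \<longleftrightarrow> integrable lborel (\<lambda>w. indicator (ball 0 1) w *\<^sub>R f w)"
  unfolding Lb_def using assms
  by (simp_all add: integral_restrict_space integral_completion integrable_restrict_space integrable_completion set_integrable_def)

lemma finite_measure_Lb: "finite_measure (Lb :: (complex ^ 'n) measure)"
proof (rule finite_measureI)
  have "emeasure Lb (space (Lb :: (complex ^ 'n) measure)) = (\<integral>\<^sup>+w. 1 \<partial>(Lb :: (complex ^ 'n) measure))" by simp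
  also have "\<dots> = emeasure lborel (ball 0 1 :: (complex ^ 'n) set)" unfolding nn_integral_Lb by simp
  also have "\<dots> < \<infinity>" by (rule emeasure_lborel_ball_finite)
  finally show "emeasure Lb (space (Lb :: (complex ^ 'n) measure)) \<noteq> \<infinity>" by simp
qed

interpretation Lb: finite_measure "Lb :: (complex ^ 'n) measure"
  by (rule finite_measure_Lb)

interpretation Lbp: pair_sigma_finite "Lb :: (complex ^ 'n) measure" "Lb :: (complex ^ 'n) measure" ..

lemma wt_mass_Lb:
  assumes "b > -1"
  shows "integrable Lb (\<lambda>w :: complex ^ 'n. hgt w powr b)"
    and "(LINT w::complex ^ 'n|Lb. hgt w powr b) = wt_mass TYPE('n) b"
    and "(\<integral>\<^sup>+w. ennreal (hgt (w :: complex ^ 'n) powr b) \<partial>Lb) = ennreal (wt_mass TYPE('n) b)"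
proof -
  have e: "(\<lambda>w :: complex ^ 'n. indicator (ball 0 1) w *\<^sub>R hgt w powr b) = wt b"
    by (auto simp: wt_eq fun_eq_iff)
  have m: "(\<lambda>w :: complex ^ 'n. indicator (ball 0 1) w *\<^sub>R hgt w powr b) \<in> borel_measurable borel"
    unfolding e by measurable
  show i: "integrable Lb (\<lambda>w :: complex ^ 'n. hgt w powr b)"
    unfolding integral_Lb(2)[OF m] e by (rule integrable_wt[OF assms])
  show v: "(LINT w::complex ^ 'n|Lb. hgt w powr b) = wt_mass TYPE('n) b"
    unfolding integral_Lb(1)[OF m] e wt_mass_def ..
  show "(\<integral>\<^sup>+w. ennreal (hgt (w :: complex ^ 'n) powr b) \<partial>Lb) = ennreal (wt_mass TYPE('n) b)"
    using nn_integral_eq_integral[OF i] v by simp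
qed

lemma H_infinity_measurable: "g \<in> H_infinity \<Longrightarrow> g \<in> borel_measurable Lb"
  unfolding Lb_def H_infinity_def
  by (intro continuous_imp_measurable_on_sets_lebesgue) (auto simp: cn_holomorphic_continuous_on)

lemma kern_bound:
  assumes z: "z \<in> ball 0 1" and w: "w \<in> ball 0 1" and b: "real CARD('n) + 1 + b \<ge> 0"
  shows "norm (kern b z (w :: complex ^ 'n)) \<le> (hgt z / 2) powr (- (real CARD('n) + 1 + b))"
  unfolding norm_kern[OF z w]
  using hgt_le_kdis[OF z w] hgt_pos[OF z] b by (intro powr_mono2') auto

text \<open>The dilates w \<mapsto> g (l w) with l < 1 are holomorphic on a larger ball with the
  same bound M. For fixed z the kernel is bounded on the ball, so dominated convergence lets l tend
  to 1.\<close>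

theorem reproducing:
  fixes g :: "complex ^ 'n \<Rightarrow> complex"
  assumes g: "g \<in> H_infinity" and \<beta>: "\<beta> > -1" and z: "z \<in> ball 0 1"
  shows "(LINT w|Lb. g w * kern \<beta> z w * of_real (hgt w powr \<beta>)) = of_real (wt_mass TYPE('n) \<beta>) * g z"
proof -
  have hol: "cn_holomorphic_on g (ball 0 1)" using g by (simp add: H_infinity_def)
  obtain M where M: "\<And>w. w \<in> ball 0 1 \<Longrightarrow> norm (g w) \<le> M"
    using g unfolding H_infinity_def bounded_iff by blast
  have M0: "M \<ge> 0" using order_trans[OF norm_ge_zero M[of 0]] by simp
  have cont: "isCont g w" if "w \<in> ball 0 1" for w
    using cn_holomorphic_continuous_on[OF hol] that by (simp add: continuous_on_eq_continuous_at)
  define K where "K = (hgt z / 2) powr (- (real CARD('n) + 1 + \<beta>))"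
  have K: "norm (kern \<beta> z w) \<le> K" if "w \<in> ball 0 1" for w
    unfolding K_def using kern_bound[OF z that, of \<beta>] \<beta> by simp
  have K0: "K \<ge> 0" by (simp add: K_def)
  define l where "l k = 1 - eta k" for k
  have l: "0 < l k" "l k < 1" for k using eta_pos[of k] by (auto simp: l_def)
  have lim: "l \<longlonglongrightarrow> 1" unfolding l_def using tendsto_diff[OF tendsto_const eta_tendsto, of 1] by simp
  have lw: "l k *\<^sub>R w \<in> ball 0 1" if "w \<in> ball 0 1" for k and w :: "complex ^ 'n"
    using that l[of k] mult_left_le_one_le[of "norm w" "l k"] by simp
  have gl: "(\<lambda>k. g (l k *\<^sub>R w)) \<longlonglongrightarrow> g w" if "w \<in> ball 0 1" for w
  proof -
    have "(\<lambda>k. l k *\<^sub>R w) \<longlonglongrightarrow> 1 *\<^sub>R w" by (intro tendsto_intros lim)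
    then show ?thesis using isCont_tendsto_compose[OF cont[OF that]] by simp
  qed
  have H: "hol_on_larger_ball (\<lambda>w. g (l k *\<^sub>R w)) (1 / l k) M" for k
  proof
    have sub: "l k *\<^sub>R w \<in> ball 0 1" if "w \<in> ball 0 (1 / l k)" for w :: "complex ^ 'n"
      using that l[of k] by (simp add: field_simps)
    show "cn_holomorphic_on (\<lambda>w. g (l k *\<^sub>R w)) (ball 0 (1 / l k))"
      by (rule cn_holomorphic_on_scaleR[OF hol sub])
    show "norm (g (l k *\<^sub>R w)) \<le> M" if "w \<in> ball 0 (1 / l k)" for w by (rule M[OF sub[OF that]])
  qed (use l[of k] in simp)
  have meas: "(\<lambda>w. g (l k *\<^sub>R w)) \<in> borel_measurable Lb" for k
    unfolding Lb_def
    by (intro continuous_imp_measurable_on_sets_lebesgue cn_holomorphic_continuous_on cn_holomorphic_on_scaleR[OF hol lw]) auto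
  note [measurable] = H_infinity_measurable[OF g] meas
  have eq: "(LINT w|Lb. g (l k *\<^sub>R w) * kern \<beta> z w * of_real (hgt w powr \<beta>)) = of_real (wt_mass TYPE('n) \<beta>) * g (l k *\<^sub>R z)" for k
  proof -
    interpret hol_on_larger_ball "\<lambda>w. g (l k *\<^sub>R w)" "1 / l k" M by (rule H)
    have e: "(\<lambda>w. indicator (ball 0 1) w *\<^sub>R (g (l k *\<^sub>R w) * kern \<beta> z w * of_real (hgt w powr \<beta>)))
      = (\<lambda>w. g (l k *\<^sub>R w) * kern \<beta> z w * of_real (wt \<beta> w))"
      by (auto simp: fun_eq_iff wt_eq)
    show ?thesis
      using reproducing_larger[OF \<beta> z] by (subst integral_Lb(1)) (simp_all add: e)
  qed
  have "(\<lambda>k. LINT w|Lb. g (l k *\<^sub>R w) * kern \<beta> z w * of_real (hgt w powr \<beta>)) \<longlonglongrightarrow> (LINT w|Lb. g w * kern \<beta> z w * of_real (hgt w powr \<beta>))"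
  proof (rule integral_dominated_convergence[where w="\<lambda>w. M * K * hgt w powr \<beta>"])
    show "integrable Lb (\<lambda>w :: complex ^ 'n. M * K * hgt w powr \<beta>)"
      by (intro integrable_mult_right wt_mass_Lb \<beta>)
    show "AE w in Lb. (\<lambda>k. g (l k *\<^sub>R w) * kern \<beta> z w * of_real (hgt w powr \<beta>)) \<longlonglongrightarrow> g w * kern \<beta> z w * of_real (hgt w powr \<beta>)"
      by (intro AE_I2 tendsto_intros gl) simp
    show "AE w in Lb. norm (g (l k *\<^sub>R w) * kern \<beta> z w * of_real (hgt w powr \<beta>)) \<le> M * K * hgt w powr \<beta>" for k
    proof (rule AE_I2)
      fix w :: "complex ^ 'n" assume "w \<in> space Lb"
      then have w: "w \<in> ball 0 1" by simp
      have "norm (g (l k *\<^sub>R w)) * norm (kern \<beta> z w) * norm (complex_of_real (hgt w powr \<beta>)) \<le> M * K * hgt w powr \<beta>"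
        by (intro mult_mono M lw K w mult_nonneg_nonneg M0 K0) auto
      then show "norm (g (l k *\<^sub>R w) * kern \<beta> z w * of_real (hgt w powr \<beta>)) \<le> M * K * hgt w powr \<beta>"
        by (simp only: norm_mult)
    qed
  qed measurable
  then have "(\<lambda>k. of_real (wt_mass TYPE('n) \<beta>) * g (l k *\<^sub>R z)) \<longlonglongrightarrow> (LINT w|Lb. g w * kern \<beta> z w * of_real (hgt w powr \<beta>))"
    unfolding eq .
  moreover have "(\<lambda>k. of_real (wt_mass TYPE('n) \<beta>) * g (l k *\<^sub>R z)) \<longlonglongrightarrow> of_real (wt_mass TYPE('n) \<beta>) * g z"
    by (intro tendsto_intros gl z)
  ultimately show ?thesis by (rule LIMSEQ_unique)
qed

section \<open>Kernel estimates\<close>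

lemma H_infinity_cong:
  assumes "g \<in> H_infinity" "\<And>w. w \<in> ball 0 1 \<Longrightarrow> f w = g w"
  shows "f \<in> H_infinity"
proof -
  have "cn_holomorphic_on f (ball 0 1)"
    unfolding cn_holomorphic_on_def
  proof
    fix z :: "complex ^ 'a" assume z: "z \<in> ball 0 1"
    then obtain f' where f': "(g has_derivative f') (at z)" "\<forall>c v. f' (c *s v) = c * f' v"
      using assms(1) unfolding H_infinity_def cn_holomorphic_on_def by blast
    have "(f has_derivative f') (at z)"
      by (rule has_derivative_transform_within_open[OF f'(1) open_ball z]) (simp add: assms(2))
    then show "\<exists>f'. (f has_derivative f') (at z) \<and> (\<forall>c v. f' (c *s v) = c * f' v)" using f'(2) by blast
  qed
  moreover have "f ` ball 0 1 = g ` ball 0 1" using assms(2) by force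
  ultimately show ?thesis using assms(1) by (simp add: H_infinity_def)
qed

lemma H_infinity_mult:
  assumes "f \<in> H_infinity" "g \<in> H_infinity"
  shows "(\<lambda>w. f w * g w) \<in> H_infinity"
proof -
  have hol: "cn_holomorphic_on (\<lambda>w. f w * g w) (ball 0 1)"
    unfolding cn_holomorphic_on_def
  proof
    fix z :: "complex ^ 'a" assume z: "z \<in> ball 0 1"
    then obtain f' g' where f': "(f has_derivative f') (at z)" "\<And>c v. f' (c *s v) = c * f' v"
      and g': "(g has_derivative g') (at z)" "\<And>c v. g' (c *s v) = c * g' v"
      using assms unfolding H_infinity_def cn_holomorphic_on_def by blast
    have "((\<lambda>w. f w * g w) has_derivative (\<lambda>h. f z * g' h + f' h * g z)) (at z)"
      by (rule has_derivative_mult[OF f'(1) g'(1)])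
    moreover have "\<forall>c v. f z * g' (c *s v) + f' (c *s v) * g z = c * (f z * g' v + f' v * g z)"
      by (simp add: f'(2) g'(2) algebra_simps)
    ultimately show "\<exists>h'. ((\<lambda>w. f w * g w) has_derivative h') (at z) \<and> (\<forall>c v. h' (c *s v) = c * h' v)"
      by blast
  qed
  obtain A where "\<forall>x\<in>f ` ball 0 1. norm x \<le> A"
    using assms(1) unfolding H_infinity_def bounded_iff by blast
  then have A: "\<And>w. w \<in> ball 0 1 \<Longrightarrow> norm (f w) \<le> A" by blast
  obtain B where "\<forall>x\<in>g ` ball 0 1. norm x \<le> B"
    using assms(2) unfolding H_infinity_def bounded_iff by blast
  then have B: "\<And>w. w \<in> ball 0 1 \<Longrightarrow> norm (g w) \<le> B" by blast
  have "norm (f w * g w) \<le> A * B" if "w \<in> ball 0 1" for w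
    using that unfolding norm_mult by (intro mult_mono A B order_trans[OF norm_ge_zero A]) auto
  then have bdd: "bounded ((\<lambda>w. f w * g w) ` ball 0 1)" unfolding bounded_iff by blast
  show ?thesis using hol bdd by (simp add: H_infinity_def)
qed

lemma H_infinity_const: "(\<lambda>w. c) \<in> H_infinity"
  unfolding H_infinity_def cn_holomorphic_on_def
  by (auto intro!: exI[of _ "\<lambda>_. 0"] simp: image_constant_conv)

text \<open>Exponents of both signs occur: negative ones give kernels, and positive ones give their
  reciprocals, which are again bounded and holomorphic in w.\<close>

definition kpow :: "real \<Rightarrow> complex ^ 'n \<Rightarrow> complex ^ 'n \<Rightarrow> complex" where
  "kpow s w a = (1 - herm w a) powr of_real s"

lemma norm_kpow: "w \<in> ball 0 1 \<Longrightarrow> a \<in> ball 0 1 \<Longrightarrow> norm (kpow s w a) = kdis w a powr s"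
  using kdis_pos[of w a] by (auto simp: kpow_def powr_def kdis_def Re_Ln)

lemma kpow_H_infinity:
  fixes a :: "complex ^ 'n"
  assumes a: "a \<in> ball 0 1"
  shows "(\<lambda>w. kpow s w a) \<in> H_infinity"
proof -
  have bl: "bounded_linear (\<lambda>w. herm w a)"
    by (intro linear_conv_bounded_linear[THEN iffD1] linearI) (simp_all add: herm_simps scaleR_conv_of_real[where 'a=complex])
  have "cn_holomorphic_on (\<lambda>w. kpow s w a) (ball 0 1)"
    unfolding cn_holomorphic_on_def
  proof
    fix z :: "complex ^ 'n" assume z: "z \<in> ball 0 1"
    have "1 - herm z a \<notin> \<real>\<^sub>\<le>\<^sub>0"
      using Re_one_minus_herm_pos[OF z a] by (simp add: complex_nonpos_Reals_iff)
    then obtain D where D: "((\<lambda>x. x powr of_real s) has_field_derivative D) (at (1 - herm z a))"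
      using has_field_derivative_powr by blast
    have "((\<lambda>w. 1 - herm w a) has_derivative (\<lambda>v. - herm v a)) (at z)"
      using has_derivative_diff[OF has_derivative_const bounded_linear.has_derivative[OF bl has_derivative_ident]] by simp
    from has_derivative_compose[OF this D[unfolded has_field_derivative_def]]
    have "((\<lambda>w. kpow s w a) has_derivative (\<lambda>v. D * - herm v a)) (at z)"
      by (simp add: kpow_def)
    moreover have "\<forall>c v. D * - herm (c *s v) a = c * (D * - herm v a)" by (simp add: herm_simps)
    ultimately show "\<exists>f'. ((\<lambda>w. kpow s w a) has_derivative f') (at z) \<and> (\<forall>c v. f' (c *s v) = c * f' v)" by blast
  qed
  moreover have "norm (kpow s w a) \<le> 2 powr \<bar>s\<bar> + (hgt a / 2) powr (- \<bar>s\<bar>)" if w: "w \<in> ball 0 1" for w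
  proof (cases "s \<ge> 0")
    case True
    have "kdis w a powr s \<le> 2 powr s" using kdis_le_2[OF w a] kdis_pos[OF w a] True by (intro powr_mono2) auto
    then show ?thesis using True by (simp add: norm_kpow[OF w a] add_increasing2)
  next
    case False
    have "kdis w a powr s \<le> (hgt a / 2) powr s"
      using hgt_le_kdis'[OF w a] hgt_pos[OF a] False by (intro powr_mono2') auto
    then show ?thesis using False by (simp add: norm_kpow[OF w a] add_increasing)
  qed
  then have "bounded ((\<lambda>w. kpow s w a) ` ball 0 1)" unfolding bounded_iff by blast
  ultimately show ?thesis by (simp add: H_infinity_def)
qed

lemma kern_kpow: "z \<in> ball 0 1 \<Longrightarrow> w \<in> ball 0 1 \<Longrightarrow> kern b z (w :: complex ^ 'n) = kpow (- (real CARD('n) + 1 + b)) z w"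
  by (simp add: kern_eq kpow_def)

lemma kern_H_infinity: "a \<in> ball 0 1 \<Longrightarrow> (\<lambda>w. kern b w a) \<in> H_infinity"
  by (rule H_infinity_cong[OF kpow_H_infinity]) (simp_all add: kern_kpow)

text \<open>The integrand is \<open>kern t w a * kern t a w\<close> times the weight. The first
  factor is holomorphic in w and the second is the kernel at a, so reproduction returns the diagonal
  value, a power of \<open>hgt a\<close>.\<close>

lemma kernel_L2_norm:
  fixes a :: "complex ^ 'n"
  assumes a: "a \<in> ball 0 1" and t: "t > -1"
  shows "(\<integral>\<^sup>+w. ennreal (hgt w powr t * kdis a w powr (- (2 * (real CARD('n) + 1 + t)))) \<partial>Lb)
    = ennreal (wt_mass TYPE('n) t * hgt a powr (- (real CARD('n) + 1 + t)))"
proof -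
  define N where "N = real CARD('n) + 1 + t"
  have eq: "kern t w a * kern t a w * of_real (hgt w powr t) = of_real (hgt w powr t * kdis a w powr (- (2 * N)))"
    if w: "w \<in> ball 0 1" for w
  proof -
    have "kern t w a * kern t a w = of_real ((norm (kern t a w))\<^sup>2)"
      unfolding cnj_kern[OF a w, symmetric] complex_norm_square by (simp add: mult.commute)
    also have "(norm (kern t a w))\<^sup>2 = kdis a w powr (- (2 * N))"
      unfolding norm_kern[OF a w] N_def[symmetric] power2_eq_square by (simp add: powr_add[symmetric])
    finally show ?thesis by simp
  qed
  have kaa: "kern t a a = of_real (hgt a powr (- N))"
  proof -
    have "1 - herm a a = of_real (hgt a)" by (simp add: herm_self hgt_def)
    then show ?thesis using hgt_pos[OF a] unfolding kern_eq[OF a a] N_def[symmetric]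
      by (simp add: powr_of_real[symmetric])
  qed
  have "complex_of_real (LINT w|Lb. hgt w powr t * kdis a w powr (- (2 * N)))
      = (LINT w|Lb. kern t w a * kern t a w * of_real (hgt w powr t))"
    unfolding integral_complex_of_real[symmetric]
    by (rule Bochner_Integration.integral_cong[OF refl]) (simp add: eq)
  also have "\<dots> = of_real (wt_mass TYPE('n) t) * kern t a a"
    by (rule reproducing[OF kern_H_infinity[OF a] t a])
  finally have I: "(LINT w|Lb. hgt w powr t * kdis a w powr (- (2 * N))) = wt_mass TYPE('n) t * hgt a powr (- N)"
    unfolding kaa of_real_mult[symmetric] of_real_eq_iff .
  have note1 [measurable]: "(\<lambda>x. x) \<in> borel_measurable (Lb :: (complex ^ 'n) measure)" by (rule measurable_Lb_id)
  have "integrable Lb (\<lambda>w. hgt w powr t * kdis a w powr (- (2 * N)))"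
  proof (rule Bochner_Integration.integrable_bound)
    show "integrable Lb (\<lambda>w :: complex ^ 'n. (hgt a / 2) powr (- (2 * N)) * hgt w powr t)"
      by (intro integrable_mult_right wt_mass_Lb t)
    show "AE w in Lb. norm (hgt w powr t * kdis a w powr (- (2 * N))) \<le> norm ((hgt a / 2) powr (- (2 * N)) * hgt w powr t)"
    proof (rule AE_I2)
      fix w :: "complex ^ 'n" assume "w \<in> space Lb"
      then have w: "w \<in> ball 0 1" by simp
      have "kdis a w powr (- (2 * N)) \<le> (hgt a / 2) powr (- (2 * N))"
        using hgt_le_kdis[OF a w] hgt_pos[OF a] t by (intro powr_mono2') (auto simp: N_def)
      then have "hgt w powr t * kdis a w powr (- (2 * N)) \<le> hgt w powr t * (hgt a / 2) powr (- (2 * N))"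
        by (intro mult_left_mono) auto
      then show "norm (hgt w powr t * kdis a w powr (- (2 * N))) \<le> norm ((hgt a / 2) powr (- (2 * N)) * hgt w powr t)"
        by (simp add: mult.commute)
    qed
  qed measurable
  moreover have "AE w in Lb. 0 \<le> hgt w powr t * kdis a w powr (- (2 * N))" by simp
  ultimately show ?thesis using nn_integral_eq_integral unfolding I[symmetric] N_def[symmetric] by blast
qed

text \<open>On the tent the squared kernel at a suitable centre a is at least (2 \<rho>)^(-2N),
  while its total integral is of order \<open>hgt a powr - N\<close>, at most \<rho>^(-N). The
  quotient has the order \<rho>^N. For \<rho> \<ge> 1 the total mass suffices.\<close>

lemma tent_measure:
  assumes t: "t > -1"
  shows "\<exists>C>0. \<forall>z\<in>ball (0::complex ^ 'n) 1. \<forall>\<rho>>0.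
    (\<integral>\<^sup>+w. ennreal (hgt w powr t) * indicator {w. kdis z w < \<rho>} w \<partial>Lb) \<le> ennreal (C * \<rho> powr (real CARD('n) + 1 + t))"
proof -
  define N where "N = real CARD('n) + 1 + t"
  have N: "N > 0" using t by (simp add: N_def)
  define J where "J = wt_mass TYPE('n) t"
  have J: "J > 0" unfolding J_def by (rule wt_mass_pos[OF t])
  have m: "(\<lambda>x. x) \<in> borel_measurable (Lb :: (complex ^ 'n) measure)" by (rule measurable_Lb_id)
  note [measurable] = m
  have "(\<integral>\<^sup>+w. ennreal (hgt w powr t) * indicator {w. kdis z w < \<rho>} w \<partial>Lb) \<le> ennreal (2 powr (2 * N) * J * \<rho> powr N)"
    if z: "z \<in> ball 0 1" and \<rho>: "\<rho> > 0" for z :: "complex ^ 'n" and \<rho>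
  proof (cases "\<rho> \<ge> 1")
    case True
    have "(\<integral>\<^sup>+w. ennreal (hgt w powr t) * indicator {w. kdis z w < \<rho>} w \<partial>Lb) \<le> (\<integral>\<^sup>+w. ennreal (hgt (w :: complex ^ 'n) powr t) \<partial>Lb)"
      by (intro nn_integral_mono) (simp split: split_indicator)
    also have "\<dots> = ennreal J" unfolding J_def by (rule wt_mass_Lb[OF t])
    also have "\<dots> \<le> ennreal (2 powr (2 * N) * J * \<rho> powr N)"
    proof (rule ennreal_leI)
      have "1 * J * 1 \<le> 2 powr (2 * N) * J * \<rho> powr N"
        using N J True ge_one_powr_ge_zero[of 2 "2 * N"] ge_one_powr_ge_zero[of \<rho> N] by (intro mult_mono) auto
      then show "J \<le> 2 powr (2 * N) * J * \<rho> powr N" by simp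
    qed
    finally show ?thesis .
  next
    case False
    \<comment> \<open>Moving the centre inwards raises its height to at least \<rho>, and changes
      the distance to points of the tent by no more than \<rho>.\<close>
    define a where "a = (1 - \<rho>) *\<^sub>R z"
    have na: "norm a = (1 - \<rho>) * norm z" using False by (simp add: a_def)
    have na1: "norm a \<le> 1 - \<rho>" unfolding na using False z mult_left_le[of "norm z" "1 - \<rho>"] by simp
    have a: "a \<in> ball 0 1" using na1 \<rho> by simp
    have "(norm a)\<^sup>2 \<le> (1 - \<rho>)\<^sup>2" using na1 by (intro power_mono) auto
    moreover have "\<rho> * \<rho> \<le> \<rho> * 1" using False \<rho> by (intro mult_left_mono) auto
    ultimately have ha: "hgt a \<ge> \<rho>" by (simp add: hgt_def power2_eq_square algebra_simps)
    have "(\<integral>\<^sup>+w. ennreal (hgt w powr t) * indicator {w. kdis z w < \<rho>} w \<partial>Lb)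
       \<le> (\<integral>\<^sup>+w. ennreal ((2 * \<rho>) powr (2 * N)) * ennreal (hgt w powr t * kdis a w powr (- (2 * N))) \<partial>Lb)"
    proof (rule nn_integral_mono)
      fix w :: "complex ^ 'n" assume "w \<in> space Lb"
      then have w: "w \<in> ball 0 1" by simp
      show "ennreal (hgt w powr t) * indicator {w. kdis z w < \<rho>} w \<le> ennreal ((2 * \<rho>) powr (2 * N)) * ennreal (hgt w powr t * kdis a w powr (- (2 * N)))"
      proof (cases "kdis z w < \<rho>")
        case True
        have e: "1 - herm a w = (1 - herm z w) + of_real \<rho> * herm z w"
          by (simp add: a_def herm_simps algebra_simps)
        have "kdis a w \<le> kdis z w + \<rho> * norm (herm z w)"
          unfolding kdis_def e using \<rho> norm_triangle_ineq[of "1 - herm z w" "of_real \<rho> * herm z w"] by (simp add: norm_mult)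
        also have "\<dots> \<le> \<rho> + \<rho> * 1"
          using norm_herm_less_1[OF z w] \<rho> True by (intro add_mono mult_left_mono) auto
        finally have k: "kdis a w \<le> 2 * \<rho>" by simp
        have kp: "kdis a w > 0" by (rule kdis_pos[OF a w])
        have "1 = kdis a w powr (2 * N) * kdis a w powr (- (2 * N))"
          using kp by (simp add: powr_add[symmetric])
        also have "\<dots> \<le> (2 * \<rho>) powr (2 * N) * kdis a w powr (- (2 * N))"
          using kp k N by (intro mult_right_mono powr_mono2) auto
        finally have "hgt w powr t * 1 \<le> hgt w powr t * ((2 * \<rho>) powr (2 * N) * kdis a w powr (- (2 * N)))"
          by (intro mult_left_mono) auto
        then show ?thesis using True by (simp add: ennreal_mult[symmetric] mult_ac ennreal_leI)
      qed simp
    qed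
    also have "\<dots> = ennreal ((2 * \<rho>) powr (2 * N)) * (\<integral>\<^sup>+w. ennreal (hgt w powr t * kdis a w powr (- (2 * N))) \<partial>Lb)"
      by (rule nn_integral_cmult) measurable
    also have "\<dots> = ennreal ((2 * \<rho>) powr (2 * N) * (J * hgt a powr (- N)))"
      unfolding N_def kernel_L2_norm[OF a t] J_def by (simp add: ennreal_mult' )
    also have "\<dots> \<le> ennreal (2 powr (2 * N) * J * \<rho> powr N)"
    proof (rule ennreal_leI)
      have "hgt a powr (- N) \<le> \<rho> powr (- N)" using ha \<rho> N by (intro powr_mono2') auto
      then have "(2 * \<rho>) powr (2 * N) * (J * hgt a powr (- N)) \<le> (2 * \<rho>) powr (2 * N) * (J * \<rho> powr (- N))"
        using J by (intro mult_left_mono) auto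
      also have "\<dots> = 2 powr (2 * N) * J * (\<rho> powr (2 * N) * \<rho> powr (- N))"
        using \<rho> by (simp add: powr_mult mult_ac)
      also have "\<rho> powr (2 * N) * \<rho> powr (- N) = \<rho> powr N" by (simp add: powr_add[symmetric])
      finally show "(2 * \<rho>) powr (2 * N) * (J * hgt a powr (- N)) \<le> 2 powr (2 * N) * J * \<rho> powr N" .
    qed
    finally show ?thesis .
  qed
  then show ?thesis unfolding N_def[symmetric] using J by (intro exI[of _ "2 powr (2 * N) * J"]) auto
qed

text \<open>Dyadic decomposition by the size of \<open>kdis z w\<close> relative to
  \<open>hgt z\<close>. The k-th tent has mass of order (2^k hgt z)^N while the integrand carries
  the power -(N + c), which leaves a geometric series with ratio 2^(-c).\<close>

theorem forelli_rudin:
  assumes t: "t > -1" and c: "c > 0"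
  shows "\<exists>C>0. \<forall>z\<in>ball (0::complex ^ 'n) 1.
    (\<integral>\<^sup>+w. ennreal (hgt w powr t * kdis z w powr (- (real CARD('n) + 1 + t + c))) \<partial>Lb) \<le> ennreal (C * hgt z powr (- c))"
proof -
  define N where "N = real CARD('n) + 1 + t"
  have N: "N > 0" using t by (simp add: N_def)
  obtain C where C: "C > 0" "\<And>z \<rho>. z \<in> ball (0::complex ^ 'n) 1 \<Longrightarrow> \<rho> > 0 \<Longrightarrow>
    (\<integral>\<^sup>+w. ennreal (hgt w powr t) * indicator {w. kdis z w < \<rho>} w \<partial>Lb) \<le> ennreal (C * \<rho> powr N)"
    using tent_measure[OF t, where 'n='n] unfolding N_def by blast
  have half: "(y / 2) powr (- e) = 2 powr e * y powr (- e)" if "y > 0" for y e :: real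
    using that by (simp add: powr_divide powr_minus field_simps)
  define B where "B = C * 2 powr (N + c) / (1 - 2 powr (- c))"
  have m: "(\<lambda>x. x) \<in> borel_measurable (Lb :: (complex ^ 'n) measure)" by (rule measurable_Lb_id)
  note [measurable] = m
  have c2: "2 powr (- c) < 1" using c by (simp add: powr_less_one)
  have "(\<integral>\<^sup>+w. ennreal (hgt w powr t * kdis z w powr (- (N + c))) \<partial>Lb) \<le> ennreal (B * hgt z powr (- c))"
    if z: "z \<in> ball 0 1" for z :: "complex ^ 'n"
  proof -
    define d where "d = hgt z"
    have d: "d > 0" unfolding d_def by (rule hgt_pos[OF z])
    \<comment> \<open>The halved radius bounds the distance from below: for k > 0 by minimality of
      k, for k = 0 because \<open>kdis z w\<close> is never less than
      \<open>hgt z / 2\<close>.\<close>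
    define a where "a k = (2 ^ k * d / 2) powr (- (N + c))" for k :: nat
    have a0: "a k \<ge> 0" for k by (simp add: a_def)
    have "(\<integral>\<^sup>+w. ennreal (hgt w powr t * kdis z w powr (- (N + c))) \<partial>Lb)
      \<le> (\<integral>\<^sup>+w. (\<Sum>k. ennreal (a k) * (ennreal (hgt w powr t) * indicator {w. kdis z w < 2 ^ k * d} w)) \<partial>Lb)"
    proof (rule nn_integral_mono)
      fix w :: "complex ^ 'n" assume "w \<in> space Lb"
      then have w: "w \<in> ball 0 1" by simp
      define k where "k = (LEAST k::nat. kdis z w < 2 ^ k * d)"
      obtain k0 :: nat where "kdis z w / d < 2 ^ k0" using real_arch_pow[of 2 "kdis z w / d"] by auto
      then have "kdis z w < 2 ^ k0 * d" using d by (simp add: field_simps)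
      then have k: "kdis z w < 2 ^ k * d" unfolding k_def by (rule LeastI)
      have k': "kdis z w \<ge> 2 ^ k * d / 2"
      proof (cases k)
        case 0
        then show ?thesis using hgt_le_kdis[OF z w] by (simp add: d_def)
      next
        case (Suc j)
        then have "\<not> kdis z w < 2 ^ j * d" unfolding k_def by (metis lessI not_less_Least)
        then show ?thesis using Suc by simp
      qed
      have "kdis z w powr (- (N + c)) \<le> a k"
        unfolding a_def using k' d N c by (intro powr_mono2') auto
      then have "hgt w powr t * kdis z w powr (- (N + c)) \<le> a k * hgt w powr t"
        by (subst mult.commute) (intro mult_right_mono, auto)
      then have "ennreal (hgt w powr t * kdis z w powr (- (N + c))) \<le> ennreal (a k) * (ennreal (hgt w powr t) * indicator {w. kdis z w < 2 ^ k * d} w)"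
        using k a0 by (simp add: ennreal_mult[symmetric] ennreal_leI)
      also have "\<dots> \<le> (\<Sum>k. ennreal (a k) * (ennreal (hgt w powr t) * indicator {w. kdis z w < 2 ^ k * d} w))"
        using sum_le_suminf[OF summableI, of "{k}" "\<lambda>k. ennreal (a k) * (ennreal (hgt w powr t) * indicator {w. kdis z w < 2 ^ k * d} w)"] by simp
      finally show "ennreal (hgt w powr t * kdis z w powr (- (N + c))) \<le> (\<Sum>k. ennreal (a k) * (ennreal (hgt w powr t) * indicator {w. kdis z w < 2 ^ k * d} w))" .
    qed
    also have "\<dots> = (\<Sum>k. \<integral>\<^sup>+w. ennreal (a k) * (ennreal (hgt w powr t) * indicator {w. kdis z w < 2 ^ k * d} w) \<partial>Lb)"
      by (rule nn_integral_suminf) measurable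
    also have "\<dots> \<le> (\<Sum>k. ennreal (C * 2 powr (N + c) * d powr (- c) * (2 powr (- c)) ^ k))"
    proof (rule suminf_le[OF _ summableI summableI])
      fix k
      have kd: "2 ^ k * d > 0" using d by simp
      have "(\<integral>\<^sup>+w. ennreal (a k) * (ennreal (hgt w powr t) * indicator {w. kdis z w < 2 ^ k * d} w) \<partial>Lb)
        = ennreal (a k) * (\<integral>\<^sup>+w. ennreal (hgt w powr t) * indicator {w. kdis z w < 2 ^ k * d} w \<partial>Lb)"
        by (rule nn_integral_cmult) measurable
      also have "\<dots> \<le> ennreal (a k) * ennreal (C * (2 ^ k * d) powr N)"
        by (intro mult_left_mono C(2)[OF z kd]) simp
      also have "\<dots> = ennreal (a k * (C * (2 ^ k * d) powr N))"
        by (rule ennreal_mult[symmetric]) (use a0 C in auto)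
      also have "a k * (C * (2 ^ k * d) powr N) = C * 2 powr (N + c) * d powr (- c) * (2 powr (- c)) ^ k"
      proof -
        have "a k = 2 powr (N + c) * (2 ^ k * d) powr (- (N + c))"
          unfolding a_def by (rule half[OF kd])
        moreover have "(2 ^ k * d) powr (- (N + c)) * (2 ^ k * d) powr N = (2 ^ k * d) powr (- c)"
          by (simp add: powr_add[symmetric])
        moreover have "(2 ^ k * d) powr (- c) = (2 powr (- c)) ^ k * d powr (- c)"
          using d by (simp add: powr_mult powr_powr powr_realpow[symmetric] mult.commute)
        ultimately show ?thesis by (simp add: mult_ac)
      qed
      finally show "(\<integral>\<^sup>+w. ennreal (a k) * (ennreal (hgt w powr t) * indicator {w. kdis z w < 2 ^ k * d} w) \<partial>Lb)
        \<le> ennreal (C * 2 powr (N + c) * d powr (- c) * (2 powr (- c)) ^ k)" .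
    qed
    also have "\<dots> = ennreal (C * 2 powr (N + c) * d powr (- c) * (1 / (1 - 2 powr (- c))))"
      by (intro suminf_ennreal_eq sums_mult geometric_sums) (use c2 C in auto)
    finally show ?thesis by (simp add: B_def d_def mult_ac)
  qed
  moreover have "B > 0" using C c2 by (simp add: B_def)
  ultimately show ?thesis unfolding N_def by (intro exI[of _ B]) auto
qed

section \<open>Bergman balls\<close>

text \<open>The Bergman ball of radius r in algebraic form, with R the square of cosh r; it contains
  its centre exactly when R > 1.\<close>

definition bset :: "real \<Rightarrow> complex ^ 'n \<Rightarrow> (complex ^ 'n) set" where
  "bset R z = {w \<in> ball 0 1. (kdis z w)\<^sup>2 < R * (hgt z * hgt w)}"

lemma bset_sub_ball: "w \<in> bset R z \<Longrightarrow> w \<in> ball 0 1"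
  by (simp add: bset_def)

lemma bset_sym: "z \<in> ball 0 1 \<Longrightarrow> w \<in> bset R z \<Longrightarrow> z \<in> bset R w"
  by (simp add: bset_def kdis_sym mult.commute)

text \<open>As \<open>hgt w\<close> is at most twice the distance, one factor of the squared
  distance cancels. On a Bergman ball the kernel modulus and both heights are thus mutually
  comparable.\<close>

lemma bset_kdis_less: assumes z: "z \<in> ball 0 1" and w: "w \<in> bset R z" and R: "R > 0"
  shows "kdis z w < 2 * R * hgt z"
proof -
  have wb: "w \<in> ball 0 1" using w by (rule bset_sub_ball)
  have "(kdis z w)\<^sup>2 < R * (hgt z * hgt w)" using w by (simp add: bset_def)
  also have "\<dots> \<le> R * (hgt z * (2 * kdis z w))"
    using hgt_le_kdis'[OF z wb] R hgt_pos[OF z] by (intro mult_left_mono) auto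
  finally have "kdis z w * kdis z w < (2 * R * hgt z) * kdis z w" by (simp add: power2_eq_square mult_ac)
  then show ?thesis using kdis_pos[OF z wb] by (simp add: mult_less_cancel_right)
qed

lemma bset_kdis_less': "z \<in> ball 0 1 \<Longrightarrow> w \<in> bset R z \<Longrightarrow> R > 0 \<Longrightarrow> kdis z w < 2 * R * hgt w"
  using bset_kdis_less[of w z R] bset_sym[of z w R] bset_sub_ball[of w R z] by (simp add: kdis_sym)

lemma bset_hgt_le: assumes z: "z \<in> ball 0 1" and w: "w \<in> bset R z" and R: "R > 0"
  shows "hgt w \<le> 4 * R * hgt z" "hgt z \<le> 4 * R * hgt w"
proof -
  have wb: "w \<in> ball 0 1" using w by (rule bset_sub_ball)
  show "hgt w \<le> 4 * R * hgt z" using hgt_le_kdis'[OF z wb] bset_kdis_less[OF assms] by simp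
  show "hgt z \<le> 4 * R * hgt w" using hgt_le_kdis[OF z wb] bset_kdis_less'[OF assms] by simp
qed

lemma powr_between:
  fixes x y K :: real
  assumes "x > 0" "y > 0" "K \<ge> 1" "x \<le> K * y" "y \<le> K * x"
  shows "x powr s \<le> K powr \<bar>s\<bar> * y powr s"
proof (cases "s \<ge> 0")
  case True
  have "x powr s \<le> (K * y) powr s" using assms True by (intro powr_mono2) auto
  then show ?thesis using True assms by (simp add: powr_mult)
next
  case False
  have "x powr s \<le> (y / K) powr s" using assms False by (intro powr_mono2') (auto simp: field_simps)
  also have "\<dots> = K powr \<bar>s\<bar> * y powr s"
    using False assms by (simp add: powr_divide powr_minus field_simps)
  finally show ?thesis .
qed

lemma bset_measurable [measurable]: "bset R z \<in> sets borel"
proof -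
  have "bset R z = ball 0 1 \<inter> {w. (kdis z w)\<^sup>2 < R * (hgt z * hgt w)}" by (auto simp: bset_def)
  moreover have "{w. (kdis z w)\<^sup>2 < R * (hgt z * hgt w)} \<in> sets borel" by measurable
  ultimately show ?thesis by simp
qed

lemma borel_in_sets_Lb: "S \<in> sets borel \<Longrightarrow> S \<subseteq> ball 0 1 \<Longrightarrow> S \<in> sets Lb"
  by (auto simp: Lb_def sets_restrict_space_iff)

lemma bset_sets_Lb [measurable]: "bset R z \<in> sets Lb"
  by (rule borel_in_sets_Lb) (auto dest: bset_sub_ball)

lemma bset_measure_upper:
  assumes R: "R > 0"
  shows "\<exists>C>0. \<forall>z\<in>ball (0::complex ^ 'n) 1. measure Lb (bset R z) \<le> C * hgt z powr (real CARD('n) + 1)"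
proof -
  obtain C where C: "C > 0" "\<And>z \<rho>. z \<in> ball (0::complex ^ 'n) 1 \<Longrightarrow> \<rho> > 0 \<Longrightarrow>
    (\<integral>\<^sup>+w. ennreal (hgt w powr 0) * indicator {w. kdis z w < \<rho>} w \<partial>Lb) \<le> ennreal (C * \<rho> powr (real CARD('n) + 1 + 0))"
    using tent_measure[of 0, where 'n='n] by auto
  have "measure Lb (bset R z) \<le> C * (2 * R) powr (real CARD('n) + 1) * hgt z powr (real CARD('n) + 1)"
    if z: "z \<in> ball 0 1" for z :: "complex ^ 'n"
  proof -
    have hz: "hgt z > 0" by (rule hgt_pos[OF z])
    have "emeasure Lb (bset R z) = (\<integral>\<^sup>+w. indicator (bset R z) w \<partial>Lb)" by simp
    also have "\<dots> \<le> (\<integral>\<^sup>+w. ennreal (hgt w powr 0) * indicator {w. kdis z w < 2 * R * hgt z} w \<partial>Lb)"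
    proof (rule nn_integral_mono)
      fix w :: "complex ^ 'n" assume "w \<in> space Lb"
      then show "indicator (bset R z) w \<le> ennreal (hgt w powr 0) * indicator {w. kdis z w < 2 * R * hgt z} w"
        using bset_kdis_less[OF z _ R, of w] hgt_pos[of w] by (auto split: split_indicator)
    qed
    also have "\<dots> \<le> ennreal (C * (2 * R * hgt z) powr (real CARD('n) + 1 + 0))"
      by (rule C(2)[OF z]) (use R hz in simp)
    also have "C * (2 * R * hgt z) powr (real CARD('n) + 1 + 0) = C * (2 * R) powr (real CARD('n) + 1) * hgt z powr (real CARD('n) + 1)"
      using R hz by (simp add: powr_mult)
    finally show ?thesis
      unfolding Lb.emeasure_eq_measure using C(1) by (subst (asm) ennreal_le_iff) auto
  qed
  then show ?thesis using C(1) R by (intro exI[of _ "C * (2 * R) powr (real CARD('n) + 1)"]) auto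
qed

text \<open>The exact integral of the squared kernel must come from somewhere. Far from z, half a
  power of the distance can be spared, and \<open>forelli_rudin\<close> with the smaller exponent
  makes that part small. Near z the integrand is at most (hgt z / 2)^(-2N), so the tent has to be
  large.\<close>

lemma tent_measure_lower:
  "\<exists>M>0. \<exists>c>0. \<forall>z\<in>ball (0::complex ^ 'n) 1. c * hgt z powr (real CARD('n) + 1) \<le> measure Lb {w\<in>ball 0 1. kdis z w < M * hgt z}"
proof -
  define N where "N = real CARD('n) + 1"
  have N: "N > 1" by (simp add: N_def)
  obtain C where C: "C > 0" "\<And>z. z \<in> ball (0::complex ^ 'n) 1 \<Longrightarrow>
    (\<integral>\<^sup>+w. ennreal (hgt w powr 0 * kdis z w powr (- (N + (N - 1 / 2)))) \<partial>Lb) \<le> ennreal (C * hgt z powr (- (N - 1 / 2)))"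
    using forelli_rudin[of 0 "N - 1 / 2", where 'n='n] N unfolding N_def by auto
  define J where "J = wt_mass TYPE('n) 0"
  have J: "J > 0" unfolding J_def by (rule wt_mass_pos) simp
  \<comment> \<open>Chosen so that the far part is exactly half of J (hgt z)^(-N).\<close>
  define M where "M = (2 * C / J)\<^sup>2"
  have M: "M > 0" using C J by (simp add: M_def)
  have sM: "M powr (- (1 / 2)) = J / (2 * C)"
    using C J by (simp add: M_def powr_minus powr_half_sqrt)
  define c where "c = J / 2 * 4 powr (- N)"
  have m: "(\<lambda>x. x) \<in> borel_measurable (Lb :: (complex ^ 'n) measure)" by (rule measurable_Lb_id)
  note [measurable] = m
  have "c * hgt z powr N \<le> measure Lb {w\<in>ball 0 1. kdis z w < M * hgt z}" if z: "z \<in> ball 0 1" for z :: "complex ^ 'n"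
  proof -
    define d where "d = hgt z"
    have d: "d > 0" unfolding d_def by (rule hgt_pos[OF z])
    define S where "S = {w\<in>ball 0 1. kdis z w < M * hgt z}"
    have [measurable]: "S \<in> sets Lb"
    proof (rule borel_in_sets_Lb)
      have "S = ball 0 1 \<inter> {w. kdis z w < M * hgt z}" by (auto simp: S_def)
      then show "S \<in> sets borel" by simp
    qed (auto simp: S_def)
    have "ennreal (J * d powr (- N)) = (\<integral>\<^sup>+w. ennreal (hgt w powr 0 * kdis z w powr (- (2 * N))) \<partial>Lb)"
      using kernel_L2_norm[OF z, of 0] unfolding J_def d_def N_def by simp
    also have "\<dots> \<le> (\<integral>\<^sup>+w. ennreal ((d / 2) powr (- (2 * N))) * indicator S w +
        ennreal ((M * d) powr (- (1 / 2))) * ennreal (hgt w powr 0 * kdis z w powr (- (N + (N - 1 / 2)))) \<partial>Lb)"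
    proof (rule nn_integral_mono)
      fix w :: "complex ^ 'n" assume "w \<in> space Lb"
      then have w: "w \<in> ball 0 1" by simp
      have h0: "hgt w powr 0 = 1" using hgt_pos[OF w] by simp
      have kp: "kdis z w > 0" by (rule kdis_pos[OF z w])
      show "ennreal (hgt w powr 0 * kdis z w powr (- (2 * N))) \<le> ennreal ((d / 2) powr (- (2 * N))) * indicator S w +
        ennreal ((M * d) powr (- (1 / 2))) * ennreal (hgt w powr 0 * kdis z w powr (- (N + (N - 1 / 2))))"
      proof (cases "w \<in> S")
        case True
        have "kdis z w powr (- (2 * N)) \<le> (d / 2) powr (- (2 * N))"
          using hgt_le_kdis[OF z w] d N by (intro powr_mono2') (auto simp: d_def)
        then show ?thesis using True by (simp add: h0 ennreal_leI add_increasing2)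
      next
        case False
        then have k: "kdis z w \<ge> M * d" using w by (simp add: S_def d_def)
        have "kdis z w powr (- (2 * N)) = kdis z w powr (- (1 / 2)) * kdis z w powr (- (N + (N - 1 / 2)))"
          by (simp add: powr_add[symmetric])
        also have "\<dots> \<le> (M * d) powr (- (1 / 2)) * kdis z w powr (- (N + (N - 1 / 2)))"
          using k M d by (intro mult_right_mono powr_mono2') auto
        finally show ?thesis using False by (simp add: h0 ennreal_leI ennreal_mult[symmetric])
      qed
    qed
    also have "\<dots> = ennreal ((d / 2) powr (- (2 * N))) * emeasure Lb S + ennreal ((M * d) powr (- (1 / 2))) *
       (\<integral>\<^sup>+w. ennreal (hgt w powr 0 * kdis z w powr (- (N + (N - 1 / 2)))) \<partial>Lb)"
      by (subst nn_integral_add) (auto simp: nn_integral_cmult)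
    also have "\<dots> \<le> ennreal ((d / 2) powr (- (2 * N))) * emeasure Lb S + ennreal ((M * d) powr (- (1 / 2))) *
       ennreal (C * hgt z powr (- (N - 1 / 2)))"
      by (intro add_left_mono mult_left_mono C(2)[OF z]) simp
    also have "\<dots> = ennreal ((d / 2) powr (- (2 * N)) * measure Lb S + (M * d) powr (- (1 / 2)) * (C * d powr (- (N - 1 / 2))))"
      unfolding Lb.emeasure_eq_measure d_def using C(1)
      by (simp add: ennreal_mult[symmetric] ennreal_plus[symmetric] del: ennreal_plus)
    also have "(M * d) powr (- (1 / 2)) * (C * d powr (- (N - 1 / 2))) = J / 2 * d powr (- N)"
    proof -
      have "(M * d) powr (- (1 / 2)) = J / (2 * C) * d powr (- (1 / 2))" using M d sM by (simp add: powr_mult)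
      moreover have "d powr (- (1 / 2)) * d powr (- (N - 1 / 2)) = d powr (- N)" by (simp add: powr_add[symmetric])
      ultimately show ?thesis using C(1) by (simp add: mult_ac)
    qed
    finally have "J * d powr (- N) \<le> (d / 2) powr (- (2 * N)) * measure Lb S + J / 2 * d powr (- N)"
      by (subst (asm) ennreal_le_iff) (use J in auto)
    then have "J / 2 * d powr (- N) \<le> (d / 2) powr (- (2 * N)) * measure Lb S" by simp
    then have h1: "(d / 2) powr (2 * N) * (J / 2 * d powr (- N)) \<le> (d / 2) powr (2 * N) * ((d / 2) powr (- (2 * N)) * measure Lb S)"
      by (rule mult_left_mono) simp
    have h2: "(d / 2) powr (2 * N) * ((d / 2) powr (- (2 * N)) * measure Lb S) = measure Lb S"
      using d by (simp add: powr_add[symmetric] mult.assoc[symmetric])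
    have h3: "(d / 2) powr (2 * N) * (J / 2 * d powr (- N)) = c * d powr N"
    proof -
      have "(d / 2) powr (2 * N) = d powr (2 * N) * 4 powr (- N)"
      proof -
        have "(2::real) powr (2 * N) = 4 powr N" by (simp add: powr_powr[symmetric])
        then show ?thesis using d by (simp add: powr_divide powr_minus field_simps)
      qed
      moreover have "d powr (2 * N) * d powr (- N) = d powr N" by (simp add: powr_add[symmetric])
      ultimately show ?thesis by (simp add: c_def mult_ac)
    qed
    show ?thesis using h1 unfolding h2 h3 unfolding S_def d_def .
  qed
  moreover have "c > 0" using J by (simp add: c_def)
  ultimately show ?thesis using M unfolding N_def by blast
qed

text \<open>The tent is generally larger than the Bergman ball. Contracting it towards z by a fixed
  ratio l moves it inside, and costs only the factor l^(2n).\<close>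

lemma bset_measure_lower:
  assumes R: "R > 1"
  shows "\<exists>c>0. \<forall>z\<in>ball (0::complex ^ 'n) 1. c * hgt z powr (real CARD('n) + 1) \<le> measure Lb (bset R z)"
proof -
  obtain M c where M: "M > 0" and c: "c > 0" "\<And>z. z \<in> ball (0::complex ^ 'n) 1 \<Longrightarrow>
    c * hgt z powr (real CARD('n) + 1) \<le> measure Lb {w\<in>ball 0 1. kdis z w < M * hgt z}"
    using tent_measure_lower[where 'n='n] by blast
  \<comment> \<open>After contraction the distance to z is at most (1 + l M) hgt z and the height at
    least (1 - l) hgt z; this quotient is therefore the radius parameter needed, and it tends to 1 <
    R.\<close>
  have "((\<lambda>l. (1 + l * M)\<^sup>2 / (1 - l)) \<longlongrightarrow> (1 + 0 * M)\<^sup>2 / (1 - 0)) (at_right 0)"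
    by (intro tendsto_intros) auto
  then have "\<forall>\<^sub>F l in at_right 0. (1 + l * M)\<^sup>2 / (1 - l) < R"
    using R by (intro order_tendstoD(2)[where y="(1 + 0 * M)\<^sup>2 / (1 - 0)"]) auto
  moreover have "\<forall>\<^sub>F l in at_right (0::real). 0 < l \<and> l < 1"
    by (auto simp: eventually_at_right_field intro: exI[of _ 1])
  ultimately have "\<forall>\<^sub>F l in at_right 0. (1 + l * M)\<^sup>2 / (1 - l) < R \<and> 0 < l \<and> l < 1"
    by eventually_elim simp
  then obtain l where l: "(1 + l * M)\<^sup>2 / (1 - l) < R" "0 < l" "l < 1"
    using eventually_happens[of _ "at_right (0::real)"] by auto
  have "l ^ DIM(complex ^ 'n) * c * hgt z powr (real CARD('n) + 1) \<le> measure Lb (bset R z)" if z: "z \<in> ball 0 1" for z :: "complex ^ 'n"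
  proof -
    define S where "S = {w\<in>ball 0 1. kdis z w < M * hgt z}"
    define T where "T w = l *\<^sub>R w + (1 - l) *\<^sub>R z" for w
    have hz: "hgt z > 0" by (rule hgt_pos[OF z])
    have Sb: "S \<in> sets borel"
    proof -
      have "S = ball 0 1 \<inter> {w. kdis z w < M * hgt z}" by (auto simp: S_def)
      then show ?thesis by simp
    qed
    have sub: "T ` S \<subseteq> bset R z"
    proof
      fix y assume "y \<in> T ` S"
      then obtain w where w: "w \<in> ball 0 1" "kdis z w < M * hgt z" "y = T w" by (auto simp: S_def)
      have k: "kdis z y \<le> (1 + l * M) * hgt z"
      proof -
        have "1 - herm z y = of_real (1 - l) * of_real (hgt z) + of_real l * (1 - herm z w)"
          unfolding w(3) T_def herm_simps herm_self hgt_def by (simp add: algebra_simps)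
        then have "kdis z y \<le> (1 - l) * hgt z + l * kdis z w"
          unfolding kdis_def using l hz norm_triangle_ineq[of "of_real (1 - l) * of_real (hgt z)" "of_real l * (1 - herm z w)"]
          by (simp add: norm_mult del: of_real_diff)
        also have "\<dots> \<le> 1 * hgt z + l * (M * hgt z)"
          using l hz w(2) by (intro add_mono mult_right_mono mult_left_mono) auto
        finally show ?thesis by (simp add: algebra_simps)
      qed
      have hy: "hgt y \<ge> (1 - l) * hgt z"
      proof -
        have "norm y \<le> l * norm w + (1 - l) * norm z"
          unfolding w(3) T_def using l norm_triangle_ineq[of "l *\<^sub>R w" "(1 - l) *\<^sub>R z"] by simp
        then have "(norm y)\<^sup>2 \<le> (l * norm w + (1 - l) * norm z)\<^sup>2" by (intro power_mono) auto
        also have "\<dots> \<le> l * (norm w)\<^sup>2 + (1 - l) * (norm z)\<^sup>2"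
        proof -
          have "l * (norm w)\<^sup>2 + (1 - l) * (norm z)\<^sup>2 - (l * norm w + (1 - l) * norm z)\<^sup>2 = l * (1 - l) * (norm w - norm z)\<^sup>2"
            by (simp add: power2_eq_square algebra_simps)
          also have "\<dots> \<ge> 0" using l by simp
          finally show ?thesis by simp
        qed
        also have "l * (norm w)\<^sup>2 \<le> l * 1" using w(1) l by (intro mult_left_mono) (auto simp: power_le_one)
        finally show ?thesis unfolding hgt_def by (simp add: algebra_simps)
      qed
      have hyp: "hgt y > 0" using hy l hz mult_pos_pos[of "1 - l" "hgt z"] by linarith
      then have yb: "y \<in> ball 0 1" by (simp only: hgt_pos_iff)
      have "(kdis z y)\<^sup>2 \<le> ((1 + l * M) * hgt z)\<^sup>2" using k by (intro power_mono) (auto simp: kdis_def)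
      also have "\<dots> = (1 + l * M)\<^sup>2 / (1 - l) * (hgt z * ((1 - l) * hgt z))" using l by (simp add: power2_eq_square field_simps)
      also have "\<dots> < R * (hgt z * ((1 - l) * hgt z))"
        using l hz by (intro mult_strict_right_mono) auto
      also have "\<dots> \<le> R * (hgt z * hgt y)" using hy hz R by (intro mult_left_mono) auto
      finally show "y \<in> bset R z" using yb by (simp add: bset_def)
    qed
    have mS: "measure Lb S = measure lebesgue S"
      unfolding Lb_def by (rule measure_restrict_space) (auto simp: S_def)
    have mB: "measure Lb (bset R z) = measure lebesgue (bset R z)"
      unfolding Lb_def by (rule measure_restrict_space) (auto simp: bset_def)
    have "l ^ DIM(complex ^ 'n) * measure lebesgue S = measure lebesgue (T ` S)"
      unfolding T_def using measure_lebesgue_affine[of l "(1 - l) *\<^sub>R z" S] l by (simp add: add.commute)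
    also have "\<dots> \<le> measure lebesgue (bset R z)"
    proof (rule measure_mono_fmeasurable[OF sub])
      have "T ` S = (\<lambda>w. (1 / l) *\<^sub>R (w - (1 - l) *\<^sub>R z)) -` S"
        using l by (auto simp: T_def image_iff field_simps scaleR_diff_right intro!: bexI[of _ "(1 / l) *\<^sub>R (_ - (1 - l) *\<^sub>R z)"])
      then show "T ` S \<in> sets lebesgue"
        using measurable_sets_borel[OF _ Sb, of "\<lambda>w. (1 / l) *\<^sub>R (w - (1 - l) *\<^sub>R z)"] by simp
      have "emeasure lborel (bset R z) \<le> emeasure lborel (ball (0::complex ^ 'n) 1)"
        by (intro emeasure_mono) (auto dest: bset_sub_ball)
      also have "\<dots> < \<infinity>" by (rule emeasure_lborel_ball_finite)
      finally show "bset R z \<in> fmeasurable lebesgue"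
        by (intro fmeasurableI) auto
    qed
    finally have "l ^ DIM(complex ^ 'n) * measure Lb S \<le> measure Lb (bset R z)" unfolding mS mB .
    moreover have "l ^ DIM(complex ^ 'n) * (c * hgt z powr (real CARD('n) + 1)) \<le> l ^ DIM(complex ^ 'n) * measure Lb S"
      using l c(2)[OF z] unfolding S_def by (intro mult_left_mono) auto
    ultimately show ?thesis by (simp add: mult_ac)
  qed
  then show ?thesis using c(1) l by (intro exI[of _ "l ^ DIM(complex ^ 'n) * c"]) auto
qed

section \<open>Schur's test\<close>

text \<open>The q-th power lies above its tangent at \<tau>. Being affine in y^q, the bound can be
  integrated before \<tau> is optimized.\<close>

lemma young_tangent:
  fixes y \<tau> q :: real
  assumes "y \<ge> 0" "\<tau> > 0" "q \<ge> 1"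
  shows "y \<le> \<tau> powr (1 - q) / q * y powr q + \<tau> * (1 - 1 / q)"
proof (cases "y = 0")
  case True
  then show ?thesis using assms by (simp add: field_simps)
next
  case False
  define x where "x = y / \<tau>"
  have x: "x > 0" "y = \<tau> * x" using False assms by (auto simp: x_def)
  have "(x powr q) powr (1 / q) * 1 powr (1 - 1 / q) \<le> 1 / q * x powr q + (1 - 1 / q) * 1"
    using assms x by (intro Youngs_inequality_0) auto
  then have "x \<le> x powr q / q + (1 - 1 / q)" using assms x by (simp add: powr_powr)
  then have "\<tau> * x \<le> \<tau> * (x powr q / q + (1 - 1 / q))" using assms by (intro mult_left_mono) auto
  also have "\<tau> * (x powr q / q + (1 - 1 / q)) = \<tau> powr (1 - q) / q * y powr q + \<tau> * (1 - 1 / q)"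
    using assms x by (simp add: powr_mult powr_diff field_simps)
  finally show ?thesis by (simp add: x)
qed

text \<open>Integrating the tangent bound and optimizing over \<tau> gives Jensen's inequality for a
  weight k of mass at most A. Stating it for a real T below the integral permits that integral to be
  infinite, as happens in Schur's test.\<close>

lemma jensen_nn_integral:
  fixes k h :: "'a \<Rightarrow> real"
  assumes [measurable]: "k \<in> borel_measurable M" "h \<in> borel_measurable M"
    and k: "\<And>x. x \<in> space M \<Longrightarrow> k x \<ge> 0" and h: "\<And>x. x \<in> space M \<Longrightarrow> h x \<ge> 0"
    and q: "q \<ge> 1" and A: "A > 0" "(\<integral>\<^sup>+x. ennreal (k x) \<partial>M) \<le> ennreal A"
    and T: "T \<ge> 0" "ennreal T \<le> (\<integral>\<^sup>+x. ennreal (k x * h x) \<partial>M)"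
  shows "ennreal (T powr q) \<le> ennreal (A powr (q - 1)) * (\<integral>\<^sup>+x. ennreal (k x * h x powr q) \<partial>M)"
proof (cases "(\<integral>\<^sup>+x. ennreal (k x * h x powr q) \<partial>M) = \<infinity>")
  case True
  then show ?thesis using A by (simp add: ennreal_mult_top)
next
  case False
  then obtain B where B: "B \<ge> 0" "(\<integral>\<^sup>+x. ennreal (k x * h x powr q) \<partial>M) = ennreal B"
    by (metis ennreal_cases infinity_ennreal_def)
  have main: "T \<le> \<tau> powr (1 - q) / q * B + \<tau> * (1 - 1 / q) * A" if \<tau>: "\<tau> > 0" for \<tau>
  proof -
    have q1: "1 - 1 / q \<ge> 0" using q by simp
    have "ennreal T \<le> (\<integral>\<^sup>+x. ennreal (k x * h x) \<partial>M)" by (rule T)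
    also have "\<dots> \<le> (\<integral>\<^sup>+x. ennreal (\<tau> powr (1 - q) / q) * ennreal (k x * h x powr q) + ennreal (\<tau> * (1 - 1 / q)) * ennreal (k x) \<partial>M)"
    proof (rule nn_integral_mono)
      fix x assume x: "x \<in> space M"
      have "k x * h x \<le> k x * (\<tau> powr (1 - q) / q * h x powr q + \<tau> * (1 - 1 / q))"
        by (intro mult_left_mono young_tangent k h x \<tau> q)
      also have "\<dots> = \<tau> powr (1 - q) / q * (k x * h x powr q) + \<tau> * (1 - 1 / q) * k x" by (simp add: algebra_simps)
      finally have "ennreal (k x * h x) \<le> ennreal (\<tau> powr (1 - q) / q * (k x * h x powr q) + \<tau> * (1 - 1 / q) * k x)"
        by (rule ennreal_leI)
      also have "\<dots> = ennreal (\<tau> powr (1 - q) / q) * ennreal (k x * h x powr q) + ennreal (\<tau> * (1 - 1 / q)) * ennreal (k x)"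
      proof -
        have "0 \<le> \<tau> powr (1 - q) / q" "0 \<le> \<tau> * (1 - 1 / q)" "0 \<le> k x * h x powr q" "0 \<le> k x"
          using q q1 k[OF x] \<tau> by auto
        then show ?thesis by (simp only: ennreal_plus ennreal_mult mult_nonneg_nonneg)
      qed
      finally show "ennreal (k x * h x) \<le> ennreal (\<tau> powr (1 - q) / q) * ennreal (k x * h x powr q) + ennreal (\<tau> * (1 - 1 / q)) * ennreal (k x)" .
    qed
    also have "\<dots> = ennreal (\<tau> powr (1 - q) / q) * ennreal B + ennreal (\<tau> * (1 - 1 / q)) * (\<integral>\<^sup>+x. ennreal (k x) \<partial>M)"
      unfolding B(2)[symmetric] by (subst nn_integral_add) (auto simp: nn_integral_cmult)
    also have "\<dots> \<le> ennreal (\<tau> powr (1 - q) / q) * ennreal B + ennreal (\<tau> * (1 - 1 / q)) * ennreal A"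
      by (intro add_left_mono mult_left_mono A) simp
    also have "\<dots> = ennreal (\<tau> powr (1 - q) / q * B + \<tau> * (1 - 1 / q) * A)"
    proof -
      have "0 \<le> \<tau> powr (1 - q) / q" "0 \<le> \<tau> * (1 - 1 / q)" "0 \<le> A"
        using q q1 \<tau> A by auto
      then show ?thesis using B by (simp only: ennreal_plus ennreal_mult mult_nonneg_nonneg)
    qed
    finally show ?thesis using q q1 \<tau> B A by (subst (asm) ennreal_le_iff) auto
  qed
  have "T powr q \<le> A powr (q - 1) * B"
  proof (cases "B = 0")
    case True
    \<comment> \<open>The optimal \<tau> would be 0 and is not admissible, so it is approached
      through \<epsilon> / A.\<close>
    have "T \<le> \<epsilon>" if "\<epsilon> > 0" for \<epsilon>
    proof -
      have "T \<le> \<epsilon> / A * (1 - 1 / q) * A" using main[of "\<epsilon> / A"] that A True by simp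
      also have "\<dots> = \<epsilon> * (1 - 1 / q)" using A by simp
      also have "\<dots> \<le> \<epsilon> * 1" using that q by (intro mult_left_mono) auto
      finally show ?thesis by simp
    qed
    then have "T \<le> 0" by (rule field_le_epsilon[of T 0, simplified]) 
    then show ?thesis using T(1) True by simp
  next
    case False
    then have B0: "B > 0" using B by simp
    \<comment> \<open>The minimizer, for which \<tau>^q A = B and both terms of the bound combine to
      \<tau> A.\<close>
    define \<tau> where "\<tau> = (B / A) powr (1 / q)"
    have \<tau>: "\<tau> > 0" "\<tau> powr q = B / A" using B0 A q by (auto simp: \<tau>_def powr_powr)
    have "\<tau> powr (1 - q) * B = \<tau> * A" using \<tau> A B0 by (simp add: powr_diff)
    then have "\<tau> powr (1 - q) / q * B + \<tau> * (1 - 1 / q) * A = \<tau> * A" using q by (simp add: field_simps)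
    then have "T \<le> \<tau> * A" using main[OF \<tau>(1)] by simp
    then have "T powr q \<le> (\<tau> * A) powr q" using T q by (intro powr_mono2) auto
    also have "\<dots> = A powr (q - 1) * B" using \<tau> A by (simp add: powr_mult powr_diff)
    finally show ?thesis .
  qed
  then show ?thesis unfolding B(2) using B A by (simp add: ennreal_mult[symmetric] ennreal_leI)
qed

text \<open>Splitting off \<open>hgt w powr m\<close>, Jensen's inequality in w and Fubini leave two
  kernel integrals, each a case of \<open>forelli_rudin\<close>. The kernel exponent is the one for
  which the powers of the heights balance. T is any function below the integral, so no measurability
  or finiteness of the operator has to be shown in advance.\<close>

theorem schur_test:
  assumes q: "q > 1" and xb: "q * x + b > -1" and ya: "q * (y + 1) > a + 1"
  shows "\<exists>C>0. \<forall>h T. h \<in> borel_measurable (Lb :: (complex ^ 'n) measure) \<longrightarrow> (\<forall>w\<in>ball 0 1. h w \<ge> 0) \<longrightarrow>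
    (\<forall>z\<in>ball 0 1. T z \<ge> 0 \<and> ennreal (T z) \<le>
      (\<integral>\<^sup>+w. ennreal (hgt z powr x * hgt w powr y * kdis z w powr (- (real CARD('n) + 1 + x + y + (b - a) / q)) * h w) \<partial>Lb)) \<longrightarrow>
    (\<integral>\<^sup>+z. ennreal (T z powr q * hgt z powr b) \<partial>Lb) \<le> ennreal C * (\<integral>\<^sup>+w. ennreal (h w powr q * hgt w powr a) \<partial>Lb)"
proof -
  define \<kappa> where "\<kappa> = real CARD('n) + 1 + x + y + (b - a) / q"
  \<comment> \<open>Admissible range of m: U1 and L1 come from the integral in w, being y - m > -1
    and x + e + m > 0; U2 and L2 are the same two conditions for the integral in z.\<close>
  define L1 where "L1 = - x - (b - a) / q"
  define L2 where "L2 = (a - y) / (q - 1)"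
  define U1 where "U1 = y + 1"
  define U2 where "U2 = (b + x + 1) / (q - 1) - (b - a) / q"
  have x': "x > - (1 + b) / q" using xb q by (simp add: field_simps)
  have y': "y + 1 > (a + 1) / q" using ya q by (simp add: field_simps)
  have xy: "x + y + 1 + (b - a) / q > 0" using x' y' by (simp add: add_divide_distrib diff_divide_distrib)
  have ba: "(b - a) = q * ((b - a) / q)" using q by simp
  define e where "e = (b - a) / q"
  have be: "b = a + q * e" using ba by (simp add: e_def)
  have hU2: "(q - 1) * U2 = b + x + 1 - (q - 1) * e" using q by (simp add: U2_def e_def right_diff_distrib)
  have hL2: "(q - 1) * L2 = a - y" using q by (simp add: L2_def)
  have "L1 < U1" using xy by (simp add: L1_def U1_def)
  moreover have "L1 < U2"
  proof -
    have "(q - 1) * L1 < (q - 1) * U2"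
      using q xb unfolding hU2 L1_def e_def[symmetric] by (simp add: algebra_simps)
    then show ?thesis using q by simp
  qed
  moreover have "L2 < U1"
  proof -
    have "(q - 1) * L2 < (q - 1) * U1" using q ya unfolding hL2 U1_def by (simp add: algebra_simps)
    then show ?thesis using q by simp
  qed
  moreover have "L2 < U2"
  proof -
    have "(q - 1) * L2 < (q - 1) * U2" using q xy unfolding hL2 hU2 e_def[symmetric] be
      by (simp add: algebra_simps)
    then show ?thesis using q by simp
  qed
  ultimately have "max L1 L2 < min U1 U2" by simp
  then obtain m where m: "max L1 L2 < m" "m < min U1 U2" using dense by blast
  have m1: "y - m > -1" "x + e + m > 0" using m by (auto simp: U1_def L1_def e_def)
  have m2: "(q - 1) * m < b + x + 1 - (q - 1) * e"
  proof -
    have "m < U2" using m by simp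
    then have "(q - 1) * m < (q - 1) * U2" using q by simp
    also have "\<dots> = b + x + 1 - (q - 1) * e" using q by (simp add: U2_def e_def right_diff_distrib)
    finally show ?thesis .
  qed
  have m3: "(q - 1) * m > a - y"
  proof -
    have "L2 < m" using m by simp
    then show ?thesis using q by (simp add: L2_def field_simps)
  qed
  define t2 where "t2 = b + x - (q - 1) * (e + m)"
  define c2 where "c2 = y - a + (q - 1) * m"
  have t2: "t2 > -1" "c2 > 0" using m2 m3 by (auto simp: t2_def c2_def algebra_simps)
  obtain C1 where C1: "C1 > 0" "\<And>z. z \<in> ball (0::complex ^ 'n) 1 \<Longrightarrow>
    (\<integral>\<^sup>+w. ennreal (hgt w powr (y - m) * kdis z w powr (- \<kappa>)) \<partial>Lb) \<le> ennreal (C1 * hgt z powr (- (x + e + m)))"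
  proof -
    have "real CARD('n) + 1 + (y - m) + (x + e + m) = \<kappa>" by (simp add: \<kappa>_def e_def)
    then show ?thesis using forelli_rudin[OF m1, where 'n='n] that by auto
  qed
  obtain C2 where C2: "C2 > 0" "\<And>z. z \<in> ball (0::complex ^ 'n) 1 \<Longrightarrow>
    (\<integral>\<^sup>+w. ennreal (hgt w powr t2 * kdis z w powr (- \<kappa>)) \<partial>Lb) \<le> ennreal (C2 * hgt z powr (- c2))"
  proof -
    have "real CARD('n) + 1 + t2 + c2 = \<kappa>" using be q by (simp add: \<kappa>_def e_def[symmetric] t2_def c2_def algebra_simps)
    then show ?thesis using forelli_rudin[OF t2, where 'n='n] that by auto
  qed
  have id: "(\<lambda>x. x) \<in> borel_measurable (Lb :: (complex ^ 'n) measure)" by (rule measurable_Lb_id)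
  note [measurable] = id
  have "(\<integral>\<^sup>+z. ennreal (T z powr q * hgt z powr b) \<partial>Lb) \<le> ennreal (C1 powr (q - 1) * C2) * (\<integral>\<^sup>+w. ennreal (h w powr q * hgt w powr a) \<partial>Lb)"
    if hm[measurable]: "h \<in> borel_measurable (Lb :: (complex ^ 'n) measure)" and h0: "\<forall>w\<in>ball 0 1. h w \<ge> 0"
      and T: "\<forall>z\<in>ball 0 1. T z \<ge> 0 \<and> ennreal (T z) \<le>
      (\<integral>\<^sup>+w. ennreal (hgt z powr x * hgt w powr y * kdis z w powr (- \<kappa>) * h w) \<partial>Lb)" for h T
  proof -
    have pt: "ennreal (T z powr q * hgt z powr b) \<le>
      (\<integral>\<^sup>+w. ennreal (C1 powr (q - 1) * (hgt z powr t2 * kdis w z powr (- \<kappa>)) * (hgt w powr (y - m) * (h w * hgt w powr m) powr q)) \<partial>Lb)"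
      if z: "z \<in> ball 0 1" for z
    proof -
      have hz: "hgt z > 0" by (rule hgt_pos[OF z])
      define A where "A = C1 * hgt z powr (- (e + m))"
      have A: "A > 0" using C1 hz by (simp add: A_def)
      define k where "k w = hgt z powr x * (hgt w powr (y - m) * kdis z w powr (- \<kappa>))" for w
      have [measurable]: "k \<in> borel_measurable Lb" unfolding k_def by measurable
      have kA: "(\<integral>\<^sup>+w. ennreal (k w) \<partial>Lb) \<le> ennreal A"
      proof -
        have "(\<integral>\<^sup>+w. ennreal (k w) \<partial>Lb) = ennreal (hgt z powr x) * (\<integral>\<^sup>+w. ennreal (hgt w powr (y - m) * kdis z w powr (- \<kappa>)) \<partial>Lb)"
          unfolding k_def by (subst nn_integral_cmult[symmetric]) (auto simp: ennreal_mult)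
        also have "\<dots> \<le> ennreal (hgt z powr x) * ennreal (C1 * hgt z powr (- (x + e + m)))"
          by (intro mult_left_mono C1(2) z) simp
        also have "\<dots> = ennreal (hgt z powr x * (C1 * hgt z powr (- (x + e + m))))"
          by (rule ennreal_mult[symmetric]) (use C1 in auto)
        also have "hgt z powr x * (C1 * hgt z powr (- (x + e + m))) = A"
          unfolding A_def by (simp add: mult.left_commute powr_add[symmetric])
        finally show ?thesis .
      qed
      have Tle: "ennreal (T z) \<le> (\<integral>\<^sup>+w. ennreal (k w * (h w * hgt w powr m)) \<partial>Lb)"
      proof -
        have "ennreal (T z) \<le> (\<integral>\<^sup>+w. ennreal (hgt z powr x * hgt w powr y * kdis z w powr (- \<kappa>) * h w) \<partial>Lb)"
          using T z by blast
        also have "\<dots> = (\<integral>\<^sup>+w. ennreal (k w * (h w * hgt w powr m)) \<partial>Lb)"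
        proof (rule nn_integral_cong)
          fix w :: "complex ^ 'n" assume "w \<in> space Lb"
          have "hgt w powr (y - m) * hgt w powr m = hgt w powr y" by (simp add: powr_add[symmetric])
          moreover have "k w * (h w * hgt w powr m) = hgt z powr x * (hgt w powr (y - m) * hgt w powr m) * kdis z w powr (- \<kappa>) * h w"
            unfolding k_def by (simp only: mult_ac)
          ultimately show "ennreal (hgt z powr x * hgt w powr y * kdis z w powr (- \<kappa>) * h w) = ennreal (k w * (h w * hgt w powr m))"
            by (simp only:)
        qed
        finally show ?thesis .
      qed
      have J: "ennreal (T z powr q) \<le> ennreal (A powr (q - 1)) * (\<integral>\<^sup>+w. ennreal (k w * (h w * hgt w powr m) powr q) \<partial>Lb)"
        by (rule jensen_nn_integral[OF _ _ _ _ _ A kA _ Tle]) (use q h0 T z in \<open>auto simp: k_def\<close>)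
      have "ennreal (T z powr q * hgt z powr b) = ennreal (T z powr q) * ennreal (hgt z powr b)"
        by (simp add: ennreal_mult)
      also have "\<dots> \<le> (ennreal (A powr (q - 1)) * (\<integral>\<^sup>+w. ennreal (k w * (h w * hgt w powr m) powr q) \<partial>Lb)) * ennreal (hgt z powr b)"
        by (intro mult_right_mono J) simp
      also have "\<dots> = ennreal (A powr (q - 1) * hgt z powr b) * (\<integral>\<^sup>+w. ennreal (k w * (h w * hgt w powr m) powr q) \<partial>Lb)"
        by (simp add: ennreal_mult mult_ac)
      also have "\<dots> = (\<integral>\<^sup>+w. ennreal (A powr (q - 1) * hgt z powr b * (k w * (h w * hgt w powr m) powr q)) \<partial>Lb)"
        by (subst nn_integral_cmult[symmetric]) (auto simp: ennreal_mult k_def intro!: nn_integral_cong)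
      also have "\<dots> = (\<integral>\<^sup>+w. ennreal (C1 powr (q - 1) * (hgt z powr t2 * kdis w z powr (- \<kappa>)) * (hgt w powr (y - m) * (h w * hgt w powr m) powr q)) \<partial>Lb)"
      proof (rule nn_integral_cong)
        fix w :: "complex ^ 'n" assume "w \<in> space Lb"
        have "A powr (q - 1) * hgt z powr b * hgt z powr x = C1 powr (q - 1) * hgt z powr t2"
          using C1 hz by (simp add: A_def powr_mult powr_powr t2_def powr_add[symmetric] algebra_simps)
        note e1 = this
        have "A powr (q - 1) * hgt z powr b * (k w * (h w * hgt w powr m) powr q)
          = (A powr (q - 1) * hgt z powr b * hgt z powr x) * (hgt w powr (y - m) * kdis z w powr (- \<kappa>) * (h w * hgt w powr m) powr q)"
          unfolding k_def by (simp only: mult_ac)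
        also have "\<dots> = C1 powr (q - 1) * (hgt z powr t2 * kdis w z powr (- \<kappa>)) * (hgt w powr (y - m) * (h w * hgt w powr m) powr q)"
          unfolding e1 kdis_sym[of z w] by (simp only: mult_ac)
        finally show "ennreal (A powr (q - 1) * hgt z powr b * (k w * (h w * hgt w powr m) powr q))
          = ennreal (C1 powr (q - 1) * (hgt z powr t2 * kdis w z powr (- \<kappa>)) * (hgt w powr (y - m) * (h w * hgt w powr m) powr q))"
          by (rule arg_cong)
      qed
      finally show ?thesis .
    qed
    have "(\<integral>\<^sup>+z. ennreal (T z powr q * hgt z powr b) \<partial>Lb) \<le>
      (\<integral>\<^sup>+z. (\<integral>\<^sup>+w. ennreal (C1 powr (q - 1) * (hgt z powr t2 * kdis w z powr (- \<kappa>)) * (hgt w powr (y - m) * (h w * hgt w powr m) powr q)) \<partial>Lb) \<partial>Lb)"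
      by (intro nn_integral_mono pt) simp
    also have "\<dots> = (\<integral>\<^sup>+w. (\<integral>\<^sup>+z. ennreal (C1 powr (q - 1) * (hgt z powr t2 * kdis w z powr (- \<kappa>)) * (hgt w powr (y - m) * (h w * hgt w powr m) powr q)) \<partial>Lb) \<partial>Lb)"
      by (rule Lbp.Fubini') measurable
    also have "\<dots> \<le> (\<integral>\<^sup>+w. ennreal (C1 powr (q - 1) * C2) * ennreal (h w powr q * hgt w powr a) \<partial>Lb)"
    proof (rule nn_integral_mono)
      fix w :: "complex ^ 'n" assume "w \<in> space Lb"
      then have w: "w \<in> ball 0 1" by simp
      have hw: "hgt w > 0" by (rule hgt_pos[OF w])
      have hh: "h w \<ge> 0" using h0 w by blast
      define B where "B = C1 powr (q - 1) * (hgt w powr (y - m) * (h w * hgt w powr m) powr q)"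
      have B: "B \<ge> 0" by (simp add: B_def)
      have "(\<integral>\<^sup>+z. ennreal (C1 powr (q - 1) * (hgt z powr t2 * kdis w z powr (- \<kappa>)) * (hgt w powr (y - m) * (h w * hgt w powr m) powr q)) \<partial>Lb)
        = (\<integral>\<^sup>+z. ennreal B * ennreal (hgt z powr t2 * kdis w z powr (- \<kappa>)) \<partial>Lb)"
        using B by (intro nn_integral_cong) (simp add: ennreal_mult[symmetric] B_def mult_ac)
      also have "\<dots> = ennreal B * (\<integral>\<^sup>+z. ennreal (hgt z powr t2 * kdis w z powr (- \<kappa>)) \<partial>Lb)"
        by (rule nn_integral_cmult) measurable
      also have "\<dots> \<le> ennreal B * ennreal (C2 * hgt w powr (- c2))"
        by (intro mult_left_mono C2(2) w) simp
      also have "\<dots> = ennreal (C1 powr (q - 1) * C2) * ennreal (h w powr q * hgt w powr a)"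
      proof -
        have "(h w * hgt w powr m) powr q = h w powr q * hgt w powr (m * q)"
          using hh hw by (simp add: powr_mult powr_powr)
        moreover have "hgt w powr (y - m) * hgt w powr (m * q) * hgt w powr (- c2) = hgt w powr a"
          by (simp add: powr_add[symmetric] c2_def algebra_simps)
        moreover have "B * (C2 * hgt w powr (- c2)) = (C1 powr (q - 1) * C2) * ((h w * hgt w powr m) powr q * (hgt w powr (y - m) * hgt w powr (- c2)))"
          unfolding B_def by (simp only: mult_ac)
        ultimately have "B * (C2 * hgt w powr (- c2)) = (C1 powr (q - 1) * C2) * (h w powr q * hgt w powr a)"
          by (simp add: mult_ac)
        then show ?thesis using B C1 C2 by (simp add: ennreal_mult[symmetric])
      qed
      finally show "(\<integral>\<^sup>+z. ennreal (C1 powr (q - 1) * (hgt z powr t2 * kdis w z powr (- \<kappa>)) * (hgt w powr (y - m) * (h w * hgt w powr m) powr q)) \<partial>Lb)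
        \<le> ennreal (C1 powr (q - 1) * C2) * ennreal (h w powr q * hgt w powr a)" .
    qed
    also have "\<dots> = ennreal (C1 powr (q - 1) * C2) * (\<integral>\<^sup>+w. ennreal (h w powr q * hgt w powr a) \<partial>Lb)"
      by (rule nn_integral_cmult) measurable
    finally show ?thesis .
  qed
  then show ?thesis unfolding \<kappa>_def[symmetric]
    using C1(1) C2(1) by (intro exI[of _ "C1 powr (q - 1) * C2"]) auto
qed

section \<open>The Bergman projection\<close>

text \<open>Valued in the extended reals, so that divergence shows as infinity and is not hidden by
  a default value.\<close>

definition qint :: "real \<Rightarrow> real \<Rightarrow> (complex ^ 'n \<Rightarrow> complex) \<Rightarrow> ennreal" where
  "qint q b F = (\<integral>\<^sup>+z. ennreal (norm (F z) powr q * hgt z powr b) \<partial>Lb)"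

definition Pj :: "real \<Rightarrow> (complex ^ 'n \<Rightarrow> complex) \<Rightarrow> complex ^ 'n \<Rightarrow> complex" where
  "Pj b F z = (LINT w|Lb. F w * kern b z w * of_real (hgt w powr b)) / of_real (wt_mass TYPE('n) b)"

lemma powr_add_le:
  fixes x y q :: real
  assumes "x \<ge> 0" "y \<ge> 0" "q \<ge> 0"
  shows "(x + y) powr q \<le> 2 powr q * (x powr q + y powr q)"
proof -
  have "(x + y) powr q \<le> (2 * max x y) powr q" using assms by (intro powr_mono2) auto
  also have "\<dots> = 2 powr q * max x y powr q" using assms by (simp add: powr_mult)
  also have "max x y powr q \<le> x powr q + y powr q" by (simp add: max_def)
  finally show ?thesis by simp
qed

lemma qint_cong: "(\<And>z. z \<in> ball 0 1 \<Longrightarrow> norm (F z) = norm (G z)) \<Longrightarrow> qint q b F = qint q b G"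
  unfolding qint_def by (intro nn_integral_cong) auto

lemma qint_add:
  fixes F G H :: "complex ^ 'n \<Rightarrow> complex"
  assumes [measurable]: "F \<in> borel_measurable Lb" "G \<in> borel_measurable Lb" and q: "q \<ge> 0"
    and H: "\<And>z. z \<in> ball 0 1 \<Longrightarrow> norm (H z) \<le> norm (F z) + norm (G z)"
  shows "qint q b H \<le> ennreal (2 powr q) * (qint q b F + qint q b G)"
proof -
  have [measurable]: "(\<lambda>x. x) \<in> borel_measurable (Lb :: (complex ^ 'n) measure)" by (rule measurable_Lb_id)
  have "qint q b H \<le> (\<integral>\<^sup>+z. ennreal (2 powr q) * (ennreal (norm (F z) powr q * hgt z powr b) + ennreal (norm (G z) powr q * hgt z powr b)) \<partial>Lb)"
    unfolding qint_def
  proof (rule nn_integral_mono)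
    fix z :: "complex ^ 'n" assume "z \<in> space Lb"
    then have "norm (H z) powr q \<le> (norm (F z) + norm (G z)) powr q" using H q by (intro powr_mono2) auto
    also have "\<dots> \<le> 2 powr q * (norm (F z) powr q + norm (G z) powr q)" using q by (intro powr_add_le) auto
    finally have "norm (H z) powr q * hgt z powr b \<le> 2 powr q * (norm (F z) powr q + norm (G z) powr q) * hgt z powr b"
      by (intro mult_right_mono) auto
    also have "\<dots> = 2 powr q * (norm (F z) powr q * hgt z powr b + norm (G z) powr q * hgt z powr b)"
      by (simp add: algebra_simps)
    finally have "ennreal (norm (H z) powr q * hgt z powr b) \<le> ennreal (2 powr q * (norm (F z) powr q * hgt z powr b + norm (G z) powr q * hgt z powr b))"
      by (rule ennreal_leI)
    also have "\<dots> = ennreal (2 powr q) * (ennreal (norm (F z) powr q * hgt z powr b) + ennreal (norm (G z) powr q * hgt z powr b))"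
      by (simp add: ennreal_mult)
    finally show "ennreal (norm (H z) powr q * hgt z powr b) \<le> ennreal (2 powr q) * (ennreal (norm (F z) powr q * hgt z powr b) + ennreal (norm (G z) powr q * hgt z powr b))" .
  qed
  also have "\<dots> = ennreal (2 powr q) * (qint q b F + qint q b G)"
    unfolding qint_def by (subst nn_integral_cmult, measurable, subst nn_integral_add) auto
  finally show ?thesis .
qed

text \<open>The weight has finite mass, so the crude bound x \<le> 1 + x^q can stand in for
  Hoelder's inequality.\<close>

lemma qint_finite_imp_L1:
  fixes F :: "complex ^ 'n \<Rightarrow> complex"
  assumes [measurable]: "F \<in> borel_measurable Lb" and q: "q \<ge> 1" and b: "b > -1" and f: "qint q b F < \<infinity>"
  shows "(\<integral>\<^sup>+w. ennreal (norm (F w) * hgt w powr b) \<partial>Lb) < \<infinity>"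
proof -
  have [measurable]: "(\<lambda>x. x) \<in> borel_measurable (Lb :: (complex ^ 'n) measure)" by (rule measurable_Lb_id)
  have "(\<integral>\<^sup>+w. ennreal (norm (F w) * hgt w powr b) \<partial>Lb) \<le>
    (\<integral>\<^sup>+w. ennreal (hgt w powr b) + ennreal (norm (F w) powr q * hgt w powr b) \<partial>Lb)"
  proof (rule nn_integral_mono)
    fix w :: "complex ^ 'n"
    have "norm (F w) \<le> 1 + norm (F w) powr q"
    proof (cases "norm (F w) \<le> 1")
      case False
      then have "norm (F w) powr 1 \<le> norm (F w) powr q" using q by (intro powr_mono) auto
      then show ?thesis using False by simp
    qed (simp add: add_increasing2)
    then have "norm (F w) * hgt w powr b \<le> (1 + norm (F w) powr q) * hgt w powr b" by (intro mult_right_mono) auto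
    also have "\<dots> = hgt w powr b + norm (F w) powr q * hgt w powr b" by (simp add: algebra_simps)
    finally have "ennreal (norm (F w) * hgt w powr b) \<le> ennreal (hgt w powr b + norm (F w) powr q * hgt w powr b)"
      by (rule ennreal_leI)
    then show "ennreal (norm (F w) * hgt w powr b) \<le> ennreal (hgt w powr b) + ennreal (norm (F w) powr q * hgt w powr b)"
      by simp
  qed
  also have "\<dots> = ennreal (wt_mass TYPE('n) b) + qint q b F"
    unfolding qint_def wt_mass_Lb(3)[OF b, symmetric] by (rule nn_integral_add) measurable
  also have "\<dots> < \<infinity>" using f by simp
  finally show ?thesis .
qed

lemma kern_integrable:
  fixes F :: "complex ^ 'n \<Rightarrow> complex"
  assumes [measurable]: "F \<in> borel_measurable Lb" and b: "b > -1" and z: "z \<in> ball 0 1"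
    and f: "(\<integral>\<^sup>+w. ennreal (norm (F w) * hgt w powr b) \<partial>Lb) < \<infinity>"
  shows "integrable Lb (\<lambda>w. F w * kern b z w * of_real (hgt w powr b))"
proof (rule integrableI_bounded)
  have [measurable]: "(\<lambda>x. x) \<in> borel_measurable (Lb :: (complex ^ 'n) measure)" by (rule measurable_Lb_id)
  show "(\<lambda>w. F w * kern b z w * of_real (hgt w powr b)) \<in> borel_measurable Lb" by measurable
  define K where "K = (hgt z / 2) powr (- (real CARD('n) + 1 + b))"
  have "(\<integral>\<^sup>+w. ennreal (norm (F w * kern b z w * of_real (hgt w powr b))) \<partial>Lb) \<le>
    (\<integral>\<^sup>+w. ennreal K * ennreal (norm (F w) * hgt w powr b) \<partial>Lb)"
  proof (rule nn_integral_mono)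
    fix w :: "complex ^ 'n" assume "w \<in> space Lb"
    then have "norm (kern b z w) \<le> K" unfolding K_def using b by (intro kern_bound z) auto
    then have "norm (F w) * norm (kern b z w) * hgt w powr b \<le> norm (F w) * K * hgt w powr b"
      by (intro mult_right_mono mult_left_mono) auto
    then show "ennreal (norm (F w * kern b z w * of_real (hgt w powr b))) \<le> ennreal K * ennreal (norm (F w) * hgt w powr b)"
      by (simp add: norm_mult ennreal_mult[symmetric] K_def mult_ac ennreal_leI)
  qed
  also have "\<dots> = ennreal K * (\<integral>\<^sup>+w. ennreal (norm (F w) * hgt w powr b) \<partial>Lb)"
    by (rule nn_integral_cmult) measurable
  also have "\<dots> < \<infinity>" using f by (simp add: ennreal_mult_less_top)
  finally show "(\<integral>\<^sup>+w. ennreal (norm (F w * kern b z w * of_real (hgt w powr b))) \<partial>Lb) < \<infinity>" .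
qed

lemma Pj_measurable [measurable]:
  fixes F :: "complex ^ 'n \<Rightarrow> complex"
  assumes [measurable]: "F \<in> borel_measurable Lb"
  shows "Pj b F \<in> borel_measurable Lb"
proof -
  have "(\<lambda>z. LINT w|Lb. F w * kern b z w * of_real (hgt w powr b)) \<in> borel_measurable (Lb :: (complex ^ 'n) measure)"
    by (rule Lb.borel_measurable_lebesgue_integral) measurable
  then show ?thesis unfolding Pj_def by measurable
qed

text \<open>If f is not integrable the left side is the default value 0, so no hypothesis is
  required.\<close>

lemma ennreal_norm_integral_le:
  fixes f :: "'a \<Rightarrow> 'b::{banach, second_countable_topology}"
  shows "ennreal (norm (LINT x|M. f x)) \<le> (\<integral>\<^sup>+x. ennreal (norm (f x)) \<partial>M)"
  by (cases "integrable M f") (auto simp: integral_norm_bound_ennreal not_integrable_integral_eq)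

lemma Pj_bounded:
  assumes q: "q > 1" and \<beta>: "\<beta> > -1" and b: "b > -1" and qb: "q * (b + 1) > \<beta> + 1"
  shows "\<exists>C>0. \<forall>F \<in> borel_measurable (Lb :: (complex ^ 'n) measure). qint q \<beta> (Pj b F) \<le> ennreal C * qint q \<beta> F"
proof -
  define J where "J = wt_mass TYPE('n) b"
  have J: "J > 0" unfolding J_def by (rule wt_mass_pos[OF b])
  obtain C where C: "C > 0" and S: "\<And>h T. h \<in> borel_measurable (Lb :: (complex ^ 'n) measure) \<Longrightarrow> (\<forall>w\<in>ball 0 1. h w \<ge> 0) \<Longrightarrow>
    (\<forall>z\<in>ball 0 1. T z \<ge> 0 \<and> ennreal (T z) \<le>
      (\<integral>\<^sup>+w. ennreal (hgt z powr 0 * hgt w powr b * kdis z w powr (- (real CARD('n) + 1 + 0 + b + (\<beta> - \<beta>) / q)) * h w) \<partial>Lb)) \<Longrightarrow>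
    (\<integral>\<^sup>+z. ennreal (T z powr q * hgt z powr \<beta>) \<partial>Lb) \<le> ennreal C * (\<integral>\<^sup>+w. ennreal (h w powr q * hgt w powr \<beta>) \<partial>Lb)"
    using schur_test[OF q, of 0 \<beta> \<beta> b, where 'n='n] \<beta> qb by auto
  have "qint q \<beta> (Pj b F) \<le> ennreal (C * (1 / J) powr q) * qint q \<beta> F" if [measurable]: "F \<in> borel_measurable Lb" for F :: "complex ^ 'n \<Rightarrow> complex"
  proof -
    have [measurable]: "(\<lambda>x. x) \<in> borel_measurable (Lb :: (complex ^ 'n) measure)" by (rule measurable_Lb_id)
    have "qint q \<beta> (Pj b F) \<le> ennreal C * (\<integral>\<^sup>+w. ennreal ((norm (F w) / J) powr q * hgt w powr \<beta>) \<partial>Lb)"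
      unfolding qint_def
    proof (rule S)
      show "(\<lambda>w. norm (F w) / J) \<in> borel_measurable Lb" by measurable
      show "\<forall>w\<in>ball 0 1. 0 \<le> norm (F w) / J" using J by simp
      show "\<forall>z\<in>ball 0 1. norm (Pj b F z) \<ge> 0 \<and> ennreal (norm (Pj b F z)) \<le>
        (\<integral>\<^sup>+w. ennreal (hgt z powr 0 * hgt w powr b * kdis z w powr (- (real CARD('n) + 1 + 0 + b + (\<beta> - \<beta>) / q)) * (norm (F w) / J)) \<partial>Lb)"
      proof
        fix z :: "complex ^ 'n" assume z: "z \<in> ball 0 1"
        have "ennreal (norm (Pj b F z)) = ennreal (norm (LINT w|Lb. F w * kern b z w * of_real (hgt w powr b) / of_real J))"
          unfolding Pj_def J_def by simp
        also have "\<dots> \<le> (\<integral>\<^sup>+w. ennreal (norm (F w * kern b z w * of_real (hgt w powr b) / of_real J)) \<partial>Lb)"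
          by (rule ennreal_norm_integral_le)
        also have "\<dots> = (\<integral>\<^sup>+w. ennreal (hgt z powr 0 * hgt w powr b * kdis z w powr (- (real CARD('n) + 1 + 0 + b + (\<beta> - \<beta>) / q)) * (norm (F w) / J)) \<partial>Lb)"
        proof (rule nn_integral_cong)
          fix w :: "complex ^ 'n" assume "w \<in> space Lb"
          then have w: "w \<in> ball 0 1" by simp
          have "hgt z powr 0 = 1" using hgt_pos[OF z] by simp
          then show "ennreal (norm (F w * kern b z w * of_real (hgt w powr b) / of_real J)) =
            ennreal (hgt z powr 0 * hgt w powr b * kdis z w powr (- (real CARD('n) + 1 + 0 + b + (\<beta> - \<beta>) / q)) * (norm (F w) / J))"
            using J norm_kern[OF z w, of b] by (simp add: norm_mult norm_divide mult_ac)
        qed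
        finally show "norm (Pj b F z) \<ge> 0 \<and> ennreal (norm (Pj b F z)) \<le>
        (\<integral>\<^sup>+w. ennreal (hgt z powr 0 * hgt w powr b * kdis z w powr (- (real CARD('n) + 1 + 0 + b + (\<beta> - \<beta>) / q)) * (norm (F w) / J)) \<partial>Lb)"
          by simp
      qed
    qed
    also have "(\<integral>\<^sup>+w. ennreal ((norm (F w) / J) powr q * hgt w powr \<beta>) \<partial>Lb) = (\<integral>\<^sup>+w. ennreal ((1 / J) powr q) * ennreal (norm (F w) powr q * hgt w powr \<beta>) \<partial>Lb)"
      using J by (intro nn_integral_cong) (simp add: powr_divide ennreal_mult[symmetric])
    also have "\<dots> = ennreal ((1 / J) powr q) * qint q \<beta> F"
      unfolding qint_def by (rule nn_integral_cmult) measurable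
    finally show ?thesis using C by (simp add: ennreal_mult mult.assoc)
  qed
  then show ?thesis using C J by (intro exI[of _ "C * (1 / J) powr q"]) auto
qed

lemma Pj_reproducing:
  assumes "g \<in> H_infinity" "b > -1" "z \<in> ball 0 1"
  shows "Pj b g z = g z"
  using wt_mass_pos[OF assms(2), where 'n='a] by (simp add: Pj_def reproducing[OF assms])

text \<open>Fubini reduces the identity to the reproducing property of \<open>P\<^sub>b\<^sub>2\<close> on the bounded holomorphic
  functions \<open>w \<mapsto> K(w,u) G(w)\<close>.\<close>

lemma Pj_Pj_aux:
  fixes F G :: "complex ^ 'n \<Rightarrow> complex"
  assumes F[measurable]: "F \<in> borel_measurable Lb" and G: "G \<in> H_infinity" and b1: "b1 > -1" and b2: "b2 > -1"
    and x: "x \<in> ball 0 1" and K0: "K \<ge> 0"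
    and K: "\<And>u. u \<in> ball (0 :: complex ^ 'n) 1 \<Longrightarrow> (\<integral>\<^sup>+w. ennreal (hgt w powr b2 * kdis u w powr (- (real CARD('n) + 1 + b1))) \<partial>Lb) \<le> ennreal (K * hgt u powr m)"
    and fin: "(\<integral>\<^sup>+u. ennreal (norm (F u) * hgt u powr (b1 + m)) \<partial>Lb) < \<infinity>"
  shows "Pj b2 (\<lambda>w. Pj b1 F w * G w) x = Pj b1 F x * G x"
proof -
  have [measurable]: "(\<lambda>x. x) \<in> borel_measurable (Lb :: (complex ^ 'n) measure)" by (rule measurable_Lb_id)
  have [measurable]: "G \<in> borel_measurable Lb" by (rule H_infinity_measurable[OF G])
  define J1 where "J1 = wt_mass TYPE('n) b1"
  define J2 where "J2 = wt_mass TYPE('n) b2"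
  have J: "J1 > 0" "J2 > 0" unfolding J1_def J2_def using wt_mass_pos b1 b2 by auto
  obtain B where B: "\<forall>y\<in>G ` ball 0 1. norm y \<le> B" using G unfolding H_infinity_def bounded_iff by blast
  then have Bw: "norm (G w) \<le> B" if "w \<in> ball 0 1" for w using that by blast
  have B0: "B \<ge> 0" using order_trans[OF norm_ge_zero Bw[OF x]] .
  define L where "L = (hgt x / 2) powr (- (real CARD('n) + 1 + b2))"
  have Lw: "norm (kern b2 x w) \<le> L" if "w \<in> ball 0 1" for w
    unfolding L_def using b2 by (intro kern_bound x that) auto
  have L0: "L \<ge> 0" by (simp add: L_def)
  define \<Phi> where "\<Phi> w u = F u * kern b1 w u * of_real (hgt u powr b1) * (G w * kern b2 x w * of_real (hgt w powr b2))" for w u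
  have m\<Phi>[measurable]: "(\<lambda>(w, u). \<Phi> w u) \<in> borel_measurable (Lb \<Otimes>\<^sub>M Lb)" unfolding \<Phi>_def by measurable
  have int: "integrable (Lb \<Otimes>\<^sub>M Lb) (\<lambda>(w, u). \<Phi> w u)"
  proof (rule integrableI_bounded)
    have "(\<integral>\<^sup>+p. ennreal (norm (case p of (w, u) \<Rightarrow> \<Phi> w u)) \<partial>(Lb \<Otimes>\<^sub>M Lb)) = (\<integral>\<^sup>+w. \<integral>\<^sup>+u. ennreal (norm (\<Phi> w u)) \<partial>Lb \<partial>Lb)"
      by (subst Lb.nn_integral_fst[symmetric]) (auto simp: case_prod_unfold)
    also have "\<dots> = (\<integral>\<^sup>+u. \<integral>\<^sup>+w. ennreal (norm (\<Phi> w u)) \<partial>Lb \<partial>Lb)"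
      by (rule Lbp.Fubini') measurable
    also have "\<dots> \<le> (\<integral>\<^sup>+u. ennreal (B * L * K) * ennreal (norm (F u) * hgt u powr (b1 + m)) \<partial>Lb)"
    proof (rule nn_integral_mono)
      fix u :: "complex ^ 'n" assume "u \<in> space Lb"
      then have u: "u \<in> ball 0 1" by simp
      define c where "c = norm (F u) * hgt u powr b1 * (B * L)"
      have c: "c \<ge> 0" using B0 L0 by (simp add: c_def)
      have "(\<integral>\<^sup>+w. ennreal (norm (\<Phi> w u)) \<partial>Lb) \<le> (\<integral>\<^sup>+w. ennreal c * ennreal (hgt w powr b2 * kdis u w powr (- (real CARD('n) + 1 + b1))) \<partial>Lb)"
      proof (rule nn_integral_mono)
        fix w :: "complex ^ 'n" assume "w \<in> space Lb"
        then have w: "w \<in> ball 0 1" by simp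
        have "norm (\<Phi> w u) = (norm (F u) * hgt u powr b1) * (norm (G w) * norm (kern b2 x w)) * (hgt w powr b2 * norm (kern b1 w u))"
          by (simp add: \<Phi>_def norm_mult)
        also have "\<dots> \<le> (norm (F u) * hgt u powr b1) * (B * L) * (hgt w powr b2 * norm (kern b1 w u))"
          using B0 L0 by (intro mult_right_mono mult_left_mono mult_mono Bw Lw w) auto
        also have "\<dots> = c * (hgt w powr b2 * kdis u w powr (- (real CARD('n) + 1 + b1)))"
          unfolding norm_kern[OF w u] c_def kdis_sym[of w u] ..
        finally have "ennreal (norm (\<Phi> w u)) \<le> ennreal (c * (hgt w powr b2 * kdis u w powr (- (real CARD('n) + 1 + b1))))"
          by (rule ennreal_leI)
        then show "ennreal (norm (\<Phi> w u)) \<le> ennreal c * ennreal (hgt w powr b2 * kdis u w powr (- (real CARD('n) + 1 + b1)))"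
          using c by (simp add: ennreal_mult)
      qed
      also have "\<dots> = ennreal c * (\<integral>\<^sup>+w. ennreal (hgt w powr b2 * kdis u w powr (- (real CARD('n) + 1 + b1))) \<partial>Lb)"
        by (rule nn_integral_cmult) measurable
      also have "\<dots> \<le> ennreal c * ennreal (K * hgt u powr m)" by (rule mult_left_mono[OF K[OF u]]) simp
      also have "\<dots> = ennreal (c * (K * hgt u powr m))" using c K0 by (simp add: ennreal_mult)
      also have "c * (K * hgt u powr m) = (B * L * K) * (norm (F u) * hgt u powr (b1 + m))"
        by (simp add: c_def powr_add mult_ac)
      also have "ennreal \<dots> = ennreal (B * L * K) * ennreal (norm (F u) * hgt u powr (b1 + m))"
        using B0 L0 K0 by (simp add: ennreal_mult)
      finally show "(\<integral>\<^sup>+w. ennreal (norm (\<Phi> w u)) \<partial>Lb) \<le> ennreal (B * L * K) * ennreal (norm (F u) * hgt u powr (b1 + m))" .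
    qed
    also have "\<dots> = ennreal (B * L * K) * (\<integral>\<^sup>+u. ennreal (norm (F u) * hgt u powr (b1 + m)) \<partial>Lb)"
      by (rule nn_integral_cmult) measurable
    also have "\<dots> < \<infinity>" using fin by (simp add: ennreal_mult_less_top)
    finally show "(\<integral>\<^sup>+p. ennreal (norm (case p of (w, u) \<Rightarrow> \<Phi> w u)) \<partial>(Lb \<Otimes>\<^sub>M Lb)) < \<infinity>" .
  qed measurable
  have inner: "(LINT u|Lb. \<Phi> w u) = (LINT u|Lb. F u * kern b1 w u * of_real (hgt u powr b1)) * (G w * kern b2 x w * of_real (hgt w powr b2))" for w
    unfolding \<Phi>_def by (rule integral_mult_left_zero)
  have "Pj b2 (\<lambda>w. Pj b1 F w * G w) x = (LINT w|Lb. (LINT u|Lb. \<Phi> w u) / of_real J1) / of_real J2"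
    unfolding inner Pj_def J1_def J2_def by (simp add: mult_ac)
  also have "\<dots> = (LINT w|Lb. LINT u|Lb. \<Phi> w u) / of_real J1 / of_real J2" by simp
  also have "(LINT w|Lb. LINT u|Lb. \<Phi> w u) = (LINT u|Lb. LINT w|Lb. \<Phi> w u)"
    by (rule Lbp.Fubini_integral[symmetric, OF int])
  also have "\<dots> = (LINT u|Lb. F u * kern b1 x u * of_real (hgt u powr b1) * (of_real J2 * G x))"
  proof (rule Bochner_Integration.integral_cong[OF refl])
    fix u :: "complex ^ 'n" assume "u \<in> space Lb"
    then have u: "u \<in> ball 0 1" by simp
    have "(LINT w|Lb. \<Phi> w u) = (F u * of_real (hgt u powr b1)) * (LINT w|Lb. (kern b1 w u * G w) * kern b2 x w * of_real (hgt w powr b2))"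
      unfolding \<Phi>_def by (subst integral_mult_right_zero[symmetric]) (simp only: mult_ac)
    also have "(LINT w|Lb. (kern b1 w u * G w) * kern b2 x w * of_real (hgt w powr b2)) = of_real J2 * (kern b1 x u * G x)"
      unfolding J2_def by (rule reproducing[OF H_infinity_mult[OF kern_H_infinity[OF u] G] b2 x])
    finally show "(LINT w|Lb. \<Phi> w u) = F u * kern b1 x u * of_real (hgt u powr b1) * (of_real J2 * G x)"
      by (simp only: mult_ac)
  qed
  also have "\<dots> / of_real J1 / of_real J2 = Pj b1 F x * G x"
    unfolding Pj_def J1_def[symmetric] using J by simp
  finally show ?thesis .
qed

text \<open>For so large an exponent b2 the weight absorbs the whole singularity of the inner
  kernel, as kdis is at least half the height of w. The inner integral is then uniformly bounded (m
  = 0) and integrability of F for its own weight suffices.\<close>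

lemma Pj_Pj_large:
  fixes F G :: "complex ^ 'n \<Rightarrow> complex"
  assumes F: "F \<in> borel_measurable Lb" and G: "G \<in> H_infinity" and b1: "b1 > -1" and b2: "b2 \<ge> real CARD('n) + 1 + b1"
    and x: "x \<in> ball 0 1" and fin: "(\<integral>\<^sup>+u. ennreal (norm (F u) * hgt u powr b1) \<partial>Lb) < \<infinity>"
  shows "Pj b2 (\<lambda>w. Pj b1 F w * G w) x = Pj b1 F x * G x"
proof (rule Pj_Pj_aux[OF F G b1 _ x])
  define N where "N = real CARD('n) + 1 + b1"
  have N: "N > 0" using b1 by (simp add: N_def)
  show "b2 > -1" using b1 b2 by simp
  have m: "(\<lambda>x. x) \<in> borel_measurable (Lb :: (complex ^ 'n) measure)" by (rule measurable_Lb_id)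
  note [measurable] = m
  show "2 powr N * measure Lb (ball (0::complex ^ 'n) 1) \<ge> 0" by simp
  show "(\<integral>\<^sup>+w. ennreal (hgt w powr b2 * kdis u w powr (- (real CARD('n) + 1 + b1))) \<partial>Lb) \<le> ennreal (2 powr N * measure Lb (ball (0::complex ^ 'n) 1) * hgt u powr 0)"
    if u: "u \<in> ball 0 1" for u :: "complex ^ 'n"
  proof -
    have "(\<integral>\<^sup>+w. ennreal (hgt w powr b2 * kdis u w powr (- N)) \<partial>Lb) \<le> (\<integral>\<^sup>+w. ennreal (2 powr N) \<partial>(Lb :: (complex ^ 'n) measure))"
    proof (rule nn_integral_mono)
      fix w :: "complex ^ 'n" assume "w \<in> space Lb"
      then have w: "w \<in> ball 0 1" by simp
      have hw: "hgt w > 0" by (rule hgt_pos[OF w])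
      have "hgt w powr b2 * kdis u w powr (- N) \<le> hgt w powr N * (hgt w / 2) powr (- N)"
        using hgt_le_1[of w] hw hgt_le_kdis'[OF u w] b2 N
        by (intro mult_mono powr_mono' powr_mono2') (auto simp: N_def)
      also have "\<dots> = 2 powr N" using hw by (simp add: powr_divide powr_minus field_simps)
      finally show "ennreal (hgt w powr b2 * kdis u w powr (- N)) \<le> ennreal (2 powr N)" by (rule ennreal_leI)
    qed
    also have "\<dots> = ennreal (2 powr N * measure Lb (ball (0::complex ^ 'n) 1))"
      by (simp add: Lb.emeasure_eq_measure ennreal_mult)
    finally show ?thesis using hgt_pos[OF u] by (simp add: N_def)
  qed
  show "(\<integral>\<^sup>+u. ennreal (norm (F u) * hgt u powr (b1 + 0)) \<partial>Lb) < \<infinity>" using fin by simp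
qed

text \<open>In this order \<open>forelli_rudin\<close> costs the factor
  \<open>hgt u powr - (b1 - b2)\<close>, which turns the weight b1 into b2, and for the weight b2
  the function F is integrable.\<close>

lemma Pj_Pj_small:
  fixes F :: "complex ^ 'n \<Rightarrow> complex"
  assumes F: "F \<in> borel_measurable Lb" and b2: "b2 > -1" and b1: "b1 > b2"
    and x: "x \<in> ball 0 1" and fin: "(\<integral>\<^sup>+u. ennreal (norm (F u) * hgt u powr b2) \<partial>Lb) < \<infinity>"
  shows "Pj b2 (Pj b1 F) x = Pj b1 F x"
proof -
  obtain C where C: "C > 0" "\<And>z. z \<in> ball (0::complex ^ 'n) 1 \<Longrightarrow>
    (\<integral>\<^sup>+w. ennreal (hgt w powr b2 * kdis z w powr (- (real CARD('n) + 1 + b2 + (b1 - b2)))) \<partial>Lb) \<le> ennreal (C * hgt z powr (- (b1 - b2)))"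
    using forelli_rudin[of b2 "b1 - b2", where 'n='n] b1 b2 by auto
  have "Pj b2 (\<lambda>w. Pj b1 F w * 1) x = Pj b1 F x * 1"
  proof (rule Pj_Pj_aux[OF F H_infinity_const _ b2 x, where K=C and m="- (b1 - b2)"])
    show "(\<integral>\<^sup>+w. ennreal (hgt w powr b2 * kdis u w powr (- (real CARD('n) + 1 + b1))) \<partial>Lb) \<le> ennreal (C * hgt u powr (- (b1 - b2)))"
      if "u \<in> ball 0 1" for u :: "complex ^ 'n" using C(2)[OF that] by (simp add: add.assoc)
    show "(\<integral>\<^sup>+u. ennreal (norm (F u) * hgt u powr (b1 + - (b1 - b2))) \<partial>Lb) < \<infinity>" using fin by simp
  qed (use b1 b2 C in auto)
  then show ?thesis by simp
qed

text \<open>Reproduction is applied to g times \<open>kpow (- c) w z\<close>. The extra factor has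
  modulus \<open>hgt z powr - c\<close> at z and supplies additional decay away from z, so the
  resulting kernel has total mass bounded in z and Jensen's inequality passes to p-th powers. It
  plays the part of a sub-mean value inequality over Bergman balls.\<close>

lemma holomorphic_submean:
  assumes b: "b > -1" and c: "c > 0" and p: "p \<ge> 1"
  shows "\<exists>C>0. \<forall>g\<in>H_infinity. \<forall>z\<in>ball (0::complex ^ 'n) 1.
    ennreal (norm (g z) powr p) \<le> ennreal C *
      (\<integral>\<^sup>+w. ennreal (hgt z powr c * (hgt w powr b * kdis z w powr (- (real CARD('n) + 1 + b + c))) * norm (g w) powr p) \<partial>Lb)"
proof -
  define J where "J = wt_mass TYPE('n) b"
  have J: "J > 0" unfolding J_def by (rule wt_mass_pos[OF b])
  define \<kappa> where "\<kappa> = real CARD('n) + 1 + b + c"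
  obtain C where C: "C > 0" "\<And>z. z \<in> ball (0::complex ^ 'n) 1 \<Longrightarrow>
    (\<integral>\<^sup>+w. ennreal (hgt w powr b * kdis z w powr (- \<kappa>)) \<partial>Lb) \<le> ennreal (C * hgt z powr (- c))"
    using forelli_rudin[OF b c, where 'n='n] unfolding \<kappa>_def by auto
  have m: "(\<lambda>x. x) \<in> borel_measurable (Lb :: (complex ^ 'n) measure)" by (rule measurable_Lb_id)
  note [measurable] = m
  have "ennreal (norm (g z) powr p) \<le> ennreal ((C / J) powr (p - 1) / J) *
      (\<integral>\<^sup>+w. ennreal (hgt z powr c * (hgt w powr b * kdis z w powr (- \<kappa>)) * norm (g w) powr p) \<partial>Lb)"
    if g: "g \<in> H_infinity" and z: "z \<in> ball 0 1" for g and z :: "complex ^ 'n"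
  proof -
    have [measurable]: "g \<in> borel_measurable Lb" by (rule H_infinity_measurable[OF g])
    have hz: "hgt z > 0" by (rule hgt_pos[OF z])
    define k where "k w = hgt z powr c * (hgt w powr b * kdis z w powr (- \<kappa>)) / J" for w
    have kz: "kpow (- c) z z = of_real (hgt z powr (- c))"
    proof -
      have "1 - herm z z = of_real (hgt z)" by (simp add: herm_self hgt_def)
      then show ?thesis using hz by (simp add: kpow_def powr_of_real[symmetric])
    qed
    define I where "I = (LINT w|Lb. (g w * kpow (- c) w z) * kern b z w * of_real (hgt w powr b))"
    have "I = of_real J * (g z * kpow (- c) z z)"
      unfolding I_def J_def by (rule reproducing[OF H_infinity_mult[OF g kpow_H_infinity[OF z]] b z])
    then have "g z = of_real (hgt z powr c / J) * I"
      using J hz by (simp add: kz powr_minus field_simps)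
    then have gz: "g z = (LINT w|Lb. of_real (hgt z powr c / J) * ((g w * kpow (- c) w z) * kern b z w * of_real (hgt w powr b)))"
      unfolding I_def by (simp only: integral_mult_right_zero)
    have T: "ennreal (norm (g z)) \<le> (\<integral>\<^sup>+w. ennreal (k w * norm (g w)) \<partial>Lb)"
    proof -
      have "ennreal (norm (g z)) \<le> (\<integral>\<^sup>+w. ennreal (norm (of_real (hgt z powr c / J) * ((g w * kpow (- c) w z) * kern b z w * of_real (hgt w powr b)))) \<partial>Lb)"
        by (subst gz) (rule ennreal_norm_integral_le)
      also have "\<dots> = (\<integral>\<^sup>+w. ennreal (k w * norm (g w)) \<partial>Lb)"
      proof (rule nn_integral_cong)
        fix w :: "complex ^ 'n" assume "w \<in> space Lb"
        then have w: "w \<in> ball 0 1" by simp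
        have "kdis z w powr (- \<kappa>) = kdis w z powr (- c) * kdis z w powr (- (real CARD('n) + 1 + b))"
          unfolding kdis_sym[of w z] by (simp add: \<kappa>_def powr_add[symmetric])
        then show "ennreal (norm (of_real (hgt z powr c / J) * ((g w * kpow (- c) w z) * kern b z w * of_real (hgt w powr b)))) = ennreal (k w * norm (g w))"
          using J unfolding norm_mult norm_kern[OF z w] norm_kpow[OF w z] k_def by (simp add: norm_divide mult_ac)
      qed
      finally show ?thesis .
    qed
    have kA: "(\<integral>\<^sup>+w. ennreal (k w) \<partial>Lb) \<le> ennreal (C / J)"
    proof -
      have "(\<integral>\<^sup>+w. ennreal (k w) \<partial>Lb) = ennreal (hgt z powr c / J) * (\<integral>\<^sup>+w. ennreal (hgt w powr b * kdis z w powr (- \<kappa>)) \<partial>Lb)"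
        unfolding k_def using J by (subst nn_integral_cmult[symmetric]) (auto simp: ennreal_mult[symmetric] intro!: nn_integral_cong)
      also have "\<dots> \<le> ennreal (hgt z powr c / J) * ennreal (C * hgt z powr (- c))" by (intro mult_left_mono C z) simp
      also have "\<dots> = ennreal (hgt z powr c / J * (C * hgt z powr (- c)))"
        by (rule ennreal_mult[symmetric]) (use C J in auto)
      also have "hgt z powr c / J * (C * hgt z powr (- c)) = C / J" using hz by (simp add: powr_minus field_simps)
      finally show ?thesis .
    qed
    have "ennreal (norm (g z) powr p) \<le> ennreal ((C / J) powr (p - 1)) * (\<integral>\<^sup>+w. ennreal (k w * norm (g w) powr p) \<partial>Lb)"
      by (rule jensen_nn_integral[OF _ _ _ _ p _ kA _ T]) (use C J in \<open>auto simp: k_def\<close>)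
    also have "(\<integral>\<^sup>+w. ennreal (k w * norm (g w) powr p) \<partial>Lb) = ennreal (1 / J) *
       (\<integral>\<^sup>+w. ennreal (hgt z powr c * (hgt w powr b * kdis z w powr (- \<kappa>)) * norm (g w) powr p) \<partial>Lb)"
      unfolding k_def using J by (subst nn_integral_cmult[symmetric]) (auto simp: ennreal_mult[symmetric] intro!: nn_integral_cong)
    finally show ?thesis using J by (simp add: mult.assoc[symmetric] ennreal_mult[symmetric])
  qed
  then show ?thesis unfolding \<kappa>_def using C J by (intro exI[of _ "(C / J) powr (p - 1) / J"]) auto
qed

text \<open>The averaging inequality with weight \<alpha> and c = N, its kernel being replaced by
  its maximum through kdis \<ge> hgt z / 2.\<close>

lemma holomorphic_pointwise:
  assumes \<alpha>: "\<alpha> > -1" and p: "p \<ge> 1"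
  shows "\<exists>C>0. \<forall>g\<in>H_infinity. \<forall>z\<in>ball (0::complex ^ 'n) 1.
    ennreal (norm (g z) powr p) \<le> ennreal (C * hgt z powr (- (real CARD('n) + 1 + \<alpha>))) * qint p \<alpha> g"
proof -
  define N where "N = real CARD('n) + 1 + \<alpha>"
  have N: "N > 0" using \<alpha> by (simp add: N_def)
  obtain C where C: "C > 0" "\<And>g z. g \<in> H_infinity \<Longrightarrow> z \<in> ball (0::complex ^ 'n) 1 \<Longrightarrow>
    ennreal (norm (g z) powr p) \<le> ennreal C *
      (\<integral>\<^sup>+w. ennreal (hgt z powr N * (hgt w powr \<alpha> * kdis z w powr (- (N + N))) * norm (g w) powr p) \<partial>Lb)"
    using holomorphic_submean[OF \<alpha> N p, where 'n='n] unfolding N_def by auto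
  have m: "(\<lambda>x. x) \<in> borel_measurable (Lb :: (complex ^ 'n) measure)" by (rule measurable_Lb_id)
  note [measurable] = m
  have "ennreal (norm (g z) powr p) \<le> ennreal (C * 2 powr (2 * N) * hgt z powr (- N)) * qint p \<alpha> g"
    if g: "g \<in> H_infinity" and z: "z \<in> ball 0 1" for g and z :: "complex ^ 'n"
  proof -
    have [measurable]: "g \<in> borel_measurable Lb" by (rule H_infinity_measurable[OF g])
    have hz: "hgt z > 0" by (rule hgt_pos[OF z])
    have "(\<integral>\<^sup>+w. ennreal (hgt z powr N * (hgt w powr \<alpha> * kdis z w powr (- (N + N))) * norm (g w) powr p) \<partial>Lb)
      \<le> (\<integral>\<^sup>+w. ennreal (2 powr (2 * N) * hgt z powr (- N)) * ennreal (norm (g w) powr p * hgt w powr \<alpha>) \<partial>Lb)"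
    proof (rule nn_integral_mono)
      fix w :: "complex ^ 'n" assume "w \<in> space Lb"
      then have w: "w \<in> ball 0 1" by simp
      have "kdis z w powr (- (N + N)) \<le> (hgt z / 2) powr (- (N + N))"
        using hz hgt_le_kdis[OF z w] N by (intro powr_mono2') auto
      also have "\<dots> = 2 powr (2 * N) * hgt z powr (- (N + N))" using hz by (simp add: powr_divide powr_minus field_simps)
      finally have "hgt z powr N * kdis z w powr (- (N + N)) \<le> hgt z powr N * (2 powr (2 * N) * hgt z powr (- (N + N)))"
        by (intro mult_left_mono) auto
      also have "\<dots> = 2 powr (2 * N) * hgt z powr (- N)" by (simp add: mult.left_commute powr_add[symmetric])
      finally have "hgt z powr N * kdis z w powr (- (N + N)) * (norm (g w) powr p * hgt w powr \<alpha>) \<le> 2 powr (2 * N) * hgt z powr (- N) * (norm (g w) powr p * hgt w powr \<alpha>)"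
        by (intro mult_right_mono) auto
      then show "ennreal (hgt z powr N * (hgt w powr \<alpha> * kdis z w powr (- (N + N))) * norm (g w) powr p) \<le> ennreal (2 powr (2 * N) * hgt z powr (- N)) * ennreal (norm (g w) powr p * hgt w powr \<alpha>)"
        by (simp add: ennreal_mult[symmetric] mult_ac ennreal_leI)
    qed
    also have "\<dots> = ennreal (2 powr (2 * N) * hgt z powr (- N)) * qint p \<alpha> g"
      unfolding qint_def by (rule nn_integral_cmult) measurable
    finally have "ennreal C * (\<integral>\<^sup>+w. ennreal (hgt z powr N * (hgt w powr \<alpha> * kdis z w powr (- (N + N))) * norm (g w) powr p) \<partial>Lb)
      \<le> ennreal C * (ennreal (2 powr (2 * N) * hgt z powr (- N)) * qint p \<alpha> g)" by (intro mult_left_mono) auto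
    then show ?thesis using C(2)[OF g z] C(1) by (simp add: ennreal_mult mult_ac)
  qed
  then show ?thesis unfolding N_def[symmetric] using C by (intro exI[of _ "C * 2 powr (2 * N)"]) auto
qed

section \<open>Necessity\<close>

lemma cnj_measurable [measurable]:
  assumes [measurable]: "f \<in> borel_measurable M"
  shows "(\<lambda>x. cnj (f x)) \<in> borel_measurable M"
  by (rule measurable_compose[OF assms borel_measurable_continuous_onI]) (intro continuous_intros)

definition Hk :: "real \<Rightarrow> (complex ^ 'n \<Rightarrow> complex) \<Rightarrow> (complex ^ 'n \<Rightarrow> complex) \<Rightarrow> complex ^ 'n \<Rightarrow> complex" where
  "Hk b f g z = f z * g z - Pj b (\<lambda>w. f w * g w) z"

lemma qint_mult_bounded:
  fixes f g :: "complex ^ 'n \<Rightarrow> complex"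
  assumes [measurable]: "f \<in> borel_measurable Lb" and g: "\<And>w. w \<in> ball 0 1 \<Longrightarrow> norm (g w) \<le> B" and q: "q \<ge> 0"
    and f: "qint q b f < \<infinity>"
  shows "qint q b (\<lambda>w. f w * g w) < \<infinity>"
proof -
  have [measurable]: "(\<lambda>x. x) \<in> borel_measurable (Lb :: (complex ^ 'n) measure)" by (rule measurable_Lb_id)
  have "qint q b (\<lambda>w. f w * g w) \<le> (\<integral>\<^sup>+w. ennreal (B powr q) * ennreal (norm (f w) powr q * hgt w powr b) \<partial>Lb)"
    unfolding qint_def
  proof (rule nn_integral_mono)
    fix w :: "complex ^ 'n" assume "w \<in> space Lb"
    then have "norm (g w) powr q \<le> B powr q" using g q by (intro powr_mono2) auto
    then have "norm (f w) powr q * norm (g w) powr q * hgt w powr b \<le> norm (f w) powr q * B powr q * hgt w powr b"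
      by (intro mult_right_mono mult_left_mono) auto
    then show "ennreal (norm (f w * g w) powr q * hgt w powr b) \<le> ennreal (B powr q) * ennreal (norm (f w) powr q * hgt w powr b)"
      by (simp add: norm_mult powr_mult ennreal_mult[symmetric] mult_ac ennreal_leI)
  qed
  also have "\<dots> = ennreal (B powr q) * qint q b f" unfolding qint_def by (rule nn_integral_cmult) measurable
  also have "\<dots> < \<infinity>" using f by (simp add: ennreal_mult_less_top)
  finally show ?thesis .
qed

lemma H_infinity_bound:
  assumes "g \<in> H_infinity" obtains B where "\<And>w. w \<in> ball 0 1 \<Longrightarrow> norm (g w) \<le> B"
proof -
  obtain B where "\<forall>y\<in>g ` ball 0 1. norm y \<le> B" using assms unfolding H_infinity_def bounded_iff by blast
  then show thesis using that by blast
qed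

lemma qint_H_infinity_finite:
  fixes g :: "complex ^ 'n \<Rightarrow> complex"
  assumes g: "g \<in> H_infinity" and b: "b > -1" and q: "q > 0"
  shows "qint q b g < \<infinity>"
proof -
  obtain B where B: "\<And>w. w \<in> ball 0 1 \<Longrightarrow> norm (g w) \<le> B" using H_infinity_bound[OF g] by blast
  have "qint q b (\<lambda>w :: complex ^ 'n. 1 * g w) < \<infinity>"
  proof (rule qint_mult_bounded[OF _ B])
    have "qint q b (\<lambda>w :: complex ^ 'n. 1) = ennreal (wt_mass TYPE('n) b)"
      unfolding qint_def using wt_mass_Lb(3)[OF b] by simp
    then show "qint q b (\<lambda>w :: complex ^ 'n. 1) < \<infinity>" by simp
  qed (use q in auto)
  then show ?thesis by simp
qed

lemma kern_integrable_qint: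
  fixes F :: "complex ^ 'n \<Rightarrow> complex"
  assumes F: "F \<in> borel_measurable Lb" and q: "q \<ge> 1" and \<beta>: "\<beta> > -1" and b: "b \<ge> \<beta>" and z: "z \<in> ball 0 1"
    and f: "qint q \<beta> F < \<infinity>"
  shows "integrable Lb (\<lambda>w. F w * kern b z w * of_real (hgt w powr b))"
    and "(\<integral>\<^sup>+w. ennreal (norm (F w) * hgt w powr b) \<partial>Lb) < \<infinity>"
proof -
  have "(\<integral>\<^sup>+w. ennreal (norm (F w) * hgt w powr b) \<partial>Lb) \<le> (\<integral>\<^sup>+w. ennreal (norm (F w) * hgt w powr \<beta>) \<partial>Lb)"
    using hgt_pos hgt_le_1 b by (intro nn_integral_mono ennreal_leI mult_left_mono powr_mono') (auto simp: less_imp_le)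
  also have "\<dots> < \<infinity>" by (rule qint_finite_imp_L1[OF F q \<beta> f])
  finally show fin: "(\<integral>\<^sup>+w. ennreal (norm (F w) * hgt w powr b) \<partial>Lb) < \<infinity>" .
  show "integrable Lb (\<lambda>w. F w * kern b z w * of_real (hgt w powr b))"
    by (rule kern_integrable[OF F _ z fin]) (use b \<beta> in simp)
qed

lemma Pj_diff:
  fixes F G :: "complex ^ 'n \<Rightarrow> complex"
  assumes "F \<in> borel_measurable Lb" "G \<in> borel_measurable Lb" and q: "q \<ge> 1" and \<beta>: "\<beta> > -1" and b: "b \<ge> \<beta>" and z: "z \<in> ball 0 1"
    and "qint q \<beta> F < \<infinity>" "qint q \<beta> G < \<infinity>"
  shows "Pj b (\<lambda>w. F w - G w) z = Pj b F z - Pj b G z"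
  unfolding Pj_def using kern_integrable_qint(1)[OF assms(1) q \<beta> b z assms(7)] kern_integrable_qint(1)[OF assms(2) q \<beta> b z assms(8)]
  by (simp add: left_diff_distrib diff_divide_distrib)

lemma Pj_cong: "(\<And>w. w \<in> ball 0 1 \<Longrightarrow> F w = G w) \<Longrightarrow> Pj b F z = Pj b G z"
  unfolding Pj_def by (intro arg_cong2[where f="(/)"] Bochner_Integration.integral_cong refl) auto

text \<open>If \<open>f k - P (f k)\<close> and \<open>cnj f k - P (cnj f k)\<close> are small for a kernel function \<open>k\<close>
  at \<open>a\<close>, then \<open>f k\<close> is close to a constant multiple of \<open>k\<close>: the projection \<open>P\<^sub>b\<close> maps
  \<open>cnj h k\<close> to \<open>cnj (h a) k\<close> for holomorphic \<open>h\<close>.\<close>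

lemma kernel_test_estimate:
  fixes f :: "complex ^ 'n \<Rightarrow> complex"
  assumes q: "q > 1" and \<beta>: "\<beta> > -1" and b: "b \<ge> real CARD('n) + 1 + \<beta>"
  shows "\<exists>C>0. \<forall>f\<in>borel_measurable (Lb :: (complex ^ 'n) measure). qint q \<beta> f < \<infinity> \<longrightarrow>
    (\<forall>a\<in>ball 0 1. \<exists>c. qint q \<beta> (\<lambda>z. (f z - c) * kern b z a) \<le>
      ennreal C * (qint q \<beta> (Hk \<beta> f (\<lambda>w. kern b w a)) + qint q \<beta> (Hk \<beta> (\<lambda>z. cnj (f z)) (\<lambda>w. kern b w a))))"
proof -
  have bb: "b > \<beta>" "b > -1" using b \<beta> by auto
  have qb: "q * (b + 1) > \<beta> + 1"
  proof -
    have "\<beta> + 1 < 1 * (b + 1)" using bb by simp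
    also have "\<dots> < q * (b + 1)" using q bb by (intro mult_strict_right_mono) auto
    finally show ?thesis .
  qed
  obtain Cb where Cb: "Cb > 0" "\<And>F. F \<in> borel_measurable (Lb :: (complex ^ 'n) measure) \<Longrightarrow> qint q \<beta> (Pj b F) \<le> ennreal Cb * qint q \<beta> F"
    using Pj_bounded[OF q \<beta> bb(2) qb, where 'n='n] by blast
  have q\<beta>: "q * (\<beta> + 1) > \<beta> + 1"
    using mult_strict_right_mono[OF q, of "\<beta> + 1"] \<beta> by simp
  obtain C\<beta> where C\<beta>: "C\<beta> > 0" "\<And>F. F \<in> borel_measurable (Lb :: (complex ^ 'n) measure) \<Longrightarrow> qint q \<beta> (Pj \<beta> F) \<le> ennreal C\<beta> * qint q \<beta> F"
    using Pj_bounded[OF q \<beta> \<beta> q\<beta>, where 'n='n] by blast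
  define C where "C = 2 powr q * (1 + 2 powr q * Cb)"
  have Cpos: "C > 0" using Cb unfolding C_def by (intro mult_pos_pos add_pos_pos) auto
  have "\<exists>c. qint q \<beta> (\<lambda>z. (f z - c) * kern b z a) \<le>
      ennreal C * (qint q \<beta> (Hk \<beta> f (\<lambda>w. kern b w a)) + qint q \<beta> (Hk \<beta> (\<lambda>z. cnj (f z)) (\<lambda>w. kern b w a)))"
    if fm[measurable]: "f \<in> borel_measurable (Lb :: (complex ^ 'n) measure)" and ff: "qint q \<beta> f < \<infinity>" and a: "a \<in> ball 0 1" for f a
  proof -
    have [measurable]: "(\<lambda>x. x) \<in> borel_measurable (Lb :: (complex ^ 'n) measure)" by (rule measurable_Lb_id)
    define k where "k w = kern b w a" for w :: "complex ^ 'n"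
    define N where "N = real CARD('n) + 1 + b"
    have kH: "k \<in> H_infinity" unfolding k_def by (rule kern_H_infinity[OF a])
    have km[measurable]: "k \<in> borel_measurable Lb" by (rule H_infinity_measurable[OF kH])
    obtain Bk where Bk: "\<And>w. w \<in> ball 0 1 \<Longrightarrow> norm (k w) \<le> Bk" using H_infinity_bound[OF kH] by blast
    have kinv: "k w * kpow N w a = 1" if w: "w \<in> ball 0 1" for w
    proof -
      have "1 - herm w a \<noteq> 0" using kdis_pos[OF w a] by (auto simp: kdis_def)
      then show ?thesis unfolding k_def kern_kpow[OF w a] N_def kpow_def by (simp add: powr_add[symmetric])
    qed
    have k0: "k w \<noteq> 0" if "w \<in> ball 0 1" for w using kinv[OF that] by auto
    define F1 where "F1 w = f w * k w" for w
    define F2 where "F2 w = cnj (f w) * k w" for w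
    have [measurable]: "F1 \<in> borel_measurable Lb" "F2 \<in> borel_measurable Lb"
      unfolding F1_def F2_def by measurable
    have f1: "qint q \<beta> F1 < \<infinity>" unfolding F1_def using q by (intro qint_mult_bounded[OF fm Bk _ ff]) auto
    have f2: "qint q \<beta> F2 < \<infinity>"
    proof -
      have "qint q \<beta> F2 = qint q \<beta> F1" by (rule qint_cong) (simp add: F1_def F2_def norm_mult)
      then show ?thesis using f1 by simp
    qed
    have pf1: "qint q \<beta> (Pj \<beta> F1) < \<infinity>" and pf2: "qint q \<beta> (Pj \<beta> F2) < \<infinity>"
      using C\<beta>(2)[of F1] C\<beta>(2)[of F2] f1 f2
      by (auto intro!: order_le_less_trans[OF C\<beta>(2)] simp: ennreal_mult_less_top)
    define E1 where "E1 w = F1 w - Pj \<beta> F1 w" for w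
    define E2 where "E2 w = F2 w - Pj \<beta> F2 w" for w
    \<comment> \<open>Conjugating \<open>E2\<close> alone would produce f times the conjugate of k.
      The unimodular factor restores k, so \<open>E1\<close> and \<open>E3\<close> both have the
      form f k minus a correction, with moduli unchanged.\<close>
    define E3 where "E3 w = cnj (E2 w) * (k w / cnj (k w))" for w
    have [measurable]: "E1 \<in> borel_measurable Lb" "E2 \<in> borel_measurable Lb" "E3 \<in> borel_measurable Lb"
      unfolding E1_def E2_def E3_def by measurable
    define V where "V w = cnj (Pj \<beta> F2 w) * (k w / cnj (k w))" for w
    have [measurable]: "V \<in> borel_measurable Lb" unfolding V_def by measurable
    have nV: "qint q \<beta> V = qint q \<beta> (Pj \<beta> F2)"
      by (rule qint_cong) (use k0 in \<open>simp add: V_def norm_mult norm_divide\<close>)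
    have nE3: "qint q \<beta> E3 = qint q \<beta> E2"
      by (rule qint_cong) (use k0 in \<open>simp add: E3_def norm_mult norm_divide\<close>)
    have E3V: "E3 w = F1 w - V w" if "w \<in> ball 0 1" for w
      using k0[OF that] by (simp add: E3_def E2_def F1_def F2_def V_def field_simps)
    \<comment> \<open>As \<open>kpow N w a\<close> is the reciprocal of k, this is the conjugate at
      a of the holomorphic function h for which \<open>V\<close> equals cnj h times k.\<close>
    define c where "c = cnj (Pj \<beta> F2 a * kpow N a a)"
    have PV: "Pj b V x = c * k x" if x: "x \<in> ball 0 1" for x
    proof -
      \<comment> \<open>The choice makes \<open>Pj b V x\<close> the conjugate of a projection
        evaluated at a: conjugation exchanges the kernels at x and at a, and division by k removes
        the conjugate of k from V.\<close>
      define G where "G w = kpow N w a * kern b w x" for w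
      have GH: "G \<in> H_infinity" unfolding G_def by (intro H_infinity_mult kpow_H_infinity kern_H_infinity a x)
      have "Pj b (\<lambda>w. Pj \<beta> F2 w * G w) a = Pj \<beta> F2 a * G a"
        by (rule Pj_Pj_large[OF _ GH \<beta> b a qint_finite_imp_L1[OF _ _ \<beta> f2]]) (use q in auto)
      then have "cnj (Pj b (\<lambda>w. Pj \<beta> F2 w * G w) a) = cnj (Pj \<beta> F2 a * G a)" by simp
      moreover have "cnj (Pj \<beta> F2 a * G a) = c * k x"
        unfolding G_def c_def k_def using cnj_kern[OF a x, of b] by simp
      moreover have "cnj (Pj b (\<lambda>w. Pj \<beta> F2 w * G w) a) = Pj b V x"
      proof -
        have "cnj (Pj b (\<lambda>w. Pj \<beta> F2 w * G w) a) = (LINT w|Lb. cnj (Pj \<beta> F2 w * G w * kern b a w * of_real (hgt w powr b))) / of_real (wt_mass TYPE('n) b)"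
          unfolding Pj_def[of b "\<lambda>w. Pj \<beta> F2 w * G w"]
          by (simp only: complex_cnj_divide complex_cnj_complex_of_real Bochner_Integration.integral_cnj)
        also have "(LINT w|Lb. cnj (Pj \<beta> F2 w * G w * kern b a w * of_real (hgt w powr b))) = (LINT w|Lb. V w * kern b x w * of_real (hgt w powr b))"
        proof (rule Bochner_Integration.integral_cong[OF refl])
          fix w :: "complex ^ 'n" assume "w \<in> space Lb"
          then have w: "w \<in> ball 0 1" by simp
          have e: "cnj (kpow N w a) = 1 / cnj (k w)"
            using kinv[OF w] k0[OF w] by (metis complex_cnj_mult complex_cnj_one complex_cnj_zero_iff nonzero_eq_divide_eq mult.commute)
          show "cnj (Pj \<beta> F2 w * G w * kern b a w * of_real (hgt w powr b)) = V w * kern b x w * of_real (hgt w powr b)"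
            unfolding V_def G_def complex_cnj_mult cnj_kern[OF w x] cnj_kern[OF a w] e k_def by (simp add: mult_ac)
        qed
        finally show ?thesis unfolding Pj_def[of b V] .
      qed
      ultimately show ?thesis by simp
    qed
    have PE1: "Pj b E1 x = Pj b F1 x - Pj \<beta> F1 x" if x: "x \<in> ball 0 1" for x
    proof -
      have "Pj b E1 x = Pj b F1 x - Pj b (Pj \<beta> F1) x"
        unfolding E1_def by (rule Pj_diff[OF _ _ _ \<beta> _ x f1 pf1]) (use q bb in auto)
      also have "Pj b (Pj \<beta> F1) x = Pj b (\<lambda>w. Pj \<beta> F1 w * 1) x" by simp
      also have "\<dots> = Pj \<beta> F1 x * 1"
        by (rule Pj_Pj_large[OF _ H_infinity_const \<beta> b x qint_finite_imp_L1[OF _ _ \<beta> f1]]) (use q in auto)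
      finally show ?thesis by simp
    qed
    have PE3: "Pj b E3 x = Pj b F1 x - c * k x" if x: "x \<in> ball 0 1" for x
    proof -
      have "Pj b E3 x = Pj b (\<lambda>w. F1 w - V w) x" by (rule Pj_cong) (rule E3V)
      also have "\<dots> = Pj b F1 x - Pj b V x"
        by (rule Pj_diff[OF _ _ _ \<beta> _ x f1]) (use q bb nV pf2 in auto)
      finally show ?thesis unfolding PV[OF x] .
    qed
    \<comment> \<open>The projection \<open>Pj b F1\<close>, over which there is no control, occurs
      in both \<open>PE1\<close> and \<open>PE3\<close> and cancels in their difference.\<close>
    have key: "(f x - c) * k x = E1 x + (Pj b E3 x - Pj b E1 x)" if "x \<in> ball 0 1" for x
      unfolding PE1[OF that] PE3[OF that] by (simp add: E1_def F1_def algebra_simps)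
    have "qint q \<beta> (\<lambda>x. Pj b E3 x - Pj b E1 x) \<le> ennreal (2 powr q) * (qint q \<beta> (Pj b E3) + qint q \<beta> (Pj b E1))"
      by (rule qint_add) (use q in \<open>auto intro: norm_triangle_ineq4\<close>)
    also have "\<dots> \<le> ennreal (2 powr q) * (ennreal Cb * qint q \<beta> E2 + ennreal Cb * qint q \<beta> E1)"
      unfolding nE3[symmetric] by (intro mult_left_mono add_mono Cb) auto
    also have "\<dots> = ennreal (2 powr q * Cb) * (qint q \<beta> E1 + qint q \<beta> E2)"
      using Cb by (simp add: ennreal_mult distrib_left add.commute mult_ac)
    finally have d: "qint q \<beta> (\<lambda>x. Pj b E3 x - Pj b E1 x) \<le> ennreal (2 powr q * Cb) * (qint q \<beta> E1 + qint q \<beta> E2)" .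
    have "qint q \<beta> (\<lambda>z. (f z - c) * k z) \<le> ennreal (2 powr q) * (qint q \<beta> E1 + qint q \<beta> (\<lambda>x. Pj b E3 x - Pj b E1 x))"
      by (rule qint_add) (use q in \<open>auto simp: key intro: norm_triangle_ineq\<close>)
    also have "\<dots> \<le> ennreal (2 powr q) * ((qint q \<beta> E1 + qint q \<beta> E2) + ennreal (2 powr q * Cb) * (qint q \<beta> E1 + qint q \<beta> E2))"
      by (intro mult_left_mono add_mono d) auto
    also have "\<dots> = ennreal C * (qint q \<beta> E1 + qint q \<beta> E2)"
    proof -
      have "ennreal C = ennreal (2 powr q) * (1 + ennreal (2 powr q * Cb))"
        using Cb by (simp add: C_def ennreal_mult)
      then show ?thesis by (simp add: distrib_left distrib_right mult.assoc)
    qed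
    finally have "qint q \<beta> (\<lambda>z. (f z - c) * k z) \<le> ennreal C * (qint q \<beta> E1 + qint q \<beta> E2)" .
    moreover have "E1 = Hk \<beta> f k" "E2 = Hk \<beta> (\<lambda>z. cnj (f z)) k"
      by (simp_all add: fun_eq_iff E1_def E2_def Hk_def F1_def[abs_def] F2_def[abs_def])
    ultimately show ?thesis unfolding k_def[abs_def] by (intro exI[of _ c]) simp
  qed
  then show ?thesis using Cpos by (intro exI[of _ C]) auto
qed

text \<open>With the kernel at a as test function, \<open>forelli_rudin\<close> gives its norm in
  the Bergman space, and on the Bergman ball its modulus is bounded below by a constant multiple of
  \<open>hgt a powr - N\<close>. All powers depending on the test exponent cancel in the
  result.\<close>

lemma necessity:
  fixes f :: "complex ^ 'n \<Rightarrow> complex"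
  assumes p: "1 < p" "p \<le> q" and \<alpha>: "\<alpha> > -1" and \<beta>: "\<beta> > -1" and R: "R > 1"
    and fm: "f \<in> borel_measurable Lb" and ff: "qint q \<beta> f < \<infinity>"
    and C1: "C1 \<ge> 0" and H1: "\<And>g. g \<in> H_infinity \<Longrightarrow> qint q \<beta> (Hk \<beta> f g) \<le> ennreal (C1 * enn2real (qint p \<alpha> g) powr (q / p))"
    and H2: "\<And>g. g \<in> H_infinity \<Longrightarrow> qint q \<beta> (Hk \<beta> (\<lambda>z. cnj (f z)) g) \<le> ennreal (C1 * enn2real (qint p \<alpha> g) powr (q / p))"
  shows "\<exists>C\<ge>0. \<forall>a\<in>ball 0 1. \<exists>c. (\<integral>\<^sup>+z. ennreal (indicator (bset R a) z * norm (f z - c) powr q) \<partial>Lb)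
     \<le> ennreal (C * hgt a powr (q * (real CARD('n) + 1 + \<alpha>) / p - \<beta>))"
proof -
  define A where "A = real CARD('n) + 1 + \<alpha>"
  \<comment> \<open>Large enough for \<open>kernel_test_estimate\<close>, and the added A makes N
    exceed A, hence p N > A as needed for the norm of the test function.\<close>
  define b where "b = real CARD('n) + 1 + \<beta> + A"
  define N where "N = real CARD('n) + 1 + b"
  have A: "A > 0" using \<alpha> by (simp add: A_def)
  have q: "q > 1" using p by simp
  have b: "b \<ge> real CARD('n) + 1 + \<beta>" using A by (simp add: b_def)
  have NA: "N > A" using \<beta> A by (simp add: N_def b_def)
  then have N: "N > 0" using A by simp
  have "1 * N \<le> p * N" using N p by (intro mult_right_mono) auto
  then have pN: "p * N > A" using NA by linarith
  obtain C where C: "C > 0" "\<And>a. a \<in> ball 0 1 \<Longrightarrow> \<exists>c. qint q \<beta> (\<lambda>z. (f z - c) * kern b z a) \<le>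
      ennreal C * (qint q \<beta> (Hk \<beta> f (\<lambda>w. kern b w a)) + qint q \<beta> (Hk \<beta> (\<lambda>z. cnj (f z)) (\<lambda>w. kern b w a)))"
    using kernel_test_estimate[OF q \<beta> b] fm ff by blast
  obtain CF where CF: "CF > 0" "\<And>z. z \<in> ball (0::complex ^ 'n) 1 \<Longrightarrow>
    (\<integral>\<^sup>+w. ennreal (hgt w powr \<alpha> * kdis z w powr (- (p * N))) \<partial>Lb) \<le> ennreal (CF * hgt z powr (- (p * N - A)))"
    using forelli_rudin[OF \<alpha>, of "p * N - A", where 'n='n] pN by (auto simp: A_def)
  define X where "X a = 2 * C * C1 * (CF * hgt a powr (- (p * N - A))) powr (q / p)" for a :: "complex ^ 'n"
  define K where "K = (2 * R) powr (q * N) * (4 * R) powr \<bar>\<beta>\<bar>"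
  have m: "(\<lambda>x. x) \<in> borel_measurable (Lb :: (complex ^ 'n) measure)" by (rule measurable_Lb_id)
  note [measurable] = m fm
  have "\<exists>c. (\<integral>\<^sup>+z. ennreal (indicator (bset R a) z * norm (f z - c) powr q) \<partial>Lb)
     \<le> ennreal (K * (2 * C * C1 * CF powr (q / p)) * hgt a powr (q * A / p - \<beta>))" if a: "a \<in> ball 0 1" for a :: "complex ^ 'n"
  proof -
    have ha: "hgt a > 0" by (rule hgt_pos[OF a])
    have kH: "(\<lambda>w. kern b w a) \<in> H_infinity" by (rule kern_H_infinity[OF a])
    have I: "enn2real (qint p \<alpha> (\<lambda>w. kern b w a)) \<le> CF * hgt a powr (- (p * N - A))"
    proof -
      have "qint p \<alpha> (\<lambda>w. kern b w a) = (\<integral>\<^sup>+w. ennreal (hgt w powr \<alpha> * kdis a w powr (- (p * N))) \<partial>Lb)"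
        unfolding qint_def
      proof (rule nn_integral_cong)
        fix w :: "complex ^ 'n" assume "w \<in> space Lb"
        then have w: "w \<in> ball 0 1" by simp
        show "ennreal (norm (kern b w a) powr p * hgt w powr \<alpha>) = ennreal (hgt w powr \<alpha> * kdis a w powr (- (p * N)))"
          unfolding norm_kern[OF w a] N_def[symmetric] kdis_sym[of w a] powr_powr by (simp add: mult.commute)
      qed
      also have "\<dots> \<le> ennreal (CF * hgt a powr (- (p * N - A)))" by (rule CF(2)[OF a])
      finally show ?thesis using CF(1) by (intro enn2real_leI) auto
    qed
    have Q: "C1 * enn2real (qint p \<alpha> (\<lambda>w. kern b w a)) powr (q / p) \<le> C1 * (CF * hgt a powr (- (p * N - A))) powr (q / p)"
      using I C1 p q by (intro mult_left_mono powr_mono2) auto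
    obtain c where c: "qint q \<beta> (\<lambda>z. (f z - c) * kern b z a) \<le>
      ennreal C * (qint q \<beta> (Hk \<beta> f (\<lambda>w. kern b w a)) + qint q \<beta> (Hk \<beta> (\<lambda>z. cnj (f z)) (\<lambda>w. kern b w a)))"
      using C(2)[OF a] by blast
    also have "\<dots> \<le> ennreal C * (ennreal (C1 * (CF * hgt a powr (- (p * N - A))) powr (q / p)) + ennreal (C1 * (CF * hgt a powr (- (p * N - A))) powr (q / p)))"
      by (intro mult_left_mono add_mono order_trans[OF H1[OF kH]] order_trans[OF H2[OF kH]] ennreal_leI Q) simp
    also have "\<dots> = ennreal (X a)"
      using C C1 by (simp add: X_def ennreal_mult[symmetric] ennreal_plus[symmetric] del: ennreal_plus)
    finally have bound: "qint q \<beta> (\<lambda>z. (f z - c) * kern b z a) \<le> ennreal (X a)" .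
    have K0: "K > 0" using R by (simp add: K_def)
    have "(\<integral>\<^sup>+z. ennreal (indicator (bset R a) z * norm (f z - c) powr q) \<partial>Lb)
      \<le> (\<integral>\<^sup>+z. ennreal (K * hgt a powr (q * N - \<beta>)) * ennreal (norm ((f z - c) * kern b z a) powr q * hgt z powr \<beta>) \<partial>Lb)"
    proof (rule nn_integral_mono)
      fix z :: "complex ^ 'n" assume "z \<in> space Lb"
      then have z: "z \<in> ball 0 1" by simp
      show "ennreal (indicator (bset R a) z * norm (f z - c) powr q) \<le> ennreal (K * hgt a powr (q * N - \<beta>)) * ennreal (norm ((f z - c) * kern b z a) powr q * hgt z powr \<beta>)"
      proof (cases "z \<in> bset R a")
        case True
        have hz: "hgt z > 0" by (rule hgt_pos[OF z])
        have kp: "kdis a z > 0" by (rule kdis_pos[OF a z])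
        have k1: "1 \<le> (2 * R * hgt a) powr (q * N) * kdis a z powr (- (q * N))"
        proof -
          have "kdis a z powr (q * N) \<le> (2 * R * hgt a) powr (q * N)"
            using bset_kdis_less[OF a True] R kp q N by (intro powr_mono2) auto
          then show ?thesis using kp by (simp add: powr_minus field_simps)
        qed
        have k2: "hgt a powr \<beta> \<le> (4 * R) powr \<bar>\<beta>\<bar> * hgt z powr \<beta>"
          using bset_hgt_le[OF a True] R ha hz by (intro powr_between) auto
        have k3: "1 \<le> (4 * R) powr \<bar>\<beta>\<bar> * hgt a powr (- \<beta>) * hgt z powr \<beta>"
          using k2 ha by (simp add: powr_minus field_simps)
        have "1 * 1 \<le> ((2 * R * hgt a) powr (q * N) * kdis a z powr (- (q * N))) * ((4 * R) powr \<bar>\<beta>\<bar> * hgt a powr (- \<beta>) * hgt z powr \<beta>)"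
          by (intro mult_mono k1 k3) auto
        also have "\<dots> = K * (hgt a powr (q * N) * hgt a powr (- \<beta>)) * (kdis a z powr (- (q * N)) * hgt z powr \<beta>)"
          using R ha by (simp add: K_def powr_mult mult_ac)
        also have "hgt a powr (q * N) * hgt a powr (- \<beta>) = hgt a powr (q * N - \<beta>)" by (simp add: powr_add[symmetric])
        finally have "norm (f z - c) powr q * 1 \<le> norm (f z - c) powr q * (K * hgt a powr (q * N - \<beta>) * (kdis a z powr (- (q * N)) * hgt z powr \<beta>))"
          by (intro mult_left_mono) auto
        moreover have "norm ((f z - c) * kern b z a) powr q = norm (f z - c) powr q * kdis a z powr (- (q * N))"
          unfolding norm_mult norm_kern[OF z a] N_def[symmetric] kdis_sym[of z a]
          by (simp add: powr_mult powr_powr mult.commute)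
        ultimately show ?thesis using True K0
          by (simp add: ennreal_mult[symmetric] mult_ac ennreal_leI)
      qed simp
    qed
    also have "\<dots> = ennreal (K * hgt a powr (q * N - \<beta>)) * qint q \<beta> (\<lambda>z. (f z - c) * kern b z a)"
      unfolding qint_def by (rule nn_integral_cmult) measurable
    also have "\<dots> \<le> ennreal (K * hgt a powr (q * N - \<beta>)) * ennreal (X a)"
      by (intro mult_left_mono bound) simp
    also have "\<dots> = ennreal (K * hgt a powr (q * N - \<beta>) * X a)"
      using K0 by (intro ennreal_mult[symmetric]) (auto simp: X_def intro!: mult_nonneg_nonneg C1 less_imp_le[OF C(1)])
    also have "K * hgt a powr (q * N - \<beta>) * X a = K * (2 * C * C1 * CF powr (q / p)) * hgt a powr (q * A / p - \<beta>)"
    proof -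
      have "(CF * hgt a powr (- (p * N - A))) powr (q / p) = CF powr (q / p) * hgt a powr (- (p * N - A) * (q / p))"
        using CF ha by (simp add: powr_mult powr_powr)
      moreover have "hgt a powr (q * N - \<beta>) * hgt a powr (- (p * N - A) * (q / p)) = hgt a powr (q * A / p - \<beta>)"
      proof -
        \<comment> \<open>The exponent N of the test function drops out here.\<close>
        have "q * N - \<beta> + - (p * N - A) * (q / p) = q * A / p - \<beta>" using p by (simp add: field_simps)
        then show ?thesis by (simp only: powr_add[symmetric])
      qed
      ultimately show ?thesis unfolding X_def by (simp add: mult_ac)
    qed
    finally show ?thesis by blast
  qed
  moreover have "K * (2 * C * C1 * CF powr (q / p)) \<ge> 0" unfolding K_def using C C1 by simp
  ultimately show ?thesis unfolding A_def by blast
qed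

section \<open>Sufficiency\<close>

text \<open>If R1 is the square of cosh s, then 2 R1 - 1 = cosh (2 s). The condition on R thus says
  that the ball of parameter R has Bergman radius at least 2 s, and the claim is the triangle
  inequality in the form \<open>kdis_triangle\<close>.\<close>

lemma bset_trans:
  fixes z u w :: "complex ^ 'n"
  assumes z: "z \<in> ball 0 1" and u: "u \<in> bset R1 z" and w: "w \<in> bset R1 u" and R1: "R1 > 1" and R: "(2 * R1 - 1)\<^sup>2 \<le> R"
  shows "w \<in> bset R z"
proof -
  have ub: "u \<in> ball 0 1" and wb: "w \<in> ball 0 1" using u w by (auto dest: bset_sub_ball)
  have h: "hgt z > 0" "hgt u > 0" "hgt w > 0" using z ub wb by (auto intro: hgt_pos)
  define A where "A = sqrt (hgt z * hgt u)"
  define B where "B = sqrt (hgt u * hgt w)"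
  have A: "A > 0" "A\<^sup>2 = hgt z * hgt u" and B: "B > 0" "B\<^sup>2 = hgt u * hgt w" using h by (auto simp: A_def B_def)
  have k1: "(kdis z u)\<^sup>2 < R1 * A\<^sup>2" using u by (simp add: bset_def A)
  have k2: "(kdis u w)\<^sup>2 < R1 * B\<^sup>2" using w by (simp add: bset_def B)
  have a1: "kdis z u \<le> sqrt R1 * A"
  proof -
    have "kdis z u \<le> sqrt (R1 * A\<^sup>2)" by (rule real_le_rsqrt) (use k1 in simp)
    then show ?thesis using A(1) by (simp add: real_sqrt_mult)
  qed
  have a2: "kdis u w \<le> sqrt R1 * B"
  proof -
    have "kdis u w \<le> sqrt (R1 * B\<^sup>2)" by (rule real_le_rsqrt) (use k2 in simp)
    then show ?thesis using B(1) by (simp add: real_sqrt_mult)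
  qed
  have a3: "sqrt ((kdis z u)\<^sup>2 - hgt z * hgt u) < sqrt (R1 - 1) * A"
  proof -
    have "sqrt ((kdis z u)\<^sup>2 - hgt z * hgt u) < sqrt ((R1 - 1) * A\<^sup>2)"
      unfolding real_sqrt_less_iff using k1 A by (simp add: algebra_simps)
    then show ?thesis using A(1) by (simp add: real_sqrt_mult)
  qed
  have a4: "sqrt ((kdis u w)\<^sup>2 - hgt u * hgt w) < sqrt (R1 - 1) * B"
  proof -
    have "sqrt ((kdis u w)\<^sup>2 - hgt u * hgt w) < sqrt ((R1 - 1) * B\<^sup>2)"
      unfolding real_sqrt_less_iff using k2 B by (simp add: algebra_simps)
    then show ?thesis using B(1) by (simp add: real_sqrt_mult)
  qed
  have nn: "sqrt ((kdis z u)\<^sup>2 - hgt z * hgt u) \<ge> 0" "sqrt ((kdis u w)\<^sup>2 - hgt u * hgt w) \<ge> 0"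
    using hgt_mult_le[OF ub, of z] hgt_mult_le[OF wb, of u] by auto
  have "kdis z w * hgt u \<le> kdis z u * kdis u w + sqrt ((kdis z u)\<^sup>2 - hgt z * hgt u) * sqrt ((kdis u w)\<^sup>2 - hgt u * hgt w)"
    by (rule kdis_triangle[OF ub])
  also have "\<dots> < (sqrt R1 * A) * (sqrt R1 * B) + (sqrt (R1 - 1) * A) * (sqrt (R1 - 1) * B)"
    using a1 a2 a3 a4 nn A B R1 by (intro add_le_less_mono mult_mono mult_strict_mono) (auto simp: kdis_def)
  also have "\<dots> = (2 * R1 - 1) * (A * B)" using R1 by (simp add: algebra_simps)
  also have "A * B = sqrt (hgt z * hgt w) * hgt u"
    using h by (simp add: A_def B_def real_sqrt_mult)
  finally have "kdis z w * hgt u < ((2 * R1 - 1) * sqrt (hgt z * hgt w)) * hgt u" by (simp add: mult.assoc)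
  then have "kdis z w < (2 * R1 - 1) * sqrt (hgt z * hgt w)" using h by (simp add: mult_less_cancel_right)
  then have "(kdis z w)\<^sup>2 < ((2 * R1 - 1) * sqrt (hgt z * hgt w))\<^sup>2"
    by (intro power_strict_mono) (auto simp: kdis_def)
  also have "\<dots> = (2 * R1 - 1)\<^sup>2 * (hgt z * hgt w)" using h by (simp add: power_mult_distrib)
  also have "\<dots> \<le> R * (hgt z * hgt w)" using R h by (intro mult_right_mono) auto
  finally show ?thesis using wb by (simp add: bset_def)
qed

section \<open>Growth of a function with controlled local oscillation\<close>

lemma hgt_scaleR: "hgt (t *\<^sub>R z) = 1 - t\<^sup>2 * (norm z)\<^sup>2"
  by (simp add: hgt_def power_mult_distrib)

lemma hgt_scaleR_mono: "0 \<le> t \<Longrightarrow> t \<le> s \<Longrightarrow> hgt (s *\<^sub>R z) \<le> hgt (t *\<^sub>R z)"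
  unfolding hgt_scaleR by (intro diff_mono mult_right_mono power_mono) auto

lemma scaleR_in_ball:
  fixes z :: "'a::real_normed_vector"
  shows "z \<in> ball 0 1 \<Longrightarrow> 0 \<le> t \<Longrightarrow> t \<le> 1 \<Longrightarrow> t *\<^sub>R z \<in> ball 0 1"
  using mult_left_le_one_le[of "norm z" t] by simp

text \<open>For two points on one radius the inner product is real, and their distance is at most
  the larger height. Membership in the Bergman ball is then decided by the ratio of the
  heights.\<close>

lemma ray_bset:
  fixes z :: "complex ^ 'n"
  assumes z: "z \<in> ball 0 1" and t: "0 \<le> t" "t \<le> s" "s \<le> 1" and h: "hgt (t *\<^sub>R z) < R1 * hgt (s *\<^sub>R z)"
  shows "s *\<^sub>R z \<in> bset R1 (t *\<^sub>R z)"
proof -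
  have tb: "t *\<^sub>R z \<in> ball 0 1" and sb: "s *\<^sub>R z \<in> ball 0 1" using z t by (intro scaleR_in_ball; simp)+
  have ht: "hgt (t *\<^sub>R z) > 0" by (rule hgt_pos[OF tb])
  have "1 - herm (t *\<^sub>R z) (s *\<^sub>R z) = of_real (1 - t * s * (norm z)\<^sup>2)"
    by (simp add: herm_simps herm_self)
  then have k: "kdis (t *\<^sub>R z) (s *\<^sub>R z) = \<bar>1 - t * s * (norm z)\<^sup>2\<bar>" unfolding kdis_def by (simp only: norm_of_real)
  have "t * t * (norm z)\<^sup>2 \<le> t * s * (norm z)\<^sup>2" using t by (intro mult_right_mono mult_left_mono) auto
  moreover have "t * s * (norm z)\<^sup>2 \<le> 1 * 1 * 1" using t z by (intro mult_mono) (auto simp: power_le_one)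
  ultimately have "kdis (t *\<^sub>R z) (s *\<^sub>R z) \<le> hgt (t *\<^sub>R z)" unfolding k hgt_scaleR by (simp add: power2_eq_square)
  then have "(kdis (t *\<^sub>R z) (s *\<^sub>R z))\<^sup>2 \<le> hgt (t *\<^sub>R z) * hgt (t *\<^sub>R z)"
    unfolding power2_eq_square by (intro mult_mono) (auto simp: kdis_def ht less_imp_le)
  also have "\<dots> < hgt (t *\<^sub>R z) * (R1 * hgt (s *\<^sub>R z))" using h ht by simp
  finally show ?thesis using sb by (simp add: bset_def mult_ac)
qed

text \<open>Along a radius the local oscillation bounds form a geometric series, summed by the induction.\<close>

lemma radial_growth:
  fixes F :: "complex ^ 'n \<Rightarrow> complex"
  assumes R1: "R1 > 1" and e: "e > 0" "e > \<gamma>" and C0: "C0 \<ge> 0"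
    and osc: "\<And>z u. z \<in> ball 0 1 \<Longrightarrow> u \<in> bset R1 z \<Longrightarrow> norm (F u - F z) \<le> C0 * hgt z powr (- \<gamma>)"
  shows "\<exists>C\<ge>0. \<forall>z\<in>ball 0 1. \<forall>t\<in>{0..1}. norm (F z - F (t *\<^sub>R z)) \<le> C * hgt z powr (- e) * hgt (t *\<^sub>R z) powr (e - \<gamma>)"
proof -
  \<comment> \<open>A ratio strictly between 1 and R1: points on a radius whose heights differ by
    the factor \<eta> satisfy the strict inequality of \<open>ray_bset\<close>.\<close>
  define \<eta> where "\<eta> = sqrt R1"
  have \<eta>: "\<eta> > 1" "\<eta> < R1" "\<eta> * \<eta> = R1"
  proof -
    show "\<eta> > 1" "\<eta> * \<eta> = R1" using R1 by (auto simp: \<eta>_def)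
    then have "\<eta> * 1 < \<eta> * \<eta>" by (intro mult_strict_left_mono) auto
    then show "\<eta> < R1" using \<open>\<eta> * \<eta> = R1\<close> by simp
  qed
  define \<theta> where "\<theta> = \<eta> powr (- (e - \<gamma>))"
  have \<theta>: "0 < \<theta>" "\<theta> < 1" using \<eta> e by (auto simp: \<theta>_def powr_less_one)
  \<comment> \<open>The fixed point C \<theta> + C0 = C, which the induction reproduces; e >
    \<gamma> ensures \<theta> < 1.\<close>
  define C where "C = C0 / (1 - \<theta>)"
  have C: "C \<ge> C0" "C * \<theta> + C0 = C"
    using \<theta> C0 by (auto simp: C_def field_simps mult_left_le)
  have step: "norm (F (s *\<^sub>R z) - F (t *\<^sub>R z)) \<le> C0 * hgt z powr (- e) * hgt (t *\<^sub>R z) powr (e - \<gamma>)"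
    if z: "z \<in> ball 0 1" and t: "0 \<le> t" "t \<le> s" "s \<le> 1" and h: "hgt (t *\<^sub>R z) < R1 * hgt (s *\<^sub>R z)" for z t s
  proof -
    have tb: "t *\<^sub>R z \<in> ball 0 1" using z t by (intro scaleR_in_ball) auto
    have ht: "hgt (t *\<^sub>R z) > 0" by (rule hgt_pos[OF tb])
    have hz: "hgt z > 0" by (rule hgt_pos[OF z])
    have "hgt z \<le> hgt (t *\<^sub>R z)" using hgt_scaleR_mono[of t 1 z] t by simp
    then have "hgt (t *\<^sub>R z) powr (- e) \<le> hgt z powr (- e)" using hz e by (intro powr_mono2') auto
    then have "hgt (t *\<^sub>R z) powr (- e) * hgt (t *\<^sub>R z) powr (e - \<gamma>) \<le> hgt z powr (- e) * hgt (t *\<^sub>R z) powr (e - \<gamma>)"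
      by (intro mult_right_mono) auto
    then have "hgt (t *\<^sub>R z) powr (- \<gamma>) \<le> hgt z powr (- e) * hgt (t *\<^sub>R z) powr (e - \<gamma>)"
      by (simp add: powr_add[symmetric])
    then have "C0 * hgt (t *\<^sub>R z) powr (- \<gamma>) \<le> C0 * (hgt z powr (- e) * hgt (t *\<^sub>R z) powr (e - \<gamma>))"
      using C0 by (intro mult_left_mono) auto
    then show ?thesis using osc[OF tb ray_bset[OF z t h]] by (simp add: mult.assoc)
  qed
  have main: "norm (F z - F (t *\<^sub>R z)) \<le> C * hgt z powr (- e) * hgt (t *\<^sub>R z) powr (e - \<gamma>)"
    if z: "z \<in> ball 0 1" and "0 \<le> t" "t \<le> 1" "hgt (t *\<^sub>R z) \<le> \<eta> ^ Suc k * hgt z" for z t k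
    using that(2-)
  proof (induction k arbitrary: t)
    have base: "norm (F z - F (t *\<^sub>R z)) \<le> C * hgt z powr (- e) * hgt (t *\<^sub>R z) powr (e - \<gamma>)"
      if t: "0 \<le> t" "t \<le> 1" "hgt (t *\<^sub>R z) < R1 * hgt z" for t
    proof -
      have "norm (F z - F (t *\<^sub>R z)) \<le> C0 * hgt z powr (- e) * hgt (t *\<^sub>R z) powr (e - \<gamma>)"
        using step[OF z, of t 1] t by simp
      also have "\<dots> \<le> C * hgt z powr (- e) * hgt (t *\<^sub>R z) powr (e - \<gamma>)"
        by (intro mult_right_mono C) auto
      finally show ?thesis .
    qed
    have hz: "hgt z > 0" by (rule hgt_pos[OF z])
    {
      case 0
      have "\<eta> * hgt z < R1 * hgt z" using \<eta> hz by simp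
      then show ?case using 0 base by simp
    next
      case (Suc k)
      show ?case
      proof (cases "hgt (t *\<^sub>R z) < R1 * hgt z")
        case True
        then show ?thesis using Suc base by simp
      next
        case False
        define d where "d = hgt (t *\<^sub>R z) / \<eta>"
        have "hgt z \<le> \<eta> * hgt z" using \<eta> hz by simp
        also have "\<dots> \<le> d"
        proof -
          have "\<eta> * (\<eta> * hgt z) = R1 * hgt z" by (simp add: mult.assoc[symmetric] \<eta>)
          then have "\<eta> * (\<eta> * hgt z) \<le> hgt (t *\<^sub>R z)" using False by (simp only: not_less)
          then show ?thesis using \<eta>(1) by (simp add: d_def field_simps)
        qed
        finally have dz: "hgt z \<le> d" .
        have hp: "hgt (t *\<^sub>R z) > 0" using Suc.prems z by (intro hgt_pos scaleR_in_ball) auto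
        have dt: "d \<le> hgt (t *\<^sub>R z)" using \<eta> hp by (simp add: d_def field_simps)
        \<comment> \<open>The next point outwards, at a height smaller by the factor \<eta>; from
          there the induction hypothesis leads to z.\<close>
        have "\<exists>s. t \<le> s \<and> s \<le> 1 \<and> hgt (s *\<^sub>R z) = d"
        proof (rule IVT2)
          show "hgt (1 *\<^sub>R z) \<le> d" using dz by simp
          show "\<forall>x. t \<le> x \<and> x \<le> 1 \<longrightarrow> isCont (\<lambda>s. hgt (s *\<^sub>R z)) x"
            unfolding hgt_scaleR by (auto intro!: continuous_intros)
        qed (use Suc.prems dt in auto)
        then obtain s where s: "t \<le> s" "s \<le> 1" "hgt (s *\<^sub>R z) = d" by blast
        have "hgt (s *\<^sub>R z) \<le> \<eta> ^ Suc k * hgt z"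
          unfolding s(3) d_def using Suc.prems(3) \<eta> by (simp add: field_simps)
        then have 1: "norm (F z - F (s *\<^sub>R z)) \<le> C * hgt z powr (- e) * hgt (s *\<^sub>R z) powr (e - \<gamma>)"
          using Suc.IH[of s] s Suc.prems by simp
        have "hgt (s *\<^sub>R z) powr (e - \<gamma>) = \<theta> * hgt (t *\<^sub>R z) powr (e - \<gamma>)"
        proof -
          have "d powr (e - \<gamma>) = hgt (t *\<^sub>R z) powr (e - \<gamma>) / \<eta> powr (e - \<gamma>)"
            unfolding d_def by (rule powr_divide)
          then show ?thesis unfolding s(3) \<theta>_def powr_minus_divide by simp
        qed
        with 1 have 1: "norm (F z - F (s *\<^sub>R z)) \<le> C * \<theta> * (hgt z powr (- e) * hgt (t *\<^sub>R z) powr (e - \<gamma>))"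
          by (simp add: mult_ac)
        have "hgt (t *\<^sub>R z) < R1 * hgt (s *\<^sub>R z)"
        proof -
          have "hgt (t *\<^sub>R z) = \<eta> * d" using \<eta> by (simp add: d_def)
          also have "\<dots> < R1 * d" using \<eta> hz dz by simp
          finally show ?thesis using s by simp
        qed
        then have 2: "norm (F (s *\<^sub>R z) - F (t *\<^sub>R z)) \<le> C0 * (hgt z powr (- e) * hgt (t *\<^sub>R z) powr (e - \<gamma>))"
          using step[OF z, of t s] s Suc.prems by (simp add: mult.assoc)
        have "norm (F z - F (t *\<^sub>R z)) \<le> norm (F z - F (s *\<^sub>R z)) + norm (F (s *\<^sub>R z) - F (t *\<^sub>R z))"
          using norm_triangle_ineq[of "F z - F (s *\<^sub>R z)" "F (s *\<^sub>R z) - F (t *\<^sub>R z)"] by simp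
        also have "\<dots> \<le> (C * \<theta> + C0) * (hgt z powr (- e) * hgt (t *\<^sub>R z) powr (e - \<gamma>))"
          using 1 2 by (simp add: distrib_right)
        finally show ?thesis unfolding C(2) by (simp add: mult.assoc)
      qed
    }
  qed
  have "norm (F z - F (t *\<^sub>R z)) \<le> C * hgt z powr (- e) * hgt (t *\<^sub>R z) powr (e - \<gamma>)"
    if z: "z \<in> ball 0 1" and t: "t \<in> {0..1}" for z t
  proof -
    have hz: "hgt z > 0" by (rule hgt_pos[OF z])
    obtain k where "hgt (t *\<^sub>R z) / hgt z < \<eta> ^ k" using real_arch_pow[OF \<eta>(1)] by blast
    then have "hgt (t *\<^sub>R z) \<le> \<eta> ^ k * hgt z" using hz by (simp add: field_simps)
    also have "\<dots> \<le> \<eta> ^ Suc k * hgt z" using hz \<eta> by (intro mult_right_mono power_increasing) auto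
    finally show ?thesis using main[OF z] t by auto
  qed
  then show ?thesis using C C0 by (intro exI[of _ C]) auto
qed

text \<open>Both points are pulled in along their radii until their heights are comparable with D =
  kdis z w. There they share a Bergman ball, and the radial parts are bounded by
  \<open>radial_growth\<close>. A factor \<open>D powr - e\<close> is finally exchanged for the
  height of the opposite point, which makes the bound symmetric.\<close>

lemma oscillation_growth:
  fixes F :: "complex ^ 'n \<Rightarrow> complex"
  assumes R1: "R1 > 1" and e: "e > 0" "e > \<gamma>" and C0: "C0 \<ge> 0"
    and osc: "\<And>z u. z \<in> ball 0 1 \<Longrightarrow> u \<in> bset R1 z \<Longrightarrow> norm (F u - F z) \<le> C0 * hgt z powr (- \<gamma>)"
  shows "\<exists>C\<ge>0. \<forall>z\<in>ball 0 1. \<forall>w\<in>ball 0 1. norm (F z - F w) \<le> C * kdis z w powr (2 * e - \<gamma>) * hgt z powr (- e) * hgt w powr (- e)"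
proof -
  have "\<exists>C\<ge>0. \<forall>z\<in>ball 0 1. \<forall>t\<in>{0..1}. norm (F z - F (t *\<^sub>R z)) \<le> C * hgt z powr (- e) * hgt (t *\<^sub>R z) powr (e - \<gamma>)"
    by (rule radial_growth[OF R1 e C0 osc])
  then obtain C where C0': "C \<ge> 0" "\<forall>z\<in>ball 0 1. \<forall>t\<in>{0..1}. norm (F z - F (t *\<^sub>R z)) \<le> C * hgt z powr (- e) * hgt (t *\<^sub>R z) powr (e - \<gamma>)"
    by blast
  have C: "C \<ge> 0" "\<And>z t. z \<in> ball 0 1 \<Longrightarrow> 0 \<le> t \<Longrightarrow> t \<le> 1 \<Longrightarrow>
    norm (F z - F (t *\<^sub>R z)) \<le> C * hgt z powr (- e) * hgt (t *\<^sub>R z) powr (e - \<gamma>)"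
    using C0' by auto
  have "((\<lambda>x::real. (1 + x)\<^sup>2) \<longlongrightarrow> (1 + 0)\<^sup>2) (at_right 0)" by (intro tendsto_intros)
  then have "\<forall>\<^sub>F x::real in at_right 0. (1 + x)\<^sup>2 < R1"
    using R1 by (intro order_tendstoD(2)[where y="(1 + 0)\<^sup>2"]) auto
  moreover have "\<forall>\<^sub>F x in at_right (0::real). 0 < x \<and> x < 1"
    by (auto simp: eventually_at_right_field intro: exI[of _ 1])
  ultimately have "\<forall>\<^sub>F x::real in at_right 0. (1 + x)\<^sup>2 < R1 \<and> 0 < x \<and> x < 1"
    by eventually_elim simp
  then obtain x :: real where x: "(1 + x)\<^sup>2 < R1" "0 < x" "x < 1"
    using eventually_happens[of _ "at_right (0::real)"] by auto
  \<comment> \<open>At heights of at least M D the pulled-in points have distance at most (1 + x) M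
    D, since D = x M D; the condition (1 + x)^2 < R1 puts them into a common Bergman ball.\<close>
  define M where "M = 1 / x"
  have M: "M > 1" "x * M = 1" using x by (auto simp: M_def)
  define K where "K = 2 powr e * (M + 2) powr (e - \<gamma>)"
  define K' where "K' = (M powr \<bar>2 * e - \<gamma>\<bar> + 1) * (2 powr \<bar>2 * e - \<gamma>\<bar> + 1)"
  have K: "K \<ge> 0" "K' \<ge> 1" using ge_one_powr_ge_zero[of M "\<bar>2 * e - \<gamma>\<bar>"]
    by (auto simp: K_def K'_def intro!: mult_ge1_I)
  have "norm (F z - F w) \<le> (2 * C + C0) * (K + K') * kdis z w powr (2 * e - \<gamma>) * hgt z powr (- e) * hgt w powr (- e)"
    if z: "z \<in> ball 0 1" and w: "w \<in> ball 0 1" for z w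
  proof -
    define D where "D = kdis z w"
    have D: "D > 0" "D \<le> 2" unfolding D_def using kdis_pos[OF z w] kdis_le_2[OF z w] by auto
    have hz: "hgt z > 0" "hgt z \<le> 1" "hgt z \<le> 2 * D" and hw: "hgt w > 0" "hgt w \<le> 1" "hgt w \<le> 2 * D"
      unfolding D_def using hgt_pos hgt_le_1 hgt_le_kdis[OF z w] hgt_le_kdis'[OF z w] z w by auto
    have inv1: "hgt v powr (- e) \<ge> 1" if "v \<in> ball 0 1" for v :: "complex ^ 'n"
      using hgt_pos[OF that] hgt_le_1[of v] e powr_mono2'[of "- e" "hgt v" 1] by simp
    define T where "T = D powr (2 * e - \<gamma>) * hgt z powr (- e) * hgt w powr (- e)"
    have T0: "T \<ge> 0" by (simp add: T_def)
    show ?thesis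
    proof (cases "M * D \<ge> 1")
      case True
      \<comment> \<open>Here D lies between 1 / M and 2, so its power is bounded below whatever the
        sign of the exponent. Both points are then compared with the centre of the ball.\<close>
      have "1 \<le> K' * D powr (2 * e - \<gamma>)"
      proof (cases "2 * e - \<gamma> \<ge> 0")
        case True
        have "1 \<le> (M * D) powr (2 * e - \<gamma>)" using \<open>M * D \<ge> 1\<close> True by (intro ge_one_powr_ge_zero) auto
        also have "\<dots> = M powr \<bar>2 * e - \<gamma>\<bar> * D powr (2 * e - \<gamma>)" using True M D by (simp add: powr_mult)
        also have "\<dots> \<le> K' * D powr (2 * e - \<gamma>)"
        proof (rule mult_right_mono)
          have "M powr \<bar>2 * e - \<gamma>\<bar> * 1 \<le> (M powr \<bar>2 * e - \<gamma>\<bar> + 1) * (2 powr \<bar>2 * e - \<gamma>\<bar> + 1)" by (intro mult_mono) auto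
          then show "M powr \<bar>2 * e - \<gamma>\<bar> \<le> K'" by (simp add: K'_def)
        qed simp
        finally show ?thesis .
      next
        case False
        have "2 powr (2 * e - \<gamma>) \<le> D powr (2 * e - \<gamma>)" using D False by (intro powr_mono2') auto
        then have "2 powr \<bar>2 * e - \<gamma>\<bar> * 2 powr (2 * e - \<gamma>) \<le> 2 powr \<bar>2 * e - \<gamma>\<bar> * D powr (2 * e - \<gamma>)" by (intro mult_left_mono) auto
        then have "1 \<le> 2 powr \<bar>2 * e - \<gamma>\<bar> * D powr (2 * e - \<gamma>)" using False by (simp add: powr_add[symmetric])
        also have "\<dots> \<le> K' * D powr (2 * e - \<gamma>)"
        proof (rule mult_right_mono)
          have "1 * 2 powr \<bar>2 * e - \<gamma>\<bar> \<le> (M powr \<bar>2 * e - \<gamma>\<bar> + 1) * (2 powr \<bar>2 * e - \<gamma>\<bar> + 1)" by (intro mult_mono) auto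
          then show "2 powr \<bar>2 * e - \<gamma>\<bar> \<le> K'" by (simp add: K'_def)
        qed simp
        finally show ?thesis .
      qed
      then have "1 * (hgt z powr (- e) * hgt w powr (- e)) \<le> K' * D powr (2 * e - \<gamma>) * (hgt z powr (- e) * hgt w powr (- e))"
        by (intro mult_right_mono) auto
      then have KT: "hgt z powr (- e) * hgt w powr (- e) \<le> K' * T" by (simp add: T_def mult_ac)
      have "hgt z powr (- e) * 1 \<le> hgt z powr (- e) * hgt w powr (- e)" using inv1[OF w] by (intro mult_left_mono) auto
      moreover have "1 * hgt w powr (- e) \<le> hgt z powr (- e) * hgt w powr (- e)" using inv1[OF z] by (intro mult_right_mono) auto
      ultimately have h2: "hgt z powr (- e) \<le> K' * T" "hgt w powr (- e) \<le> K' * T" using KT by auto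
      have "norm (F z - F 0) \<le> C * hgt z powr (- e)" "norm (F w - F 0) \<le> C * hgt w powr (- e)"
        using C(2)[OF z, of 0] C(2)[OF w, of 0] by (auto simp: hgt_def)
      then have "norm (F z - F 0) \<le> C * (K' * T)" "norm (F w - F 0) \<le> C * (K' * T)"
        using h2 C(1) by (auto intro: order_trans mult_left_mono)
      then have "norm (F z - F w) \<le> 2 * C * (K' * T)"
        using norm_triangle_ineq4[of "F z - F 0" "F w - F 0"] by simp
      also have "\<dots> \<le> (2 * C + C0) * ((K + K') * T)"
        using C(1) C0 K T0 by (intro mult_mono mult_right_mono) auto
      finally show ?thesis by (simp add: T_def D_def mult_ac)
    next
      case False
      \<comment> \<open>The solution of 1 - t^2 = M D, so that scaling by t raises every height in
        the ball to at least M D.\<close>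
      define t where "t = sqrt (1 - M * D)"
      have MD: "M * D > 0" using M D by simp
      have t: "0 \<le> t" "t \<le> 1" "t\<^sup>2 = 1 - M * D" using False MD by (auto simp: t_def)
      have tz: "t *\<^sub>R z \<in> ball 0 1" and tw: "t *\<^sub>R w \<in> ball 0 1" using z w t by (intro scaleR_in_ball; simp)+
      have hy: "hgt (t *\<^sub>R v) = M * D + t\<^sup>2 * hgt v" for v :: "complex ^ 'n"
        unfolding hgt_scaleR unfolding hgt_def unfolding t(3) by (simp add: algebra_simps)
      have ylo: "M * D \<le> hgt (t *\<^sub>R v)" "hgt (t *\<^sub>R v) \<le> (M + 2) * D" if "v \<in> ball 0 1" "hgt v \<le> 2 * D" for v :: "complex ^ 'n"
      proof -
        show "M * D \<le> hgt (t *\<^sub>R v)" unfolding hy using hgt_pos[OF that(1)] by simp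
        have "t\<^sup>2 * hgt v \<le> 1 * hgt v" using hgt_pos[OF that(1)] MD unfolding t(3) by (intro mult_right_mono) auto
        then show "hgt (t *\<^sub>R v) \<le> (M + 2) * D" unfolding hy using that(2) by (simp add: algebra_simps)
      qed
      have hb: "hgt (t *\<^sub>R v) powr (e - \<gamma>) \<le> (M + 2) powr (e - \<gamma>) * D powr (e - \<gamma>)" if "v \<in> ball 0 1" "hgt v \<le> 2 * D" for v :: "complex ^ 'n"
      proof -
        have "hgt (t *\<^sub>R v) powr (e - \<gamma>) \<le> ((M + 2) * D) powr (e - \<gamma>)"
          using ylo[OF that] MD e by (intro powr_mono2) auto
        then show ?thesis using M D by (simp add: powr_mult)
      qed
      have ex: "hgt v powr (- e) * ((M + 2) powr (e - \<gamma>) * D powr (e - \<gamma>)) \<le> K * T"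
        if v: "(v = z \<and> v' = w) \<or> (v = w \<and> v' = z)" for v v'
      proof -
        have v': "hgt v' > 0" "hgt v' \<le> 2 * D" using v hz hw by auto
        have "D powr (- e) \<le> (hgt v' / 2) powr (- e)" using v' e D by (intro powr_mono2') auto
        also have "\<dots> = 2 powr e * hgt v' powr (- e)" using v' by (simp add: powr_divide powr_minus field_simps)
        finally have d: "D powr (- e) \<le> 2 powr e * hgt v' powr (- e)" .
        have "D powr (e - \<gamma>) = D powr (2 * e - \<gamma>) * D powr (- e)" by (simp add: powr_add[symmetric])
        also have "\<dots> \<le> D powr (2 * e - \<gamma>) * (2 powr e * hgt v' powr (- e))" by (intro mult_left_mono d) simp
        finally have "hgt v powr (- e) * ((M + 2) powr (e - \<gamma>) * D powr (e - \<gamma>)) \<le>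
          hgt v powr (- e) * ((M + 2) powr (e - \<gamma>) * (D powr (2 * e - \<gamma>) * (2 powr e * hgt v' powr (- e))))"
          by (intro mult_left_mono) auto
        also have "\<dots> = K * (D powr (2 * e - \<gamma>) * (hgt v powr (- e) * hgt v' powr (- e)))" by (simp add: K_def mult_ac)
        also have "hgt v powr (- e) * hgt v' powr (- e) = hgt z powr (- e) * hgt w powr (- e)" using v by auto
        finally show ?thesis by (simp add: T_def mult_ac)
      qed
      have 1: "norm (F z - F (t *\<^sub>R z)) \<le> C * (K * T)"
      proof -
        have "norm (F z - F (t *\<^sub>R z)) \<le> C * (hgt z powr (- e) * hgt (t *\<^sub>R z) powr (e - \<gamma>))"
          using C(2)[OF z t(1,2)] by (simp add: mult.assoc)
        also have "\<dots> \<le> C * (hgt z powr (- e) * ((M + 2) powr (e - \<gamma>) * D powr (e - \<gamma>)))"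
          using C(1) hz by (intro mult_left_mono hb z) auto
        also have "\<dots> \<le> C * (K * T)" using C(1) ex[of z w] by (intro mult_left_mono) auto
        finally show ?thesis .
      qed
      have 2: "norm (F w - F (t *\<^sub>R w)) \<le> C * (K * T)"
      proof -
        have "norm (F w - F (t *\<^sub>R w)) \<le> C * (hgt w powr (- e) * hgt (t *\<^sub>R w) powr (e - \<gamma>))"
          using C(2)[OF w t(1,2)] by (simp add: mult.assoc)
        also have "\<dots> \<le> C * (hgt w powr (- e) * ((M + 2) powr (e - \<gamma>) * D powr (e - \<gamma>)))"
          using C(1) hw by (intro mult_left_mono hb w) auto
        also have "\<dots> \<le> C * (K * T)" using C(1) ex[of w z] by (intro mult_left_mono) auto
        finally show ?thesis .
      qed
      have "t *\<^sub>R w \<in> bset R1 (t *\<^sub>R z)"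
      proof -
        have "1 - herm (t *\<^sub>R z) (t *\<^sub>R w) = of_real (M * D) + of_real (t\<^sup>2) * (1 - herm z w)"
        proof -
          have "herm (t *\<^sub>R z) (t *\<^sub>R w) = of_real (t\<^sup>2) * herm z w" by (simp add: herm_simps power2_eq_square)
          moreover have "complex_of_real (M * D) = 1 - of_real (t\<^sup>2)" unfolding t(3) by simp
          ultimately show ?thesis by (simp add: algebra_simps)
        qed
        then have "kdis (t *\<^sub>R z) (t *\<^sub>R w) \<le> norm (complex_of_real (M * D)) + norm (of_real (t\<^sup>2) * (1 - herm z w))"
          unfolding kdis_def by (metis norm_triangle_ineq)
        also have "\<dots> = M * D + t\<^sup>2 * D"
          using M MD D by (simp only: norm_of_real norm_mult D_def[symmetric] kdis_def[symmetric]) simp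
        also have "t\<^sup>2 * D \<le> 1 * D" using D MD unfolding t(3) by (intro mult_right_mono) auto
        also have "M * D + 1 * D = (1 + x) * (M * D)"
          using M(2) by (simp add: distrib_right mult.assoc[symmetric])
        finally have "(kdis (t *\<^sub>R z) (t *\<^sub>R w))\<^sup>2 \<le> ((1 + x) * (M * D))\<^sup>2" by (intro power_mono) (auto simp: kdis_def)
        also have "\<dots> = (1 + x)\<^sup>2 * ((M * D) * (M * D))" by (simp add: power2_eq_square mult_ac)
        also have "\<dots> < R1 * ((M * D) * (M * D))" using x MD by (intro mult_strict_right_mono) auto
        also have "\<dots> \<le> R1 * (hgt (t *\<^sub>R z) * hgt (t *\<^sub>R w))"
          using R1 MD ylo[OF z hz(3)] ylo[OF w hw(3)] by (intro mult_left_mono mult_mono) auto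
        finally show ?thesis using tw by (simp add: bset_def)
      qed
      then have "norm (F (t *\<^sub>R w) - F (t *\<^sub>R z)) \<le> C0 * hgt (t *\<^sub>R z) powr (- \<gamma>)" by (rule osc[OF tz])
      also have "\<dots> \<le> C0 * (K * T)"
      proof (rule mult_left_mono[OF _ C0])
        have "hgt z \<le> hgt (t *\<^sub>R z)" using hgt_scaleR_mono[of t 1 z] t by simp
        then have "hgt (t *\<^sub>R z) powr (- e) \<le> hgt z powr (- e)" using hz e by (intro powr_mono2') auto
        have "hgt (t *\<^sub>R z) powr (- \<gamma>) = hgt (t *\<^sub>R z) powr (- e) * hgt (t *\<^sub>R z) powr (e - \<gamma>)" by (simp add: powr_add[symmetric])
        also have "\<dots> \<le> hgt z powr (- e) * ((M + 2) powr (e - \<gamma>) * D powr (e - \<gamma>))"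
          using hz by (intro mult_mono hb z \<open>hgt (t *\<^sub>R z) powr (- e) \<le> hgt z powr (- e)\<close>) auto
        also have "\<dots> \<le> K * T" using ex[of z w] by auto
        finally show "hgt (t *\<^sub>R z) powr (- \<gamma>) \<le> K * T" .
      qed
      finally have 3: "norm (F (t *\<^sub>R w) - F (t *\<^sub>R z)) \<le> C0 * (K * T)" .
      have split: "F z - F w = (F z - F (t *\<^sub>R z)) - (F w - F (t *\<^sub>R w)) - (F (t *\<^sub>R w) - F (t *\<^sub>R z))" by simp
      have "norm (F z - F w) \<le> norm (F z - F (t *\<^sub>R z)) + norm (F w - F (t *\<^sub>R w)) + norm (F (t *\<^sub>R w) - F (t *\<^sub>R z))"
        by (subst split) (rule order_trans[OF norm_triangle_ineq4 add_right_mono[OF norm_triangle_ineq4]])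
      also have "\<dots> \<le> (2 * C + C0) * (K * T)" using 1 2 3 by (simp add: distrib_right)
      also have "\<dots> \<le> (2 * C + C0) * ((K + K') * T)"
        using C(1) C0 K T0 by (intro mult_left_mono mult_right_mono) auto
      finally show ?thesis by (simp add: T_def D_def mult_ac)
    qed
  qed
  then show ?thesis using C(1) C0 K by (intro exI[of _ "(2 * C + C0) * (K + K')"]) auto
qed

section \<open>From bounds on Bergman balls to a Carleson embedding\<close>

lemma emeasure_bset_eq:
  "z \<in> ball 0 1 \<Longrightarrow> (\<integral>\<^sup>+u. ennreal (if (kdis z u)\<^sup>2 < R * (hgt z * hgt u) then 1 else 0) \<partial>Lb) = ennreal (measure Lb (bset R z))"
proof -
  have "(\<integral>\<^sup>+u. ennreal (if (kdis z u)\<^sup>2 < R * (hgt z * hgt u) then 1 else 0) \<partial>Lb) = (\<integral>\<^sup>+u. indicator (bset R z) u \<partial>Lb)"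
    by (intro nn_integral_cong) (auto simp: bset_def split: split_indicator)
  then show ?thesis by (simp add: Lb.emeasure_eq_measure)
qed

text \<open>Averaging over Bergman balls transfers local bounds of \<open>\<phi>\<close> to integrals against the slowly
  varying weights \<open>hgt z powr s * kdis z w powr - \<kappa>\<close>.\<close>

lemma local_bound_integral:
  fixes \<phi> :: "complex ^ 'n \<Rightarrow> real"
  assumes R: "R > 1" and \<phi>m[measurable]: "\<phi> \<in> borel_measurable Lb" and \<phi>0: "\<And>z. \<phi> z \<ge> 0" and E: "E \<ge> 0"
    and loc: "\<And>u. u \<in> ball 0 1 \<Longrightarrow> (\<integral>\<^sup>+z. ennreal (indicator (bset R u) z * \<phi> z) \<partial>Lb) \<le> ennreal (E * hgt u powr l)"
    and t: "s - (real CARD('n) + 1) + l > -1" and c: "c > 0" and \<kappa>: "\<kappa> = s + l + c" and \<kappa>0: "\<kappa> > 0"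
  shows "\<exists>C\<ge>0. \<forall>w\<in>ball 0 1. (\<integral>\<^sup>+z. ennreal (\<phi> z * hgt z powr s * kdis z w powr (- \<kappa>)) \<partial>Lb) \<le> ennreal (C * hgt w powr (- c))"
proof -
  define N where "N = real CARD('n) + 1"
  obtain c0 where c0: "c0 > 0" "\<And>z. z \<in> ball (0::complex ^ 'n) 1 \<Longrightarrow> c0 * hgt z powr N \<le> measure Lb (bset R z)"
    using bset_measure_lower[OF R, where 'n='n] unfolding N_def by blast
  obtain C where C: "C > 0" "\<And>z. z \<in> ball (0::complex ^ 'n) 1 \<Longrightarrow>
    (\<integral>\<^sup>+w. ennreal (hgt w powr (s - N + l) * kdis z w powr (- \<kappa>)) \<partial>Lb) \<le> ennreal (C * hgt z powr (- c))"
  proof -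
    have "real CARD('n) + 1 + (s - N + l) + c = \<kappa>" by (simp add: N_def \<kappa>)
    then show ?thesis using forelli_rudin[of "s - N + l" c, where 'n='n] t c that unfolding N_def by auto
  qed
  define K where "K = 1 / c0 * ((4 * R) powr \<bar>s - N\<bar> * (4 * R) powr \<kappa>)"
  have K: "K \<ge> 0" using c0 by (simp add: K_def)
  have [measurable]: "(\<lambda>x. x) \<in> borel_measurable (Lb :: (complex ^ 'n) measure)" by (rule measurable_Lb_id)
  \<comment> \<open>The Bergman ball indicator written as a condition on the pair of points: joint
    measurability for Fubini and symmetry in both arguments are then immediate.\<close>
  define cut where "cut z u = ((if (kdis z u)\<^sup>2 < R * (hgt z * hgt u) then 1 else 0) :: real)" for z u :: "complex ^ 'n"
  have cutm[measurable]: "(\<lambda>x. cut (f x) (g x)) \<in> borel_measurable M"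
    if [measurable]: "f \<in> borel_measurable M" "g \<in> borel_measurable M" for f g and M :: "'m measure"
    unfolding cut_def by measurable
  have "(\<integral>\<^sup>+z. ennreal (\<phi> z * hgt z powr s * kdis z w powr (- \<kappa>)) \<partial>Lb) \<le> ennreal (K * E * C * hgt w powr (- c))"
    if w: "w \<in> ball 0 1" for w :: "complex ^ 'n"
  proof -
    have "(\<integral>\<^sup>+z. ennreal (\<phi> z * hgt z powr s * kdis z w powr (- \<kappa>)) \<partial>Lb)
      \<le> (\<integral>\<^sup>+z. (\<integral>\<^sup>+u. ennreal (K * cut z u * \<phi> z * (hgt u powr (s - N) * kdis u w powr (- \<kappa>))) \<partial>Lb) \<partial>Lb)"
    proof (rule nn_integral_mono)
      fix z :: "complex ^ 'n" assume "z \<in> space Lb"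
      then have z: "z \<in> ball 0 1" by simp
      have hz: "hgt z > 0" by (rule hgt_pos[OF z])
      define B where "B = \<phi> z * hgt z powr (s - N) * kdis z w powr (- \<kappa>) / c0"
      have B: "B \<ge> 0" using \<phi>0 c0 by (simp add: B_def)
      have "\<phi> z * hgt z powr s * kdis z w powr (- \<kappa>) = B * (c0 * hgt z powr N)"
        using c0 by (simp add: B_def powr_diff)
      also have "\<dots> \<le> B * measure Lb (bset R z)" using B c0(2)[OF z] by (intro mult_left_mono) auto
      finally have "ennreal (\<phi> z * hgt z powr s * kdis z w powr (- \<kappa>)) \<le> ennreal (B * measure Lb (bset R z))" by (rule ennreal_leI)
      also have "\<dots> = ennreal B * (\<integral>\<^sup>+u. ennreal (cut z u) \<partial>Lb)"
        using B emeasure_bset_eq[OF z, of R] by (simp add: ennreal_mult cut_def)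
      also have "\<dots> = (\<integral>\<^sup>+u. ennreal B * ennreal (cut z u) \<partial>Lb)" by (rule nn_integral_cmult[symmetric]) measurable
      also have "\<dots> \<le> (\<integral>\<^sup>+u. ennreal (K * cut z u * \<phi> z * (hgt u powr (s - N) * kdis u w powr (- \<kappa>))) \<partial>Lb)"
      proof (rule nn_integral_mono)
        fix u :: "complex ^ 'n" assume "u \<in> space Lb"
        then have u: "u \<in> ball 0 1" by simp
        show "ennreal B * ennreal (cut z u) \<le> ennreal (K * cut z u * \<phi> z * (hgt u powr (s - N) * kdis u w powr (- \<kappa>)))"
        proof (cases "(kdis z u)\<^sup>2 < R * (hgt z * hgt u)")
          case True
          then have ub: "u \<in> bset R z" using u by (simp add: bset_def)
          have hu: "hgt u > 0" by (rule hgt_pos[OF u])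
          have 1: "hgt z powr (s - N) \<le> (4 * R) powr \<bar>s - N\<bar> * hgt u powr (s - N)"
            using bset_hgt_le[OF z ub] R hz hu by (intro powr_between) auto
          \<comment> \<open>The quasi-triangle inequality. Since kdis u z is comparable with hgt z
            on the Bergman ball, replacing z by u in the kernel costs only a constant.\<close>
          have "kdis u w * hgt z \<le> 2 * (kdis u z * kdis z w)"
          proof -
            have "sqrt ((kdis u z)\<^sup>2 - hgt u * hgt z) \<le> kdis u z"
              using hu hz by (intro real_le_lsqrt) (auto simp: kdis_def)
            moreover have "sqrt ((kdis z w)\<^sup>2 - hgt z * hgt w) \<le> kdis z w"
              using hz hgt_pos[OF w] by (intro real_le_lsqrt) (auto simp: kdis_def)
            ultimately have "sqrt ((kdis u z)\<^sup>2 - hgt u * hgt z) * sqrt ((kdis z w)\<^sup>2 - hgt z * hgt w) \<le> kdis u z * kdis z w"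
              using hgt_mult_le[OF z, of u] hgt_mult_le[OF w, of z] by (intro mult_mono) (auto simp: kdis_def)
            then show ?thesis using kdis_triangle[OF z, of u w] by simp
          qed
          also have "\<dots> \<le> 2 * ((2 * R * hgt z) * kdis z w)"
          proof -
            have "kdis u z \<le> 2 * R * hgt z" using bset_kdis_less[OF z ub] R by (simp add: kdis_sym[of u z])
            then show ?thesis by (intro mult_left_mono mult_right_mono) (auto simp: kdis_def)
          qed
          finally have "kdis u w * hgt z \<le> (4 * R * kdis z w) * hgt z" by (simp add: mult_ac)
          then have "kdis u w \<le> 4 * R * kdis z w" using hz by simp
          then have "kdis u w / (4 * R) \<le> kdis z w" using R by (simp add: field_simps)
          then have "kdis z w powr (- \<kappa>) \<le> (kdis u w / (4 * R)) powr (- \<kappa>)"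
            using kdis_pos[OF u w] R \<kappa>0 by (intro powr_mono2') auto
          also have "\<dots> = (4 * R) powr \<kappa> * kdis u w powr (- \<kappa>)"
            using kdis_pos[OF u w] R by (simp add: powr_divide powr_minus field_simps)
          finally have 2: "kdis z w powr (- \<kappa>) \<le> (4 * R) powr \<kappa> * kdis u w powr (- \<kappa>)" .
          have "B = 1 / c0 * \<phi> z * (hgt z powr (s - N) * kdis z w powr (- \<kappa>))" by (simp add: B_def)
          also have "\<dots> \<le> 1 / c0 * \<phi> z * (((4 * R) powr \<bar>s - N\<bar> * hgt u powr (s - N)) * ((4 * R) powr \<kappa> * kdis u w powr (- \<kappa>)))"
            using c0 \<phi>0 by (intro mult_left_mono mult_mono 1 2) auto
          also have "\<dots> = K * \<phi> z * (hgt u powr (s - N) * kdis u w powr (- \<kappa>))" by (simp add: K_def mult_ac)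
          finally show ?thesis using True by (simp add: cut_def ennreal_leI)
        qed (simp add: cut_def)
      qed
      finally show "ennreal (\<phi> z * hgt z powr s * kdis z w powr (- \<kappa>)) \<le> (\<integral>\<^sup>+u. ennreal (K * cut z u * \<phi> z * (hgt u powr (s - N) * kdis u w powr (- \<kappa>))) \<partial>Lb)" .
    qed
    also have "\<dots> = (\<integral>\<^sup>+u. (\<integral>\<^sup>+z. ennreal (K * cut z u * \<phi> z * (hgt u powr (s - N) * kdis u w powr (- \<kappa>))) \<partial>Lb) \<partial>Lb)"
      by (rule Lbp.Fubini') measurable
    also have "\<dots> \<le> (\<integral>\<^sup>+u. ennreal (K * E) * ennreal (hgt u powr (s - N + l) * kdis w u powr (- \<kappa>)) \<partial>Lb)"
    proof (rule nn_integral_mono)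
      fix u :: "complex ^ 'n" assume "u \<in> space Lb"
      then have u: "u \<in> ball 0 1" by simp
      define B where "B = K * (hgt u powr (s - N) * kdis u w powr (- \<kappa>))"
      have B: "B \<ge> 0" using K by (simp add: B_def)
      have "(\<integral>\<^sup>+z. ennreal (K * cut z u * \<phi> z * (hgt u powr (s - N) * kdis u w powr (- \<kappa>))) \<partial>Lb) = (\<integral>\<^sup>+z. ennreal B * ennreal (indicator (bset R u) z * \<phi> z) \<partial>Lb)"
      proof (rule nn_integral_cong)
        fix z :: "complex ^ 'n" assume "z \<in> space Lb"
        then have "cut z u = indicator (bset R u) z"
          by (auto simp: cut_def bset_def kdis_sym[of u z] mult.commute split: split_indicator)
        then show "ennreal (K * cut z u * \<phi> z * (hgt u powr (s - N) * kdis u w powr (- \<kappa>))) = ennreal B * ennreal (indicator (bset R u) z * \<phi> z)"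
          using B \<phi>0 by (simp add: ennreal_mult[symmetric] B_def mult_ac)
      qed
      also have "\<dots> = ennreal B * (\<integral>\<^sup>+z. ennreal (indicator (bset R u) z * \<phi> z) \<partial>Lb)" by (rule nn_integral_cmult) measurable
      also have "\<dots> \<le> ennreal B * ennreal (E * hgt u powr l)" by (rule mult_left_mono[OF loc[OF u]]) simp
      also have "\<dots> = ennreal (B * (E * hgt u powr l))" by (rule ennreal_mult[symmetric]) (use B E in auto)
      also have "B * (E * hgt u powr l) = K * E * (hgt u powr (s - N + l) * kdis w u powr (- \<kappa>))"
        unfolding B_def kdis_sym[of u w] powr_add by (simp only: mult_ac)
      also have "ennreal \<dots> = ennreal (K * E) * ennreal (hgt u powr (s - N + l) * kdis w u powr (- \<kappa>))"
        using K E by (intro ennreal_mult) auto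
      finally show "(\<integral>\<^sup>+z. ennreal (K * cut z u * \<phi> z * (hgt u powr (s - N) * kdis u w powr (- \<kappa>))) \<partial>Lb) \<le> ennreal (K * E) * ennreal (hgt u powr (s - N + l) * kdis w u powr (- \<kappa>))" .
    qed
    also have "\<dots> = ennreal (K * E) * (\<integral>\<^sup>+u. ennreal (hgt u powr (s - N + l) * kdis w u powr (- \<kappa>)) \<partial>Lb)"
      by (rule nn_integral_cmult) measurable
    also have "\<dots> \<le> ennreal (K * E) * ennreal (C * hgt w powr (- c))" by (rule mult_left_mono[OF C(2)[OF w]]) simp
    also have "\<dots> = ennreal (K * E * C * hgt w powr (- c))"
      using K E C(1) by (simp add: ennreal_mult[symmetric] mult.assoc)
    finally show ?thesis .
  qed
  then show ?thesis using K E C(1) by (intro exI[of _ "K * E * C"]) auto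
qed

text \<open>The device that converts spare powers of |g| into powers of its norm and of the height;
  it is applied with \<theta> = q - p and with \<theta> = 1 - p / q.\<close>

lemma holomorphic_power_bound:
  assumes \<alpha>: "\<alpha> > -1" and p: "p \<ge> 1"
  shows "\<exists>C>0. \<forall>g\<in>H_infinity. \<forall>w\<in>ball (0::complex ^ 'n) 1. \<forall>\<theta>\<ge>0.
    norm (g w) powr \<theta> \<le> (C * hgt w powr (- (real CARD('n) + 1 + \<alpha>)) * enn2real (qint p \<alpha> g)) powr (\<theta> / p)"
proof -
  obtain C where C: "C > 0" "\<And>g z. g \<in> H_infinity \<Longrightarrow> z \<in> ball (0::complex ^ 'n) 1 \<Longrightarrow>
    ennreal (norm (g z) powr p) \<le> ennreal (C * hgt z powr (- (real CARD('n) + 1 + \<alpha>))) * qint p \<alpha> g"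
    using holomorphic_pointwise[OF \<alpha> p, where 'n='n] by blast
  have "norm (g w) powr \<theta> \<le> (C * hgt w powr (- (real CARD('n) + 1 + \<alpha>)) * enn2real (qint p \<alpha> g)) powr (\<theta> / p)"
    if g: "g \<in> H_infinity" and w: "w \<in> ball 0 1" and \<theta>: "\<theta> \<ge> 0" for g \<theta> and w :: "complex ^ 'n"
  proof -
    have fin: "qint p \<alpha> g < \<infinity>" using qint_H_infinity_finite[OF g \<alpha>] p by simp
    then have "qint p \<alpha> g = ennreal (enn2real (qint p \<alpha> g))" by simp
    then have "ennreal (norm (g w) powr p) \<le> ennreal (C * hgt w powr (- (real CARD('n) + 1 + \<alpha>))) * ennreal (enn2real (qint p \<alpha> g))"
      using C(2)[OF g w] by simp
    also have "\<dots> = ennreal (C * hgt w powr (- (real CARD('n) + 1 + \<alpha>)) * enn2real (qint p \<alpha> g))"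
      by (rule ennreal_mult[symmetric]) (use C in auto)
    finally have le: "norm (g w) powr p \<le> C * hgt w powr (- (real CARD('n) + 1 + \<alpha>)) * enn2real (qint p \<alpha> g)"
      by (subst (asm) ennreal_le_iff) (use C in auto)
    have "norm (g w) powr \<theta> = (norm (g w) powr p) powr (\<theta> / p)" using p by (simp add: powr_powr)
    also have "\<dots> \<le> (C * hgt w powr (- (real CARD('n) + 1 + \<alpha>)) * enn2real (qint p \<alpha> g)) powr (\<theta> / p)"
      using le \<theta> p by (intro powr_mono2) auto
    finally show ?thesis .
  qed
  then show ?thesis using C by blast
qed

text \<open>|g|^q is replaced by its weighted average and, after Fubini, the integral over z is
  estimated from the local bounds on f2. The surplus |g|^(q - p) is then traded for the norm, and
  the powers of the height collapse to \<alpha>.\<close>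

lemma carleson_embedding:
  fixes f2 :: "complex ^ 'n \<Rightarrow> complex"
  assumes p: "1 < p" "p \<le> q" and \<alpha>: "\<alpha> > -1" and \<beta>: "\<beta> > -1" and R: "R > 1"
    and \<gamma>: "\<gamma> = (real CARD('n) + 1 + \<beta>) / q - (real CARD('n) + 1 + \<alpha>) / p"
    and fm[measurable]: "f2 \<in> borel_measurable Lb" and E: "E \<ge> 0"
    and loc: "\<And>u. u \<in> ball 0 1 \<Longrightarrow> (\<integral>\<^sup>+z. ennreal (indicator (bset R u) z * norm (f2 z) powr q) \<partial>Lb) \<le> ennreal (E * hgt u powr (real CARD('n) + 1 - q * \<gamma>))"
  shows "\<exists>C\<ge>0. \<forall>g\<in>H_infinity. qint q \<beta> (\<lambda>z. f2 z * g z) \<le> ennreal (C * enn2real (qint p \<alpha> g) powr (q / p))"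
proof -
  define N where "N = real CARD('n) + 1"
  define A where "A = N + \<alpha>"
  have N: "N > 0" by (simp add: N_def)
  have A: "A > 0" using \<alpha> by (simp add: A_def N_def)
  have q: "q > 1" "q \<ge> 1" using p by auto
  \<comment> \<open>These generous exponents guarantee that \<beta> + c - q \<gamma> exceeds -1 and
    that c3 is positive, whatever the sign of \<gamma>.\<close>
  define c where "c = 1 + \<bar>q * \<gamma>\<bar>"
  define b where "b = \<bar>\<beta>\<bar> + \<bar>q * \<gamma>\<bar> + 1"
  have c0: "c > 0" and b0: "b > -1" by (auto simp: c_def b_def)
  define c3 where "c3 = b - \<beta> + q * \<gamma>"
  have c3: "c3 > 0" by (auto simp: c3_def b_def)
  define \<kappa> where "\<kappa> = N + b + c"
  have \<kappa>0: "\<kappa> > 0" using N by (simp add: \<kappa>_def b_def c_def)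
  obtain C1 where C1: "C1 > 0" "\<And>g z. g \<in> H_infinity \<Longrightarrow> z \<in> ball (0::complex ^ 'n) 1 \<Longrightarrow>
    ennreal (norm (g z) powr q) \<le> ennreal C1 *
      (\<integral>\<^sup>+w. ennreal (hgt z powr c * (hgt w powr b * kdis z w powr (- \<kappa>)) * norm (g w) powr q) \<partial>Lb)"
    using holomorphic_submean[OF b0 c0 q(2), where 'n='n] unfolding \<kappa>_def N_def by blast
  obtain C2 where C2: "C2 \<ge> 0" "\<And>w. w \<in> ball (0::complex ^ 'n) 1 \<Longrightarrow>
    (\<integral>\<^sup>+z. ennreal (norm (f2 z) powr q * hgt z powr (\<beta> + c) * kdis z w powr (- \<kappa>)) \<partial>Lb) \<le> ennreal (C2 * hgt w powr (- c3))"
  proof -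
    have "\<exists>C\<ge>0. \<forall>w\<in>ball (0::complex ^ 'n) 1. (\<integral>\<^sup>+z. ennreal (norm (f2 z) powr q * hgt z powr (\<beta> + c) * kdis z w powr (- \<kappa>)) \<partial>Lb) \<le> ennreal (C * hgt w powr (- c3))"
    proof (rule local_bound_integral[OF R _ _ E loc _ c3])
      show "-1 < \<beta> + c - (real CARD('n) + 1) + (real CARD('n) + 1 - q * \<gamma>)" using \<beta> by (simp add: c_def)
      show "\<kappa> = \<beta> + c + (real CARD('n) + 1 - q * \<gamma>) + c3" by (simp add: \<kappa>_def N_def c3_def)
    qed (use \<kappa>0 in auto)
    then show ?thesis using that by blast
  qed
  obtain C3 where C3: "C3 > 0" "\<And>g w \<theta>. g \<in> H_infinity \<Longrightarrow> w \<in> ball (0::complex ^ 'n) 1 \<Longrightarrow> \<theta> \<ge> 0 \<Longrightarrow>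
    norm (g w) powr \<theta> \<le> (C3 * hgt w powr (- A) * enn2real (qint p \<alpha> g)) powr (\<theta> / p)"
    using holomorphic_power_bound[OF \<alpha>, of p, where 'n='n] p unfolding A_def N_def by auto
  have [measurable]: "(\<lambda>x. x) \<in> borel_measurable (Lb :: (complex ^ 'n) measure)" by (rule measurable_Lb_id)
  define D where "D = C1 * C2 * C3 powr ((q - p) / p)"
  have D: "D \<ge> 0" using C1 C2 by (simp add: D_def)
  have "qint q \<beta> (\<lambda>z. f2 z * g z) \<le> ennreal (D * enn2real (qint p \<alpha> g) powr (q / p))" if g: "g \<in> H_infinity" for g :: "complex ^ 'n \<Rightarrow> complex"
  proof -
    have [measurable]: "g \<in> borel_measurable Lb" by (rule H_infinity_measurable[OF g])
    define P where "P = enn2real (qint p \<alpha> g)"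
    have P: "P \<ge> 0" "qint p \<alpha> g = ennreal P"
      using qint_H_infinity_finite[OF g \<alpha>, of p] p by (auto simp: P_def)
    have "qint q \<beta> (\<lambda>z. f2 z * g z) \<le> (\<integral>\<^sup>+z. (\<integral>\<^sup>+w. ennreal (C1 * (norm (f2 z) powr q * hgt z powr (\<beta> + c) * kdis z w powr (- \<kappa>)) * (hgt w powr b * norm (g w) powr q)) \<partial>Lb) \<partial>Lb)"
      unfolding qint_def
    proof (rule nn_integral_mono)
      fix z :: "complex ^ 'n" assume "z \<in> space Lb"
      then have z: "z \<in> ball 0 1" by simp
      define B where "B = norm (f2 z) powr q * hgt z powr \<beta>"
      have B: "B \<ge> 0" by (simp add: B_def)
      have "ennreal (norm (f2 z * g z) powr q * hgt z powr \<beta>) = ennreal B * ennreal (norm (g z) powr q)"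
        by (simp add: B_def norm_mult powr_mult ennreal_mult[symmetric] mult_ac)
      also have "\<dots> \<le> ennreal B * (ennreal C1 * (\<integral>\<^sup>+w. ennreal (hgt z powr c * (hgt w powr b * kdis z w powr (- \<kappa>)) * norm (g w) powr q) \<partial>Lb))"
        by (rule mult_left_mono[OF C1(2)[OF g z]]) simp
      also have "\<dots> = ennreal (B * C1) * (\<integral>\<^sup>+w. ennreal (hgt z powr c * (hgt w powr b * kdis z w powr (- \<kappa>)) * norm (g w) powr q) \<partial>Lb)"
        using B C1 by (simp add: ennreal_mult mult.assoc)
      also have "\<dots> = (\<integral>\<^sup>+w. ennreal (B * C1) * ennreal (hgt z powr c * (hgt w powr b * kdis z w powr (- \<kappa>)) * norm (g w) powr q) \<partial>Lb)"
        by (rule nn_integral_cmult[symmetric]) measurable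
      also have "\<dots> = (\<integral>\<^sup>+w. ennreal (C1 * (norm (f2 z) powr q * hgt z powr (\<beta> + c) * kdis z w powr (- \<kappa>)) * (hgt w powr b * norm (g w) powr q)) \<partial>Lb)"
        using B C1 by (intro nn_integral_cong) (simp add: ennreal_mult[symmetric] B_def powr_add mult_ac)
      finally show "ennreal (norm (f2 z * g z) powr q * hgt z powr \<beta>) \<le> (\<integral>\<^sup>+w. ennreal (C1 * (norm (f2 z) powr q * hgt z powr (\<beta> + c) * kdis z w powr (- \<kappa>)) * (hgt w powr b * norm (g w) powr q)) \<partial>Lb)" .
    qed
    also have "\<dots> = (\<integral>\<^sup>+w. (\<integral>\<^sup>+z. ennreal (C1 * (norm (f2 z) powr q * hgt z powr (\<beta> + c) * kdis z w powr (- \<kappa>)) * (hgt w powr b * norm (g w) powr q)) \<partial>Lb) \<partial>Lb)"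
      by (rule Lbp.Fubini') measurable
    also have "\<dots> \<le> (\<integral>\<^sup>+w. ennreal (D * P powr ((q - p) / p)) * ennreal (norm (g w) powr p * hgt w powr \<alpha>) \<partial>Lb)"
    proof (rule nn_integral_mono)
      fix w :: "complex ^ 'n" assume "w \<in> space Lb"
      then have w: "w \<in> ball 0 1" by simp
      have hw: "hgt w > 0" by (rule hgt_pos[OF w])
      define B where "B = C1 * (hgt w powr b * norm (g w) powr q)"
      have B: "B \<ge> 0" using C1 by (simp add: B_def)
      have "(\<integral>\<^sup>+z. ennreal (C1 * (norm (f2 z) powr q * hgt z powr (\<beta> + c) * kdis z w powr (- \<kappa>)) * (hgt w powr b * norm (g w) powr q)) \<partial>Lb)
        = (\<integral>\<^sup>+z. ennreal B * ennreal (norm (f2 z) powr q * hgt z powr (\<beta> + c) * kdis z w powr (- \<kappa>)) \<partial>Lb)"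
        using B by (intro nn_integral_cong) (simp add: ennreal_mult[symmetric] B_def mult_ac)
      also have "\<dots> = ennreal B * (\<integral>\<^sup>+z. ennreal (norm (f2 z) powr q * hgt z powr (\<beta> + c) * kdis z w powr (- \<kappa>)) \<partial>Lb)"
        by (rule nn_integral_cmult) measurable
      also have "\<dots> \<le> ennreal B * ennreal (C2 * hgt w powr (- c3))" by (rule mult_left_mono[OF C2(2)[OF w]]) simp
      also have "\<dots> = ennreal (B * (C2 * hgt w powr (- c3)))" by (rule ennreal_mult[symmetric]) (use B C2 in auto)
      also have "\<dots> \<le> ennreal (D * P powr ((q - p) / p) * (norm (g w) powr p * hgt w powr \<alpha>))"
      proof (rule ennreal_leI)
        have gq: "norm (g w) powr q \<le> norm (g w) powr p * (C3 powr ((q - p) / p) * hgt w powr (- A * ((q - p) / p)) * P powr ((q - p) / p))"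
        proof -
          have "norm (g w) powr q = norm (g w) powr p * norm (g w) powr (q - p)" by (simp add: powr_add[symmetric])
          also have "\<dots> \<le> norm (g w) powr p * (C3 * hgt w powr (- A) * P) powr ((q - p) / p)"
            using C3(2)[OF g w, of "q - p"] p by (intro mult_left_mono) (auto simp: P_def)
          also have "(C3 * hgt w powr (- A) * P) powr ((q - p) / p) = C3 powr ((q - p) / p) * hgt w powr (- A * ((q - p) / p)) * P powr ((q - p) / p)"
            using C3(1) P by (simp add: powr_mult powr_powr)
          finally show ?thesis .
        qed
        \<comment> \<open>Here the definition of \<gamma> is used: it is the value for which exactly
          the weight \<alpha> remains.\<close>
        have ex: "b + - A * ((q - p) / p) + - c3 = \<alpha>"
        proof -
          have "q * \<gamma> = N + \<beta> - q * A / p" using p unfolding \<gamma> A_def N_def by (simp add: field_simps)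
          moreover have "- A * ((q - p) / p) = A - q * A / p" using p by (simp add: field_simps)
          ultimately have "b + - A * ((q - p) / p) + - c3 = b + (A - q * A / p) + - (b - \<beta> + (N + \<beta> - q * A / p))"
            by (simp only: c3_def)
          then show ?thesis by (simp add: A_def)
        qed
        have "B * (C2 * hgt w powr (- c3)) = C1 * C2 * (hgt w powr b * hgt w powr (- c3)) * norm (g w) powr q" by (simp add: B_def mult_ac)
        also have "\<dots> \<le> C1 * C2 * (hgt w powr b * hgt w powr (- c3)) * (norm (g w) powr p * (C3 powr ((q - p) / p) * hgt w powr (- A * ((q - p) / p)) * P powr ((q - p) / p)))"
          using C1 C2 by (intro mult_left_mono gq) auto
        also have "\<dots> = D * P powr ((q - p) / p) * (norm (g w) powr p * (hgt w powr b * hgt w powr (- A * ((q - p) / p)) * hgt w powr (- c3)))"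
          unfolding D_def by (simp only: mult_ac)
        also have "hgt w powr b * hgt w powr (- A * ((q - p) / p)) * hgt w powr (- c3) = hgt w powr \<alpha>"
          unfolding powr_add[symmetric] ex ..
        finally show "B * (C2 * hgt w powr (- c3)) \<le> D * P powr ((q - p) / p) * (norm (g w) powr p * hgt w powr \<alpha>)" .
      qed
      also have "\<dots> = ennreal (D * P powr ((q - p) / p)) * ennreal (norm (g w) powr p * hgt w powr \<alpha>)"
        by (rule ennreal_mult) (use D in auto)
      finally show "(\<integral>\<^sup>+z. ennreal (C1 * (norm (f2 z) powr q * hgt z powr (\<beta> + c) * kdis z w powr (- \<kappa>)) * (hgt w powr b * norm (g w) powr q)) \<partial>Lb)
        \<le> ennreal (D * P powr ((q - p) / p)) * ennreal (norm (g w) powr p * hgt w powr \<alpha>)" .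
    qed
    also have "\<dots> = ennreal (D * P powr ((q - p) / p)) * qint p \<alpha> g" unfolding qint_def by (rule nn_integral_cmult) measurable
    also have "\<dots> = ennreal (D * P powr ((q - p) / p) * P)" unfolding P(2) by (rule ennreal_mult[symmetric]) (use D P in auto)
    also have "D * P powr ((q - p) / p) * P = D * P powr (q / p)"
    proof (cases "P = 0")
      case False
      have "q / p = (q - p) / p + 1" using p by (simp add: field_simps)
      then have "P powr (q / p) = P powr ((q - p) / p) * P powr 1" by (simp only: powr_add)
      then show ?thesis using False P by (simp add: mult.assoc)
    qed simp
    finally show ?thesis by (simp add: P_def)
  qed
  then show ?thesis using D by blast
qed

section \<open>The operator with large exponent and the reduction to it\<close>

lemma Hk_measurable:
  fixes f g :: "complex ^ 'n \<Rightarrow> complex"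
  assumes [measurable]: "f \<in> borel_measurable Lb" "g \<in> borel_measurable Lb"
  shows "Hk b f g \<in> borel_measurable Lb"
  unfolding Hk_def[abs_def] by measurable

text \<open>Reproduction of g gives f g - P_b (f g) = (f - F) g + T, where T z integrates (F z - f
  w) g against the kernel. Inserting F w splits the integrand of T: one part is bounded by the
  growth of the oscillation of F, the other is the projection of (f - F) g. Each falls to Schur's
  test, with target weight \<beta> and source weights \<alpha> and \<beta> respectively.\<close>

lemma kernel_operator_estimate:
  fixes f F :: "complex ^ 'n \<Rightarrow> complex"
  assumes p: "1 < p" "p \<le> q" and \<alpha>: "\<alpha> > -1" and \<beta>: "\<beta> > -1" and R1: "R1 > 1"
    and \<gamma>: "\<gamma> = (real CARD('n) + 1 + \<beta>) / q - (real CARD('n) + 1 + \<alpha>) / p"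
    and fm[measurable]: "f \<in> borel_measurable Lb" and ff: "qint q \<beta> f < \<infinity>"
    and Fm[measurable]: "F \<in> borel_measurable Lb"
    and C0: "C0 \<ge> 0" and osc: "\<And>z u. z \<in> ball 0 1 \<Longrightarrow> u \<in> bset R1 z \<Longrightarrow> norm (F u - F z) \<le> C0 * hgt z powr (- \<gamma>)"
    and E: "E \<ge> 0" and loc: "\<And>u. u \<in> ball 0 1 \<Longrightarrow>
      (\<integral>\<^sup>+z. ennreal (indicator (bset R1 u) z * norm (f z - F z) powr q) \<partial>Lb) \<le> ennreal (E * hgt u powr (real CARD('n) + 1 - q * \<gamma>))"
  shows "\<exists>b>\<beta>. \<exists>C\<ge>0. \<forall>g\<in>H_infinity. qint q \<beta> (Hk b f g) \<le> ennreal (C * enn2real (qint p \<alpha> g) powr (q / p))"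
proof -
  define N where "N = real CARD('n) + 1"
  define A where "A = N + \<alpha>"
  have N: "N \<ge> 1" by (simp add: N_def)
  have A: "A > 0" using \<alpha> N by (simp add: A_def)
  have q: "q > 1" "q \<ge> 1" "q \<ge> 0" using p by auto
  \<comment> \<open>By p \<le> q the dimensional terms n / q - n / p are nonpositive, and \<alpha> >
    -1 makes the inequality strict.\<close>
  have \<gamma>lt: "\<gamma> < (1 + \<beta>) / q"
  proof -
    have "(N - 1) / q \<le> (N - 1) / p" using p N by (intro divide_left_mono) auto
    moreover have "(1 + \<alpha>) / p > 0" using \<alpha> p by simp
    moreover have "\<gamma> = (1 + \<beta>) / q + (N - 1) / q - (N - 1) / p - (1 + \<alpha>) / p"
      unfolding \<gamma> N_def by (simp add: add_divide_distrib)
    ultimately show ?thesis by linarith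
  qed
  \<comment> \<open>The lower bounds are those of \<open>oscillation_growth\<close>; the upper bound
    makes the weight with exponent \<beta> - q e integrable, as Schur's test requires.\<close>
  obtain e where e: "e > max \<gamma> 0" "e < (1 + \<beta>) / q"
  proof -
    have "max \<gamma> 0 < (1 + \<beta>) / q" using \<gamma>lt \<beta> q by simp
    then show ?thesis using that dense by blast
  qed
  then have e0: "e > 0" "e > \<gamma>" by auto
  \<comment> \<open>The power of the height lost when |g|^(1 - p / q) is replaced by its growth
    bound.\<close>
  define \<delta> where "\<delta> = A * (1 / p - 1 / q)"
  have \<delta>: "\<delta> \<ge> 0" unfolding \<delta>_def using A p by (intro mult_nonneg_nonneg) (auto simp: field_simps)
  define b where "b = \<bar>\<beta>\<bar> + \<bar>\<alpha>\<bar> + 1 + e + \<delta> + 1"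
  have b: "b > \<beta>" "b > -1" using e0 \<delta> by (auto simp: b_def)
  define J where "J = wt_mass TYPE('n) b"
  have J: "J > 0" unfolding J_def by (rule wt_mass_pos[OF b(2)])
  obtain Cg where Cg: "Cg \<ge> 0" "\<And>z w. z \<in> ball 0 1 \<Longrightarrow> w \<in> ball 0 1 \<Longrightarrow>
    norm (F z - F w) \<le> Cg * kdis z w powr (2 * e - \<gamma>) * hgt z powr (- e) * hgt w powr (- e)"
    using oscillation_growth[OF R1 e0 C0 osc] by blast
  define f2 where "f2 z = f z - F z" for z
  have [measurable]: "f2 \<in> borel_measurable Lb" unfolding f2_def by measurable
  obtain C2 where C2: "C2 \<ge> 0" "\<And>g. g \<in> H_infinity \<Longrightarrow> qint q \<beta> (\<lambda>z. f2 z * g z) \<le> ennreal (C2 * enn2real (qint p \<alpha> g) powr (q / p))"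
    using carleson_embedding[OF p \<alpha> \<beta> R1 \<gamma> _ E, of f2] loc unfolding f2_def by auto
  obtain C3 where C3: "C3 > 0" "\<And>g w \<theta>. g \<in> H_infinity \<Longrightarrow> w \<in> ball (0::complex ^ 'n) 1 \<Longrightarrow> \<theta> \<ge> 0 \<Longrightarrow>
    norm (g w) powr \<theta> \<le> (C3 * hgt w powr (- A) * enn2real (qint p \<alpha> g)) powr (\<theta> / p)"
    using holomorphic_power_bound[OF \<alpha>, of p, where 'n='n] p unfolding A_def N_def by auto
  define y where "y = b - e - \<delta>"
  define \<kappa>1 where "\<kappa>1 = real CARD('n) + 1 + - e + y + (\<beta> - \<alpha>) / q"
  define \<kappa>2 where "\<kappa>2 = real CARD('n) + 1 + 0 + b + (\<beta> - \<beta>) / q"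
  \<comment> \<open>The exponent prescribed by Schur's test coincides with N + b from the kernel
    less the 2 e - \<gamma> gained from the oscillation; this is again the definition of
    \<gamma>.\<close>
  have \<kappa>1: "\<kappa>1 = N + b - 2 * e + \<gamma>"
    unfolding \<kappa>1_def y_def \<delta>_def A_def N_def \<gamma> by (simp add: add_divide_distrib diff_divide_distrib algebra_simps)
  obtain S1 where S1: "S1 > 0" "\<And>h T. h \<in> borel_measurable (Lb :: (complex ^ 'n) measure) \<Longrightarrow> (\<forall>w\<in>ball 0 1. h w \<ge> 0) \<Longrightarrow>
    (\<forall>z\<in>ball 0 1. T z \<ge> 0 \<and> ennreal (T z) \<le> (\<integral>\<^sup>+w. ennreal (hgt z powr (- e) * hgt w powr y * kdis z w powr (- \<kappa>1) * h w) \<partial>Lb)) \<Longrightarrow>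
    (\<integral>\<^sup>+z. ennreal (T z powr q * hgt z powr \<beta>) \<partial>Lb) \<le> ennreal S1 * (\<integral>\<^sup>+w. ennreal (h w powr q * hgt w powr \<alpha>) \<partial>Lb)"
  proof -
    have 1: "q * - e + \<beta> > -1" using e(2) q by (simp add: field_simps)
    have "\<alpha> + 1 < 1 * (y + 1)" by (simp add: y_def b_def)
    also have "\<dots> \<le> q * (y + 1)" using q by (intro mult_right_mono) (auto simp: y_def b_def)
    finally have 2: "q * (y + 1) > \<alpha> + 1" .
    show ?thesis using schur_test[OF q(1) 1 2, where 'n='n] that unfolding \<kappa>1_def by blast
  qed
  obtain S2 where S2: "S2 > 0" "\<And>h T. h \<in> borel_measurable (Lb :: (complex ^ 'n) measure) \<Longrightarrow> (\<forall>w\<in>ball 0 1. h w \<ge> 0) \<Longrightarrow>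
    (\<forall>z\<in>ball 0 1. T z \<ge> 0 \<and> ennreal (T z) \<le> (\<integral>\<^sup>+w. ennreal (hgt z powr 0 * hgt w powr b * kdis z w powr (- \<kappa>2) * h w) \<partial>Lb)) \<Longrightarrow>
    (\<integral>\<^sup>+z. ennreal (T z powr q * hgt z powr \<beta>) \<partial>Lb) \<le> ennreal S2 * (\<integral>\<^sup>+w. ennreal (h w powr q * hgt w powr \<beta>) \<partial>Lb)"
  proof -
    have 1: "q * 0 + \<beta> > -1" using \<beta> by simp
    have "\<beta> + 1 < 1 * (b + 1)" using b by simp
    also have "\<dots> \<le> q * (b + 1)" using q b by (intro mult_right_mono) auto
    finally have 2: "q * (b + 1) > \<beta> + 1" .
    show ?thesis using schur_test[OF q(1) 1 2, where 'n='n] that unfolding \<kappa>2_def by blast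
  qed
  have [measurable]: "(\<lambda>x. x) \<in> borel_measurable (Lb :: (complex ^ 'n) measure)" by (rule measurable_Lb_id)
  define D1 where "D1 = S1 * ((Cg / J) powr q * C3 powr ((q - p) / p))"
  define D2 where "D2 = S2 * ((1 / J) powr q * C2)"
  define D where "D = 2 powr q * (C2 + 2 powr q * (D1 + D2))"
  have DD: "D1 \<ge> 0" "D2 \<ge> 0" using S1 S2 C2 by (auto simp: D1_def D2_def)
  have D: "D \<ge> 0" using DD C2 by (simp add: D_def)
  have "qint q \<beta> (Hk b f g) \<le> ennreal (D * enn2real (qint p \<alpha> g) powr (q / p))" if g: "g \<in> H_infinity" for g :: "complex ^ 'n \<Rightarrow> complex"
  proof -
    have gm[measurable]: "g \<in> borel_measurable Lb" by (rule H_infinity_measurable[OF g])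
    obtain Bg where Bg: "\<And>w. w \<in> ball 0 1 \<Longrightarrow> norm (g w) \<le> Bg" using H_infinity_bound[OF g] by blast
    define P where "P = enn2real (qint p \<alpha> g)"
    have P: "P \<ge> 0" "qint p \<alpha> g = ennreal P"
      using qint_H_infinity_finite[OF g \<alpha>, of p] p by (auto simp: P_def)
    define T where "T z = F z * g z - Pj b (\<lambda>w. f w * g w) z" for z
    have [measurable]: "T \<in> borel_measurable Lb" unfolding T_def by measurable
    \<comment> \<open>Only the power p / q of |g| is kept, so that the L^q estimate of Schur's test
      returns the p-th power integral of g.\<close>
    define h1 where "h1 w = Cg / J * ((C3 * P) powr ((1 - p / q) / p) * norm (g w) powr (p / q))" for w
    define h2 where "h2 w = norm (f2 w * g w) / J" for w
    have [measurable]: "h1 \<in> borel_measurable Lb" "h2 \<in> borel_measurable Lb" unfolding h1_def h2_def by measurable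
    have h0: "h1 w \<ge> 0" "h2 w \<ge> 0" for w using Cg J by (auto simp: h1_def h2_def)
    define U1 where "U1 z = (\<integral>\<^sup>+w. ennreal (hgt z powr (- e) * hgt w powr y * kdis z w powr (- \<kappa>1) * h1 w) \<partial>Lb)" for z
    define U2 where "U2 z = (\<integral>\<^sup>+w. ennreal (hgt z powr 0 * hgt w powr b * kdis z w powr (- \<kappa>2) * h2 w) \<partial>Lb)" for z
    have [measurable]: "U1 \<in> borel_measurable Lb" unfolding U1_def by (rule Lb.borel_measurable_nn_integral) measurable
    have [measurable]: "U2 \<in> borel_measurable Lb" unfolding U2_def by (rule Lb.borel_measurable_nn_integral) measurable
    have TU: "ennreal (norm (T z)) \<le> U1 z + U2 z" if z: "z \<in> ball 0 1" for z
    proof -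
      have i1: "integrable Lb (\<lambda>w. g w * kern b z w * of_real (hgt w powr b))"
        by (rule kern_integrable_qint(1)[OF gm q(2) \<beta> _ z]) (use b qint_H_infinity_finite[OF g \<beta>, of q] q in auto)
      have i2: "integrable Lb (\<lambda>w. (f w * g w) * kern b z w * of_real (hgt w powr b))"
        by (rule kern_integrable_qint(1)[OF _ q(2) \<beta> _ z qint_mult_bounded[OF fm Bg _ ff]]) (use b q in auto)
      have "T z = F z * Pj b g z - Pj b (\<lambda>w. f w * g w) z" unfolding T_def Pj_reproducing[OF g b(2) z] ..
      also have "\<dots> = ((LINT w|Lb. F z * (g w * kern b z w * of_real (hgt w powr b))) - (LINT w|Lb. (f w * g w) * kern b z w * of_real (hgt w powr b))) / of_real J"
        unfolding Pj_def J_def by (simp add: diff_divide_distrib)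
      also have "\<dots> = (LINT w|Lb. F z * (g w * kern b z w * of_real (hgt w powr b)) - (f w * g w) * kern b z w * of_real (hgt w powr b)) / of_real J"
        using i1 i2 by simp
      also have "\<dots> = (LINT w|Lb. (F z - f w) * g w * kern b z w * of_real (hgt w powr b) / of_real J)"
        by (simp add: left_diff_distrib mult.assoc)
      finally have Tz: "T z = (LINT w|Lb. (F z - f w) * g w * kern b z w * of_real (hgt w powr b) / of_real J)" .
      have "ennreal (norm (T z)) \<le> (\<integral>\<^sup>+w. ennreal (norm ((F z - f w) * g w * kern b z w * of_real (hgt w powr b) / of_real J)) \<partial>Lb)"
        unfolding Tz by (rule ennreal_norm_integral_le)
      also have "\<dots> \<le> (\<integral>\<^sup>+w. ennreal (hgt z powr (- e) * hgt w powr y * kdis z w powr (- \<kappa>1) * h1 w) + ennreal (hgt z powr 0 * hgt w powr b * kdis z w powr (- \<kappa>2) * h2 w) \<partial>Lb)"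
      proof (rule nn_integral_mono)
        fix w :: "complex ^ 'n" assume "w \<in> space Lb"
        then have w: "w \<in> ball 0 1" by simp
        have hw: "hgt w > 0" and hz: "hgt z > 0" using hgt_pos w z by auto
        define k where "k = kdis z w powr (- (N + b)) * hgt w powr b / J"
        have k: "k \<ge> 0" using J by (simp add: k_def)
        have nk: "norm (kern b z w) = kdis z w powr (- (N + b))" using norm_kern[OF z w, of b] by (simp add: N_def)
        have "norm ((F z - f w) * g w * kern b z w * of_real (hgt w powr b) / of_real J) = norm (F z - f w) * norm (g w) * k"
          using J by (simp add: norm_mult norm_divide k_def nk)
        also have "norm (F z - f w) \<le> norm (F z - F w) + norm (f2 w)"
          unfolding f2_def using norm_triangle_ineq4[of "F z - F w" "f w - F w"] by simp
        finally have le: "norm ((F z - f w) * g w * kern b z w * of_real (hgt w powr b) / of_real J) \<le> norm (F z - F w) * norm (g w) * k + norm (f2 w) * norm (g w) * k"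
          using k by (simp add: distrib_right mult_right_mono)
        have gw: "norm (g w) \<le> (C3 * P) powr ((1 - p / q) / p) * hgt w powr (- \<delta>) * norm (g w) powr (p / q)"
        proof (cases "g w = 0")
          case False
          have "norm (g w) = norm (g w) powr (1 - p / q) * norm (g w) powr (p / q)" using False by (simp add: powr_add[symmetric])
          also have "\<dots> \<le> (C3 * hgt w powr (- A) * P) powr ((1 - p / q) / p) * norm (g w) powr (p / q)"
            using C3(2)[OF g w, of "1 - p / q"] p by (intro mult_right_mono) (auto simp: P_def)
          also have "(C3 * hgt w powr (- A) * P) powr ((1 - p / q) / p) = (C3 * P) powr ((1 - p / q) / p) * hgt w powr (- A * ((1 - p / q) / p))"
            using C3(1) P by (simp add: powr_mult powr_powr mult_ac)
          also have "- A * ((1 - p / q) / p) = - \<delta>" using p by (simp add: \<delta>_def field_simps)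
          finally show ?thesis .
        qed simp
        have "norm (F z - F w) * norm (g w) * k \<le>
          (Cg * kdis z w powr (2 * e - \<gamma>) * hgt z powr (- e) * hgt w powr (- e)) * ((C3 * P) powr ((1 - p / q) / p) * hgt w powr (- \<delta>) * norm (g w) powr (p / q)) * k"
          using Cg(1) k by (intro mult_right_mono mult_mono Cg(2) gw z w) auto
        also have "\<dots> = hgt z powr (- e) * (hgt w powr (- e) * hgt w powr (- \<delta>) * hgt w powr b) * (kdis z w powr (2 * e - \<gamma>) * kdis z w powr (- (N + b))) * h1 w"
          by (simp add: k_def h1_def mult_ac)
        also have "hgt w powr (- e) * hgt w powr (- \<delta>) * hgt w powr b = hgt w powr y" by (simp add: powr_add[symmetric] y_def algebra_simps)
        also have "kdis z w powr (2 * e - \<gamma>) * kdis z w powr (- (N + b)) = kdis z w powr (- \<kappa>1)" by (simp add: powr_add[symmetric] \<kappa>1 algebra_simps)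
        finally have a1: "norm (F z - F w) * norm (g w) * k \<le> hgt z powr (- e) * hgt w powr y * kdis z w powr (- \<kappa>1) * h1 w" .
        have a2: "norm (f2 w) * norm (g w) * k = hgt z powr 0 * hgt w powr b * kdis z w powr (- \<kappa>2) * h2 w"
          using hz by (simp add: k_def h2_def \<kappa>2_def N_def norm_mult mult_ac)
        show "ennreal (norm ((F z - f w) * g w * kern b z w * of_real (hgt w powr b) / of_real J)) \<le>
          ennreal (hgt z powr (- e) * hgt w powr y * kdis z w powr (- \<kappa>1) * h1 w) + ennreal (hgt z powr 0 * hgt w powr b * kdis z w powr (- \<kappa>2) * h2 w)"
        proof -
          have "norm ((F z - f w) * g w * kern b z w * of_real (hgt w powr b) / of_real J) \<le>
            hgt z powr (- e) * hgt w powr y * kdis z w powr (- \<kappa>1) * h1 w + hgt z powr 0 * hgt w powr b * kdis z w powr (- \<kappa>2) * h2 w"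
            using le a1 a2 by linarith
          then have "ennreal (norm ((F z - f w) * g w * kern b z w * of_real (hgt w powr b) / of_real J)) \<le>
            ennreal (hgt z powr (- e) * hgt w powr y * kdis z w powr (- \<kappa>1) * h1 w + hgt z powr 0 * hgt w powr b * kdis z w powr (- \<kappa>2) * h2 w)"
            by (rule ennreal_leI)
          also have "\<dots> = ennreal (hgt z powr (- e) * hgt w powr y * kdis z w powr (- \<kappa>1) * h1 w) + ennreal (hgt z powr 0 * hgt w powr b * kdis z w powr (- \<kappa>2) * h2 w)"
            using h0 by (intro ennreal_plus mult_nonneg_nonneg) auto
          finally show ?thesis .
        qed
      qed
      also have "\<dots> = U1 z + U2 z" unfolding U1_def U2_def by (rule nn_integral_add) measurable
      finally show ?thesis .
    qed
    \<comment> \<open>The integrals \<open>U1\<close> and \<open>U2\<close> might be infinite,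
      whereas Schur's test asks for real functions. Truncation at |T z| makes them finite, and the
      sum still dominates |T|.\<close>
    define T1 where "T1 z = enn2real (min (ennreal (norm (T z))) (U1 z))" for z
    define T2 where "T2 z = enn2real (min (ennreal (norm (T z))) (U2 z))" for z
    have [measurable]: "T1 \<in> borel_measurable Lb" "T2 \<in> borel_measurable Lb" unfolding T1_def T2_def by measurable
    have eT1: "ennreal (T1 z) = min (ennreal (norm (T z))) (U1 z)" and eT2: "ennreal (T2 z) = min (ennreal (norm (T z))) (U2 z)" for z
      unfolding T1_def T2_def by (auto intro!: ennreal_enn2real simp: min_less_iff_disj)
    have T0: "T1 z \<ge> 0" "T2 z \<ge> 0" for z by (auto simp: T1_def T2_def)
    have T12: "norm (T z) \<le> T1 z + T2 z" if z: "z \<in> ball 0 1" for z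
    proof -
      have "ennreal (norm (T z)) \<le> ennreal (T1 z) + ennreal (T2 z)"
        unfolding eT1 eT2 using TU[OF z] by (auto simp: min_def add_increasing add_increasing2)
      also have "\<dots> = ennreal (T1 z + T2 z)" using T0 by simp
      finally show ?thesis using T0 by (subst (asm) ennreal_le_iff) auto
    qed
    have q1: "qint q \<beta> (\<lambda>z. of_real (T1 z)) \<le> ennreal (D1 * P powr (q / p))"
    proof -
      have "qint q \<beta> (\<lambda>z. of_real (T1 z)) = (\<integral>\<^sup>+z. ennreal (T1 z powr q * hgt z powr \<beta>) \<partial>Lb)"
        unfolding qint_def using T0 by simp
      also have "\<dots> \<le> ennreal S1 * (\<integral>\<^sup>+w. ennreal (h1 w powr q * hgt w powr \<alpha>) \<partial>Lb)"
        by (rule S1(2)) (use h0 T0 eT1 in \<open>auto simp: U1_def[symmetric]\<close>)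
      also have "(\<integral>\<^sup>+w. ennreal (h1 w powr q * hgt w powr \<alpha>) \<partial>Lb) = (\<integral>\<^sup>+w. ennreal ((Cg / J) powr q * (C3 * P) powr ((q - p) / p)) * ennreal (norm (g w) powr p * hgt w powr \<alpha>) \<partial>Lb)"
      proof (rule nn_integral_cong)
        fix w :: "complex ^ 'n"
        have ex: "((1 - p / q) / p) * q = (q - p) / p" "p / q * q = p" using p by (auto simp: field_simps)
        have "h1 w powr q = (Cg / J) powr q * (C3 * P) powr ((q - p) / p) * norm (g w) powr p"
          unfolding h1_def powr_mult[of "Cg / J"] powr_mult[of "(C3 * P) powr _"] powr_powr ex by (simp only: mult_ac)
        then show "ennreal (h1 w powr q * hgt w powr \<alpha>) = ennreal ((Cg / J) powr q * (C3 * P) powr ((q - p) / p)) * ennreal (norm (g w) powr p * hgt w powr \<alpha>)"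
          by (simp add: ennreal_mult[symmetric] mult_ac)
      qed
      also have "\<dots> = ennreal ((Cg / J) powr q * (C3 * P) powr ((q - p) / p)) * qint p \<alpha> g"
        unfolding qint_def by (rule nn_integral_cmult) measurable
      also have "ennreal S1 * \<dots> = ennreal (S1 * ((Cg / J) powr q * (C3 * P) powr ((q - p) / p) * P))"
        unfolding P(2) using S1 P by (simp add: ennreal_mult)
      also have "S1 * ((Cg / J) powr q * (C3 * P) powr ((q - p) / p) * P) = S1 * ((Cg / J) powr q * ((C3 * P) powr ((q - p) / p) * P))"
        by (simp only: mult.assoc)
      also have "(C3 * P) powr ((q - p) / p) * P = C3 powr ((q - p) / p) * P powr (q / p)"
      proof (cases "P = 0")
        case False
        have "q / p = (q - p) / p + 1" using p by (simp add: field_simps)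
        then have "P powr (q / p) = P powr ((q - p) / p) * P powr 1" by (simp only: powr_add)
        then show ?thesis using False P C3 by (simp add: powr_mult)
      qed simp
      finally show ?thesis by (simp add: D1_def mult.assoc)
    qed
    have q2: "qint q \<beta> (\<lambda>z. of_real (T2 z)) \<le> ennreal (D2 * P powr (q / p))"
    proof -
      have "qint q \<beta> (\<lambda>z. of_real (T2 z)) = (\<integral>\<^sup>+z. ennreal (T2 z powr q * hgt z powr \<beta>) \<partial>Lb)"
        unfolding qint_def using T0 by simp
      also have "\<dots> \<le> ennreal S2 * (\<integral>\<^sup>+w. ennreal (h2 w powr q * hgt w powr \<beta>) \<partial>Lb)"
      proof (rule S2(2))
        show "\<forall>z\<in>ball 0 1. T2 z \<ge> 0 \<and> ennreal (T2 z) \<le> (\<integral>\<^sup>+w. ennreal (hgt z powr 0 * hgt w powr b * kdis z w powr (- \<kappa>2) * h2 w) \<partial>Lb)"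
          unfolding U2_def[symmetric] eT2 using T0 by (simp del: powr_zero_eq_one)
      qed (use h0 in auto)
      also have "(\<integral>\<^sup>+w. ennreal (h2 w powr q * hgt w powr \<beta>) \<partial>Lb) = (\<integral>\<^sup>+w. ennreal ((1 / J) powr q) * ennreal (norm (f2 w * g w) powr q * hgt w powr \<beta>) \<partial>Lb)"
        unfolding h2_def using J by (intro nn_integral_cong) (simp add: powr_divide ennreal_mult[symmetric])
      also have "\<dots> = ennreal ((1 / J) powr q) * qint q \<beta> (\<lambda>w. f2 w * g w)" unfolding qint_def by (rule nn_integral_cmult) measurable
      also have "ennreal S2 * (ennreal ((1 / J) powr q) * qint q \<beta> (\<lambda>w. f2 w * g w)) \<le> ennreal S2 * (ennreal ((1 / J) powr q) * ennreal (C2 * P powr (q / p)))"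
        unfolding P_def by (intro mult_left_mono C2(2) g) auto
      also have "\<dots> = ennreal (D2 * P powr (q / p))" using S2 C2 by (simp add: D2_def ennreal_mult mult.assoc)
      finally show ?thesis .
    qed
    have qT: "qint q \<beta> T \<le> ennreal (2 powr q * (D1 + D2) * P powr (q / p))"
    proof -
      have "qint q \<beta> T \<le> ennreal (2 powr q) * (qint q \<beta> (\<lambda>z. complex_of_real (T1 z)) + qint q \<beta> (\<lambda>z. complex_of_real (T2 z)))"
        by (rule qint_add) (use q T12 T0 in auto)
      also have "\<dots> \<le> ennreal (2 powr q) * (ennreal (D1 * P powr (q / p)) + ennreal (D2 * P powr (q / p)))"
        by (intro mult_left_mono add_mono q1 q2) simp
      also have "\<dots> = ennreal (2 powr q * (D1 * P powr (q / p) + D2 * P powr (q / p)))"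
        using DD by (simp add: ennreal_mult)
      finally show ?thesis by (simp add: algebra_simps)
    qed
    have "qint q \<beta> (Hk b f g) \<le> ennreal (2 powr q) * (qint q \<beta> (\<lambda>z. f2 z * g z) + qint q \<beta> T)"
    proof (rule qint_add)
      fix z
      have "Hk b f g z = f2 z * g z + T z" by (simp add: Hk_def f2_def T_def algebra_simps)
      then show "norm (Hk b f g z) \<le> norm (f2 z * g z) + norm (T z)" by (simp add: norm_triangle_ineq)
    qed (use q in auto)
    also have "\<dots> \<le> ennreal (2 powr q) * (ennreal (C2 * P powr (q / p)) + ennreal (2 powr q * (D1 + D2) * P powr (q / p)))"
      unfolding P_def by (intro mult_left_mono add_mono C2(2) g qT[unfolded P_def]) simp
    also have "\<dots> = ennreal (2 powr q * (C2 * P powr (q / p) + 2 powr q * (D1 + D2) * P powr (q / p)))"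
      using DD C2 by (simp add: ennreal_mult)
    also have "2 powr q * (C2 * P powr (q / p) + 2 powr q * (D1 + D2) * P powr (q / p)) = D * P powr (q / p)"
      by (simp add: D_def algebra_simps)
    finally show ?thesis by (simp add: P_def)
  qed
  then show ?thesis using D b(1) by blast
qed

text \<open>The hypothesis compares f near u with the constant \<open>F u\<close>. Overlapping
  Bergman balls turn this into an oscillation bound for F, and then into a comparison of f with the
  varying value \<open>F z\<close>, on balls of the smaller parameter R1. These are the two inputs
  of \<open>kernel_operator_estimate\<close>.\<close>

lemma sufficiency:
  fixes f F :: "complex ^ 'n \<Rightarrow> complex"
  assumes p: "1 < p" "p \<le> q" and \<alpha>: "\<alpha> > -1" and \<beta>: "\<beta> > -1" and R: "R > 1"
    and \<gamma>: "\<gamma> = (real CARD('n) + 1 + \<beta>) / q - (real CARD('n) + 1 + \<alpha>) / p"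
    and fm[measurable]: "f \<in> borel_measurable Lb" and ff: "qint q \<beta> f < \<infinity>"
    and Fm[measurable]: "F \<in> borel_measurable Lb"
    and E: "E \<ge> 0" and loc: "\<And>u. u \<in> ball 0 1 \<Longrightarrow>
      (\<integral>\<^sup>+z. ennreal (indicator (bset R u) z * norm (f z - F u) powr q) \<partial>Lb) \<le> ennreal (E * hgt u powr (real CARD('n) + 1 - q * \<gamma>))"
  shows "\<exists>C\<ge>0. \<forall>g\<in>H_infinity. qint q \<beta> (Hk \<beta> f g) \<le> ennreal (C * enn2real (qint p \<alpha> g) powr (q / p))"
proof -
  define N where "N = real CARD('n) + 1"
  define l where "l = N - q * \<gamma>"
  have q: "q > 1" "q \<ge> 1" "q \<ge> 0" using p by auto
  \<comment> \<open>Solves 2 R1 - 1 = sqrt R, so two steps in balls of parameter R1 stay within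
    parameter R.\<close>
  define R1 where "R1 = (1 + sqrt R) / 2"
  have R1: "R1 > 1" "(2 * R1 - 1)\<^sup>2 \<le> R" using R by (auto simp: R1_def field_simps)
  have R1R: "R1 \<le> R"
  proof -
    have "sqrt R * 1 \<le> sqrt R * sqrt R" using R by (intro mult_left_mono) auto
    then have "sqrt R \<le> R" using R by simp
    then show ?thesis using R by (simp add: R1_def)
  qed
  have sub: "bset R1 z \<subseteq> bset R z" if "z \<in> ball 0 1" for z :: "complex ^ 'n"
  proof
    fix w assume w: "w \<in> bset R1 z"
    then have "(kdis z w)\<^sup>2 < R1 * (hgt z * hgt w)" by (simp add: bset_def)
    also have "\<dots> \<le> R * (hgt z * hgt w)" using R1R hgt_pos[OF that] hgt_pos[OF bset_sub_ball[OF w]] by (intro mult_right_mono) auto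
    finally show "w \<in> bset R z" using bset_sub_ball[OF w] by (simp add: bset_def)
  qed
  obtain c0 where c0: "c0 > 0" "\<And>z. z \<in> ball (0::complex ^ 'n) 1 \<Longrightarrow> c0 * hgt z powr N \<le> measure Lb (bset R1 z)"
    using bset_measure_lower[OF R1(1), where 'n='n] unfolding N_def by blast
  obtain c1 where c1: "c1 > 0" "\<And>z. z \<in> ball (0::complex ^ 'n) 1 \<Longrightarrow> measure Lb (bset R1 z) \<le> c1 * hgt z powr N"
    using bset_measure_upper[of R1, where 'n='n] R1 unfolding N_def by auto
  have [measurable]: "(\<lambda>x. x) \<in> borel_measurable (Lb :: (complex ^ 'n) measure)" by (rule measurable_Lb_id)
  define K where "K = (4 * R1) powr \<bar>l\<bar>"
  have K: "K \<ge> 1" using R1 by (auto simp: K_def intro: ge_one_powr_ge_zero)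
  define C0 where "C0 = (2 powr q * (E + E * K) / c0 * (4 * R1) powr \<bar>N\<bar>) powr (1 / q)"
  have sum2: "norm (x - y) powr q \<le> 2 powr q * (norm (u - x) powr q + norm (u - y) powr q)" for x y u :: complex
  proof -
    have "norm (x - y) \<le> norm (u - x) + norm (u - y)"
      using norm_triangle_ineq4[of "u - y" "u - x"] by simp
    then have "norm (x - y) powr q \<le> (norm (u - x) + norm (u - y)) powr q" using q by (intro powr_mono2) auto
    also have "\<dots> \<le> 2 powr q * (norm (u - x) powr q + norm (u - y) powr q)" using q by (intro powr_add_le) auto
    finally show ?thesis .
  qed
  have osc: "norm (F u - F z) \<le> C0 * hgt z powr (- \<gamma>)" if z: "z \<in> ball 0 1" and u: "u \<in> bset R1 z" for z u
  proof -
    have ub: "u \<in> ball 0 1" using u by (rule bset_sub_ball)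
    have hz: "hgt z > 0" and hu: "hgt u > 0" using hgt_pos z ub by auto
    have zu: "hgt z \<le> 4 * R1 * hgt u" "hgt u \<le> 4 * R1 * hgt z" using bset_hgt_le[OF z u] R1 by auto
    \<comment> \<open>The constant |F u - F z| is averaged over the ball of parameter R1 at u, which
      lies in the balls of parameter R at both u and z, so that both local bounds apply.\<close>
    have "ennreal (norm (F u - F z) powr q * measure Lb (bset R1 u)) = (\<integral>\<^sup>+w. ennreal (norm (F u - F z) powr q) * indicator (bset R1 u) w \<partial>Lb)"
      by (simp add: nn_integral_cmult Lb.emeasure_eq_measure ennreal_mult)
    also have "\<dots> \<le> (\<integral>\<^sup>+w. ennreal (2 powr q) * (ennreal (indicator (bset R u) w * norm (f w - F u) powr q) + ennreal (indicator (bset R z) w * norm (f w - F z) powr q)) \<partial>Lb)"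
    proof (rule nn_integral_mono)
      fix w :: "complex ^ 'n"
      show "ennreal (norm (F u - F z) powr q) * indicator (bset R1 u) w \<le> ennreal (2 powr q) * (ennreal (indicator (bset R u) w * norm (f w - F u) powr q) + ennreal (indicator (bset R z) w * norm (f w - F z) powr q))"
      proof (cases "w \<in> bset R1 u")
        case True
        have "w \<in> bset R u" "w \<in> bset R z" using True sub[OF ub] bset_trans[OF z u True R1] by auto
        then show ?thesis using True sum2[of "F u" "F z" "f w"]
          by (simp add: ennreal_mult[symmetric] ennreal_plus[symmetric] ennreal_leI del: ennreal_plus)
      qed simp
    qed
    also have "\<dots> = ennreal (2 powr q) * ((\<integral>\<^sup>+w. ennreal (indicator (bset R u) w * norm (f w - F u) powr q) \<partial>Lb) + (\<integral>\<^sup>+w. ennreal (indicator (bset R z) w * norm (f w - F z) powr q) \<partial>Lb))"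
      by (subst nn_integral_cmult, measurable, subst nn_integral_add) auto
    also have "\<dots> \<le> ennreal (2 powr q) * (ennreal (E * hgt u powr l) + ennreal (E * hgt z powr l))"
      using loc[OF ub] loc[OF z] unfolding l_def N_def by (intro mult_left_mono add_mono) auto
    also have "\<dots> = ennreal (2 powr q * (E * hgt u powr l + E * hgt z powr l))"
      using E by (simp add: ennreal_mult)
    finally have 1: "norm (F u - F z) powr q * measure Lb (bset R1 u) \<le> 2 powr q * (E * hgt u powr l + E * hgt z powr l)"
      using E by (subst (asm) ennreal_le_iff) auto
    have ul: "hgt u powr l \<le> K * hgt z powr l" unfolding K_def using hu hz R1 zu by (intro powr_between) auto
    have uN: "hgt z powr N \<le> (4 * R1) powr \<bar>N\<bar> * hgt u powr N" using hu hz R1 zu by (intro powr_between) auto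
    have "norm (F u - F z) powr q * (c0 * hgt z powr N) \<le> norm (F u - F z) powr q * (c0 * ((4 * R1) powr \<bar>N\<bar> * hgt u powr N))"
      using c0 by (intro mult_left_mono uN) auto
    also have "\<dots> = (4 * R1) powr \<bar>N\<bar> * (norm (F u - F z) powr q * (c0 * hgt u powr N))" by simp
    also have "\<dots> \<le> (4 * R1) powr \<bar>N\<bar> * (norm (F u - F z) powr q * measure Lb (bset R1 u))"
      by (intro mult_left_mono c0 ub) auto
    also have "\<dots> \<le> (4 * R1) powr \<bar>N\<bar> * (2 powr q * (E * (K * hgt z powr l) + E * hgt z powr l))"
      by (intro mult_left_mono order_trans[OF 1 mult_left_mono[OF add_right_mono[OF mult_left_mono[OF ul E]]]]) auto
    finally have "norm (F u - F z) powr q * (c0 * hgt z powr N) \<le> (4 * R1) powr \<bar>N\<bar> * 2 powr q * (E + E * K) * hgt z powr l"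
      by (simp add: algebra_simps)
    then have "norm (F u - F z) powr q \<le> (4 * R1) powr \<bar>N\<bar> * 2 powr q * (E + E * K) * hgt z powr l / (c0 * hgt z powr N)"
      using c0 hz by (simp add: pos_le_divide_eq)
    also have "\<dots> = (2 powr q * (E + E * K) / c0 * (4 * R1) powr \<bar>N\<bar>) * (hgt z powr l / hgt z powr N)"
      by simp
    also have "hgt z powr l / hgt z powr N = hgt z powr (- q * \<gamma>)"
      using hz by (simp add: powr_diff[symmetric] l_def)
    finally have "(norm (F u - F z) powr q) powr (1 / q) \<le> ((2 powr q * (E + E * K) / c0 * (4 * R1) powr \<bar>N\<bar>) * hgt z powr (- q * \<gamma>)) powr (1 / q)"
      using q by (intro powr_mono2) auto
    also have "\<dots> = C0 * hgt z powr (- \<gamma>)"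
      unfolding C0_def using q by (simp only: powr_mult powr_powr) (simp add: E)
    finally show ?thesis using q by (simp add: powr_powr)
  qed
  define E2 where "E2 = 2 powr q * (E + C0 powr q * c1)"
  have E2: "E2 \<ge> 0" using E c1 by (simp add: E2_def)
  have C00: "C0 \<ge> 0" by (simp add: C0_def)
  have loc2: "(\<integral>\<^sup>+z. ennreal (indicator (bset R1 u) z * norm (f z - F z) powr q) \<partial>Lb) \<le> ennreal (E2 * hgt u powr (real CARD('n) + 1 - q * \<gamma>))"
    if u: "u \<in> ball 0 1" for u
  proof -
    have hu: "hgt u > 0" by (rule hgt_pos[OF u])
    define B where "B = C0 * hgt u powr (- \<gamma>)"
    have B: "B \<ge> 0" using C00 by (simp add: B_def)
    have "(\<integral>\<^sup>+z. ennreal (indicator (bset R1 u) z * norm (f z - F z) powr q) \<partial>Lb) \<le>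
      (\<integral>\<^sup>+z. ennreal (2 powr q) * (ennreal (indicator (bset R u) z * norm (f z - F u) powr q) + ennreal (B powr q) * indicator (bset R1 u) z) \<partial>Lb)"
    proof (rule nn_integral_mono)
      fix z :: "complex ^ 'n"
      show "ennreal (indicator (bset R1 u) z * norm (f z - F z) powr q) \<le> ennreal (2 powr q) * (ennreal (indicator (bset R u) z * norm (f z - F u) powr q) + ennreal (B powr q) * indicator (bset R1 u) z)"
      proof (cases "z \<in> bset R1 u")
        case True
        have zR: "z \<in> bset R u" using True sub[OF u] by auto
        have B1: "norm (F u - F z) powr q \<le> B powr q"
          using osc[OF u True] q unfolding B_def norm_minus_commute[of "F u"] by (intro powr_mono2) auto
        have "norm (f z - F z) powr q \<le> 2 powr q * (norm (F u - f z) powr q + norm (F u - F z) powr q)" by (rule sum2)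
        also have "\<dots> \<le> 2 powr q * (norm (F u - f z) powr q + B powr q)"
          by (intro mult_left_mono add_left_mono B1) simp
        also have "norm (F u - f z) = norm (f z - F u)" by (rule norm_minus_commute)
        finally have "norm (f z - F z) powr q \<le> 2 powr q * (norm (f z - F u) powr q + B powr q)" .
        then show ?thesis using True zR
          by (simp add: ennreal_mult[symmetric] ennreal_plus[symmetric] ennreal_leI del: ennreal_plus)
      qed simp
    qed
    also have "\<dots> = ennreal (2 powr q) * ((\<integral>\<^sup>+z. ennreal (indicator (bset R u) z * norm (f z - F u) powr q) \<partial>Lb) + ennreal (B powr q) * emeasure Lb (bset R1 u))"
      by (subst nn_integral_cmult, measurable, subst nn_integral_add) (auto simp: nn_integral_cmult)
    also have "\<dots> \<le> ennreal (2 powr q) * (ennreal (E * hgt u powr l) + ennreal (B powr q) * ennreal (c1 * hgt u powr N))"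
      using loc[OF u] c1(2)[OF u] unfolding l_def N_def Lb.emeasure_eq_measure by (intro mult_left_mono add_mono ennreal_leI) auto
    also have "\<dots> = ennreal (2 powr q * (E * hgt u powr l + B powr q * (c1 * hgt u powr N)))"
      using E c1 by (simp add: ennreal_mult)
    also have "B powr q * (c1 * hgt u powr N) = C0 powr q * c1 * hgt u powr l"
    proof -
      have "B powr q = C0 powr q * hgt u powr (- \<gamma> * q)" using C00 hu by (simp add: B_def powr_mult powr_powr)
      moreover have "hgt u powr (- \<gamma> * q) * hgt u powr N = hgt u powr l" by (simp add: powr_add[symmetric] l_def mult.commute)
      ultimately show ?thesis by (simp add: mult_ac)
    qed
    also have "2 powr q * (E * hgt u powr l + C0 powr q * c1 * hgt u powr l) = E2 * hgt u powr l" by (simp add: E2_def algebra_simps)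
    finally show ?thesis by (simp add: l_def N_def)
  qed
  obtain b C where bC: "b > \<beta>" "C \<ge> 0" "\<And>g. g \<in> H_infinity \<Longrightarrow> qint q \<beta> (Hk b f g) \<le> ennreal (C * enn2real (qint p \<alpha> g) powr (q / p))"
    using kernel_operator_estimate[OF p \<alpha> \<beta> R1(1) \<gamma> fm ff Fm C00 osc E2 loc2] by blast
  have "\<beta> + 1 < q * (\<beta> + 1)" using mult_strict_right_mono[OF q(1), of "\<beta> + 1"] \<beta> by simp
  then obtain C\<beta> where C\<beta>: "C\<beta> > 0" "\<And>F. F \<in> borel_measurable (Lb :: (complex ^ 'n) measure) \<Longrightarrow> qint q \<beta> (Pj \<beta> F) \<le> ennreal C\<beta> * qint q \<beta> F"
    using Pj_bounded[OF q(1) \<beta> \<beta>, where 'n='n] by blast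
  have "\<beta> + 1 < 1 * (b + 1)" using bC by simp
  also have "\<dots> \<le> q * (b + 1)" using q bC \<beta> by (intro mult_right_mono) auto
  finally obtain Cb where Cb: "Cb > 0" "\<And>F. F \<in> borel_measurable (Lb :: (complex ^ 'n) measure) \<Longrightarrow> qint q \<beta> (Pj b F) \<le> ennreal Cb * qint q \<beta> F"
    using Pj_bounded[OF q(1) \<beta>, of b, where 'n='n] bC \<beta> by auto
  have "qint q \<beta> (Hk \<beta> f g) \<le> ennreal (2 powr q * (1 + C\<beta>) * C * enn2real (qint p \<alpha> g) powr (q / p))" if g: "g \<in> H_infinity" for g :: "complex ^ 'n \<Rightarrow> complex"
  proof -
    have [measurable]: "g \<in> borel_measurable Lb" by (rule H_infinity_measurable[OF g])
    obtain Bg where Bg: "\<And>w. w \<in> ball 0 1 \<Longrightarrow> norm (g w) \<le> Bg" using H_infinity_bound[OF g] by blast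
    define G where "G w = f w * g w" for w
    have [measurable]: "G \<in> borel_measurable Lb" unfolding G_def by measurable
    have fG: "qint q \<beta> G < \<infinity>" unfolding G_def by (rule qint_mult_bounded[OF fm Bg q(3) ff])
    have fPG: "qint q \<beta> (Pj b G) < \<infinity>"
      using fG by (intro order_le_less_trans[OF Cb(2)]) (auto simp: ennreal_mult_less_top)
    have Hm[measurable]: "Hk b f g \<in> borel_measurable Lb" by (rule Hk_measurable) measurable
    have eq: "Hk \<beta> f g z = Hk b f g z - Pj \<beta> (Hk b f g) z" if z: "z \<in> ball 0 1" for z
    proof -
      have "Pj \<beta> (Hk b f g) z = Pj \<beta> (\<lambda>w. G w - Pj b G w) z" by (simp add: Hk_def[abs_def] G_def[abs_def])
      also have "\<dots> = Pj \<beta> G z - Pj \<beta> (Pj b G) z"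
        by (rule Pj_diff[OF _ _ q(2) \<beta> _ z fG fPG]) auto
      also have "Pj \<beta> (Pj b G) z = Pj b G z"
        by (rule Pj_Pj_small[OF _ \<beta> bC(1) z qint_finite_imp_L1[OF _ q(2) \<beta> fG]]) measurable
      finally have e: "Pj \<beta> (Hk b f g) z = Pj \<beta> G z - Pj b G z" .
      have "Hk a f g z = G z - Pj a G z" for a by (simp add: Hk_def G_def[abs_def])
      then show ?thesis unfolding e by simp
    qed
    have "qint q \<beta> (Hk \<beta> f g) \<le> ennreal (2 powr q) * (qint q \<beta> (Hk b f g) + qint q \<beta> (Pj \<beta> (Hk b f g)))"
      by (rule qint_add) (use q in \<open>auto simp: eq intro: norm_triangle_ineq4\<close>)
    also have "\<dots> \<le> ennreal (2 powr q) * (qint q \<beta> (Hk b f g) + ennreal C\<beta> * qint q \<beta> (Hk b f g))"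
      by (intro mult_left_mono add_left_mono C\<beta>(2) Hm) simp
    also have "\<dots> = ennreal (2 powr q * (1 + C\<beta>)) * qint q \<beta> (Hk b f g)"
      using C\<beta> by (simp add: ennreal_mult distrib_right mult.assoc)
    also have "\<dots> \<le> ennreal (2 powr q * (1 + C\<beta>)) * ennreal (C * enn2real (qint p \<alpha> g) powr (q / p))"
      by (intro mult_left_mono bC(3) g) simp
    also have "\<dots> = ennreal (2 powr q * (1 + C\<beta>) * C * enn2real (qint p \<alpha> g) powr (q / p))"
      using C\<beta> bC by (simp add: ennreal_mult[symmetric] mult.assoc)
    finally show ?thesis .
  qed
  moreover have "2 powr q * (1 + C\<beta>) * C \<ge> 0" using C\<beta> bC by simp
  ultimately show ?thesis by blast
qed

section \<open>The weighted measures and the Bergman metric\<close>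

lemma measure_Lb_pos: "measure (Lb :: (complex ^ 'n) measure) (ball 0 1) > 0"
proof -
  have "measure (Lb :: (complex ^ 'n) measure) (ball 0 1) = (LINT w::complex ^ 'n|Lb. 1)" by simp
  also have "\<dots> = (LINT w::complex ^ 'n|Lb. hgt w powr 0)"
    by (intro Bochner_Integration.integral_cong) (use hgt_pos in force)+
  also have "\<dots> = wt_mass TYPE('n) 0" by (rule wt_mass_Lb) simp
  finally show ?thesis using wt_mass_pos[of 0, where 'n='n] by simp
qed

lemma ball_vol_eq: "(ball_vol :: (complex ^ 'n) measure) = density Lb (\<lambda>_. ennreal (1 / measure (Lb :: (complex ^ 'n) measure) (ball 0 1)))"
proof -
  have e: "emeasure (Lb :: (complex ^ 'n) measure) (ball 0 1) = ennreal (measure (Lb :: (complex ^ 'n) measure) (ball 0 1))"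
    by (rule Lb.emeasure_eq_measure)
  have [measurable]: "ball 0 1 \<in> sets (Lb :: (complex ^ 'n) measure)" by (rule borel_in_sets_Lb) auto
  have d: "1 / ennreal (measure (Lb :: (complex ^ 'n) measure) (ball 0 1)) = ennreal (1 / measure (Lb :: (complex ^ 'n) measure) (ball 0 1))"
    using divide_ennreal[of 1 "measure (Lb :: (complex ^ 'n) measure) (ball 0 1)"] measure_Lb_pos[where 'n='n] by simp
  show ?thesis
    unfolding ball_vol_def uniform_measure_def Lb_def[symmetric] e d[symmetric]
    by (rule density_cong) (measurable, auto intro!: AE_I2)
qed

lemma wt_vol_eq: "(wt_vol \<sigma> :: (complex ^ 'n) measure) =
  density Lb (\<lambda>z. ennreal (hgt z powr \<sigma> / measure (Lb :: (complex ^ 'n) measure) (ball 0 1)))"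
proof -
  have [measurable]: "(\<lambda>x. x) \<in> borel_measurable (Lb :: (complex ^ 'n) measure)" by (rule measurable_Lb_id)
  show ?thesis
    unfolding wt_vol_def ball_vol_eq hgt_def[symmetric]
    by (subst density_density_eq) (use measure_Lb_pos[where 'n='n] in \<open>auto simp: ennreal_mult[symmetric]\<close>)
qed

lemma prob_vol_eq:
  assumes \<alpha>: "\<alpha> > -1"
  shows "(prob_vol \<alpha> :: (complex ^ 'n) measure) = density Lb (\<lambda>z. ennreal (hgt z powr \<alpha> / wt_mass TYPE('n) \<alpha>))"
proof -
  have [measurable]: "(\<lambda>x. x) \<in> borel_measurable (Lb :: (complex ^ 'n) measure)" by (rule measurable_Lb_id)
  define V where "V = measure (Lb :: (complex ^ 'n) measure) (ball 0 1)"
  have V: "V > 0" unfolding V_def by (rule measure_Lb_pos)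
  have J: "wt_mass TYPE('n) \<alpha> > 0" by (rule wt_mass_pos[OF \<alpha>])
  have "norm_const TYPE('n) \<alpha> = 1 / (LINT z::complex ^ 'n|Lb. (1 / V) *\<^sub>R hgt z powr \<alpha>)"
    unfolding norm_const_def ball_vol_eq hgt_def[symmetric] V_def[symmetric]
    by (subst integral_density) (use V in auto)
  then have "norm_const TYPE('n) \<alpha> = V / wt_mass TYPE('n) \<alpha>" by (simp add: wt_mass_Lb(2)[OF \<alpha>])
  then show ?thesis
    unfolding prob_vol_def ball_vol_eq hgt_def[symmetric] V_def[symmetric]
    by (subst density_density_eq) (use V J in \<open>auto simp: ennreal_mult[symmetric]\<close>)
qed

section \<open>Translation of the norms and of the Hankel operator\<close>

lemma nn_integral_prob_vol:
  fixes f :: "complex ^ 'n \<Rightarrow> complex"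
  assumes \<alpha>: "\<alpha> > -1" and [measurable]: "f \<in> borel_measurable Lb"
  shows "(\<integral>\<^sup>+z. ennreal (norm (f z) powr p) \<partial>prob_vol \<alpha>) = ennreal (1 / wt_mass TYPE('n) \<alpha>) * qint p \<alpha> f"
proof -
  have [measurable]: "(\<lambda>x. x) \<in> borel_measurable (Lb :: (complex ^ 'n) measure)" by (rule measurable_Lb_id)
  have J: "wt_mass TYPE('n) \<alpha> > 0" by (rule wt_mass_pos[OF \<alpha>])
  have "(\<integral>\<^sup>+z. ennreal (norm (f z) powr p) \<partial>prob_vol \<alpha>) =
    (\<integral>\<^sup>+z. ennreal (1 / wt_mass TYPE('n) \<alpha>) * ennreal (norm (f z) powr p * hgt z powr \<alpha>) \<partial>Lb)"
    unfolding prob_vol_eq[OF \<alpha>]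
    by (subst nn_integral_density) (use J in \<open>auto intro!: nn_integral_cong simp: ennreal_mult[symmetric] mult.commute\<close>)
  then show ?thesis by (simp add: nn_integral_cmult qint_def)
qed

lemma measurable_prob_vol: "\<alpha> > -1 \<Longrightarrow> f \<in> borel_measurable (prob_vol \<alpha>) \<longleftrightarrow> f \<in> borel_measurable Lb"
  by (simp add: prob_vol_eq)

lemma Lp_space_iff:
  fixes f :: "complex ^ 'n \<Rightarrow> complex"
  assumes \<alpha>: "\<alpha> > -1"
  shows "f \<in> Lp_space p \<alpha> \<longleftrightarrow> f \<in> borel_measurable Lb \<and> qint p \<alpha> f < \<infinity>"
proof (cases "f \<in> borel_measurable Lb")
  case True
  have J: "wt_mass TYPE('n) \<alpha> > 0" by (rule wt_mass_pos[OF \<alpha>])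
  have m: "(\<lambda>z. norm (f z) powr p) \<in> borel_measurable (prob_vol \<alpha>)"
    unfolding measurable_prob_vol[OF \<alpha>] using True by measurable
  have "f \<in> Lp_space p \<alpha> \<longleftrightarrow> (\<integral>\<^sup>+z. ennreal (norm (f z) powr p) \<partial>prob_vol \<alpha>) < \<infinity>"
    using m True by (simp add: Lp_space_def measurable_prob_vol[OF \<alpha>] integrable_iff_bounded)
  then show ?thesis
    unfolding nn_integral_prob_vol[OF \<alpha> True] using J True by (auto simp: ennreal_mult_less_top)
qed (simp add: Lp_space_def measurable_prob_vol[OF \<alpha>])

lemma Lp_norm_eq:
  fixes f :: "complex ^ 'n \<Rightarrow> complex"
  assumes \<alpha>: "\<alpha> > -1" and f: "f \<in> borel_measurable Lb"
  shows "Lp_norm p \<alpha> f = (enn2real (qint p \<alpha> f) / wt_mass TYPE('n) \<alpha>) powr (1 / p)"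
proof -
  have J: "wt_mass TYPE('n) \<alpha> > 0" by (rule wt_mass_pos[OF \<alpha>])
  have m: "(\<lambda>z. norm (f z) powr p) \<in> borel_measurable (prob_vol \<alpha>)"
    unfolding measurable_prob_vol[OF \<alpha>] using f by measurable
  have "(LINT z|prob_vol \<alpha>. norm (f z) powr p) = enn2real (ennreal (1 / wt_mass TYPE('n) \<alpha>) * qint p \<alpha> f)"
    unfolding nn_integral_prob_vol[OF assms, symmetric] by (rule integral_eq_nn_integral) (use m in auto)
  then show ?thesis unfolding Lp_norm_def using J by (simp add: enn2real_mult)
qed

lemma bergman_proj_eq:
  fixes g :: "complex ^ 'n \<Rightarrow> complex"
  assumes \<beta>: "\<beta> > -1" and [measurable]: "g \<in> borel_measurable Lb" and z: "z \<in> ball 0 1"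
  shows "bergman_proj \<beta> g z = Pj \<beta> g z"
proof -
  have [measurable]: "(\<lambda>x. x) \<in> borel_measurable (Lb :: (complex ^ 'n) measure)" by (rule measurable_Lb_id)
  define G where "G w = g w / (1 - herm z w) powr complex_of_real (real CARD('n) + 1 + \<beta>)" for w
  have J: "wt_mass TYPE('n) \<beta> > 0" by (rule wt_mass_pos[OF \<beta>])
  have e: "G w = g w * kern \<beta> z w" if "w \<in> space Lb" for w
  proof -
    have "x powr (- c) = inverse (x powr c)" for x c :: complex by (simp add: powr_def exp_minus)
    then show ?thesis using that by (simp only: G_def kern_eq[OF z] divide_inverse space_Lb)
  qed
  have "(\<lambda>w. g w * kern \<beta> z w) \<in> borel_measurable Lb" by measurable
  then have G: "G \<in> borel_measurable Lb" using e by (subst measurable_cong[where g="\<lambda>w. g w * kern \<beta> z w"]) auto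
  have "bergman_proj \<beta> g z = (LINT w|prob_vol \<beta>. G w)" by (simp add: bergman_proj_def G_def)
  also have "\<dots> = (LINT w|Lb. (hgt w powr \<beta> / wt_mass TYPE('n) \<beta>) *\<^sub>R G w)"
    unfolding prob_vol_eq[OF \<beta>] by (rule integral_density) (use G J in auto)
  also have "\<dots> = (LINT w|Lb. g w * kern \<beta> z w * of_real (hgt w powr \<beta>) / of_real (wt_mass TYPE('n) \<beta>))"
    by (intro Bochner_Integration.integral_cong) (auto simp: e scaleR_conv_of_real)
  finally show ?thesis by (simp add: Pj_def)
qed

lemma hankel_eq:
  fixes f g :: "complex ^ 'n \<Rightarrow> complex"
  assumes "\<beta> > -1" "f \<in> borel_measurable Lb" "g \<in> borel_measurable Lb" "z \<in> ball 0 1"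
  shows "hankel \<beta> f g z = Hk \<beta> f g z"
  using assms by (simp add: hankel_def Hk_def bergman_proj_eq)

text \<open>The q-th power of the norm inequality, with normalizing constants absorbed into C. The
  right side is finite, so the inequality between extended reals already contains membership in the
  target space. The test function enters through \<open>enn2real\<close>, which is faithful because
  bounded functions have finite integrals.\<close>

lemma hankel_bounded_iff:
  fixes f :: "complex ^ 'n \<Rightarrow> complex"
  assumes p: "0 < p" "0 < q" and \<alpha>: "\<alpha> > -1" and \<beta>: "\<beta> > -1" and f: "f \<in> borel_measurable Lb"
  shows "hankel_bounded p \<alpha> q \<beta> f \<longleftrightarrow>
    (\<exists>C\<ge>0. \<forall>g\<in>H_infinity. qint q \<beta> (Hk \<beta> f g) \<le> ennreal (C * enn2real (qint p \<alpha> g) powr (q / p)))"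
proof -
  define I where "I = wt_mass TYPE('n) \<alpha>"
  define J where "J = wt_mass TYPE('n) \<beta>"
  have IJ: "I > 0" "J > 0" unfolding I_def J_def by (rule wt_mass_pos[OF \<alpha>], rule wt_mass_pos[OF \<beta>])
  have Hm: "Hk \<beta> f g \<in> borel_measurable Lb" if "g \<in> H_infinity" for g
    using f H_infinity_measurable[OF that] by (rule Hk_measurable)
  have eq: "hankel \<beta> f g z = Hk \<beta> f g z" if "g \<in> H_infinity" "z \<in> ball 0 1" for g z
    using hankel_eq[OF \<beta> f H_infinity_measurable[OF that(1)] that(2)] .
  have hm: "hankel \<beta> f g \<in> borel_measurable Lb" if "g \<in> H_infinity" for g
    using Hm[OF that] eq[OF that] by (subst measurable_cong[where g="Hk \<beta> f g"]) auto
  have hq: "qint q \<beta> (hankel \<beta> f g) = qint q \<beta> (Hk \<beta> f g)" if "g \<in> H_infinity" for g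
    by (rule qint_cong) (simp add: eq[OF that])
  have iff: "hankel \<beta> f g \<in> Lp_space q \<beta> \<and> Lp_norm q \<beta> (hankel \<beta> f g) \<le> C * Lp_norm p \<alpha> g \<longleftrightarrow>
    qint q \<beta> (Hk \<beta> f g) \<le> ennreal (J * C powr q / I powr (q / p) * enn2real (qint p \<alpha> g) powr (q / p))"
    if g: "g \<in> H_infinity" and C: "C > 0" for g C
  proof -
    define Y where "Y = enn2real (qint p \<alpha> g)"
    have Y: "Y \<ge> 0" by (simp add: Y_def)
    have gm: "g \<in> borel_measurable Lb" by (rule H_infinity_measurable[OF g])
    have r: "(J * C powr q / I powr (q / p)) * Y powr (q / p) = J * (C * (Y / I) powr (1 / p)) powr q"
      using p by (simp add: powr_mult powr_divide powr_powr)
    show ?thesis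
    proof (cases "qint q \<beta> (Hk \<beta> f g) = \<infinity>")
      case False
      then obtain X where X: "X \<ge> 0" "qint q \<beta> (Hk \<beta> f g) = ennreal X" by (cases "qint q \<beta> (Hk \<beta> f g)") auto
      have "(X / J) powr (1 / q) \<le> C * (Y / I) powr (1 / p) \<longleftrightarrow> X / J \<le> (C * (Y / I) powr (1 / p)) powr q"
      proof
        assume "(X / J) powr (1 / q) \<le> C * (Y / I) powr (1 / p)"
        then have "((X / J) powr (1 / q)) powr q \<le> (C * (Y / I) powr (1 / p)) powr q" using p by (intro powr_mono2) auto
        then show "X / J \<le> (C * (Y / I) powr (1 / p)) powr q" using p X IJ by (simp add: powr_powr)
      next
        assume "X / J \<le> (C * (Y / I) powr (1 / p)) powr q"
        then have "(X / J) powr (1 / q) \<le> ((C * (Y / I) powr (1 / p)) powr q) powr (1 / q)" using p X IJ by (intro powr_mono2) auto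
        then show "(X / J) powr (1 / q) \<le> C * (Y / I) powr (1 / p)" using p C Y IJ by (simp add: powr_powr)
      qed
      also have "\<dots> \<longleftrightarrow> X \<le> J * (C * (Y / I) powr (1 / p)) powr q"
        using IJ by (simp add: pos_divide_le_eq mult.commute)
      finally show ?thesis
        unfolding Lp_space_iff[OF \<beta>] Lp_norm_eq[OF \<beta> hm[OF g]] Lp_norm_eq[OF \<alpha> gm] hq[OF g] I_def[symmetric] J_def[symmetric] Y_def[symmetric] r X(2)
        using X IJ hm[OF g] by (simp add: ennreal_le_iff)
    qed (simp add: Lp_space_iff[OF \<beta>] hq[OF g] top_unique)
  qed
  show ?thesis
  proof
    assume "hankel_bounded p \<alpha> q \<beta> f"
    then obtain C where C: "C > 0" "\<forall>g\<in>H_infinity. hankel \<beta> f g \<in> Lp_space q \<beta> \<and> Lp_norm q \<beta> (hankel \<beta> f g) \<le> C * Lp_norm p \<alpha> g"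
      unfolding hankel_bounded_def by blast
    then have "\<forall>g\<in>H_infinity. qint q \<beta> (Hk \<beta> f g) \<le> ennreal (J * C powr q / I powr (q / p) * enn2real (qint p \<alpha> g) powr (q / p))"
      using iff by blast
    moreover have "J * C powr q / I powr (q / p) \<ge> 0" using IJ by simp
    ultimately show "\<exists>C\<ge>0. \<forall>g\<in>H_infinity. qint q \<beta> (Hk \<beta> f g) \<le> ennreal (C * enn2real (qint p \<alpha> g) powr (q / p))" by blast
  next
    assume "\<exists>C\<ge>0. \<forall>g\<in>H_infinity. qint q \<beta> (Hk \<beta> f g) \<le> ennreal (C * enn2real (qint p \<alpha> g) powr (q / p))"
    then obtain C where C: "C \<ge> 0" "\<And>g. g \<in> H_infinity \<Longrightarrow> qint q \<beta> (Hk \<beta> f g) \<le> ennreal (C * enn2real (qint p \<alpha> g) powr (q / p))"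
      by blast
    \<comment> \<open>Inverts the relation between the constants in \<open>iff\<close>; C + 1
      replaces C because the operator bound must be positive.\<close>
    define C' where "C' = ((C + 1) * I powr (q / p) / J) powr (1 / q)"
    have C': "C' > 0" "J * C' powr q / I powr (q / p) = C + 1" using C IJ p by (auto simp: C'_def powr_powr)
    have "hankel \<beta> f g \<in> Lp_space q \<beta> \<and> Lp_norm q \<beta> (hankel \<beta> f g) \<le> C' * Lp_norm p \<alpha> g" if g: "g \<in> H_infinity" for g
      unfolding iff[OF g C'(1)] C'(2)
      by (rule order_trans[OF C(2)[OF g]]) (intro ennreal_leI mult_right_mono; simp)
    then show "hankel_bounded p \<alpha> q \<beta> f" unfolding hankel_bounded_def using C'(1) by blast
  qed
qed

text \<open>With E = exp (2 r) the witness (E + 1)^2 / (4 E) is the square of cosh r. The condition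
  on the distance becomes \<rho> < (E - 1) / (E + 1) = tanh r, and squaring it leaves a comparison
  of 1 - \<rho>^2 with 1 / R.\<close>

lemma bergman_ball_eq:
  fixes r :: real
  assumes r: "r > 0"
  obtains R where "R > 1" "\<And>z :: complex ^ 'n. z \<in> ball 0 1 \<Longrightarrow> bergman_ball z r = bset R z"
proof -
  define E where "E = exp (2 * r)"
  have E: "E > 1" "E > 0" using r by (auto simp: E_def)
  define R where "R = (E + 1)\<^sup>2 / (4 * E)"
  have "0 < (E - 1)\<^sup>2" using E by simp
  then have R: "R > 1" using E by (simp add: R_def power2_eq_square algebra_simps)
  have "bergman_dist z w < r \<longleftrightarrow> (kdis z w)\<^sup>2 < R * (hgt z * hgt w)" if z: "z \<in> ball 0 1" and w: "w \<in> ball 0 1" for z w :: "complex ^ 'n"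
  proof -
    define X where "X = hgt z * hgt w / (kdis z w)\<^sup>2"
    have k: "kdis z w > 0" by (rule kdis_pos[OF z w])
    have X: "X > 0" "X \<le> 1" using hgt_mult_le[OF w, of z] k hgt_pos[OF z] hgt_pos[OF w] by (auto simp: X_def)
    define \<rho> where "\<rho> = sqrt (1 - X)"
    have \<rho>: "\<rho> \<ge> 0" "\<rho> < 1" "\<rho>\<^sup>2 = 1 - X" using X by (auto simp: \<rho>_def real_less_lsqrt)
    have "bergman_dist z w < r \<longleftrightarrow> ln ((1 + \<rho>) / (1 - \<rho>)) < 2 * r"
      unfolding bergman_dist_def bergman_rho_def hgt_def[symmetric] kdis_def[symmetric] X_def[symmetric] \<rho>_def[symmetric] by auto
    also have "\<dots> \<longleftrightarrow> (1 + \<rho>) / (1 - \<rho>) < E"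
      unfolding E_def using \<rho> by (subst exp_less_cancel_iff[symmetric], subst exp_ln) auto
    also have "\<dots> \<longleftrightarrow> \<rho> < (E - 1) / (E + 1)" using \<rho> E by (simp add: field_simps)
    also have "\<dots> \<longleftrightarrow> \<rho>\<^sup>2 < ((E - 1) / (E + 1))\<^sup>2" 
      using \<rho> E power_strict_mono[of \<rho> "(E - 1) / (E + 1)" 2] power_less_imp_less_base[of \<rho> 2 "(E - 1) / (E + 1)"] by auto
    also have "((E - 1) / (E + 1))\<^sup>2 = 1 - 1 / R"
    proof -
      have "1 - 1 / R = ((E + 1)\<^sup>2 - 4 * E) / (E + 1)\<^sup>2" using E by (simp add: R_def diff_divide_distrib)
      also have "(E + 1)\<^sup>2 - 4 * E = (E - 1)\<^sup>2" by (simp add: power2_eq_square algebra_simps)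
      finally show ?thesis by (simp add: power_divide)
    qed
    also have "\<rho>\<^sup>2 < 1 - 1 / R \<longleftrightarrow> 1 < R * X" unfolding \<rho>(3) using R by (simp add: field_simps)
    also have "\<dots> \<longleftrightarrow> (kdis z w)\<^sup>2 < R * (hgt z * hgt w)" using k by (simp add: X_def field_simps)
    finally show ?thesis .
  qed
  then show ?thesis using that[OF R] by (auto simp: bergman_ball_def bset_def)
qed

section \<open>Mean oscillation\<close>

lemma bset_powr_le:
  assumes "z \<in> ball 0 1" "w \<in> bset R z" "R > 1"
  shows "hgt w powr s \<le> (4 * R) powr \<bar>s\<bar> * hgt z powr s" "hgt z powr s \<le> (4 * R) powr \<bar>s\<bar> * hgt w powr s"
  using assms bset_hgt_le[of z w R] hgt_pos[of z] hgt_pos[OF bset_sub_ball[of w R z]]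
  by (auto intro!: powr_between)

lemma bset_measure_pos:
  fixes z :: "complex ^ 'n"
  assumes "R > 1" "z \<in> ball 0 1"
  shows "measure Lb (bset R z) > 0"
proof -
  obtain c where "c > 0" "\<And>z. z \<in> ball (0::complex ^ 'n) 1 \<Longrightarrow> c * hgt z powr (real CARD('n) + 1) \<le> measure Lb (bset R z)"
    using bset_measure_lower[OF assms(1)] by blast
  moreover from this(1) have "c * hgt z powr (real CARD('n) + 1) > 0" using hgt_pos[OF assms(2)] by simp
  ultimately show ?thesis using assms(2) by (blast intro: less_le_trans)
qed

text \<open>On a Bergman ball the height is comparable with that of the centre, so the weight with
  exponent \<sigma> is constant up to the factor \<open>K\<close>. This makes the oscillation
  condition insensitive to \<sigma>. Finiteness of the integral of f for the weight \<beta> secures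
  the convergence of all local integrals.\<close>

locale weighted_average =
  fixes R \<sigma> q \<beta> :: real and f :: "complex ^ 'n \<Rightarrow> complex" and z :: "complex ^ 'n"
  assumes R: "R > 1" and q: "q \<ge> 1" and \<beta>: "\<beta> > -1" and f [measurable]: "f \<in> borel_measurable Lb"
    and ff: "qint q \<beta> f < \<infinity>" and z: "z \<in> ball 0 1"
begin

definition k where "k w = indicator (bset R z) w * hgt w powr \<sigma>"

definition W where "W = (LINT w|Lb. k w)"

definition A where "A = (LINT w|Lb. k w *\<^sub>R f w) / of_real W"

definition m where "m = measure Lb (bset R z)"

abbreviation K where "K \<equiv> (4 * R) powr \<bar>\<sigma>\<bar>"

lemma id_measurable [measurable]: "(\<lambda>x. x) \<in> borel_measurable (Lb :: (complex ^ 'n) measure)"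
  by (rule measurable_Lb_id)

lemma k_nonneg: "k w \<ge> 0"
  by (simp add: k_def)

lemma k_measurable [measurable]: "k \<in> borel_measurable Lb"
  unfolding k_def[abs_def] by measurable

lemma hz: "hgt z > 0"
  by (rule hgt_pos[OF z])

lemma K_pos: "K > 0"
  using R by simp

lemma k_le: "k w \<le> K * hgt z powr \<sigma> * indicator (bset R z) w"
  using bset_powr_le(1)[OF z _ R, of w \<sigma>] by (auto simp: k_def indicator_def)

lemma k_ge: "hgt z powr \<sigma> * indicator (bset R z) w \<le> K * k w"
  using bset_powr_le(2)[OF z _ R, of w \<sigma>] by (auto simp: k_def indicator_def)

lemma indicator_integrable: "integrable Lb (indicator (bset R z) :: _ \<Rightarrow> real)"
  by (rule integrable_real_indicator) (simp_all add: Lb.emeasure_eq_measure)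

lemma k_integrable: "integrable Lb k"
  by (rule Bochner_Integration.integrable_bound[where f="\<lambda>w. K * hgt z powr \<sigma> * indicator (bset R z) w"])
     (use indicator_integrable k_le k_nonneg in \<open>auto intro!: AE_I2\<close>)

lemma m_pos: "m > 0"
  unfolding m_def by (rule bset_measure_pos[OF R z])

lemma W_bounds: "W \<le> K * hgt z powr \<sigma> * m" "hgt z powr \<sigma> * m \<le> K * W"
proof -
  have e: "(LINT w|Lb. c * indicator (bset R z) w) = c * m" for c :: real
    by (simp add: m_def Int_absorb2 subset_iff bset_def)
  have i: "integrable Lb (\<lambda>w. c * indicator (bset R z) w :: real)" for c
    by (intro integrable_mult_right indicator_integrable)
  have "W \<le> (LINT w|Lb. K * hgt z powr \<sigma> * indicator (bset R z) w)"
    unfolding W_def by (rule integral_mono[OF k_integrable i k_le])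
  then show "W \<le> K * hgt z powr \<sigma> * m" unfolding e .
  have "(LINT w|Lb. hgt z powr \<sigma> * indicator (bset R z) w) \<le> (LINT w|Lb. K * k w)"
    by (rule integral_mono[OF i integrable_mult_right[OF k_integrable] k_ge])
  then show "hgt z powr \<sigma> * m \<le> K * W" unfolding e by (simp add: W_def)
qed

lemma W_pos: "W > 0"
proof -
  have "0 < hgt z powr \<sigma> * m" using m_pos hz by simp
  then have "0 < K * W" using W_bounds(2) by (rule less_le_trans)
  then show ?thesis using K_pos by (simp add: zero_less_mult_iff)
qed

lemma nn_k: "(\<integral>\<^sup>+w. ennreal (k w) \<partial>Lb) = ennreal W"
  unfolding W_def by (rule nn_integral_eq_integral) (use k_integrable k_nonneg in auto)

text \<open>Dependence on z is harmless: the constant only transfers integrability from the weight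
  \<beta> to the local weight \<open>k\<close>.\<close>

definition D where "D = K * hgt z powr \<sigma> * ((4 * R) powr \<bar>\<beta>\<bar> * hgt z powr (- \<beta>))"

lemma D_pos: "D > 0"
  using R hz by (simp add: D_def)

lemma k_le_weight: "k w \<le> D * hgt w powr \<beta>"
proof (cases "w \<in> bset R z")
  case True
  have "1 = hgt z powr (- \<beta>) * hgt z powr \<beta>" using hz by (simp add: powr_add[symmetric])
  also have "\<dots> \<le> hgt z powr (- \<beta>) * ((4 * R) powr \<bar>\<beta>\<bar> * hgt w powr \<beta>)"
    by (intro mult_left_mono bset_powr_le(2)[OF z True R]) auto
  finally have "K * hgt z powr \<sigma> * 1 \<le> K * hgt z powr \<sigma> * (hgt z powr (- \<beta>) * ((4 * R) powr \<bar>\<beta>\<bar> * hgt w powr \<beta>))"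
    by (intro mult_left_mono) auto
  also have "\<dots> = D * hgt w powr \<beta>" by (simp add: D_def mult_ac)
  finally show ?thesis using k_le[of w] True by simp
qed (use D_pos in \<open>simp add: k_def\<close>)

lemma finite_q: "(\<integral>\<^sup>+w. ennreal (k w * norm (f w) powr q) \<partial>Lb) < \<infinity>"
proof -
  have "(\<integral>\<^sup>+w. ennreal (k w * norm (f w) powr q) \<partial>Lb) \<le> (\<integral>\<^sup>+w. ennreal D * ennreal (norm (f w) powr q * hgt w powr \<beta>) \<partial>Lb)"
  proof (rule nn_integral_mono)
    fix w
    have "k w * norm (f w) powr q \<le> D * hgt w powr \<beta> * norm (f w) powr q" by (intro mult_right_mono k_le_weight) auto
    then show "ennreal (k w * norm (f w) powr q) \<le> ennreal D * ennreal (norm (f w) powr q * hgt w powr \<beta>)"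
      using D_pos by (simp add: ennreal_mult[symmetric] ennreal_leI mult_ac)
  qed
  also have "\<dots> = ennreal D * qint q \<beta> f" unfolding qint_def by (rule nn_integral_cmult) measurable
  also have "\<dots> < \<infinity>" using ff by (simp add: ennreal_mult_less_top)
  finally show ?thesis .
qed

lemma kf_integrable: "integrable Lb (\<lambda>w. k w *\<^sub>R f w)"
proof (rule integrableI_bounded)
  have "(\<integral>\<^sup>+w. ennreal (norm (k w *\<^sub>R f w)) \<partial>Lb) \<le> (\<integral>\<^sup>+w. ennreal D * ennreal (norm (f w) * hgt w powr \<beta>) \<partial>Lb)"
  proof (rule nn_integral_mono)
    fix w
    have "k w * norm (f w) \<le> D * hgt w powr \<beta> * norm (f w)" by (intro mult_right_mono k_le_weight) auto
    then show "ennreal (norm (k w *\<^sub>R f w)) \<le> ennreal D * ennreal (norm (f w) * hgt w powr \<beta>)"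
      using D_pos k_nonneg[of w] by (simp add: ennreal_mult[symmetric] ennreal_leI mult_ac)
  qed
  also have "\<dots> = ennreal D * (\<integral>\<^sup>+w. ennreal (norm (f w) * hgt w powr \<beta>) \<partial>Lb)" by (rule nn_integral_cmult) measurable
  also have "\<dots> < \<infinity>" using qint_finite_imp_L1[OF f q \<beta> ff] by (simp add: ennreal_mult_less_top)
  finally show "(\<integral>\<^sup>+w. ennreal (norm (k w *\<^sub>R f w)) \<partial>Lb) < \<infinity>" .
qed measurable

definition S where "S c = (\<integral>\<^sup>+w. ennreal (k w * norm (f w - c) powr q) \<partial>Lb)"

lemma S_add: 
  assumes [measurable]: "u \<in> borel_measurable Lb" 
    and le: "\<And>w. norm (u w) \<le> norm (v w :: complex) + d" and [measurable]: "v \<in> borel_measurable Lb" and d: "d \<ge> 0"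
  shows "(\<integral>\<^sup>+w. ennreal (k w * norm (u w :: complex) powr q) \<partial>Lb) \<le>
    ennreal (2 powr q) * ((\<integral>\<^sup>+w. ennreal (k w * norm (v w) powr q) \<partial>Lb) + ennreal (W * d powr q))"
proof -
  have "(\<integral>\<^sup>+w. ennreal (k w * norm (u w) powr q) \<partial>Lb) \<le>
    (\<integral>\<^sup>+w. ennreal (2 powr q) * (ennreal (k w * norm (v w) powr q) + ennreal (d powr q) * ennreal (k w)) \<partial>Lb)"
  proof (rule nn_integral_mono)
    fix w
    have "norm (u w) powr q \<le> (norm (v w) + d) powr q" using le[of w] q by (intro powr_mono2) auto
    also have "\<dots> \<le> 2 powr q * (norm (v w) powr q + d powr q)" using q d by (intro powr_add_le) auto
    finally have "k w * norm (u w) powr q \<le> k w * (2 powr q * (norm (v w) powr q + d powr q))"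
      by (intro mult_left_mono k_nonneg)
    also have "\<dots> = 2 powr q * (k w * norm (v w) powr q + d powr q * k w)" by (simp add: algebra_simps)
    finally have "ennreal (k w * norm (u w) powr q) \<le> ennreal (2 powr q * (k w * norm (v w) powr q + d powr q * k w))"
      by (rule ennreal_leI)
    then show "ennreal (k w * norm (u w) powr q) \<le> ennreal (2 powr q) * (ennreal (k w * norm (v w) powr q) + ennreal (d powr q) * ennreal (k w))"
      using k_nonneg[of w] by (simp add: ennreal_mult)
  qed
  also have "\<dots> = ennreal (2 powr q) * ((\<integral>\<^sup>+w. ennreal (k w * norm (v w) powr q) \<partial>Lb) + ennreal (d powr q) * ennreal W)"
    by (simp add: nn_integral_cmult nn_integral_add nn_k)
  also have "ennreal (d powr q) * ennreal W = ennreal (W * d powr q)" using W_pos by (simp add: ennreal_mult mult.commute)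
  finally show ?thesis .
qed

lemma S_finite: "S c < \<infinity>"
proof -
  have "S c \<le> ennreal (2 powr q) * ((\<integral>\<^sup>+w. ennreal (k w * norm (f w) powr q) \<partial>Lb) + ennreal (W * norm c powr q))"
    unfolding S_def by (rule S_add) (auto intro: norm_triangle_ineq4)
  also have "\<dots> < \<infinity>" using finite_q by (simp add: ennreal_mult_less_top)
  finally show ?thesis .
qed

text \<open>Jensen's inequality for the measure with density \<open>k\<close> and total mass W,
  applied to f - c, whose integral is W (A - c).\<close>

lemma average_le: "ennreal (W * norm (A - c) powr q) \<le> S c"
proof -
  define T where "T = norm (LINT w|Lb. k w *\<^sub>R (f w - c))"
  have "(LINT w|Lb. k w *\<^sub>R (f w - c)) = (LINT w|Lb. k w *\<^sub>R f w) - (LINT w|Lb. k w *\<^sub>R c)"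
    unfolding scaleR_diff_right by (rule Bochner_Integration.integral_diff) (use kf_integrable k_integrable in auto)
  also have "(LINT w|Lb. k w *\<^sub>R c) = of_real W * c" by (simp add: W_def k_integrable scaleR_conv_of_real)
  finally have "(LINT w|Lb. k w *\<^sub>R (f w - c)) = of_real W * (A - c)" using W_pos by (simp add: A_def algebra_simps)
  then have T: "T = W * norm (A - c)" using W_pos by (simp add: T_def norm_mult)
  have "ennreal T \<le> (\<integral>\<^sup>+w. ennreal (k w * norm (f w - c)) \<partial>Lb)"
    unfolding T_def using ennreal_norm_integral_le[of Lb "\<lambda>w. k w *\<^sub>R (f w - c)"] k_nonneg by simp
  then have le: "ennreal (T powr q) \<le> ennreal (W powr (q - 1)) * S c"
    unfolding S_def by (intro jensen_nn_integral) (use q k_nonneg W_pos nn_k in \<open>auto simp: T\<close>)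
  obtain s where s: "s \<ge> 0" "S c = ennreal s" using S_finite[of c] by (cases "S c") auto
  have "T powr q \<le> W powr (q - 1) * s" using le s(1) W_pos unfolding s(2) by (simp add: ennreal_mult[symmetric] ennreal_le_iff)
  moreover have "T powr q = W powr (q - 1) * (W * norm (A - c) powr q)"
    using W_pos by (simp add: T powr_mult powr_diff)
  ultimately have "W * norm (A - c) powr q \<le> s" using W_pos by (simp add: mult_le_cancel_left)
  then show ?thesis unfolding s(2) by (rule ennreal_leI)
qed

lemma S_le_unweighted: "S c \<le> ennreal (K * hgt z powr \<sigma>) * (\<integral>\<^sup>+w. ennreal (indicator (bset R z) w * norm (f w - c) powr q) \<partial>Lb)"
proof -
  have "S c \<le> (\<integral>\<^sup>+w. ennreal (K * hgt z powr \<sigma>) * ennreal (indicator (bset R z) w * norm (f w - c) powr q) \<partial>Lb)"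
    unfolding S_def
  proof (rule nn_integral_mono)
    fix w
    have "k w * norm (f w - c) powr q \<le> K * hgt z powr \<sigma> * indicator (bset R z) w * norm (f w - c) powr q"
      by (intro mult_right_mono k_le) auto
    then show "ennreal (k w * norm (f w - c) powr q) \<le> ennreal (K * hgt z powr \<sigma>) * ennreal (indicator (bset R z) w * norm (f w - c) powr q)"
      by (simp add: ennreal_mult[symmetric] ennreal_leI mult_ac)
  qed
  also have "\<dots> = ennreal (K * hgt z powr \<sigma>) * (\<integral>\<^sup>+w. ennreal (indicator (bset R z) w * norm (f w - c) powr q) \<partial>Lb)"
    by (rule nn_integral_cmult) measurable
  finally show ?thesis .
qed

lemma unweighted_le_S: "(\<integral>\<^sup>+w. ennreal (indicator (bset R z) w * norm (f w - c) powr q) \<partial>Lb) \<le> ennreal (K * hgt z powr (- \<sigma>)) * S c"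
proof -
  have "(\<integral>\<^sup>+w. ennreal (indicator (bset R z) w * norm (f w - c) powr q) \<partial>Lb) \<le> (\<integral>\<^sup>+w. ennreal (K * hgt z powr (- \<sigma>)) * ennreal (k w * norm (f w - c) powr q) \<partial>Lb)"
  proof (rule nn_integral_mono)
    fix w
    have "indicator (bset R z) w = hgt z powr (- \<sigma>) * (hgt z powr \<sigma> * indicator (bset R z) w)"
      using hz by (simp add: powr_add[symmetric] mult.assoc[symmetric])
    also have "\<dots> \<le> hgt z powr (- \<sigma>) * (K * k w)" by (intro mult_left_mono k_ge) auto
    finally have "indicator (bset R z) w * norm (f w - c) powr q \<le> hgt z powr (- \<sigma>) * (K * k w) * norm (f w - c) powr q"
      by (intro mult_right_mono) auto
    then show "ennreal (indicator (bset R z) w * norm (f w - c) powr q) \<le> ennreal (K * hgt z powr (- \<sigma>)) * ennreal (k w * norm (f w - c) powr q)"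
      using k_nonneg[of w] by (simp add: ennreal_mult[symmetric] ennreal_leI mult_ac)
  qed
  also have "\<dots> = ennreal (K * hgt z powr (- \<sigma>)) * S c" unfolding S_def by (rule nn_integral_cmult) measurable
  finally show ?thesis .
qed

definition osc where "osc = enn2real (S A) / W"

lemma S_A: "S A = ennreal (osc * W)"
  using S_finite[of A] W_pos by (simp add: osc_def less_top)

lemma osc_nonneg: "osc \<ge> 0"
  using W_pos by (simp add: osc_def)

text \<open>The average is a nearly optimal constant: passing from c to A costs one more copy of the
  integral for c, hence 2 times 2^q. One factor \<open>K\<close> comes from removing the weight in
  the integral, the other from comparing W with the Lebesgue measure of the ball.\<close>

lemma osc_le:
  assumes B: "B \<ge> 0" and c: "(\<integral>\<^sup>+w. ennreal (indicator (bset R z) w * norm (f w - c) powr q) \<partial>Lb) \<le> ennreal B"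
  shows "osc \<le> 2 * 2 powr q * K\<^sup>2 * B / m"
proof -
  obtain s where s: "s \<ge> 0" "S c = ennreal s" using S_finite[of c] by (cases "S c") auto
  have "W * norm (A - c) powr q \<le> s" using average_le[of c] s by simp
  have "S A \<le> ennreal (2 powr q) * (S c + ennreal (W * norm (A - c) powr q))"
    unfolding S_def
  proof (rule S_add)
    show "norm (f w - A) \<le> norm (f w - c) + norm (A - c)" for w
      using norm_triangle_ineq4[of "f w - c" "A - c"] by simp
  qed auto
  also have "\<dots> \<le> ennreal (2 powr q) * (S c + S c)" by (intro mult_left_mono add_left_mono average_le) auto
  also have "\<dots> = ennreal (2 * 2 powr q * s)" using s by (simp add: ennreal_mult[symmetric] flip: ennreal_plus)
  finally have 1: "osc * W \<le> 2 * 2 powr q * s" unfolding S_A using s by (simp add: ennreal_le_iff)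
  have "ennreal s \<le> ennreal (K * hgt z powr \<sigma>) * ennreal B"
    unfolding s(2)[symmetric] by (rule order_trans[OF S_le_unweighted]) (intro mult_left_mono c; simp)
  also have "\<dots> = ennreal (K * hgt z powr \<sigma> * B)" using B by (simp add: ennreal_mult)
  finally have 2: "s \<le> K * hgt z powr \<sigma> * B" using B by (simp add: ennreal_le_iff)
  have "hgt z powr \<sigma> * (osc * m) = osc * (hgt z powr \<sigma> * m)" by simp
  also have "\<dots> \<le> osc * (K * W)" by (intro mult_left_mono W_bounds osc_nonneg)
  also have "\<dots> = K * (osc * W)" by simp
  also have "\<dots> \<le> K * (2 * 2 powr q * (K * hgt z powr \<sigma> * B))"
    using 2 K_pos by (intro mult_left_mono order_trans[OF 1]) auto
  also have "\<dots> = hgt z powr \<sigma> * (2 * 2 powr q * K\<^sup>2 * B)" by (simp add: power2_eq_square)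
  finally have "osc * m \<le> 2 * 2 powr q * K\<^sup>2 * B" using hz by simp
  then show ?thesis using m_pos by (simp add: pos_le_divide_eq)
qed

lemma unweighted_le_osc:
  "(\<integral>\<^sup>+w. ennreal (indicator (bset R z) w * norm (f w - A) powr q) \<partial>Lb) \<le> ennreal (K\<^sup>2 * m * osc)"
proof -
  have "(\<integral>\<^sup>+w. ennreal (indicator (bset R z) w * norm (f w - A) powr q) \<partial>Lb) \<le> ennreal (K * hgt z powr (- \<sigma>) * (osc * W))"
    using unweighted_le_S[of A] W_pos osc_nonneg by (simp add: S_A ennreal_mult[symmetric])
  also have "\<dots> \<le> ennreal (K\<^sup>2 * m * osc)"
  proof (rule ennreal_leI)
    have "K * hgt z powr (- \<sigma>) * (osc * W) \<le> K * hgt z powr (- \<sigma>) * (osc * (K * hgt z powr \<sigma> * m))"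
      by (intro mult_left_mono W_bounds osc_nonneg) auto
    also have "\<dots> = K\<^sup>2 * m * osc" using hz by (simp add: power2_eq_square powr_minus)
    finally show "K * hgt z powr (- \<sigma>) * (osc * W) \<le> K\<^sup>2 * m * osc" .
  qed
  finally show ?thesis .
qed

end

section \<open>Identification with the averages and mean oscillations of the statement\<close>

lemma (in weighted_average) set_integral_wt_vol:
  fixes g :: "complex ^ 'n \<Rightarrow> 'b :: {banach, second_countable_topology}"
  assumes [measurable]: "g \<in> borel_measurable Lb"
  shows "(LINT w:bset R z|wt_vol \<sigma>. g w) = (1 / measure (Lb :: (complex ^ 'n) measure) (ball 0 1)) *\<^sub>R (LINT w|Lb. k w *\<^sub>R g w)"
proof -
  have "(LINT w:bset R z|wt_vol \<sigma>. g w) =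
    (LINT w|Lb. (hgt w powr \<sigma> / measure (Lb :: (complex ^ 'n) measure) (ball 0 1)) *\<^sub>R (indicator (bset R z) w *\<^sub>R g w))"
    unfolding set_lebesgue_integral_def wt_vol_eq by (rule integral_density) auto
  also have "\<dots> = (LINT w|Lb. (1 / measure (Lb :: (complex ^ 'n) measure) (ball 0 1)) *\<^sub>R (k w *\<^sub>R g w))"
    by (intro Bochner_Integration.integral_cong) (auto simp: k_def)
  also have "\<dots> = (1 / measure (Lb :: (complex ^ 'n) measure) (ball 0 1)) *\<^sub>R (LINT w|Lb. k w *\<^sub>R g w)"
    by (rule integral_scaleR_right)
  finally show ?thesis .
qed

lemma (in weighted_average) measure_wt_vol_bset:
  "measure (wt_vol \<sigma>) (bset R z) = W / measure (Lb :: (complex ^ 'n) measure) (ball 0 1)"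
proof -
  define V where "V = measure (Lb :: (complex ^ 'n) measure) (ball 0 1)"
  have V: "V > 0" unfolding V_def by (rule measure_Lb_pos)
  have "emeasure (wt_vol \<sigma>) (bset R z) = (\<integral>\<^sup>+w. ennreal (hgt w powr \<sigma> / V) * indicator (bset R z) w \<partial>Lb)"
    unfolding wt_vol_eq V_def by (rule emeasure_density) auto
  also have "\<dots> = (\<integral>\<^sup>+w. ennreal (1 / V) * ennreal (k w) \<partial>Lb)"
    by (intro nn_integral_cong) (use V in \<open>auto simp: k_def ennreal_mult[symmetric] split: split_indicator\<close>)
  also have "\<dots> = ennreal (1 / V) * ennreal W" by (simp add: nn_integral_cmult nn_k)
  also have "\<dots> = ennreal (W / V)" using V W_pos by (simp add: ennreal_mult[symmetric])
  finally show ?thesis using V W_pos by (simp add: measure_def V_def)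
qed

lemma (in weighted_average) bergman_avg_eq:
  assumes "bergman_ball z r = bset R z"
  shows "bergman_avg \<sigma> r f z = A"
  using measure_Lb_pos[where 'n='n] W_pos
  by (simp add: bergman_avg_def assms set_integral_wt_vol[OF f] measure_wt_vol_bset A_def scaleR_conv_of_real)

lemma (in weighted_average) mean_osc_eq:
  assumes "bergman_ball z r = bset R z"
  shows "mean_osc \<sigma> q r f z powr q = osc"
proof -
  have m: "(\<lambda>w. norm (f w - A) powr q) \<in> borel_measurable Lb" by measurable
  have "(LINT w|Lb. k w *\<^sub>R (norm (f w - A) powr q)) = enn2real (S A)"
    unfolding S_def using k_nonneg by (simp add: integral_eq_nn_integral)
  then have "mean_osc \<sigma> q r f z = osc powr (1 / q)"
    using measure_Lb_pos[where 'n='n] W_pos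
    by (simp add: mean_osc_def bergman_avg_eq[OF assms] assms set_integral_wt_vol[OF m] measure_wt_vol_bset osc_def)
  then show ?thesis using q osc_nonneg by (simp add: powr_powr)
qed

lemma mean_osc_nonneg: "mean_osc \<sigma> q r f z \<ge> 0"
  by (simp add: mean_osc_def)

text \<open>The average is a quotient of two integrals depending on z. Written with an inequality in
  z and w in place of the indicator of a moving ball, their integrands are jointly
  measurable.\<close>

lemma bergman_avg_measurable:
  fixes f :: "complex ^ 'n \<Rightarrow> complex"
  assumes R: "R > 1" and q: "q \<ge> 1" and \<beta>: "\<beta> > -1" and fm [measurable]: "f \<in> borel_measurable Lb" and ff: "qint q \<beta> f < \<infinity>"
    and bb: "\<And>z :: complex ^ 'n. z \<in> ball 0 1 \<Longrightarrow> bergman_ball z r = bset R z"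
  shows "bergman_avg \<sigma> r f \<in> borel_measurable Lb"
proof -
  have [measurable]: "(\<lambda>x. x) \<in> borel_measurable (Lb :: (complex ^ 'n) measure)" by (rule measurable_Lb_id)
  define h where "h z w = (if (kdis z w)\<^sup>2 < R * (hgt z * hgt w) then hgt w powr \<sigma> else 0)" for z w :: "complex ^ 'n"
  have h [measurable]: "(\<lambda>x. h (fst x) (snd x)) \<in> borel_measurable (Lb \<Otimes>\<^sub>M Lb)"
    unfolding h_def by measurable
  define F where "F z = (LINT w|Lb. h z w *\<^sub>R f w) / of_real (LINT w|Lb. h z w)" for z
  have h' [measurable]: "case_prod h \<in> borel_measurable (Lb \<Otimes>\<^sub>M Lb)" using h by (simp add: case_prod_unfold)
  have "(\<lambda>z. LINT w|Lb. h z w *\<^sub>R f w) \<in> borel_measurable Lb"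
    by (rule Lb.borel_measurable_lebesgue_integral) (simp add: case_prod_unfold)
  moreover have [measurable]: "(\<lambda>z. LINT w|Lb. h z w) \<in> borel_measurable Lb"
    by (rule Lb.borel_measurable_lebesgue_integral[OF h'])
  ultimately have F: "F \<in> borel_measurable Lb" unfolding F_def[abs_def] by (intro borel_measurable_divide) auto
  have "bergman_avg \<sigma> r f z = F z" if "z \<in> space Lb" for z
  proof -
    have z: "z \<in> ball 0 1" using that by simp
    interpret weighted_average R \<sigma> q \<beta> f z by unfold_locales (use R q \<beta> fm ff z in auto)
    have e: "k w = h z w" if "w \<in> space Lb" for w
      using that by (auto simp: k_def h_def bset_def)
    show ?thesis
      unfolding bergman_avg_eq[OF bb[OF z]] A_def W_def F_def
      by (intro arg_cong2[where f="(/)"] arg_cong[where f=of_real] Bochner_Integration.integral_cong) (simp_all add: e)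
  qed
  then show ?thesis using F by (subst measurable_cong[where g=F]) auto
qed

text \<open>On a compact subset of the ball the continuous positive weight attains a positive
  minimum.\<close>

lemma Lp_space_imp_Lq_loc:
  fixes f :: "complex ^ 'n \<Rightarrow> complex"
  assumes fm [measurable]: "f \<in> borel_measurable Lb" and ff: "qint q \<beta> f < \<infinity>"
  shows "f \<in> Lq_loc q"
proof -
  have [measurable]: "(\<lambda>x. x) \<in> borel_measurable (Lb :: (complex ^ 'n) measure)" by (rule measurable_Lb_id)
  have "set_integrable ball_vol K (\<lambda>z. norm (f z) powr q)" if K: "compact K" "K \<subseteq> ball 0 1" for K
  proof -
    have [measurable]: "K \<in> sets Lb" using K by (intro borel_in_sets_Lb) (auto intro: borel_compact)
    obtain c where c: "c > 0" "\<And>z. z \<in> K \<Longrightarrow> c \<le> hgt z powr \<beta>"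
    proof (cases "K = {}")
      case False
      have pos: "hgt z > 0" if "z \<in> K" for z using K that by (intro hgt_pos) auto
      have "continuous_on K (\<lambda>z. hgt z powr \<beta>)"
        unfolding hgt_def by (intro continuous_intros) (use pos in \<open>force simp: hgt_def\<close>)
      from continuous_attains_inf[OF K(1) False this] obtain z where "z \<in> K" "\<forall>y\<in>K. hgt z powr \<beta> \<le> hgt y powr \<beta>" by blast
      then show ?thesis using that[of "hgt z powr \<beta>"] pos[of z] by auto
    qed (use that[of 1] in auto)
    have "integrable Lb (\<lambda>z. indicator K z * norm (f z) powr q)"
    proof (rule integrableI_bounded)
      have "(\<integral>\<^sup>+z. ennreal (norm (indicator K z * norm (f z) powr q)) \<partial>Lb) \<le> (\<integral>\<^sup>+z. ennreal (1 / c) * ennreal (norm (f z) powr q * hgt z powr \<beta>) \<partial>Lb)"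
      proof (rule nn_integral_mono)
        fix z
        have "indicator K z * norm (f z) powr q \<le> hgt z powr \<beta> / c * norm (f z) powr q"
          using c(1) c(2)[of z] by (intro mult_right_mono) (auto simp: indicator_def pos_le_divide_eq)
        then show "ennreal (norm (indicator K z * norm (f z) powr q)) \<le> ennreal (1 / c) * ennreal (norm (f z) powr q * hgt z powr \<beta>)"
          using c(1) by (simp add: ennreal_mult[symmetric] ennreal_leI mult_ac)
      qed
      also have "\<dots> = ennreal (1 / c) * qint q \<beta> f" unfolding qint_def by (rule nn_integral_cmult) measurable
      also have "\<dots> < \<infinity>" using ff by (simp add: ennreal_mult_less_top)
      finally show "(\<integral>\<^sup>+z. ennreal (norm (indicator K z * norm (f z) powr q)) \<partial>Lb) < \<infinity>" .
    qed measurable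
    then show ?thesis
      unfolding set_integrable_def ball_vol_eq by (subst integrable_density) auto
  qed
  then show ?thesis by (simp add: Lq_loc_def ball_vol_eq)
qed

theorem theorem4p1:
  fixes p q \<alpha> \<beta> \<gamma> r \<sigma> :: real
    and f :: "complex ^ 'n \<Rightarrow> complex"
  assumes "1 < p" and "p \<le> q"
    and "\<alpha> > -1" and "\<beta> > -1"
    and "f \<in> Lp_space q \<beta>"
    and "\<gamma> = (real CARD('n) + 1 + \<beta>) / q - (real CARD('n) + 1 + \<alpha>) / p"
    and "r > 0"
  shows "hankel_bounded p \<alpha> q \<beta> f \<and> hankel_bounded p \<alpha> q \<beta> (\<lambda>z. cnj (f z))
           \<longleftrightarrow> f \<in> BMO \<sigma> q r \<gamma>"
proof -
  note p = assms(1,2) and \<alpha> = assms(3) and \<beta> = assms(4) and \<gamma> = assms(6)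
  have q: "0 < p" "0 < q" "q \<ge> 1" using p by auto
  have fm [measurable]: "f \<in> borel_measurable Lb" and ff: "qint q \<beta> f < \<infinity>"
    using assms(5) unfolding Lp_space_iff[OF \<beta>] by auto
  have cm [measurable]: "(\<lambda>z. cnj (f z)) \<in> borel_measurable Lb" by measurable
  have cf: "qint q \<beta> (\<lambda>z. cnj (f z)) < \<infinity>" using ff qint_cong[of "\<lambda>z. cnj (f z)" f q \<beta>] by simp
  obtain R where R: "R > 1" and bb: "\<And>z :: complex ^ 'n. z \<in> ball 0 1 \<Longrightarrow> bergman_ball z r = bset R z"
    using bergman_ball_eq[OF assms(7)] by metis
  define K where "K = (4 * R) powr \<bar>\<sigma>\<bar>"
  have K: "K > 0" using R by (simp add: K_def)
  let ?N = "real CARD('n) + 1"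
  let ?mo = "mean_osc \<sigma> q r f" and ?F = "bergman_avg \<sigma> r f"
  have wa: "weighted_average R q \<beta> f z" if "z \<in> ball 0 1" for z
    using R q \<beta> fm ff that by unfold_locales auto
  have upper: "?mo z powr q \<le> 2 * 2 powr q * K\<^sup>2 * B / measure Lb (bset R z)"
    if z: "z \<in> ball 0 1" and B: "B \<ge> 0" "(\<integral>\<^sup>+w. ennreal (indicator (bset R z) w * norm (f w - c) powr q) \<partial>Lb) \<le> ennreal B" for z c B
  proof -
    interpret weighted_average R \<sigma> q \<beta> f z by (rule wa[OF z])
    show ?thesis using osc_le[OF B] by (simp add: mean_osc_eq[OF bb[OF z]] m_def K_def)
  qed
  have lower: "(\<integral>\<^sup>+w. ennreal (indicator (bset R z) w * norm (f w - ?F z) powr q) \<partial>Lb) \<le> ennreal (K\<^sup>2 * measure Lb (bset R z) * ?mo z powr q)"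
    if z: "z \<in> ball 0 1" for z
  proof -
    interpret weighted_average R \<sigma> q \<beta> f z by (rule wa[OF z])
    show ?thesis using unweighted_le_osc by (simp add: mean_osc_eq[OF bb[OF z]] bergman_avg_eq[OF bb[OF z]] m_def K_def)
  qed
  obtain c0 where c0: "c0 > 0" "\<And>z. z \<in> ball (0::complex ^ 'n) 1 \<Longrightarrow> c0 * hgt z powr ?N \<le> measure Lb (bset R z)"
    using bset_measure_lower[OF R] by blast
  obtain C0 where C0: "C0 > 0" "\<And>z. z \<in> ball (0::complex ^ 'n) 1 \<Longrightarrow> measure Lb (bset R z) \<le> C0 * hgt z powr ?N"
    using bset_measure_upper[of R] R by (metis less_trans zero_less_one)
  \<comment> \<open>Matches the exponent delivered by \<open>necessity\<close> with the one that
    \<open>sufficiency\<close> expects.\<close>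
  have ex: "q * (?N + \<alpha>) / p - \<beta> = ?N - q * \<gamma>" using q unfolding \<gamma> by (simp add: field_simps)
  show ?thesis
  proof
    assume hb: "hankel_bounded p \<alpha> q \<beta> f \<and> hankel_bounded p \<alpha> q \<beta> (\<lambda>z. cnj (f z))"
    then obtain C1 where C1: "C1 \<ge> 0" "\<And>g. g \<in> H_infinity \<Longrightarrow> qint q \<beta> (Hk \<beta> f g) \<le> ennreal (C1 * enn2real (qint p \<alpha> g) powr (q / p))"
      unfolding hankel_bounded_iff[OF q(1,2) \<alpha> \<beta> fm] by blast
    obtain C2 where C2: "C2 \<ge> 0" "\<And>g. g \<in> H_infinity \<Longrightarrow> qint q \<beta> (Hk \<beta> (\<lambda>z. cnj (f z)) g) \<le> ennreal (C2 * enn2real (qint p \<alpha> g) powr (q / p))"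
      using hb unfolding hankel_bounded_iff[OF q(1,2) \<alpha> \<beta> cm] by blast
    obtain C where C: "C \<ge> 0" "\<forall>a\<in>ball 0 1. \<exists>c. (\<integral>\<^sup>+z. ennreal (indicator (bset R a) z * norm (f z - c) powr q) \<partial>Lb)
        \<le> ennreal (C * hgt a powr (?N - q * \<gamma>))"
    proof -
      have "qint q \<beta> (Hk \<beta> f g) \<le> ennreal (max C1 C2 * enn2real (qint p \<alpha> g) powr (q / p))"
        "qint q \<beta> (Hk \<beta> (\<lambda>z. cnj (f z)) g) \<le> ennreal (max C1 C2 * enn2real (qint p \<alpha> g) powr (q / p))" if "g \<in> H_infinity" for g
        by (rule order_trans[OF C1(2)[OF that]] order_trans[OF C2(2)[OF that]], intro ennreal_leI mult_right_mono; simp)+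
      then show ?thesis using necessity[OF p \<alpha> \<beta> R fm ff, of "max C1 C2"] C1(1) that unfolding ex by (auto simp: le_max_iff_disj)
    qed
    define D where "D = 2 * 2 powr q * K\<^sup>2 * C / c0"
    have D: "D \<ge> 0" using C c0 by (simp add: D_def)
    have "hgt z powr \<gamma> * ?mo z \<le> D powr (1 / q)" if z: "z \<in> ball 0 1" for z
    proof -
      have hz: "hgt z > 0" by (rule hgt_pos[OF z])
      obtain c where c: "(\<integral>\<^sup>+w. ennreal (indicator (bset R z) w * norm (f w - c) powr q) \<partial>Lb) \<le> ennreal (C * hgt z powr (?N - q * \<gamma>))"
        using C(2) z by blast
      have "?mo z powr q \<le> 2 * 2 powr q * K\<^sup>2 * (C * hgt z powr (?N - q * \<gamma>)) / measure Lb (bset R z)"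
        by (rule upper[OF z _ c]) (use C in simp)
      also have "\<dots> \<le> 2 * 2 powr q * K\<^sup>2 * (C * hgt z powr (?N - q * \<gamma>)) / (c0 * hgt z powr ?N)"
        using C c0 hz by (intro divide_left_mono c0(2) z mult_pos_pos less_le_trans[OF _ c0(2)[OF z]]) auto
      also have "\<dots> = D * hgt z powr (- q * \<gamma>)"
        using hz by (simp add: D_def powr_diff powr_minus divide_inverse mult_ac)
      finally have "hgt z powr (q * \<gamma>) * ?mo z powr q \<le> hgt z powr (q * \<gamma>) * (D * hgt z powr (- q * \<gamma>))"
        by (intro mult_left_mono) auto
      also have "\<dots> = D" using hz by (simp add: powr_minus)
      finally have "(hgt z powr \<gamma> * ?mo z) powr q \<le> D"
        by (simp add: powr_mult powr_powr mult.commute)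
      then have "((hgt z powr \<gamma> * ?mo z) powr q) powr (1 / q) \<le> D powr (1 / q)"
        using q by (intro powr_mono2) auto
      then show ?thesis using q mean_osc_nonneg[of \<sigma> q r f z] by (simp add: powr_powr)
    qed
    then have "bdd_above ((\<lambda>z. (1 - (norm z)\<^sup>2) powr \<gamma> * ?mo z) ` ball 0 1)"
      unfolding hgt_def[symmetric] by (intro bdd_aboveI2)
    then show "f \<in> BMO \<sigma> q r \<gamma>" using Lp_space_imp_Lq_loc[OF fm ff] by (simp add: BMO_def)
  next
    assume "f \<in> BMO \<sigma> q r \<gamma>"
    then obtain B0 where "\<forall>z\<in>ball 0 1. hgt z powr \<gamma> * ?mo z \<le> B0"
      unfolding BMO_def hgt_def[symmetric] bdd_above_def by auto
    then have B0: "hgt z powr \<gamma> * ?mo z \<le> B0" if "z \<in> ball 0 1" for z using that by blast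
    define B where "B = max B0 0"
    define E where "E = K\<^sup>2 * C0 * B powr q"
    have E: "E \<ge> 0" using C0 by (simp add: E_def)
    have loc: "(\<integral>\<^sup>+w. ennreal (indicator (bset R z) w * norm (f w - ?F z) powr q) \<partial>Lb) \<le> ennreal (E * hgt z powr (?N - q * \<gamma>))"
      if z: "z \<in> ball 0 1" for z
    proof (rule order_trans[OF lower[OF z]], rule ennreal_leI)
      have hz: "hgt z > 0" by (rule hgt_pos[OF z])
      have "?mo z = hgt z powr (- \<gamma>) * (hgt z powr \<gamma> * ?mo z)" using hz by (simp add: powr_minus)
      also have "\<dots> \<le> hgt z powr (- \<gamma>) * B" using B0[OF z] by (intro mult_left_mono) (auto simp: B_def)
      finally have "?mo z powr q \<le> (hgt z powr (- \<gamma>) * B) powr q" using q mean_osc_nonneg by (intro powr_mono2) auto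
      also have "\<dots> = hgt z powr (- q * \<gamma>) * B powr q" by (simp add: powr_mult powr_powr mult.commute)
      finally have "K\<^sup>2 * measure Lb (bset R z) * ?mo z powr q \<le> K\<^sup>2 * (C0 * hgt z powr ?N) * (hgt z powr (- q * \<gamma>) * B powr q)"
        using C0 z by (intro mult_mono) auto
      also have "\<dots> = E * (hgt z powr ?N * hgt z powr (- q * \<gamma>))" by (simp add: E_def mult_ac)
      also have "hgt z powr ?N * hgt z powr (- q * \<gamma>) = hgt z powr (?N - q * \<gamma>)" by (simp add: powr_add[symmetric])
      finally show "K\<^sup>2 * measure Lb (bset R z) * ?mo z powr q \<le> E * hgt z powr (?N - q * \<gamma>)" .
    qed
    have Fm [measurable]: "?F \<in> borel_measurable Lb" by (rule bergman_avg_measurable[OF R q(3) \<beta> fm ff bb])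
    \<comment> \<open>The conjugated averages serve as comparison function for the conjugate of f
      with the same constant E, so one argument yields both operators.\<close>
    have cl: "(\<integral>\<^sup>+w. ennreal (indicator (bset R z) w * norm (cnj (f w) - cnj (?F z)) powr q) \<partial>Lb) \<le> ennreal (E * hgt z powr (?N - q * \<gamma>))"
      if z: "z \<in> ball 0 1" for z
      using loc[OF z] unfolding complex_cnj_diff[symmetric] complex_mod_cnj .
    have cF: "(\<lambda>z. cnj (?F z)) \<in> borel_measurable Lb" by measurable
    show "hankel_bounded p \<alpha> q \<beta> f \<and> hankel_bounded p \<alpha> q \<beta> (\<lambda>z. cnj (f z))"
      unfolding hankel_bounded_iff[OF q(1,2) \<alpha> \<beta> fm] hankel_bounded_iff[OF q(1,2) \<alpha> \<beta> cm]
      using sufficiency[OF p \<alpha> \<beta> R \<gamma> fm ff Fm E loc] sufficiency[OF p \<alpha> \<beta> R \<gamma> cm cf cF E cl] by blast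
  qed
qed

end
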